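(* Let $d\ge 3$, let $V$ be a nonnegative potential on $\mathbb{R}^d$, not identically zero, satisfying a reverse Hölder inequality of some exponent $s>d/2$, with critical radius function $\rho$ and region $N=\{(x,y):|x-y|\le\rho(x)\}$, and let $\mathcal{L}=-\Delta+V$. Let $2\le q<\infty$ and let $X$ be a Banach space such that the operator $$f\longmapsto Tf(x)=t\partial_tP_t\left(\chi_N(x,\cdot)f(\cdot)\right)(x),\qquad x\in\mathbb{R}^d,\ t>0,$$ is bounded from $L^p_X(\mathbb{R}^d)$ into $L^p_{L^q_X((0,\infty),\frac{dt}{t})}(\mathbb{R}^d)$ for some $p$, $1<p<\infty$. Then $T$ maps $BMO_{\mathcal{L},X}$ into $BMO_{\mathcal{L},L^q_X((0,\infty),\frac{dt}{t})}$ and $H^1_{\mathcal{L},X}$ into $L^1_{L^q_X((0,\infty),\frac{dt}{t})}(\mathbb{R}^d)$.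
   Context: Reverse Hölder inequality: $V\ge 0$ is locally integrable and there is a constant $C$ with $\left(\frac1{|B|}\int_B V^s\,dy\right)^{1/s}\le \frac{C}{|B|}\int_B V\,dy$ for all balls $B\subset\mathbb{R}^d$. Critical radius: $\rho(x)=\sup\{r>0: \frac{1}{r^{d-2}}\int_{B(x,r)}V(y)\,dy\le 1\}$ (so $0<\rho(x)<\infty$). Classical Poisson kernel: $P_t(x)=c_d\frac{t}{(t^2+|x|^2)^{(d+1)/2}}$, where $c_d$ normalizes $\int P_t=1$, and $P_tf=P_t*f$. Thus $Tf(x)$ is the function of $t$ given by $\int_{|x-y|\le\rho(x)}t\,\partial_tP_t(x-y)f(y)\,dy$, regarded as an element of $L^q_X((0,\infty),\frac{dt}{t})$. Spaces, for a Banach space $Y$: $L^p_Y(\mathbb{R}^d)$ is the Bochner–Lebesgue space. $BMO_{\mathcal{L},Y}$ is the set of locally integrable $f:\mathbb{R}^d\to Y$ for which there is $C$ such that (1) $\frac1{|B|}\int_B\|f(x)-f_B\|_Y\,dx\le C$ for every ball $B$, where $f_B=\frac1{|B|}\int_B f$, and (2) $\frac1{|B|}\int_B\|f(x)\|_Y\,dx\le C$ for every ball $B=B(x_0,r_0)$ with $r_0\ge\rho(x_0)$; its norm is the infimum of such $C$. An $H^1_{\mathcal{L},Y}$-atom associated with a ball $B(x_0,r)$ is a function $a:\mathbb{R}^d\to Y$ with $\operatorname{supp}a\subset B(x_0,r)$, $\|a\|_{L^\infty_Y}\le |B(x_0,r)|^{-1}$, and, whenever $0<r<\rho(x_0)$,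 $\int a=0$. $H^1_{\mathcal{L},Y}$ is the set of integrable $f=\sum_j\lambda_ja_j$ with $a_j$ atoms and $\sum_j|\lambda_j|<\infty$, with norm the infimum of $\sum_j|\lambda_j|$ over such representations. "Maps $E$ into $F$" means boundedly: $\|Tf\|_F\le C\|f\|_E$ with $C$ independent of $f$. *)

theory Defs
  imports "HOL-Analysis.Analysis" "HOL-Library.Function_Algebras"
begin

text \<open>
  The library's Bochner integral is confined to second countable target types, and the Banach space
  $Y = L^q_X((0,\infty), dt/t)$ depends on the real number $q$, so that it is not a type.  Both
  difficulties are met by developing Bochner--Lebesgue spaces over an extended seminorm
  \<open>N :: 'y \<Rightarrow> ennreal\<close> on a real vector space.  The target space consists of the vectors with
  \<open>N y < \<infinity>\<close>, two of which are identified when \<open>N (y - z) = 0\<close>.  A Banach space \<open>X\<close> is given by a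
  type of class \<open>banach\<close> with \<open>N = xnorm\<close>; for $Y$ the vectors are functions \<open>real \<Rightarrow> 'x\<close>
  with pointwise operations, and \<open>N = Lq_dt_t q\<close>.
\<close>

instantiation "fun" :: (type, real_vector) real_vector
begin

definition scaleR_fun :: "real \<Rightarrow> ('a \<Rightarrow> 'b) \<Rightarrow> 'a \<Rightarrow> 'b"
  where "scaleR_fun c f = (\<lambda>x. c *\<^sub>R f x)"

instance
  by standard (auto simp: scaleR_fun_def fun_eq_iff scaleR_add_right scaleR_add_left)

end

definition xnorm :: "'x::real_normed_vector \<Rightarrow> ennreal"
  where "xnorm v = ennreal (norm v)"

text \<open>Only used for exponents \<open>p > 0\<close>.\<close>
definition epowr :: "ennreal \<Rightarrow> real \<Rightarrow> ennreal"
  where "epowr a p = (if a = \<infinity> then \<infinity> else ennreal (enn2real a powr p))"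

definition strongly_measurable ::
    "('y::real_vector \<Rightarrow> ennreal) \<Rightarrow> 'm measure \<Rightarrow> ('m \<Rightarrow> 'y) \<Rightarrow> bool"
  where "strongly_measurable N M f \<longleftrightarrow>
    (\<exists>s. (\<forall>i::nat. simple_function M (s i) \<and> (\<forall>x\<in>space M. N (s i x) < \<infinity>)) \<and>
         (AE x in M. (\<lambda>i. N (f x - s i x)) \<longlonglongrightarrow> 0))"

text \<open>The analogue of \<open>has_bochner_integral\<close>; the value \<open>v\<close> is unique up to \<open>N\<close>-null vectors.\<close>
definition has_bochner ::
    "('y::real_vector \<Rightarrow> ennreal) \<Rightarrow> 'm measure \<Rightarrow> ('m \<Rightarrow> 'y) \<Rightarrow> 'y \<Rightarrow> bool"
  where "has_bochner N M f v \<longleftrightarrow>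
    strongly_measurable N M f \<and> N v < \<infinity> \<and>
    (\<exists>s. (\<forall>i::nat. Bochner_Integration.simple_bochner_integrable M (s i) \<and> (\<forall>x\<in>space M. N (s i x) < \<infinity>)) \<and>
         (\<lambda>i. \<integral>\<^sup>+ x. N (f x - s i x) \<partial>M) \<longlonglongrightarrow> 0 \<and>
         (\<lambda>i. N (Bochner_Integration.simple_bochner_integral M (s i) - v)) \<longlonglongrightarrow> 0)"

definition bochner ::
    "('y::real_vector \<Rightarrow> ennreal) \<Rightarrow> 'm measure \<Rightarrow> ('m \<Rightarrow> 'y) \<Rightarrow> 'y"
  where "bochner N M f = (SOME v. has_bochner N M f v)"

text \<open>
  Norms of function spaces are extended to all functions by \<open>\<infinity>\<close>, so that a function belongs to the
  space iff its norm is finite; in particular \<open>Lp_norm N M p f < \<infinity>\<close> includes strong measurability.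
\<close>
definition Lp_norm ::
    "('y::real_vector \<Rightarrow> ennreal) \<Rightarrow> 'm measure \<Rightarrow> real \<Rightarrow> ('m \<Rightarrow> 'y) \<Rightarrow> ennreal"
  where "Lp_norm N M p f =
    (if strongly_measurable N M f then epowr (\<integral>\<^sup>+ x. epowr (N (f x)) p \<partial>M) (1 / p) else \<infinity>)"

definition dt_t :: "real measure"
  where "dt_t = density (lebesgue_on {0<..}) (\<lambda>t. ennreal (1 / t))"

text \<open>The norm of $L^q_X((0,\infty), dt/t)$; the values of \<open>g\<close> outside $(0,\infty)$ are irrelevant.\<close>
definition Lq_dt_t :: "real \<Rightarrow> (real \<Rightarrow> 'x::real_normed_vector) \<Rightarrow> ennreal"
  where "Lq_dt_t q g = Lp_norm xnorm dt_t q g"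

definition maps_boundedly ::
    "('e \<Rightarrow> 'f) \<Rightarrow> ('e \<Rightarrow> ennreal) \<Rightarrow> ('f \<Rightarrow> ennreal) \<Rightarrow> bool"
  where "maps_boundedly T nE nF \<longleftrightarrow>
    (\<exists>C\<ge>0. \<forall>f. nE f < \<infinity> \<longrightarrow> nF (T f) \<le> ennreal C * nE f)"

definition reverse_Hoelder :: "real \<Rightarrow> ('a::euclidean_space \<Rightarrow> real) \<Rightarrow> bool"
  where "reverse_Hoelder s V \<longleftrightarrow>
    (\<forall>x. V x \<ge> 0) \<and>
    (\<forall>x. \<forall>r>0. integrable (lebesgue_on (ball x r)) V) \<and>
    (\<exists>C. \<forall>x. \<forall>r>0.
       integrable (lebesgue_on (ball x r)) (\<lambda>y. V y powr s) \<and>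
       (1 / measure lebesgue (ball x r) * (\<integral>y. V y powr s \<partial>lebesgue_on (ball x r))) powr (1 / s)
         \<le> C / measure lebesgue (ball x r) * (\<integral>y. V y \<partial>lebesgue_on (ball x r)))"

definition critical_radius :: "('a::euclidean_space \<Rightarrow> real) \<Rightarrow> 'a \<Rightarrow> real"
  where "critical_radius V x =
    Sup {r. r > 0 \<and> 1 / r ^ (DIM('a) - 2) * (\<integral>y. V y \<partial>lebesgue_on (ball x r)) \<le> 1}"

definition poisson_shape :: "real \<Rightarrow> 'a::euclidean_space \<Rightarrow> real"
  where "poisson_shape t x = t / (t\<^sup>2 + (norm x)\<^sup>2) powr ((real DIM('a) + 1) / 2)"

text \<open>
  The constant $c_d$ is fixed by the normalisation at $t = 1$; since
  $P_t(x) = t^{-d} P_1(x/t)$, it normalises every $P_t$ with $t > 0$.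
\<close>
definition poisson_kernel :: "real \<Rightarrow> 'a::euclidean_space \<Rightarrow> real"
  where "poisson_kernel t x = 1 / (\<integral>z. poisson_shape 1 (z::'a) \<partial>lebesgue) * poisson_shape t x"

text \<open>The argument \<open>\<rho>\<close> is the critical radius function, and \<open>T_loc \<rho> f x t\<close> is $(Tf(x))(t)$.\<close>
definition T_loc ::
    "('a::euclidean_space \<Rightarrow> real) \<Rightarrow> ('a \<Rightarrow> 'x::banach) \<Rightarrow> 'a \<Rightarrow> real \<Rightarrow> 'x"
  where "T_loc \<rho> f x t =
    bochner xnorm (lebesgue_on (cball x (\<rho> x)))
      (\<lambda>y. (t * deriv (\<lambda>u. poisson_kernel u (x - y)) t) *\<^sub>R f y)"

definition locally_integrable ::
    "('y::real_vector \<Rightarrow> ennreal) \<Rightarrow> ('a::euclidean_space \<Rightarrow> 'y) \<Rightarrow> bool"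
  where "locally_integrable N f \<longleftrightarrow> (\<forall>x. \<forall>r>0. Lp_norm N (lebesgue_on (ball x r)) 1 f < \<infinity>)"

definition ball_mean ::
    "('y::real_vector \<Rightarrow> ennreal) \<Rightarrow> 'a::euclidean_space \<Rightarrow> real \<Rightarrow> ('a \<Rightarrow> 'y) \<Rightarrow> 'y"
  where "ball_mean N x r f =
    (1 / measure lebesgue (ball x r)) *\<^sub>R bochner N (lebesgue_on (ball x r)) f"

definition BMO_norm ::
    "('a::euclidean_space \<Rightarrow> real) \<Rightarrow> ('y::real_vector \<Rightarrow> ennreal) \<Rightarrow> ('a \<Rightarrow> 'y) \<Rightarrow> ennreal"
  where "BMO_norm \<rho> N f = Inf {C. locally_integrable N f \<and>
    (\<forall>x. \<forall>r>0. (\<integral>\<^sup>+ y. N (f y - ball_mean N x r f) \<partial>lebesgue_on (ball x r))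
                 / emeasure lebesgue (ball x r) \<le> C) \<and>
    (\<forall>x. \<forall>r>0. r \<ge> \<rho> x \<longrightarrow>
       (\<integral>\<^sup>+ y. N (f y) \<partial>lebesgue_on (ball x r)) / emeasure lebesgue (ball x r) \<le> C)}"

text \<open>Support and supremum bound are understood almost everywhere, as for elements of $L^\infty_Y$.\<close>
definition H1_atom ::
    "('a::euclidean_space \<Rightarrow> real) \<Rightarrow> ('y::real_vector \<Rightarrow> ennreal) \<Rightarrow> 'a \<Rightarrow> real \<Rightarrow> ('a \<Rightarrow> 'y) \<Rightarrow> bool"
  where "H1_atom \<rho> N x0 r a \<longleftrightarrow>
    r > 0 \<and> strongly_measurable N lebesgue a \<and>
    (AE x in lebesgue. x \<notin> ball x0 r \<longrightarrow> N (a x) = 0) \<and>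
    (AE x in lebesgue. N (a x) \<le> ennreal (1 / measure lebesgue (ball x0 r))) \<and>
    (r < \<rho> x0 \<longrightarrow> has_bochner N lebesgue a 0)"

text \<open>
  Atoms have $L^1$-norm at most $1$, so that $\sum_j \lambda_j a_j$ converges absolutely in $L^1_Y$,
  and the equation $f = \sum_j \lambda_j a_j$ is read in $L^1_Y$.
\<close>
definition H1_norm ::
    "('a::euclidean_space \<Rightarrow> real) \<Rightarrow> ('y::real_vector \<Rightarrow> ennreal) \<Rightarrow> ('a \<Rightarrow> 'y) \<Rightarrow> ennreal"
  where "H1_norm \<rho> N f = Inf {ennreal (\<Sum>j. \<bar>c j\<bar>) | c a.
    summable (\<lambda>j::nat. \<bar>c j :: real\<bar>) \<and> (\<forall>j. \<exists>x0 r. H1_atom \<rho> N x0 r (a j)) \<and>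
    (\<lambda>n. Lp_norm N lebesgue 1 (\<lambda>x. f x - (\<Sum>j<n. c j *\<^sub>R a j x))) \<longlonglongrightarrow> 0}"

end

theory Submission
  imports Defs
begin

text \<open>
  The kernel of \<open>t \<partial>\<^sub>t P\<^sub>t\<close> is, with values in \<open>L\<^sup>q(dt/t)\<close>, a Calderon--Zygmund kernel: every estimate has
  the shape (power of the distance \<open>z\<close>) times \<open>t z / (t\<^sup>2 + z\<^sup>2)\<close>, and the last factor has bounded norm
  in \<open>L\<^sup>q(dt/t)\<close>. The reverse Hoelder inequality makes \<open>\<rho>\<close> comparable at points whose distance is at most
  a multiple of \<open>\<rho>\<close>, so the truncation to \<open>|x - y| \<le> \<rho>(x)\<close> interferes with the kernel only at distances
  of order \<open>\<rho>\<close>.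

  For an atom, \<open>L\<^sup>p\<close> boundedness and Hoelder's inequality give the estimate near its ball. Away from it one
  uses the cancellation of the atom as long as its ball lies within the truncation, and the mere size of the
  kernel on the remaining region, whose points have distance of order \<open>\<rho>\<close> from the ball.

  For a function of bounded mean oscillation, the John--Nirenberg inequality turns the oscillation of the
  local part into an \<open>L\<^sup>p\<close> bound. This suffices on balls of radius at least of order \<open>\<rho>\<close>. On a ball of radius
  \<open>r\<close> much smaller than \<open>\<rho>\<close>, subtract the mean \<open>m\<close> over the double ball: the part of \<open>f - m\<close> up to a
  radius \<open>R\<close> of order \<open>\<rho>\<close> is treated with the regularity of the kernel, the part of \<open>f\<close> beyond \<open>R\<close> with its
  size, and the constant \<open>m\<close> on the ball of radius \<open>R\<close> by translation invariance: moving the centre by \<open>r\<close>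
  gains a factor \<open>r / R\<close>, which beats the growth of \<open>|m|\<close> like \<open>log (R / r)\<close>.
\<close>

subsection \<open>Extended seminorms and strong measurability\<close>

text \<open>Two features shape the estimates. Bounds on the norm in L^q(dt/t) are first proved for
  each fixed \<open>t\<close>, as a finite sum of terms \<open>b i * bump (w i) t\<close> whose
  widths do not depend on the variable of integration; the triangle inequality of L^q(dt/t) is then
  applied to these finitely many real functions, in place of Minkowski's integral inequality. Dyadic
  annuli and the halving of distances serve to freeze the widths. Secondly, \<open>T f\<close> is
  made of chosen values of integrals, so neither its measurability as a function with values in
  L^q(dt/t) nor its agreement with an atomic series is automatic. Measurability enters only through
  the assumed L^p bound, because a finite \<open>Lp_norm\<close> includes it. It is passed on to
  functions of bounded mean oscillation by local agreement with truncated functions, and to the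
  Hardy space by almost everywhere limits of finite sums over atoms.\<close>

locale ext_seminorm =
  fixes N :: "'y::real_vector \<Rightarrow> ennreal"
  assumes zero [simp]: "N 0 = 0"
    and triangle: "N (x + y) \<le> N x + N y"
    and scale: "N (c *\<^sub>R x) = ennreal \<bar>c\<bar> * N x"
begin

lemma minus [simp]: "N (- x) = N x"
  using scale[of "-1" x] by simp

lemma diff_commute: "N (x - y) = N (y - x)"
  by (metis minus minus_diff_eq)

lemma diff_triangle: "N (x - z) \<le> N (x - y) + N (y - z)"
  using triangle[of "x - y" "y - z"] by simp

lemma le_diff_add: "N x \<le> N (x - y) + N y"
  using triangle[of "x - y" y] by simp

lemma triangle_diff: "N (x - y) \<le> N x + N y"
  using triangle[of x "- y"] by simp

lemma sum_le: "N (sum f A) \<le> (\<Sum>i\<in>A. N (f i))"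
proof (induction A rule: infinite_finite_induct)
  case (insert a A)
  then show ?case
    using triangle[of "f a" "sum f A"] by (simp, meson add_left_mono order_trans)
qed simp_all

lemma add_finite: "N x < \<infinity> \<Longrightarrow> N y < \<infinity> \<Longrightarrow> N (x + y) < \<infinity>"
  using triangle[of x y] by (simp add: order.strict_trans1)

lemma diff_finite: "N x < \<infinity> \<Longrightarrow> N y < \<infinity> \<Longrightarrow> N (x - y) < \<infinity>"
  using triangle_diff[of x y] by (simp add: order.strict_trans1)

lemma scale_finite: "N x < \<infinity> \<Longrightarrow> N (c *\<^sub>R x) < \<infinity>"
  by (simp add: scale ennreal_mult_less_top)

text \<open>The finite case squeezes \<open>N (s i)\<close> between \<open>N x - N (x - s i)\<close>
  and \<open>N x + N (x - s i)\<close>. When \<open>N x\<close> is infinite, \<open>N (s i)\<close>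
  is infinite as soon as \<open>N (x - s i)\<close> is finite.\<close>

lemma tendsto_of_diff:
  assumes "(\<lambda>i. N (x - s i)) \<longlonglongrightarrow> 0"
  shows "(\<lambda>i. N (s i)) \<longlonglongrightarrow> N x"
proof (cases "N x = \<infinity>")
  case True
  have "eventually (\<lambda>i. N (x - s i) < \<infinity>) sequentially"
    using assms by (rule order_tendstoD) simp
  then have "eventually (\<lambda>i. N (s i) = N x) sequentially"
  proof eventually_elim
    case (elim i)
    then show ?case using le_diff_add[of x "s i"] True
      by (auto simp: top_unique ennreal_add_eq_top)
  qed
  then show ?thesis by (simp add: tendsto_eventually)
next
  case False
  show ?thesis
  proof (rule tendsto_sandwich)
    show "eventually (\<lambda>i. N x - N (x - s i) \<le> N (s i)) sequentially"
      using le_diff_add[of x] False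
      by (intro always_eventually allI) (simp add: ennreal_minus_le_iff infinity_ennreal_def)
    show "eventually (\<lambda>i. N (s i) \<le> N x + N (x - s i)) sequentially"
      using le_diff_add[of "s _" x]
      by (intro always_eventually allI) (simp add: diff_commute add.commute)
    show "(\<lambda>i. N x - N (x - s i)) \<longlonglongrightarrow> N x"
      using tendsto_diff_ennreal[OF tendsto_const assms, of "N x"] False by simp
    show "(\<lambda>i. N x + N (x - s i)) \<longlonglongrightarrow> N x"
      using tendsto_add[OF tendsto_const assms, of "N x"] by simp
  qed
qed

lemma strongly_measurableI:
  assumes "\<And>i::nat. simple_function M (s i)" "\<And>i x. x \<in> space M \<Longrightarrow> N (s i x) < \<infinity>"
    "AE x in M. (\<lambda>i. N (f x - s i x)) \<longlonglongrightarrow> 0"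
  shows "strongly_measurable N M f"
  unfolding strongly_measurable_def using assms by (intro exI[of _ s]) simp

lemma strongly_measurable_simple:
  assumes "simple_function M f" "\<And>x. x \<in> space M \<Longrightarrow> N (f x) < \<infinity>"
  shows "strongly_measurable N M f"
  unfolding strongly_measurable_def using assms by (intro exI[of _ "\<lambda>_. f"]) auto

lemma strongly_measurable_zero [simp]: "strongly_measurable N M (\<lambda>_. 0)"
  by (rule strongly_measurable_simple) auto

lemma strongly_measurable_cong_AE:
  assumes "strongly_measurable N M f" "AE x in M. N (g x - f x) = 0"
  shows "strongly_measurable N M g"
proof -
  obtain s where s: "\<And>i::nat. simple_function M (s i)" "\<And>i x. x \<in> space M \<Longrightarrow> N (s i x) < \<infinity>"
    "AE x in M. (\<lambda>i. N (f x - s i x)) \<longlonglongrightarrow> 0"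
    using assms(1) unfolding strongly_measurable_def by blast
  have "AE x in M. (\<lambda>i. N (g x - s i x)) \<longlonglongrightarrow> 0"
    using s(3) assms(2)
  proof eventually_elim
    case (elim x)
    have "N (g x - s i x) \<le> N (f x - s i x)" for i
      using diff_triangle[of "g x" "s i x" "f x"] elim(2) by simp
    then show ?case
      using tendsto_sandwich[of "\<lambda>_. 0", OF _ _ tendsto_const elim(1)] by simp
  qed
  then show ?thesis unfolding strongly_measurable_def using s by blast
qed

lemma strongly_measurable_add:
  assumes "strongly_measurable N M f" "strongly_measurable N M g"
  shows "strongly_measurable N M (\<lambda>x. f x + g x)"
proof -
  obtain s where s: "\<And>i::nat. simple_function M (s i)" "\<And>i x. x \<in> space M \<Longrightarrow> N (s i x) < \<infinity>"
    "AE x in M. (\<lambda>i. N (f x - s i x)) \<longlonglongrightarrow> 0"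
    using assms(1) unfolding strongly_measurable_def by blast
  obtain u where u: "\<And>i::nat. simple_function M (u i)" "\<And>i x. x \<in> space M \<Longrightarrow> N (u i x) < \<infinity>"
    "AE x in M. (\<lambda>i. N (g x - u i x)) \<longlonglongrightarrow> 0"
    using assms(2) unfolding strongly_measurable_def by blast
  have "AE x in M. (\<lambda>i. N (f x + g x - (s i x + u i x))) \<longlonglongrightarrow> 0"
    using s(3) u(3)
  proof eventually_elim
    case (elim x)
    have "N (f x + g x - (s i x + u i x)) \<le> N (f x - s i x) + N (g x - u i x)" for i
      using triangle[of "f x - s i x" "g x - u i x"] by (simp add: algebra_simps)
    then show ?case
      using tendsto_sandwich[of "\<lambda>_. 0", OF _ _ tendsto_const tendsto_add[OF elim, simplified]] by simp
  qed
  then show ?thesis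
    by (intro strongly_measurableI[of M "\<lambda>i x. s i x + u i x"]
        simple_function_compose2[where h="(+)"] s(1) u(1) add_finite s(2) u(2))
qed

lemma strongly_measurable_mult:
  fixes h :: "'m \<Rightarrow> real"
  assumes h: "h \<in> borel_measurable M" and f: "strongly_measurable N M f"
  shows "strongly_measurable N M (\<lambda>x. h x *\<^sub>R f x)"
proof -
  obtain s where s: "\<And>i::nat. simple_function M (s i)" "\<And>i x. x \<in> space M \<Longrightarrow> N (s i x) < \<infinity>"
    "AE x in M. (\<lambda>i. N (f x - s i x)) \<longlonglongrightarrow> 0"
    using f unfolding strongly_measurable_def by blast
  obtain u where u: "\<And>i. simple_function M (u i)" "\<And>x. x \<in> space M \<Longrightarrow> (\<lambda>i. u i x) \<longlonglongrightarrow> h x"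
    using borel_measurable_implies_sequence_metric[OF h, of 0] by blast
  have "AE x in M. (\<lambda>i. N (h x *\<^sub>R f x - u i x *\<^sub>R s i x)) \<longlonglongrightarrow> 0"
    using s(3) AE_space
  proof eventually_elim
    case (elim x)
    \<comment> \<open>Finiteness lets \<open>ennreal \<bar>h x - u i x\<bar> * N (f x)\<close> tend
      to 0: with an infinite factor, every nonzero difference would give infinity.\<close>
    have fin: "N (f x) < \<infinity>"
    proof -
      have "eventually (\<lambda>i. N (f x - s i x) < \<infinity>) sequentially"
        using elim(1) by (rule order_tendstoD) simp
      then obtain i where "N (f x - s i x) < \<infinity>" by (auto dest: eventually_happens)
      then show ?thesis using add_finite[of "f x - s i x" "s i x"] s(2)[OF elim(2), of i] by simp
    qed
    have le: "N (h x *\<^sub>R f x - u i x *\<^sub>R s i x) \<le>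
        ennreal \<bar>h x - u i x\<bar> * N (f x) + ennreal \<bar>u i x\<bar> * N (f x - s i x)" for i
    proof -
      have "h x *\<^sub>R f x - u i x *\<^sub>R s i x = (h x - u i x) *\<^sub>R f x + u i x *\<^sub>R (f x - s i x)"
        by (simp add: algebra_simps)
      then show ?thesis
        using triangle[of "(h x - u i x) *\<^sub>R f x" "u i x *\<^sub>R (f x - s i x)"] by (simp only: scale)
    qed
    have a: "(\<lambda>i. ennreal \<bar>h x - u i x\<bar> * N (f x)) \<longlonglongrightarrow> 0"
    proof -
      have "(\<lambda>i. \<bar>h x - u i x\<bar>) \<longlonglongrightarrow> 0"
        using tendsto_rabs[OF tendsto_diff[OF tendsto_const u(2)[OF elim(2)]], of "h x"] by simp
      from ennreal_tendsto_cmult[OF fin[unfolded infinity_ennreal_def] tendsto_ennrealI[OF this]]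
      show ?thesis by (simp add: mult.commute)
    qed
    have b: "(\<lambda>i. ennreal \<bar>u i x\<bar> * N (f x - s i x)) \<longlonglongrightarrow> 0"
    proof -
      have "(\<lambda>i. ennreal \<bar>u i x\<bar>) \<longlonglongrightarrow> ennreal \<bar>h x\<bar>"
        using tendsto_ennrealI[OF tendsto_rabs[OF u(2)[OF elim(2)]]] .
      from tendsto_mult_ennreal[OF this elim(1)] show ?thesis by simp
    qed
    show ?case
      using tendsto_sandwich[of "\<lambda>_. 0", OF _ _ tendsto_const tendsto_add[OF a b, simplified]] le by simp
  qed
  then show ?thesis
    by (intro strongly_measurableI[of M "\<lambda>i x. u i x *\<^sub>R s i x"]
        simple_function_compose2[where h="(*\<^sub>R)"] s(1) u(1) scale_finite s(2))
qed

lemma strongly_measurable_scaleR: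
  "strongly_measurable N M f \<Longrightarrow> strongly_measurable N M (\<lambda>x. c *\<^sub>R f x)"
  by (rule strongly_measurable_mult) auto

lemma strongly_measurable_diff:
  assumes "strongly_measurable N M f" "strongly_measurable N M g"
  shows "strongly_measurable N M (\<lambda>x. f x - g x)"
  using strongly_measurable_add[OF assms(1) strongly_measurable_scaleR[OF assms(2), of "-1"]] by simp

lemma strongly_measurable_sum:
  "(\<And>i. i \<in> A \<Longrightarrow> strongly_measurable N M (f i)) \<Longrightarrow> strongly_measurable N M (\<lambda>x. \<Sum>i\<in>A. f i x)"
  by (induction A rule: infinite_finite_induct) (auto intro: strongly_measurable_add)

lemma strongly_measurable_const: "N c < \<infinity> \<Longrightarrow> strongly_measurable N M (\<lambda>_. c)"
  by (rule strongly_measurable_simple) auto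

lemma strongly_measurable_AE_finite:
  assumes "strongly_measurable N M f"
  shows "AE x in M. N (f x) < \<infinity>"
proof -
  obtain s where s: "\<And>i::nat. simple_function M (s i)" "\<And>i x. x \<in> space M \<Longrightarrow> N (s i x) < \<infinity>"
    "AE x in M. (\<lambda>i. N (f x - s i x)) \<longlonglongrightarrow> 0"
    using assms unfolding strongly_measurable_def by blast
  show ?thesis using s(3) AE_space
  proof eventually_elim
    case (elim x)
    have "eventually (\<lambda>i. N (f x - s i x) < \<infinity>) sequentially"
      using elim(1) by (rule order_tendstoD) simp
    then obtain i where "N (f x - s i x) < \<infinity>" by (auto dest: eventually_happens)
    then show ?case using add_finite[of "f x - s i x" "s i x"] s(2)[OF elim(2), of i] by simp
  qed
qed

end

text \<open>Strong measurability only asks for convergence almost everywhere, so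
  \<open>N (f x)\<close> is a limit of measurable functions off a null set. Completeness makes every
  subset of that null set measurable, which is why the integral theory below is stated for complete
  measures.\<close>

lemma complete_measure_cong_AE:
  fixes f g :: "'m \<Rightarrow> 'b::topological_space"
  assumes "complete_measure M" "g \<in> borel_measurable M" "AE x in M. f x = g x"
  shows "f \<in> borel_measurable M"
proof -
  interpret complete_measure M by fact
  obtain Z where Z: "Z \<in> null_sets M" "{x\<in>space M. f x \<noteq> g x} \<subseteq> Z"
    using assms(3) by (auto elim!: AE_E)
  show ?thesis
  proof (rule measurableI)
    fix A :: "'b set" assume A: "A \<in> sets borel"
    have 1: "g -` A \<inter> space M \<in> sets M" using assms(2) A by (rule measurable_sets)
    have 2: "f -` A \<inter> space M \<inter> Z \<in> sets M" using complete2[of "f -` A \<inter> space M \<inter> Z" Z] Z(1) by auto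
    have 3: "f -` A \<inter> space M = (g -` A \<inter> space M - Z) \<union> (f -` A \<inter> space M \<inter> Z)"
      using Z(2) by auto
    show "f -` A \<inter> space M \<in> sets M"
      using 1 2 Z(1) by (subst 3) (auto intro: sets.Un sets.Diff)
  qed simp
qed

lemma complete_measure_lebesgue: "complete_measure lebesgue"
  by (rule completion.complete_measure_axioms)

lemma complete_measure_restrict_space:
  assumes "complete_measure M" "S \<in> sets M"
  shows "complete_measure (restrict_space M S)"
proof -
  interpret complete_measure M by fact
  have S: "S \<inter> space M \<in> sets M" using assms(2) by auto
  show ?thesis
  proof
    fix A B assume AB: "B \<subseteq> A" "A \<in> null_sets (restrict_space M S)"
    then have "A \<in> null_sets M" "A \<subseteq> S" by (auto simp: null_sets_restrict_space[OF assms(2)])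
    then have "B \<in> sets M" using AB(1) complete by blast
    then show "B \<in> sets (restrict_space M S)"
      using AB(1) \<open>A \<subseteq> S\<close> by (auto simp: sets_restrict_space_iff[OF S])
  qed
qed

lemma complete_measure_density:
  assumes "complete_measure M" "f \<in> borel_measurable M" "\<And>x. x \<in> space M \<Longrightarrow> f x > 0"
  shows "complete_measure (density M f)"
proof -
  interpret complete_measure M by fact
  show ?thesis
  proof
    fix A B assume AB: "B \<subseteq> A" "A \<in> null_sets (density M f)"
    then have A: "A \<in> sets M" "AE x in M. x \<in> A \<longrightarrow> f x = 0"
      using null_sets_density_iff[OF assms(2)] by auto
    have "AE x in M. x \<notin> A" using A(2) AE_space by eventually_elim (use assms(3) in force)
    then have "A \<in> null_sets M" by (rule Measure_Space.AE_iff_null_sets[OF A(1), THEN iffD2])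
    then show "B \<in> sets (density M f)" using AB(1) complete by auto
  qed
qed

lemma complete_measure_dt_t: "complete_measure dt_t"
  unfolding dt_t_def
proof (rule complete_measure_density)
  show "complete_measure (lebesgue_on {0::real<..})"
    by (intro complete_measure_restrict_space complete_measure_lebesgue) simp
  show "(\<lambda>t. ennreal (1 / t)) \<in> borel_measurable (lebesgue_on {0::real<..})"
    by (intro measurable_restrict_space1 measurable_completion) simp
qed (auto simp: space_restrict_space)

section \<open>Measurability of the seminorm, restriction to subsets, and limits\<close>

context ext_seminorm
begin

lemma borel_measurable_seminorm:
  assumes M: "complete_measure M" and f: "strongly_measurable N M f"
  shows "(\<lambda>x. N (f x)) \<in> borel_measurable M"
proof -
  obtain s where s: "\<And>i::nat. simple_function M (s i)" "\<And>i x. x \<in> space M \<Longrightarrow> N (s i x) < \<infinity>"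
    "AE x in M. (\<lambda>i. N (f x - s i x)) \<longlonglongrightarrow> 0"
    using f unfolding strongly_measurable_def by blast
  have [measurable]: "(\<lambda>x. N (s i x)) \<in> borel_measurable M" for i
    using simple_function_compose1[OF s(1), of N] by (rule borel_measurable_simple_function)
  show ?thesis
  proof (rule complete_measure_cong_AE[OF M])
    show "(\<lambda>x. liminf (\<lambda>i. N (s i x))) \<in> borel_measurable M" by measurable
    show "AE x in M. N (f x) = liminf (\<lambda>i. N (s i x))"
      using s(3) by eventually_elim (auto dest!: tendsto_of_diff lim_imp_Liminf[rotated])
  qed
qed

lemma strongly_measurable_restrict:
  assumes S: "S \<in> sets M" and f: "strongly_measurable N M f"
  shows "strongly_measurable N (restrict_space M S) f"
proof -
  obtain s where s: "\<And>i::nat. simple_function M (s i)" "\<And>i x. x \<in> space M \<Longrightarrow> N (s i x) < \<infinity>"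
    "AE x in M. (\<lambda>i. N (f x - s i x)) \<longlonglongrightarrow> 0"
    using f unfolding strongly_measurable_def by blast
  have S': "S \<inter> space M \<in> sets M" using S by auto
  have "simple_function (restrict_space M S) (s i)" for i
    unfolding simple_function_def
  proof (intro conjI ballI)
    show "finite (s i ` space (restrict_space M S))"
      using s(1)[of i] by (auto simp: simple_function_def space_restrict_space intro: finite_subset[rotated])
    fix y assume "y \<in> s i ` space (restrict_space M S)"
    have "s i -` {y} \<inter> space M \<in> sets M" using s(1) by (rule simple_functionD)
    moreover have "s i -` {y} \<inter> space (restrict_space M S) = (s i -` {y} \<inter> space M) \<inter> S"
      by (auto simp: space_restrict_space)
    ultimately show "s i -` {y} \<inter> space (restrict_space M S) \<in> sets (restrict_space M S)"
      using S by (auto simp: sets_restrict_space_iff[OF S'])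
  qed
  moreover have "AE x in restrict_space M S. (\<lambda>i. N (f x - s i x)) \<longlonglongrightarrow> 0"
    using s(3) by (auto simp: AE_restrict_space_iff[OF S'])
  ultimately show ?thesis
    using s(2) by (intro strongly_measurableI[of _ s]) (auto simp: space_restrict_space)
qed

lemma simple_function_extend:
  assumes S: "S \<in> sets M" and s: "simple_function (restrict_space M S) s"
  shows "simple_function M (\<lambda>x. indicator S x *\<^sub>R s x :: 'z::real_vector)"
  unfolding simple_function_def
proof (intro conjI ballI)
  have S': "S \<inter> space M \<in> sets M" using S by auto
  have "(\<lambda>x. indicator S x *\<^sub>R s x) ` space M \<subseteq> insert 0 (s ` space (restrict_space M S))"
    by (auto simp: space_restrict_space indicator_def)
  then show "finite ((\<lambda>x. indicator S x *\<^sub>R s x) ` space M)"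
    using s by (auto simp: simple_function_def intro: finite_subset)
  fix y
  have "s -` {y} \<inter> space (restrict_space M S) \<in> sets (restrict_space M S)"
    using s by (rule simple_functionD)
  then have 1: "s -` {y} \<inter> (space M \<inter> S) \<in> sets M"
    by (simp add: sets_restrict_space_iff[OF S'] space_restrict_space Int_commute)
  have "(\<lambda>x. indicator S x *\<^sub>R s x) -` {y} \<inter> space M =
      (if y = 0 then s -` {y} \<inter> (space M \<inter> S) \<union> (space M - S) else s -` {y} \<inter> (space M \<inter> S))"
    by (auto simp: indicator_def)
  then show "(\<lambda>x. indicator S x *\<^sub>R s x) -` {y} \<inter> space M \<in> sets M"
    using 1 S by auto
qed

lemma strongly_measurable_extend:
  assumes S: "S \<in> sets M" and f: "strongly_measurable N (restrict_space M S) f"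
  shows "strongly_measurable N M (\<lambda>x. indicator S x *\<^sub>R f x)"
proof -
  obtain s where s: "\<And>i::nat. simple_function (restrict_space M S) (s i)"
    "\<And>i x. x \<in> space (restrict_space M S) \<Longrightarrow> N (s i x) < \<infinity>"
    "AE x in restrict_space M S. (\<lambda>i. N (f x - s i x)) \<longlonglongrightarrow> 0"
    using f unfolding strongly_measurable_def by blast
  have S': "S \<inter> space M \<in> sets M" using S by auto
  show ?thesis
  proof (rule strongly_measurableI[of M "\<lambda>i x. indicator S x *\<^sub>R s i x"])
    show "AE x in M. (\<lambda>i. N (indicator S x *\<^sub>R f x - indicator S x *\<^sub>R s i x)) \<longlonglongrightarrow> 0"
      using s(3) unfolding AE_restrict_space_iff[OF S']
      by eventually_elim (auto simp: indicator_def)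
    show "simple_function M (\<lambda>x. indicator S x *\<^sub>R s i x)" for i
      using S s(1) by (rule simple_function_extend)
  qed (use s(2) in \<open>auto simp: indicator_def space_restrict_space\<close>)
qed

lemma ennreal_half_add_half: "e / 2 + e / 2 = (e::ennreal)"
proof -
  have "e / 2 + e / 2 = 2 * (e / 2)" by (rule mult_2[symmetric])
  also have "\<dots> = 2 * e / 2" by (rule ennreal_times_divide)
  also have "\<dots> = e" using ennreal_mult_divide_eq[of 2 e] by (simp add: mult.commute)
  finally show ?thesis .
qed

text \<open>Strong measurability amounts to almost separable range and measurable distances; this
  characterisation is stable under almost everywhere limits.\<close>
lemma strongly_measurable_separable:
  assumes M: "complete_measure M" and d: "\<And>n::nat. N (d n) < \<infinity>"
    and meas: "\<And>n. (\<lambda>x. N (f x - d n)) \<in> borel_measurable M"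
    and dense: "AE x in M. (INF n. N (f x - d n)) = 0"
  shows "strongly_measurable N M f"
proof -
  \<comment> \<open>The first nearest point among \<open>d 0\<close>, ..., \<open>d n\<close>.
    Comparing finitely many distances and taking the least index makes the choice a measurable
    function of \<open>x\<close>.\<close>
  define best where "best n x = (LEAST k. k \<le> n \<and> (\<forall>j\<le>n. N (f x - d k) \<le> N (f x - d j)))" for n x
  have best: "best n x \<le> n \<and> (\<forall>j\<le>n. N (f x - d (best n x)) \<le> N (f x - d j))" for n x
  proof -
    let ?D = "(\<lambda>k. N (f x - d k)) ` {..n}"
    have "Min ?D \<in> ?D" by (rule Min_in) auto
    then obtain k where "Min ?D = N (f x - d k)" "k \<in> {..n}" by (rule imageE)
    moreover have "Min ?D \<le> N (f x - d j)" if "j \<le> n" for j using that by (intro Min_le) auto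
    ultimately have "\<exists>k. k \<le> n \<and> (\<forall>j\<le>n. N (f x - d k) \<le> N (f x - d j))"
      by (intro exI[of _ k]) auto
    then show ?thesis unfolding best_def by (rule LeastI_ex)
  qed
  have [measurable]: "(\<lambda>x. N (f x - d k)) \<in> borel_measurable M" for k by (rule meas)
  have [measurable]: "Measurable.pred M (\<lambda>x. N (f x - d k) \<le> N (f x - d j))" for k j
    by measurable
  have [measurable]: "best n \<in> measurable M (count_space UNIV)" for n
    unfolding best_def by (intro measurable_Least) measurable
  have sf: "simple_function M (best n)" for n
  proof (rule simple_function_def[THEN iffD2], intro conjI ballI)
    show "finite (best n ` space M)" by (rule finite_subset[of _ "{..n}"]) (use best in blast)+
  qed (auto intro: measurable_sets[of _ _ "count_space UNIV"])
  show ?thesis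
  proof (rule strongly_measurableI[of M "\<lambda>n x. d (best n x)"])
    show "simple_function M (\<lambda>x. d (best n x))" for n
      using sf by (rule simple_function_compose1)
    show "AE x in M. (\<lambda>n. N (f x - d (best n x))) \<longlonglongrightarrow> 0"
      using dense
    proof eventually_elim
      case (elim x)
      show ?case
      proof (rule order_tendstoI)
        fix e :: ennreal assume "0 < e"
        then have "(INF n. N (f x - d n)) < e" using elim by simp
        then obtain j where j: "N (f x - d j) < e" by (auto simp: INF_less_iff)
        show "eventually (\<lambda>n. N (f x - d (best n x)) < e) sequentially"
          using eventually_ge_at_top[of j]
          by eventually_elim (use best j in \<open>meson order.strict_trans1\<close>)
      qed simp
    qed
  qed (use d in auto)
qed

text \<open>The values of all simple approximations to all \<open>f n\<close> form a countable set,
  and almost every \<open>g x\<close> can be approximated from it; this is the separability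
  criterion. The distances \<open>N (g x - d k)\<close> are measurable as limits of
  \<open>N (f n x - d k)\<close>. An empty space is set apart because it provides no value from
  which to enumerate the set.\<close>

lemma strongly_measurable_limit:
  assumes M: "complete_measure M" and f: "\<And>n::nat. strongly_measurable N M (f n)"
    and lim: "AE x in M. (\<lambda>n. N (g x - f n x)) \<longlonglongrightarrow> 0"
  shows "strongly_measurable N M g"
proof (cases "space M = {}")
  case True
  then show ?thesis
    by (intro strongly_measurableI[of _ "\<lambda>_ _. 0"]) (auto simp: AE_iff_null)
next
  case False
  have "\<exists>s. \<forall>n. (\<forall>i::nat. simple_function M (s n i) \<and> (\<forall>x\<in>space M. N (s n i x) < \<infinity>)) \<and>
      (AE x in M. (\<lambda>i. N (f n x - s n i x)) \<longlonglongrightarrow> 0)"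
    using f unfolding strongly_measurable_def by (intro choice) blast
  then obtain s where s: "\<And>n i. simple_function M (s n i)" "\<And>n i x. x \<in> space M \<Longrightarrow> N (s n i x) < \<infinity>"
    "\<And>n. AE x in M. (\<lambda>i. N (f n x - s n i x)) \<longlonglongrightarrow> 0"
    by blast
  define D where "D = (\<Union>n. \<Union>i. s n i ` space M)"
  have "finite (s n i ` space M)" for n i using s(1) by (simp add: simple_function_def)
  then have "countable D" "D \<noteq> {}" using False by (auto simp: D_def countable_finite)
  then obtain d :: "nat \<Rightarrow> 'y" where d: "range d = D" using that[of "from_nat_into D"] by simp
  have dfin: "N (d k) < \<infinity>" for k
  proof -
    have "d k \<in> D" using d by auto
    then show ?thesis using s(2) by (auto simp: D_def)
  qed
  show ?thesis
  proof (rule strongly_measurable_separable[OF M, of d])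
    show "N (d k) < \<infinity>" for k by fact
    show "(\<lambda>x. N (g x - d k)) \<in> borel_measurable M" for k
    proof (rule complete_measure_cong_AE[OF M])
      have [measurable]: "(\<lambda>x. N (f n x - d k)) \<in> borel_measurable M" for n
        by (intro borel_measurable_seminorm[OF M] strongly_measurable_diff f strongly_measurable_const dfin)
      show "(\<lambda>x. liminf (\<lambda>n. N (f n x - d k))) \<in> borel_measurable M" by measurable
      show "AE x in M. N (g x - d k) = liminf (\<lambda>n. N (f n x - d k))"
        using lim
      proof eventually_elim
        case (elim x)
        have "(\<lambda>n. N (f n x - d k)) \<longlonglongrightarrow> N (g x - d k)"
          by (rule tendsto_of_diff) (use elim in simp)
        then show ?case by (auto dest!: lim_imp_Liminf[rotated])
      qed
    qed
    have AE: "AE x in M. \<forall>n. (\<lambda>i. N (f n x - s n i x)) \<longlonglongrightarrow> 0"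
      using s(3) by (simp add: AE_all_countable)
    show "AE x in M. (INF k. N (g x - d k)) = 0"
      using lim AE AE_space
    proof eventually_elim
      case (elim x)
      have "(INF k. N (g x - d k)) \<le> e" if "0 < e" for e
      proof -
        have e2: "0 < e / 2" using that by (simp add: ennreal_zero_less_divide)
        obtain n where n: "N (g x - f n x) < e / 2"
          using order_tendstoD(2)[OF elim(1) e2] by (auto simp: eventually_sequentially)
        obtain i where i: "N (f n x - s n i x) < e / 2"
          using order_tendstoD(2)[OF elim(2)[rule_format, of n] e2] by (auto simp: eventually_sequentially)
        have "s n i x \<in> D" using elim(3) by (auto simp: D_def)
        then obtain k where k: "d k = s n i x" using d by (metis imageE)
        have "(INF k. N (g x - d k)) \<le> N (g x - s n i x)"
          by (rule INF_lower2[of k]) (auto simp: k)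
        also have "\<dots> \<le> N (g x - f n x) + N (f n x - s n i x)" by (rule diff_triangle)
        also have "\<dots> \<le> e / 2 + e / 2" using n i by (intro add_mono) auto
        also have "\<dots> = e" by (rule ennreal_half_add_half)
        finally show ?thesis .
      qed
      then show ?case by (metis dense_ge le_zero_eq)
    qed
  qed
qed

end

subsection \<open>The Bochner integral over an extended seminorm\<close>

text \<open>Completeness in terms of sequences with summable increments: a rapidly convergent
  subsequence has this form, and so have the partial sums of an absolutely convergent series. The
  limit \<open>w\<close> is determined only up to \<open>N\<close>-null vectors.\<close>

definition seminorm_complete :: "('y::real_vector \<Rightarrow> ennreal) \<Rightarrow> bool"
  where "seminorm_complete N \<longleftrightarrow>
    (\<forall>v::nat \<Rightarrow> 'y. (\<forall>i. N (v i) < \<infinity>) \<and> (\<Sum>i. N (v (Suc i) - v i)) < \<infinity> \<longrightarrow>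
      (\<exists>w. N w < \<infinity> \<and> (\<lambda>i. N (v i - w)) \<longlonglongrightarrow> 0))"

context ext_seminorm
begin

lemma has_bochnerI:
  assumes "strongly_measurable N M f" "N v < \<infinity>"
    "\<And>i::nat. Bochner_Integration.simple_bochner_integrable M (s i)"
    "\<And>i x. x \<in> space M \<Longrightarrow> N (s i x) < \<infinity>"
    "(\<lambda>i. \<integral>\<^sup>+ x. N (f x - s i x) \<partial>M) \<longlonglongrightarrow> 0"
    "(\<lambda>i. N (Bochner_Integration.simple_bochner_integral M (s i) - v)) \<longlonglongrightarrow> 0"
  shows "has_bochner N M f v"
  unfolding has_bochner_def using assms by blast

lemma has_bochnerE:
  assumes "has_bochner N M f v"
  obtains s where "strongly_measurable N M f" "N v < \<infinity>"
    "\<And>i::nat. Bochner_Integration.simple_bochner_integrable M (s i)"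
    "\<And>i x. x \<in> space M \<Longrightarrow> N (s i x) < \<infinity>"
    "(\<lambda>i. \<integral>\<^sup>+ x. N (f x - s i x) \<partial>M) \<longlonglongrightarrow> 0"
    "(\<lambda>i. N (Bochner_Integration.simple_bochner_integral M (s i) - v)) \<longlonglongrightarrow> 0"
  using assms unfolding has_bochner_def by blast

lemma simple_bochner_integral_bound:
  assumes s: "Bochner_Integration.simple_bochner_integrable M s"
  shows "N (Bochner_Integration.simple_bochner_integral M s) \<le> (\<integral>\<^sup>+ x. N (s x) \<partial>M)"
proof -
  have sf: "simple_function M s" and fin: "emeasure M {y\<in>space M. s y \<noteq> 0} \<noteq> \<infinity>"
    using s by (auto elim: Bochner_Integration.simple_bochner_integrable.cases)
  have [simp]: "finite (s ` space M)" using sf by (simp add: simple_function_def)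
  have ms: "{x\<in>space M. s x = y} \<in> sets M" for y
    using simple_functionD(2)[OF sf, of "{y}"] by (simp add: vimage_def Int_def conj_commute)
  have "N (Bochner_Integration.simple_bochner_integral M s)
      \<le> (\<Sum>y\<in>s ` space M. N (measure M {x\<in>space M. s x = y} *\<^sub>R y))"
    unfolding Bochner_Integration.simple_bochner_integral_def by (rule sum_le)
  also have "\<dots> = (\<Sum>y\<in>s ` space M. N y * emeasure M {x\<in>space M. s x = y})"
  proof (rule sum.cong[OF refl])
    fix y
    show "N (measure M {x\<in>space M. s x = y} *\<^sub>R y) = N y * emeasure M {x\<in>space M. s x = y}"
    \<comment> \<open>The level set of 0 may have infinite measure, where \<open>measure\<close> and
      \<open>emeasure\<close> disagree; for \<open>y = 0\<close> both sides vanish.\<close>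
    proof (cases "y = 0")
      case False
      have "emeasure M {x\<in>space M. s x = y} \<le> emeasure M {x\<in>space M. s x \<noteq> 0}"
        using False simple_functionD(2)[OF sf, of "- {0}"]
        by (intro emeasure_mono) (auto simp: vimage_def Int_def conj_commute)
      then have "emeasure M {x\<in>space M. s x = y} \<noteq> top" using fin by (auto simp: top_unique)
      then show ?thesis by (simp add: scale emeasure_eq_ennreal_measure mult.commute)
    qed simp
  qed
  also have "\<dots> = (\<Sum>y\<in>s ` space M. \<integral>\<^sup>+ x. N y * indicator {x\<in>space M. s x = y} x \<partial>M)"
    using ms by (intro sum.cong refl nn_integral_cmult_indicator[symmetric])
  also have "\<dots> = (\<integral>\<^sup>+ x. (\<Sum>y\<in>s ` space M. N y * indicator {x\<in>space M. s x = y} x) \<partial>M)"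
    using ms by (intro nn_integral_sum[symmetric]) auto
  also have "\<dots> = (\<integral>\<^sup>+ x. N (s x) \<partial>M)"
  proof (rule nn_integral_cong)
    fix x assume x: "x \<in> space M"
    have "(\<Sum>y\<in>s ` space M. N y * indicator {x\<in>space M. s x = y} x) =
        (\<Sum>y\<in>s ` space M. if y = s x then N y else 0)"
      using x by (intro sum.cong) (auto simp: indicator_def)
    then show "(\<Sum>y\<in>s ` space M. N y * indicator {x\<in>space M. s x = y} x) = N (s x)"
      using x by simp
  qed
  finally show ?thesis .
qed

lemma nn_integral_triangle:
  assumes "complete_measure M" "strongly_measurable N M f" "strongly_measurable N M g"
  shows "(\<integral>\<^sup>+ x. N (f x + g x) \<partial>M) \<le> (\<integral>\<^sup>+ x. N (f x) \<partial>M) + (\<integral>\<^sup>+ x. N (g x) \<partial>M)"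
proof -
  have "(\<integral>\<^sup>+ x. N (f x + g x) \<partial>M) \<le> (\<integral>\<^sup>+ x. N (f x) + N (g x) \<partial>M)"
    by (intro nn_integral_mono triangle)
  also have "\<dots> = (\<integral>\<^sup>+ x. N (f x) \<partial>M) + (\<integral>\<^sup>+ x. N (g x) \<partial>M)"
    using assms by (intro nn_integral_add borel_measurable_seminorm)
  finally show ?thesis .
qed

lemma nn_integral_triangle_diff:
  assumes "complete_measure M" "strongly_measurable N M f" "strongly_measurable N M g"
  shows "(\<integral>\<^sup>+ x. N (f x - g x) \<partial>M) \<le> (\<integral>\<^sup>+ x. N (f x) \<partial>M) + (\<integral>\<^sup>+ x. N (g x) \<partial>M)"
  using nn_integral_triangle[OF assms(1,2) strongly_measurable_scaleR[OF assms(3), of "-1"]] by simp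

lemma strongly_measurable_simple_bochner:
  assumes "Bochner_Integration.simple_bochner_integrable M s" "\<And>x. x \<in> space M \<Longrightarrow> N (s x) < \<infinity>"
  shows "strongly_measurable N M s"
  using assms by (intro strongly_measurable_simple)
    (auto elim: Bochner_Integration.simple_bochner_integrable.cases)

lemma has_bochner_bound:
  assumes M: "complete_measure M" and f: "has_bochner N M f v"
  shows "N v \<le> (\<integral>\<^sup>+ x. N (f x) \<partial>M)"
proof -
  from f obtain s where s: "strongly_measurable N M f" "N v < \<infinity>"
    "\<And>i::nat. Bochner_Integration.simple_bochner_integrable M (s i)"
    "\<And>i x. x \<in> space M \<Longrightarrow> N (s i x) < \<infinity>"
    "(\<lambda>i. \<integral>\<^sup>+ x. N (f x - s i x) \<partial>M) \<longlonglongrightarrow> 0"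
    "(\<lambda>i. N (Bochner_Integration.simple_bochner_integral M (s i) - v)) \<longlonglongrightarrow> 0"
    by (rule has_bochnerE) blast
  let ?I = "\<lambda>i. Bochner_Integration.simple_bochner_integral M (s i)"
  have sm: "strongly_measurable N M (s i)" for i using s(3,4) by (rule strongly_measurable_simple_bochner)
  have le: "N v \<le> N (?I i - v) + ((\<integral>\<^sup>+ x. N (f x - s i x) \<partial>M) + (\<integral>\<^sup>+ x. N (f x) \<partial>M))" for i
  proof -
    have "N v \<le> N (?I i - v) + N (?I i)" unfolding diff_commute[of "?I i"] by (rule le_diff_add)
    moreover have "N (?I i) \<le> (\<integral>\<^sup>+ x. N (s i x) \<partial>M)"
      using s(3) by (rule simple_bochner_integral_bound)
    moreover have "(\<integral>\<^sup>+ x. N (s i x) \<partial>M) \<le> (\<integral>\<^sup>+ x. N (f x - s i x) \<partial>M) + (\<integral>\<^sup>+ x. N (f x) \<partial>M)"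
      using nn_integral_triangle[OF M strongly_measurable_diff[OF sm[of i] s(1)] s(1)]
      by (simp add: diff_commute)
    ultimately show ?thesis by (meson add_left_mono order_trans)
  qed
  have "(\<lambda>i. N (?I i - v) + ((\<integral>\<^sup>+ x. N (f x - s i x) \<partial>M) + (\<integral>\<^sup>+ x. N (f x) \<partial>M)))
      \<longlonglongrightarrow> 0 + (0 + (\<integral>\<^sup>+ x. N (f x) \<partial>M))"
    by (intro tendsto_add s tendsto_const)
  then show ?thesis
    using le by (intro LIMSEQ_le_const) auto
qed

lemma has_bochner_add:
  assumes M: "complete_measure M" and f: "has_bochner N M f v" and g: "has_bochner N M g w"
  shows "has_bochner N M (\<lambda>x. f x + g x) (v + w)"
proof -
  from f obtain s where s: "strongly_measurable N M f" "N v < \<infinity>"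
    "\<And>i::nat. Bochner_Integration.simple_bochner_integrable M (s i)"
    "\<And>i x. x \<in> space M \<Longrightarrow> N (s i x) < \<infinity>"
    "(\<lambda>i. \<integral>\<^sup>+ x. N (f x - s i x) \<partial>M) \<longlonglongrightarrow> 0"
    "(\<lambda>i. N (Bochner_Integration.simple_bochner_integral M (s i) - v)) \<longlonglongrightarrow> 0"
    by (rule has_bochnerE) blast
  from g obtain u where u: "strongly_measurable N M g" "N w < \<infinity>"
    "\<And>i::nat. Bochner_Integration.simple_bochner_integrable M (u i)"
    "\<And>i x. x \<in> space M \<Longrightarrow> N (u i x) < \<infinity>"
    "(\<lambda>i. \<integral>\<^sup>+ x. N (g x - u i x) \<partial>M) \<longlonglongrightarrow> 0"
    "(\<lambda>i. N (Bochner_Integration.simple_bochner_integral M (u i) - w)) \<longlonglongrightarrow> 0"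
    by (rule has_bochnerE) blast
  have sm: "strongly_measurable N M (s i)" "strongly_measurable N M (u i)" for i
    using s(3,4) u(3,4) by (auto intro: strongly_measurable_simple_bochner)
  show ?thesis
  proof (rule has_bochnerI[of M _ _ "\<lambda>i x. s i x + u i x"])
    show "strongly_measurable N M (\<lambda>x. f x + g x)" using s(1) u(1) by (rule strongly_measurable_add)
    show "N (v + w) < \<infinity>" using s(2) u(2) by (rule add_finite)
    show "Bochner_Integration.simple_bochner_integrable M (\<lambda>x. s i x + u i x)" for i
      using s(3) u(3) by (intro simple_bochner_integrable_compose2[where p="(+)"]) auto
    show "N (s i x + u i x) < \<infinity>" if "x \<in> space M" for i x
      using s(4) u(4) that by (intro add_finite)
    show "(\<lambda>i. \<integral>\<^sup>+ x. N (f x + g x - (s i x + u i x)) \<partial>M) \<longlonglongrightarrow> 0"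
    proof (rule tendsto_sandwich[OF _ _ tendsto_const])
      have eq: "f x + g x - (s i x + u i x) = (f x - s i x) + (g x - u i x)" for i x by simp
      have "(\<integral>\<^sup>+ x. N (f x + g x - (s i x + u i x)) \<partial>M)
          \<le> (\<integral>\<^sup>+ x. N (f x - s i x) \<partial>M) + (\<integral>\<^sup>+ x. N (g x - u i x) \<partial>M)" for i
        unfolding eq using nn_integral_triangle[OF M strongly_measurable_diff[OF s(1) sm(1)[of i]]
            strongly_measurable_diff[OF u(1) sm(2)[of i]]] by simp
      then show "\<forall>\<^sub>F i in sequentially. (\<integral>\<^sup>+ x. N (f x + g x - (s i x + u i x)) \<partial>M)
          \<le> (\<integral>\<^sup>+ x. N (f x - s i x) \<partial>M) + (\<integral>\<^sup>+ x. N (g x - u i x) \<partial>M)" by simp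
      show "(\<lambda>i. (\<integral>\<^sup>+ x. N (f x - s i x) \<partial>M) + (\<integral>\<^sup>+ x. N (g x - u i x) \<partial>M)) \<longlonglongrightarrow> 0"
        using tendsto_add[OF s(5) u(5)] by simp
    qed simp
    show "(\<lambda>i. N (Bochner_Integration.simple_bochner_integral M (\<lambda>x. s i x + u i x) - (v + w))) \<longlonglongrightarrow> 0"
    proof (rule tendsto_sandwich[OF _ _ tendsto_const])
      have eq: "a + b - (v + w) = (a - v) + (b - w)" for a b by simp
      have "N (a + b - (v + w)) \<le> N (a - v) + N (b - w)" for a b
        unfolding eq using triangle[of "a - v" "b - w"] by simp
      then show "\<forall>\<^sub>F i in sequentially.
          N (Bochner_Integration.simple_bochner_integral M (\<lambda>x. s i x + u i x) - (v + w))
          \<le> N (Bochner_Integration.simple_bochner_integral M (s i) - v) +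
             N (Bochner_Integration.simple_bochner_integral M (u i) - w)"
        using s(3) u(3) by (simp add: simple_bochner_integral_add)
      show "(\<lambda>i. N (Bochner_Integration.simple_bochner_integral M (s i) - v) +
             N (Bochner_Integration.simple_bochner_integral M (u i) - w)) \<longlonglongrightarrow> 0"
        using tendsto_add[OF s(6) u(6)] by simp
    qed simp
  qed
qed

lemma has_bochner_scaleR:
  assumes f: "has_bochner N M f v" and M: "complete_measure M"
  shows "has_bochner N M (\<lambda>x. c *\<^sub>R f x) (c *\<^sub>R v)"
proof -
  from f obtain s where s: "strongly_measurable N M f" "N v < \<infinity>"
    "\<And>i::nat. Bochner_Integration.simple_bochner_integrable M (s i)"
    "\<And>i x. x \<in> space M \<Longrightarrow> N (s i x) < \<infinity>"
    "(\<lambda>i. \<integral>\<^sup>+ x. N (f x - s i x) \<partial>M) \<longlonglongrightarrow> 0"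
    "(\<lambda>i. N (Bochner_Integration.simple_bochner_integral M (s i) - v)) \<longlonglongrightarrow> 0"
    by (rule has_bochnerE) blast
  have sm: "strongly_measurable N M (s i)" for i using s(3,4) by (rule strongly_measurable_simple_bochner)
  show ?thesis
  proof (rule has_bochnerI[of M _ _ "\<lambda>i x. c *\<^sub>R s i x"])
    show "strongly_measurable N M (\<lambda>x. c *\<^sub>R f x)" using s(1) by (rule strongly_measurable_scaleR)
    show "N (c *\<^sub>R v) < \<infinity>" using s(2) by (rule scale_finite)
    show "Bochner_Integration.simple_bochner_integrable M (\<lambda>x. c *\<^sub>R s i x)" for i
      using s(3)[of i] s(3)[of i] by (rule simple_bochner_integrable_compose2[where p="\<lambda>x y. c *\<^sub>R x", rotated]) simp
    show "N (c *\<^sub>R s i x) < \<infinity>" if "x \<in> space M" for i x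
      using s(4) that by (intro scale_finite)
    have "(\<integral>\<^sup>+ x. N (c *\<^sub>R f x - c *\<^sub>R s i x) \<partial>M) = ennreal \<bar>c\<bar> * (\<integral>\<^sup>+ x. N (f x - s i x) \<partial>M)" for i
      unfolding scaleR_diff_right[symmetric] scale
      by (intro nn_integral_cmult borel_measurable_seminorm[OF M] strongly_measurable_diff s(1) sm)
    then show "(\<lambda>i. \<integral>\<^sup>+ x. N (c *\<^sub>R f x - c *\<^sub>R s i x) \<partial>M) \<longlonglongrightarrow> 0"
      using ennreal_tendsto_cmult[OF _ s(5), of "ennreal \<bar>c\<bar>"] by simp
    have "Bochner_Integration.simple_bochner_integral M (\<lambda>x. c *\<^sub>R s i x) =
        c *\<^sub>R Bochner_Integration.simple_bochner_integral M (s i)" for i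
      by (rule simple_bochner_integral_linear[OF _ s(3)]) (rule linear_scaleR)
    then show "(\<lambda>i. N (Bochner_Integration.simple_bochner_integral M (\<lambda>x. c *\<^sub>R s i x) - c *\<^sub>R v)) \<longlonglongrightarrow> 0"
      using ennreal_tendsto_cmult[OF _ s(6), of "ennreal \<bar>c\<bar>"]
      by (simp add: scaleR_diff_right[symmetric] scale)
  qed
qed

lemma has_bochner_diff:
  assumes "complete_measure M" "has_bochner N M f v" "has_bochner N M g w"
  shows "has_bochner N M (\<lambda>x. f x - g x) (v - w)"
  using has_bochner_add[OF assms(1,2) has_bochner_scaleR[OF assms(3,1), of "-1"]] by simp

lemma has_bochner_cong_AE:
  assumes M: "complete_measure M" and f: "has_bochner N M f v" and eq: "AE x in M. N (g x - f x) = 0"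
  shows "has_bochner N M g v"
proof -
  from f obtain s where s: "strongly_measurable N M f" "N v < \<infinity>"
    "\<And>i::nat. Bochner_Integration.simple_bochner_integrable M (s i)"
    "\<And>i x. x \<in> space M \<Longrightarrow> N (s i x) < \<infinity>"
    "(\<lambda>i. \<integral>\<^sup>+ x. N (f x - s i x) \<partial>M) \<longlonglongrightarrow> 0"
    "(\<lambda>i. N (Bochner_Integration.simple_bochner_integral M (s i) - v)) \<longlonglongrightarrow> 0"
    by (rule has_bochnerE) blast
  have "(\<integral>\<^sup>+ x. N (g x - s i x) \<partial>M) = (\<integral>\<^sup>+ x. N (f x - s i x) \<partial>M)" for i
  proof (rule nn_integral_cong_AE)
    show "AE x in M. N (g x - s i x) = N (f x - s i x)"
      using eq
    proof eventually_elim
      case (elim x)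
      have "N (g x - s i x) \<le> N (f x - s i x)" "N (f x - s i x) \<le> N (g x - s i x)"
        using diff_triangle[of "g x" "s i x" "f x"] diff_triangle[of "f x" "s i x" "g x"] elim
        by (simp_all add: diff_commute[of "f x" "g x"])
      then show ?case by (rule antisym)
    qed
  qed
  then show ?thesis
    using s by (intro has_bochnerI[of M g v s] strongly_measurable_cong_AE[OF s(1) eq]) auto
qed

lemma has_bochner_zero: "has_bochner N M (\<lambda>_. 0) 0"
  by (rule has_bochnerI[of M _ _ "\<lambda>_ _. 0"])
    (auto simp: Bochner_Integration.simple_bochner_integrable.simps
      Bochner_Integration.simple_bochner_integral_def image_constant_conv)

lemma has_bochner_scaleR_const:
  fixes h :: "'m \<Rightarrow> real"
  assumes M: "complete_measure M" and h: "has_bochner_integral M h a" and c: "N c < \<infinity>"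
  shows "has_bochner N M (\<lambda>x. h x *\<^sub>R c) (a *\<^sub>R c)"
proof -
  obtain s where s: "\<And>i::nat. Bochner_Integration.simple_bochner_integrable M (s i)"
    "(\<lambda>i. \<integral>\<^sup>+x. norm (h x - s i x) \<partial>M) \<longlonglongrightarrow> 0"
    "(\<lambda>i. Bochner_Integration.simple_bochner_integral M (s i)) \<longlonglongrightarrow> a" "h \<in> borel_measurable M"
    using h by (rule has_bochner_integral.cases) blast
  have [measurable]: "s i \<in> borel_measurable M" "h \<in> borel_measurable M" for i
    using s(1)[of i] s(4)
    by (auto intro: borel_measurable_simple_function elim: Bochner_Integration.simple_bochner_integrable.cases)
  show ?thesis
  proof (rule has_bochnerI[of M _ _ "\<lambda>i x. s i x *\<^sub>R c"])
    show "strongly_measurable N M (\<lambda>x. h x *\<^sub>R c)"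
      using s(4) c by (intro strongly_measurable_mult strongly_measurable_const)
    show "Bochner_Integration.simple_bochner_integrable M (\<lambda>x. s i x *\<^sub>R c)" for i
      using s(1)[of i] s(1)[of i]
      by (rule simple_bochner_integrable_compose2[where p="\<lambda>x y. x *\<^sub>R c", rotated]) simp
    have "(\<integral>\<^sup>+ x. N (h x *\<^sub>R c - s i x *\<^sub>R c) \<partial>M) = (\<integral>\<^sup>+ x. ennreal (norm (h x - s i x)) \<partial>M) * N c" for i
      unfolding scaleR_diff_left[symmetric] scale
      by (subst nn_integral_multc) auto
    then show "(\<lambda>i. \<integral>\<^sup>+ x. N (h x *\<^sub>R c - s i x *\<^sub>R c) \<partial>M) \<longlonglongrightarrow> 0"
      using ennreal_tendsto_cmult[OF _ s(2), of "N c"] c by (simp add: mult.commute)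
    have lin: "Bochner_Integration.simple_bochner_integral M (\<lambda>x. s i x *\<^sub>R c) =
        Bochner_Integration.simple_bochner_integral M (s i) *\<^sub>R c" for i
      by (rule simple_bochner_integral_linear[OF _ s(1)]) (rule linear_scaleR_left)
    have "(\<lambda>i. \<bar>Bochner_Integration.simple_bochner_integral M (s i) - a\<bar>) \<longlonglongrightarrow> 0"
      using tendsto_rabs[OF tendsto_diff[OF s(3) tendsto_const[of a]]] by simp
    from ennreal_tendsto_cmult[OF _ tendsto_ennrealI[OF this], of "N c"] c
    show "(\<lambda>i. N (Bochner_Integration.simple_bochner_integral M (\<lambda>x. s i x *\<^sub>R c) - a *\<^sub>R c)) \<longlonglongrightarrow> 0"
      by (simp add: lin scaleR_diff_left[symmetric] scale mult.commute)
  qed (rule scale_finite, rule c)+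
qed

text \<open>Compares an integral with that of a constant; after division by the total mass it bounds
  the distance from \<open>c\<close> to the mean value of \<open>f\<close>.\<close>

lemma has_bochner_bound_const:
  assumes M: "complete_measure M" and f: "has_bochner N M f v" and c: "N c < \<infinity>"
    and fin: "emeasure M (space M) < \<infinity>"
  shows "N (v - measure M (space M) *\<^sub>R c) \<le> (\<integral>\<^sup>+ x. N (f x - c) \<partial>M)"
proof -
  have "has_bochner N M (\<lambda>x. indicator (space M) x *\<^sub>R c) (measure M (space M) *\<^sub>R c)"
    using fin by (intro has_bochner_scaleR_const M c has_bochner_integral_real_indicator) auto
  from has_bochner_bound[OF M has_bochner_diff[OF M f this]]
  have "N (v - measure M (space M) *\<^sub>R c) \<le> (\<integral>\<^sup>+ x. N (f x - indicator (space M) x *\<^sub>R c) \<partial>M)" .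
  also have "\<dots> = (\<integral>\<^sup>+ x. N (f x - c) \<partial>M)" by (intro nn_integral_cong) simp
  finally show ?thesis .
qed

text \<open>\<open>T_loc\<close> integrates over a ball that moves with the point, each time on
  another measure space. Extension by zero brings all these integrals to one space, where linearity
  can combine them.\<close>

lemma has_bochner_extend:
  assumes S: "S \<in> sets M" and f: "has_bochner N (restrict_space M S) f v"
  shows "has_bochner N M (\<lambda>x. indicator S x *\<^sub>R f x) v"
proof -
  from f obtain s where s: "strongly_measurable N (restrict_space M S) f" "N v < \<infinity>"
    "\<And>i::nat. Bochner_Integration.simple_bochner_integrable (restrict_space M S) (s i)"
    "\<And>i x. x \<in> space (restrict_space M S) \<Longrightarrow> N (s i x) < \<infinity>"
    "(\<lambda>i. \<integral>\<^sup>+ x. N (f x - s i x) \<partial>restrict_space M S) \<longlonglongrightarrow> 0"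
    "(\<lambda>i. N (Bochner_Integration.simple_bochner_integral (restrict_space M S) (s i) - v)) \<longlonglongrightarrow> 0"
    by (rule has_bochnerE) blast
  have S': "S \<inter> space M \<in> sets M" "S \<subseteq> space M" using S sets.sets_into_space by auto
  have sf: "simple_function M (\<lambda>x. indicator S x *\<^sub>R s i x)" for i
    using S s(3)[of i] by (intro simple_function_extend)
      (auto elim: Bochner_Integration.simple_bochner_integrable.cases)
  have int: "Bochner_Integration.simple_bochner_integrable M (\<lambda>x. indicator S x *\<^sub>R s i x)" for i
  proof (rule Bochner_Integration.simple_bochner_integrable.intros[OF sf])
    have "{y \<in> space M. indicator S y *\<^sub>R s i y \<noteq> 0} = {y \<in> space (restrict_space M S). s i y \<noteq> 0}"
      using S' by (auto simp: space_restrict_space indicator_def)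
    moreover have "emeasure (restrict_space M S) {y \<in> space (restrict_space M S). s i y \<noteq> 0} \<noteq> \<infinity>"
      using s(3)[of i] by (auto elim: Bochner_Integration.simple_bochner_integrable.cases)
    ultimately show "emeasure M {y \<in> space M. indicator S y *\<^sub>R s i y \<noteq> 0} \<noteq> \<infinity>"
      by (subst (asm) emeasure_restrict_space) (use S' in \<open>auto simp: space_restrict_space\<close>)
  qed
  have eq: "Bochner_Integration.simple_bochner_integral M (\<lambda>x. indicator S x *\<^sub>R s i x) =
      Bochner_Integration.simple_bochner_integral (restrict_space M S) (s i)" for i
  proof -
    let ?t = "\<lambda>x. indicator S x *\<^sub>R s i x"
    have fin: "finite (s i ` S)"
      using s(3)[of i] S'(2) by (auto elim!: Bochner_Integration.simple_bochner_integrable.cases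
          simp: simple_function_def space_restrict_space Int_absorb2)
    have img: "?t ` space M \<subseteq> insert 0 (s i ` S)" by (auto simp: indicator_def)
    \<comment> \<open>Extension by zero may add the value 0, so both integrals are compared with the
      sum over the nonzero values.\<close>
    have "Bochner_Integration.simple_bochner_integral M ?t =
        (\<Sum>y\<in>s i ` S - {0}. measure M {x \<in> space M. ?t x = y} *\<^sub>R y)"
      unfolding Bochner_Integration.simple_bochner_integral_def
    proof (rule sum.mono_neutral_cong)
      show "finite (?t ` space M)" using fin img by (meson finite.insertI finite_subset)
      show "measure M {x \<in> space M. ?t x = y} *\<^sub>R y = 0" if "y \<in> ?t ` space M - (s i ` S - {0})" for y
        using that img by auto
      show "measure M {x \<in> space M. ?t x = y} *\<^sub>R y = 0" if "y \<in> (s i ` S - {0}) - ?t ` space M" for y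
        using that by (metis (mono_tags, lifting) DiffD2 empty_Collect_eq image_eqI measure_empty scaleR_zero_left)
    qed (use fin in auto)
    also have "\<dots> = (\<Sum>y\<in>s i ` S - {0}. measure (restrict_space M S) {x \<in> S. s i x = y} *\<^sub>R y)"
    proof (intro sum.cong refl arg_cong2[where f=scaleR])
      fix y assume y: "y \<in> s i ` S - {0}"
      then have "{x \<in> space M. ?t x = y} = {x \<in> S. s i x = y}" using S'(2) by (auto simp: indicator_def)
      then show "measure M {x \<in> space M. ?t x = y} = measure (restrict_space M S) {x \<in> S. s i x = y}"
        using S' by (subst measure_restrict_space) auto
    qed
    also have "\<dots> = Bochner_Integration.simple_bochner_integral (restrict_space M S) (s i)"
      unfolding Bochner_Integration.simple_bochner_integral_def using fin S'(2)
      by (intro sum.mono_neutral_cong_left) (auto simp: space_restrict_space Int_absorb2)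
    finally show ?thesis .
  qed
  have nn: "(\<integral>\<^sup>+ x. N (indicator S x *\<^sub>R f x - indicator S x *\<^sub>R s i x) \<partial>M) =
      (\<integral>\<^sup>+ x. N (f x - s i x) \<partial>restrict_space M S)" for i
    by (subst nn_integral_restrict_space[OF S'(1)], intro nn_integral_cong) (auto simp: indicator_def)
  show ?thesis
  proof (rule has_bochnerI[of M _ _ "\<lambda>i x. indicator S x *\<^sub>R s i x"])
    show "N (indicator S x *\<^sub>R s i x) < \<infinity>" if "x \<in> space M" for x i
      using s(4)[of x i] that by (auto simp: indicator_def space_restrict_space)
  qed (use s int strongly_measurable_extend[OF S s(1)] in \<open>simp_all add: eq nn\<close>)
qed

lemma has_bochner_exists:
  assumes M: "complete_measure M" and cN: "seminorm_complete N" and f: "strongly_measurable N M f"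
    and fin: "(\<integral>\<^sup>+ x. N (f x) \<partial>M) < \<infinity>"
  shows "\<exists>v. has_bochner N M f v"
proof -
  obtain s where s: "\<And>i::nat. simple_function M (s i)" "\<And>i x. x \<in> space M \<Longrightarrow> N (s i x) < \<infinity>"
    "AE x in M. (\<lambda>i. N (f x - s i x)) \<longlonglongrightarrow> 0"
    using f unfolding strongly_measurable_def by blast
  have Nf [measurable]: "(\<lambda>x. N (f x)) \<in> borel_measurable M" by (rule borel_measurable_seminorm[OF M f])
  have Ns [measurable]: "(\<lambda>x. N (s i x)) \<in> borel_measurable M" for i
    using simple_function_compose1[OF s(1), of N] by (rule borel_measurable_simple_function)
  \<comment> \<open>The cut at \<open>2 * N (f x)\<close> provides an integrable majorant for
    dominated convergence and is eventually inactive where \<open>N (f x)\<close> is positive and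
    finite. The condition \<open>0 < N (s i x)\<close> makes \<open>u i x\<close> equal to 0
    wherever its seminorm vanishes, so that its support is detected by \<open>N\<close>.\<close>
  define u where "u i x = (if N (s i x) \<le> 2 * N (f x) \<and> 0 < N (s i x) then s i x else 0)" for i x
  have su: "simple_function M (u i)" for i
    unfolding u_def by (intro simple_function_If s(1) simple_function_const) measurable
  have uN: "N (u i x) \<le> 2 * N (f x)" for i x by (simp add: u_def)
  have smu: "strongly_measurable N M (u i)" for i
    using su by (rule strongly_measurable_simple) (use s(2) in \<open>auto simp: u_def\<close>)
  have lim: "(\<lambda>i. \<integral>\<^sup>+ x. N (f x - u i x) \<partial>M) \<longlonglongrightarrow> (\<integral>\<^sup>+ x. 0 \<partial>M)"
  proof (rule nn_integral_dominated_convergence)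
    show "(\<lambda>x. N (f x - u i x)) \<in> borel_measurable M" for i
      by (intro borel_measurable_seminorm[OF M] strongly_measurable_diff f smu)
    show "(\<lambda>x. 3 * N (f x)) \<in> borel_measurable M" by measurable
    have "(\<integral>\<^sup>+ x. 3 * N (f x) \<partial>M) = 3 * (\<integral>\<^sup>+ x. N (f x) \<partial>M)" by (rule nn_integral_cmult) measurable
    then show "(\<integral>\<^sup>+ x. 3 * N (f x) \<partial>M) < \<infinity>" using fin by (simp add: ennreal_mult_less_top)
    show "AE x in M. N (f x - u i x) \<le> 3 * N (f x)" for i
    proof (rule AE_I2)
      fix x
      have "N (f x - u i x) \<le> N (f x) + 2 * N (f x)"
        using triangle_diff[of "f x" "u i x"] uN[of i x] by (meson add_left_mono order_trans)
      also have "\<dots> = (1 + 2) * N (f x)" by (simp only: distrib_right mult_1)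
      also have "\<dots> = 3 * N (f x)" by simp
      finally show "N (f x - u i x) \<le> 3 * N (f x)" .
    qed
    show "AE x in M. (\<lambda>i. N (f x - u i x)) \<longlonglongrightarrow> 0"
      using s(3) strongly_measurable_AE_finite[OF f]
    proof eventually_elim
      case (elim x)
      show ?case
      proof (cases "N (f x) = 0")
        case True
        then have "u i x = 0" for i using not_gr_zero by (auto simp: u_def)
        then show ?thesis using True by simp
      next
        case False
        have t: "(\<lambda>i. N (s i x)) \<longlonglongrightarrow> N (f x)" using elim(1) by (rule tendsto_of_diff)
        have "N (f x) < 2 * N (f x)"
          using False elim(2) by (cases "N (f x)") (auto simp: ennreal_mult[symmetric] ennreal_less_iff simp flip: ennreal_numeral)
        then have "\<forall>\<^sub>F i in sequentially. u i x = s i x"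
          using order_tendstoD(1)[OF t, of 0] order_tendstoD(2)[OF t, of "2 * N (f x)"] False
          by (auto simp: u_def zero_less_iff_neq_zero elim: eventually_elim2)
        then have "\<forall>\<^sub>F i in sequentially. N (f x - u i x) = N (f x - s i x)"
          by eventually_elim simp
        then show ?thesis using elim(1) by (simp add: tendsto_cong)
      qed
    qed
  qed measurable
  have ui: "Bochner_Integration.simple_bochner_integrable M (u i)" for i
  proof (rule Bochner_Integration.simple_bochner_integrable.intros[OF su])
    have "emeasure M {x\<in>space M. N (u i x) \<noteq> 0} \<noteq> \<infinity>"
    proof (rule simple_function_finite_support)
      show "simple_function M (\<lambda>x. N (u i x))" using su by (rule simple_function_compose1)
      have "(\<integral>\<^sup>+ x. N (u i x) \<partial>M) \<le> (\<integral>\<^sup>+ x. 2 * N (f x) \<partial>M)" by (intro nn_integral_mono uN)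
      also have "\<dots> = 2 * (\<integral>\<^sup>+ x. N (f x) \<partial>M)" by (rule nn_integral_cmult) measurable
      finally show "(\<integral>\<^sup>+ x. N (u i x) \<partial>M) < \<infinity>"
        using fin by (auto simp: ennreal_mult_less_top elim: order.strict_trans1)
    qed simp
    moreover have "{x\<in>space M. N (u i x) \<noteq> 0} = {x\<in>space M. u i x \<noteq> 0}"
      by (auto simp: u_def)
    ultimately show "emeasure M {x\<in>space M. u i x \<noteq> 0} \<noteq> \<infinity>" by simp
  qed
  \<comment> \<open>A subsequence with geometric errors turns the integrals into a sequence with
    summable increments, as \<open>seminorm_complete\<close> demands.\<close>
  have "\<exists>r::nat \<Rightarrow> nat. strict_mono r \<and> (\<forall>n. (\<integral>\<^sup>+ x. N (f x - u (r n) x) \<partial>M) \<le> ennreal ((1/2) ^ n))"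
  proof -
    have "\<forall>n m. \<exists>k>m. (\<integral>\<^sup>+ x. N (f x - u k x) \<partial>M) \<le> ennreal ((1/2) ^ n)"
    proof (intro allI)
      fix n m
      have "\<forall>\<^sub>F k in sequentially. (\<integral>\<^sup>+ x. N (f x - u k x) \<partial>M) < ennreal ((1/2) ^ n)"
        using lim by (rule order_tendstoD) simp
      then have "\<forall>\<^sub>F k in sequentially. k > m \<and> (\<integral>\<^sup>+ x. N (f x - u k x) \<partial>M) < ennreal ((1/2) ^ n)"
        using eventually_gt_at_top[of m] by eventually_elim simp
      then show "\<exists>k>m. (\<integral>\<^sup>+ x. N (f x - u k x) \<partial>M) \<le> ennreal ((1/2) ^ n)"
        by (auto dest!: eventually_happens intro: less_imp_le)
    qed
    then obtain g where g: "\<And>n m. g n m > m" "\<And>n m. (\<integral>\<^sup>+ x. N (f x - u (g n m) x) \<partial>M) \<le> ennreal ((1/2) ^ n)"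
      by metis
    define r where "r = rec_nat (g 0 0) (\<lambda>n m. g (Suc n) m)"
    have "strict_mono r" unfolding strict_mono_Suc_iff using g(1) by (simp add: r_def)
    moreover have "(\<integral>\<^sup>+ x. N (f x - u (r n) x) \<partial>M) \<le> ennreal ((1/2) ^ n)" for n
    proof (cases n)
      case 0
      then show ?thesis using g(2)[of 0 0] by (simp add: r_def)
    next
      case (Suc m)
      then show ?thesis using g(2)[of "Suc m" "r m"] by (simp add: r_def del: power_Suc)
    qed
    ultimately show ?thesis by blast
  qed
  then obtain r :: "nat \<Rightarrow> nat" where r: "strict_mono r"
    "\<And>n. (\<integral>\<^sup>+ x. N (f x - u (r n) x) \<partial>M) \<le> ennreal ((1/2) ^ n)" by blast
  let ?I = "\<lambda>n. Bochner_Integration.simple_bochner_integral M (u (r n))"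
  have Ifin: "N (?I n) < \<infinity>" for n
  proof -
    have "N (?I n) \<le> (\<integral>\<^sup>+ x. N (u (r n) x) \<partial>M)" using ui by (rule simple_bochner_integral_bound)
    also have "\<dots> \<le> (\<integral>\<^sup>+ x. 2 * N (f x) \<partial>M)" by (intro nn_integral_mono uN)
    also have "\<dots> = 2 * (\<integral>\<^sup>+ x. N (f x) \<partial>M)" by (rule nn_integral_cmult) measurable
    also have "\<dots> < \<infinity>" using fin by (auto simp: ennreal_mult_less_top)
    finally show ?thesis .
  qed
  have step: "N (?I (Suc n) - ?I n) \<le> ennreal (2 * (1/2) ^ n)" for n
  proof -
    have int: "Bochner_Integration.simple_bochner_integrable M (\<lambda>x. u (r (Suc n)) x - u (r n) x)"
      using ui ui by (rule simple_bochner_integrable_compose2[rotated]) simp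
    have "N (?I (Suc n) - ?I n) = N (Bochner_Integration.simple_bochner_integral M (\<lambda>x. u (r (Suc n)) x - u (r n) x))"
      by (simp add: simple_bochner_integral_diff ui)
    also have "\<dots> \<le> (\<integral>\<^sup>+ x. N (u (r (Suc n)) x - u (r n) x) \<partial>M)"
      using int by (rule simple_bochner_integral_bound)
    also have "\<dots> = (\<integral>\<^sup>+ x. N ((f x - u (r n) x) - (f x - u (r (Suc n)) x)) \<partial>M)" by simp
    also have "\<dots> \<le> (\<integral>\<^sup>+ x. N (f x - u (r n) x) \<partial>M) + (\<integral>\<^sup>+ x. N (f x - u (r (Suc n)) x) \<partial>M)"
      by (intro nn_integral_triangle_diff M strongly_measurable_diff f smu)
    also have "\<dots> \<le> ennreal ((1/2)^n) + ennreal ((1/2)^Suc n)" by (intro add_mono r(2))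
    also have "\<dots> = ennreal ((1/2)^n + (1/2)^Suc n)" by (simp del: power_Suc)
    also have "\<dots> \<le> ennreal (2 * (1/2) ^ n)" by (intro ennreal_leI) simp
    finally show ?thesis .
  qed
  have "(\<Sum>n. N (?I (Suc n) - ?I n)) \<le> (\<Sum>n. ennreal (2 * (1/2) ^ n))"
    by (intro suminf_le step) auto
  also have "\<dots> = ennreal (\<Sum>n. 2 * (1/2) ^ n)"
    by (intro suminf_ennreal2 summable_mult summable_geometric) auto
  finally have "(\<Sum>n. N (?I (Suc n) - ?I n)) < \<infinity>" by (auto elim: order.strict_trans1)
  then obtain w where w: "N w < \<infinity>" "(\<lambda>n. N (?I n - w)) \<longlonglongrightarrow> 0"
    using cN[unfolded seminorm_complete_def, rule_format, of ?I] Ifin by blast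
  have "has_bochner N M f w"
  proof (rule has_bochnerI[of M f w "\<lambda>n. u (r n)"])
    show "(\<lambda>i. \<integral>\<^sup>+ x. N (f x - u (r i) x) \<partial>M) \<longlonglongrightarrow> 0"
      using LIMSEQ_subseq_LIMSEQ[OF lim r(1)] by (simp add: comp_def)
    show "N (u (r i) x) < \<infinity>" if "x \<in> space M" for i x using s(2)[OF that] by (auto simp: u_def)
  qed (use f w ui in auto)
  then show ?thesis ..
qed

lemma has_bochner_bochner:
  assumes "complete_measure M" "seminorm_complete N" "strongly_measurable N M f" "(\<integral>\<^sup>+ x. N (f x) \<partial>M) < \<infinity>"
  shows "has_bochner N M f (bochner N M f)"
  unfolding bochner_def using has_bochner_exists[OF assms] by (rule someI_ex)

end

subsection \<open>Lebesgue norms of vector-valued functions\<close>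

lemma epowr_ennreal: "0 \<le> r \<Longrightarrow> epowr (ennreal r) p = ennreal (r powr p)"
  by (simp add: epowr_def)

lemma epowr_zero [simp]: "epowr 0 p = 0"
  by (simp add: epowr_def)

lemma epowr_one [simp]: "epowr a 1 = a"
  by (simp add: epowr_def less_top[symmetric])

lemma epowr_le_iff:
  assumes "0 < p" "0 \<le> b"
  shows "epowr a p \<le> ennreal (b powr p) \<longleftrightarrow> a \<le> ennreal b"
proof (cases a)
  case (real r)
  have "r powr p \<le> b powr p \<longleftrightarrow> r \<le> b"
    using assms real(1) by (metis linorder_not_le powr_less_mono2 powr_mono2 order_less_imp_le)
  then show ?thesis using real assms by (simp add: epowr_ennreal)
qed (simp add: epowr_def top_unique)

lemma epowr_mono:
  assumes "0 < p" "a \<le> b"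
  shows "epowr a p \<le> epowr b p"
proof (cases b)
  case (real r)
  then show ?thesis using assms by (simp add: epowr_ennreal epowr_le_iff)
qed (simp add: epowr_def)

lemma epowr_mult:
  assumes "0 < p" "0 < k"
  shows "epowr (ennreal k * a) p = ennreal (k powr p) * epowr a p"
proof (cases a)
  case (real r)
  then show ?thesis using assms
    by (simp add: ennreal_mult[symmetric] epowr_ennreal powr_mult)
qed (use assms in \<open>simp add: epowr_def ennreal_mult_top\<close>)

lemma borel_measurable_epowr [measurable]:
  assumes [measurable]: "f \<in> borel_measurable M"
  shows "(\<lambda>x. epowr (f x) p) \<in> borel_measurable M"
  unfolding epowr_def infinity_ennreal_def by measurable

lemma tendsto_epowr:
  assumes "(\<lambda>n. u n) \<longlonglongrightarrow> a" "a < \<infinity>" "0 < p"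
  shows "(\<lambda>n. epowr (u n) p) \<longlonglongrightarrow> epowr a p"
proof -
  have ev: "\<forall>\<^sub>F n in sequentially. u n < \<infinity>" using assms(1,2) by (rule order_tendstoD)
  have a: "a = ennreal (enn2real a)" using assms(2) by simp
  have "(\<lambda>n. enn2real (u n)) \<longlonglongrightarrow> enn2real a"
    using assms(1) a by (intro tendsto_enn2real) auto
  then have "(\<lambda>n. ennreal (enn2real (u n) powr p)) \<longlonglongrightarrow> ennreal (enn2real a powr p)"
    using assms(3) by (intro tendsto_ennrealI tendsto_powr2 tendsto_const) auto
  moreover have "\<forall>\<^sub>F n in sequentially. ennreal (enn2real (u n) powr p) = epowr (u n) p"
    using ev by eventually_elim (simp add: epowr_def less_top)
  moreover have "epowr a p = ennreal (enn2real a powr p)"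
    using assms(2) by (simp add: epowr_def less_top)
  ultimately show ?thesis by (simp add: tendsto_cong)
qed

lemma Lp_norm_le_iff:
  assumes "0 < p" "0 \<le> a"
  shows "Lp_norm N M p f \<le> ennreal a \<longleftrightarrow>
    strongly_measurable N M f \<and> (\<integral>\<^sup>+ x. epowr (N (f x)) p \<partial>M) \<le> ennreal (a powr p)"
  using epowr_le_iff[of "1 / p" "a powr p" "\<integral>\<^sup>+ x. epowr (N (f x)) p \<partial>M"] assms
  by (auto simp: Lp_norm_def powr_powr top_unique)

lemma Lp_norm_one:
  "Lp_norm N M 1 f = (if strongly_measurable N M f then \<integral>\<^sup>+ x. N (f x) \<partial>M else \<infinity>)"
  by (simp add: Lp_norm_def)

text \<open>For positive arguments this is convexity of the power; when one argument vanishes it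
  reduces to \<open>t powr q \<le> t\<close> for \<open>t\<close> in the unit interval.\<close>

lemma powr_convex_combination:
  fixes x y :: real
  assumes "1 \<le> q" "0 \<le> s" "0 \<le> t" "s + t = 1" "0 \<le> x" "0 \<le> y"
  shows "(s * x + t * y) powr q \<le> s * x powr q + t * y powr q"
proof -
  have scaled: "(t * y) powr q \<le> t * y powr q" if "0 \<le> t" "t \<le> 1" "0 \<le> y" for t y :: real
  proof -
    have "t powr q \<le> t" using powr_mono'[of 1 q t] that assms(1) by (cases "t = 0") auto
    then show ?thesis using that by (simp add: powr_mult mult_right_mono)
  qed
  consider "x = 0" | "y = 0" | "x > 0" "y > 0" using assms by linarith
  then show ?thesis
  proof cases
    case 1
    then show ?thesis using scaled[of t y] assms by simp
  next
    case 2
    then show ?thesis using scaled[of s x] assms by simp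
  next
    case 3
    have s: "s = 1 - t" using assms by simp
    show ?thesis using convex_onD[OF powr_convex[OF assms(1)], of t x y] 3 assms unfolding s by simp
  qed
qed

text \<open>With \<open>a\<close> and \<open>b\<close> standing for bounds on the norms of two
  functions, \<open>(u + v) / (a + b)\<close> is the convex combination of \<open>u / a\<close> and
  \<open>v / b\<close> with weights \<open>a / (a + b)\<close> and \<open>b / (a + b)\<close>.
  Integrating the resulting inequality gives Minkowski's inequality without a conjugate
  exponent.\<close>

lemma epowr_add_le:
  assumes q: "1 \<le> q" and ab: "0 < a" "0 < b"
  shows "epowr (u + v) q \<le>
    ennreal ((a + b) powr q * (a / (a + b)) / a powr q) * epowr u q +
    ennreal ((a + b) powr q * (b / (a + b)) / b powr q) * epowr v q"
proof (cases "u = \<infinity> \<or> v = \<infinity>")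
  case True
  have "(a + b) powr q * (a / (a + b)) / a powr q > 0" "(a + b) powr q * (b / (a + b)) / b powr q > 0"
    using ab by (auto intro!: divide_pos_pos mult_pos_pos add_pos_pos)
  then show ?thesis using True
    by (auto simp: epowr_def ennreal_mult_top)
next
  case False
  then obtain x y where xy: "u = ennreal x" "0 \<le> x" "v = ennreal y" "0 \<le> y"
    by (metis infinity_ennreal_def ennreal_cases)
  have "a / (a + b) * (x / a) + b / (a + b) * (y / b) = (x + y) / (a + b)"
    using ab by (simp add: add_divide_distrib)
  then have "(x + y) powr q = ((a + b) * (a / (a + b) * (x / a) + b / (a + b) * (y / b))) powr q"
    using ab by simp
  also have "\<dots> = (a + b) powr q * (a / (a + b) * (x / a) + b / (a + b) * (y / b)) powr q"
    by (rule powr_mult)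
  also have "\<dots> \<le> (a + b) powr q * (a / (a + b) * (x / a) powr q + b / (a + b) * (y / b) powr q)"
    using ab xy q by (intro mult_left_mono powr_convex_combination) (auto simp: add_divide_distrib[symmetric])
  also have "\<dots> = (a + b) powr q * (a / (a + b)) / a powr q * x powr q +
      (a + b) powr q * (b / (a + b)) / b powr q * y powr q"
    using ab xy by (simp add: powr_divide algebra_simps)
  finally show ?thesis
    using ab xy by (simp add: epowr_ennreal ennreal_mult[symmetric] del: ennreal_plus flip: ennreal_plus)
qed

context ext_seminorm
begin

lemma Lp_norm_add_le:
  assumes M: "complete_measure M" and q: "1 \<le> q" and ab: "0 < a" "0 < b"
    and f: "Lp_norm N M q f \<le> ennreal a" and g: "Lp_norm N M q g \<le> ennreal b"
  shows "Lp_norm N M q (\<lambda>x. f x + g x) \<le> ennreal (a + b)"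
proof -
  have sm: "strongly_measurable N M f" "strongly_measurable N M g"
    and I: "(\<integral>\<^sup>+ x. epowr (N (f x)) q \<partial>M) \<le> ennreal (a powr q)"
      "(\<integral>\<^sup>+ x. epowr (N (g x)) q \<partial>M) \<le> ennreal (b powr q)"
    using f g q ab by (simp_all add: Lp_norm_le_iff)
  have [measurable]: "(\<lambda>x. N (f x)) \<in> borel_measurable M" "(\<lambda>x. N (g x)) \<in> borel_measurable M"
    using sm by (auto intro: borel_measurable_seminorm[OF M])
  let ?A = "(a + b) powr q * (a / (a + b)) / a powr q" and ?B = "(a + b) powr q * (b / (a + b)) / b powr q"
  have "(\<integral>\<^sup>+ x. epowr (N (f x + g x)) q \<partial>M) \<le>
      (\<integral>\<^sup>+ x. ennreal ?A * epowr (N (f x)) q + ennreal ?B * epowr (N (g x)) q \<partial>M)"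
    using q by (intro nn_integral_mono order_trans[OF epowr_mono[OF _ triangle] epowr_add_le[OF q ab]]) auto
  also have "\<dots> = ennreal ?A * (\<integral>\<^sup>+ x. epowr (N (f x)) q \<partial>M) + ennreal ?B * (\<integral>\<^sup>+ x. epowr (N (g x)) q \<partial>M)"
    by (simp add: nn_integral_add nn_integral_cmult)
  also have "\<dots> \<le> ennreal ?A * ennreal (a powr q) + ennreal ?B * ennreal (b powr q)"
    by (intro add_mono mult_left_mono I) auto
  also have "\<dots> = ennreal (?A * a powr q + ?B * b powr q)"
    using ab by (simp add: ennreal_mult[symmetric] del: ennreal_plus flip: ennreal_plus)
  also have "?A * a powr q + ?B * b powr q = (a + b) powr q * (a / (a + b) + b / (a + b))"
  proof -
    have "?A * a powr q = (a + b) powr q * (a / (a + b))" "?B * b powr q = (a + b) powr q * (b / (a + b))"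
      using ab by simp_all
    then show ?thesis by (simp only: distrib_left)
  qed
  also have "\<dots> = (a + b) powr q"
    using ab by (simp add: add_divide_distrib[symmetric])
  finally show ?thesis
    using q ab sm by (simp add: Lp_norm_le_iff strongly_measurable_add del: ennreal_plus)
qed

lemma Lp_norm_scale_le:
  assumes M: "complete_measure M" and q: "1 \<le> q" and c: "c \<noteq> 0"
  shows "Lp_norm N M q (\<lambda>x. c *\<^sub>R f x) \<le> ennreal \<bar>c\<bar> * Lp_norm N M q f"
proof (cases "Lp_norm N M q f")
  case (real a)
  then have sm: "strongly_measurable N M f"
    and I: "(\<integral>\<^sup>+ x. epowr (N (f x)) q \<partial>M) \<le> ennreal (a powr q)"
    using Lp_norm_le_iff[of q a N M f] q by auto
  have [measurable]: "(\<lambda>x. N (f x)) \<in> borel_measurable M"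
    using sm by (auto intro: borel_measurable_seminorm[OF M])
  have "(\<integral>\<^sup>+ x. epowr (N (c *\<^sub>R f x)) q \<partial>M) = (\<integral>\<^sup>+ x. ennreal (\<bar>c\<bar> powr q) * epowr (N (f x)) q \<partial>M)"
    using c q by (simp add: scale epowr_mult)
  also have "\<dots> = ennreal (\<bar>c\<bar> powr q) * (\<integral>\<^sup>+ x. epowr (N (f x)) q \<partial>M)"
    by (simp add: nn_integral_cmult)
  also have "\<dots> \<le> ennreal (\<bar>c\<bar> powr q) * ennreal (a powr q)" by (intro mult_left_mono I) auto
  also have "\<dots> = ennreal ((\<bar>c\<bar> * a) powr q)" using real by (simp add: ennreal_mult[symmetric] powr_mult)
  finally have "Lp_norm N M q (\<lambda>x. c *\<^sub>R f x) \<le> ennreal (\<bar>c\<bar> * a)"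
    using q real(1) strongly_measurable_scaleR[OF sm] by (simp add: Lp_norm_le_iff)
  then show ?thesis using real by (simp add: ennreal_mult)
qed (use c in \<open>simp add: ennreal_mult_top\<close>)

text \<open>This makes a Lebesgue space itself a target for the integral above: its vectors are
  functions, and the whole theory applies to functions with values in L^q(dt/t).\<close>

lemma ext_seminorm_Lp_norm:
  assumes M: "complete_measure M" and q: "1 \<le> q"
  shows "ext_seminorm (Lp_norm N M q)"
proof
  show "Lp_norm N M q 0 = 0" by (simp add: Lp_norm_def zero_fun_def)
  show "Lp_norm N M q (f + g) \<le> Lp_norm N M q f + Lp_norm N M q g" for f g
  proof (cases "Lp_norm N M q f = \<infinity> \<or> Lp_norm N M q g = \<infinity>")
    case True
    then show ?thesis by auto
  next
    case False
    then obtain a b where ab: "Lp_norm N M q f = ennreal a" "0 \<le> a" "Lp_norm N M q g = ennreal b" "0 \<le> b"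
      by (metis infinity_ennreal_def ennreal_cases)
    show ?thesis
    proof (rule ennreal_le_epsilon)
      \<comment> \<open>\<open>Lp_norm_add_le\<close> divides by the two bounds; adding
        \<open>e/2\<close> to each keeps them positive even when a norm is 0.\<close>
      fix e :: real assume "0 < e"
      then have "Lp_norm N M q (\<lambda>x. f x + g x) \<le> ennreal ((a + e/2) + (b + e/2))"
        using ab by (intro Lp_norm_add_le[OF M q]) (auto intro: ennreal_leI)
      also have "(a + e/2) + (b + e/2) = a + b + e" by simp
      finally show "Lp_norm N M q (f + g) \<le> Lp_norm N M q f + Lp_norm N M q g + ennreal e"
        using ab \<open>0 < e\<close> by (simp add: plus_fun_def)
    qed
  qed
  show "Lp_norm N M q (c *\<^sub>R f) = ennreal \<bar>c\<bar> * Lp_norm N M q f" for c f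
  proof (cases "c = 0")
    case True
    then show ?thesis by (simp add: Lp_norm_def zero_fun_def)
  next
    case False
    show ?thesis
    proof (rule antisym)
      show "Lp_norm N M q (c *\<^sub>R f) \<le> ennreal \<bar>c\<bar> * Lp_norm N M q f"
        using Lp_norm_scale_le[OF M q False] by (simp add: scaleR_fun_def)
      have "ennreal \<bar>c\<bar> * Lp_norm N M q f = ennreal \<bar>c\<bar> * Lp_norm N M q (\<lambda>x. inverse c *\<^sub>R (c *\<^sub>R f) x)"
        using False by (simp add: scaleR_fun_def)
      also have "\<dots> \<le> ennreal \<bar>c\<bar> * (ennreal \<bar>inverse c\<bar> * Lp_norm N M q (c *\<^sub>R f))"
        using False by (intro mult_left_mono Lp_norm_scale_le[OF M q]) auto
      also have "\<dots> = Lp_norm N M q (c *\<^sub>R f)"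
        using False by (simp add: mult.assoc[symmetric] ennreal_mult[symmetric] abs_mult[symmetric])
      finally show "ennreal \<bar>c\<bar> * Lp_norm N M q f \<le> Lp_norm N M q (c *\<^sub>R f)" .
    qed
  qed
qed

lemma Lp_norm_Fatou:
  assumes M: "complete_measure M" and q: "0 < q" and a: "0 \<le> a"
    and f: "\<And>n::nat. Lp_norm N M q (f n) \<le> ennreal a"
    and lim: "AE x in M. (\<lambda>n. N (g x - f n x)) \<longlonglongrightarrow> 0"
  shows "Lp_norm N M q g \<le> ennreal a"
proof -
  have sm: "strongly_measurable N M (f n)" and I: "(\<integral>\<^sup>+ x. epowr (N (f n x)) q \<partial>M) \<le> ennreal (a powr q)" for n
    using f[of n] q a by (simp_all add: Lp_norm_le_iff)
  have g: "strongly_measurable N M g" using M sm lim by (rule strongly_measurable_limit)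
  have [measurable]: "(\<lambda>x. N (f n x)) \<in> borel_measurable M" for n
    using sm by (rule borel_measurable_seminorm[OF M])
  have "(\<integral>\<^sup>+ x. epowr (N (g x)) q \<partial>M) = (\<integral>\<^sup>+ x. liminf (\<lambda>n. epowr (N (f n x)) q) \<partial>M)"
  proof (rule nn_integral_cong_AE)
    show "AE x in M. epowr (N (g x)) q = liminf (\<lambda>n. epowr (N (f n x)) q)"
      using lim strongly_measurable_AE_finite[OF g]
    proof eventually_elim
      case (elim x)
      have "(\<lambda>n. epowr (N (f n x)) q) \<longlonglongrightarrow> epowr (N (g x)) q"
        using tendsto_epowr[OF tendsto_of_diff[OF elim(1)] elim(2) q] .
      then show ?case by (auto dest!: lim_imp_Liminf[rotated])
    qed
  qed
  also have "\<dots> \<le> liminf (\<lambda>n. \<integral>\<^sup>+ x. epowr (N (f n x)) q \<partial>M)"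
    by (rule nn_integral_liminf) measurable
  also have "\<dots> \<le> limsup (\<lambda>n. \<integral>\<^sup>+ x. epowr (N (f n x)) q \<partial>M)"
    by (rule Liminf_le_Limsup) simp
  also have "\<dots> \<le> ennreal (a powr q)"
    by (rule Limsup_bounded) (simp add: I)
  finally show ?thesis using q a g by (simp add: Lp_norm_le_iff)
qed

end

section \<open>The norm of a Banach space and the norm of L^q(dt/t)\<close>

lemma ext_seminorm_xnorm: "ext_seminorm (xnorm :: 'x::real_normed_vector \<Rightarrow> ennreal)"
proof
  show "xnorm (x + y) \<le> xnorm x + xnorm y" for x y :: 'x
    unfolding xnorm_def by (metis ennreal_leI ennreal_plus norm_ge_zero norm_triangle_ineq)
qed (auto simp: xnorm_def ennreal_mult)

interpretation xnorm: ext_seminorm "xnorm :: 'x::real_normed_vector \<Rightarrow> ennreal"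
  by (rule ext_seminorm_xnorm)

lemma xnorm_finite [simp]: "xnorm x < \<infinity>" "xnorm x < top" "xnorm x \<noteq> top"
  by (simp_all add: xnorm_def)

lemma xnorm_eq_0 [simp]: "xnorm x = 0 \<longleftrightarrow> x = 0"
  by (simp add: xnorm_def)

lemma epowr_xnorm: "epowr (xnorm x) q = ennreal (norm x powr q)"
  by (simp add: xnorm_def epowr_ennreal)

lemma tendsto_xnorm_iff: "(\<lambda>n. xnorm (x - u n)) \<longlonglongrightarrow> 0 \<longleftrightarrow> u \<longlonglongrightarrow> x"
proof -
  have "(\<lambda>n. xnorm (x - u n)) \<longlonglongrightarrow> ennreal 0 \<longleftrightarrow> (\<lambda>n. norm (u n - x)) \<longlonglongrightarrow> 0"
    unfolding xnorm_def norm_minus_commute[of x]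
    by (intro iffI tendsto_ennrealI) (rule tendsto_ennrealD, auto)
  then show ?thesis by (simp add: tendsto_norm_zero_iff LIM_zero_iff)
qed

lemma strongly_measurable_norm:
  assumes "strongly_measurable xnorm M f"
  shows "strongly_measurable xnorm M (\<lambda>x. norm (f x))"
proof -
  obtain s where s: "\<And>i::nat. simple_function M (s i)"
    "AE x in M. (\<lambda>i. xnorm (f x - s i x)) \<longlonglongrightarrow> 0"
    using assms unfolding strongly_measurable_def by blast
  show ?thesis
  proof (rule xnorm.strongly_measurableI[of M "\<lambda>i x. norm (s i x)"])
    show "simple_function M (\<lambda>x. norm (s i x))" for i using s(1) by (rule simple_function_compose1)
    show "AE x in M. (\<lambda>i. xnorm (norm (f x) - norm (s i x))) \<longlonglongrightarrow> 0"
      using s(2) unfolding tendsto_xnorm_iff by eventually_elim (rule tendsto_norm)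
  qed simp
qed

lemma seminorm_complete_xnorm: "seminorm_complete (xnorm :: 'x::banach \<Rightarrow> ennreal)"
  unfolding seminorm_complete_def
proof (intro allI impI)
  fix v :: "nat \<Rightarrow> 'x" assume *: "(\<forall>i. xnorm (v i) < \<infinity>) \<and> (\<Sum>i. xnorm (v (Suc i) - v i)) < \<infinity>"
  then have "summable (\<lambda>i. norm (v (Suc i) - v i))"
    unfolding xnorm_def by (intro summable_suminf_not_top) auto
  then have "summable (\<lambda>i. v (Suc i) - v i)" by (rule summable_norm_cancel)
  then have "convergent (\<lambda>n. \<Sum>i<n. v (Suc i) - v i)" by (rule summable_iff_convergent[THEN iffD1])
  then have "convergent (\<lambda>n. v n - v 0)" by (simp add: sum_lessThan_telescope)
  then obtain w where "(\<lambda>n. v n - v 0) \<longlonglongrightarrow> w" unfolding convergent_def by blast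
  from tendsto_add[OF this tendsto_const[of "v 0"]] have "v \<longlonglongrightarrow> w + v 0" by simp
  then show "\<exists>w. xnorm w < \<infinity> \<and> (\<lambda>i. xnorm (v i - w)) \<longlonglongrightarrow> 0"
    by (intro exI[of _ "w + v 0"]) (simp add: xnorm.diff_commute[of "v _"] tendsto_xnorm_iff)
qed

lemma ennreal_suminf_tail:
  fixes f :: "nat \<Rightarrow> ennreal"
  assumes "(\<Sum>i. f i) < \<infinity>"
  shows "(\<lambda>n. \<Sum>i. f (i + n)) \<longlonglongrightarrow> 0"
proof -
  have fin: "f i < top" for i
    using assms ennreal_suminf_lessD[of f top] by simp
  define g where "g i = enn2real (f i)" for i
  have f: "f = (\<lambda>i. ennreal (g i))" using fin by (auto simp: g_def)
  have g0: "g i \<ge> 0" for i by (simp add: g_def)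
  have sg: "summable g" using assms unfolding f by (intro summable_suminf_not_top) (auto simp: g0)
  have "(\<lambda>n. suminf g - (\<Sum>i<n. g i)) \<longlonglongrightarrow> suminf g - suminf g"
    using sg by (intro tendsto_diff tendsto_const summable_LIMSEQ)
  then have "(\<lambda>n. \<Sum>i. g (i + n)) \<longlonglongrightarrow> 0"
    by (simp add: suminf_minus_initial_segment[OF sg])
  from tendsto_ennrealI[OF this] show ?thesis
    unfolding f using g0 sg by (subst suminf_ennreal2) (auto intro: summable_ignore_initial_segment)
qed

lemma sum_pointwise: "(\<Sum>i\<in>A. f i) x = (\<Sum>i\<in>A. (f i x :: 'b::comm_monoid_add))"
  by (induction A rule: infinite_finite_induct) auto

text \<open>The Riesz--Fischer argument: the partial sums \<open>h n\<close> of the norms of the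
  increments stay bounded in L^q by the sum \<open>S\<close> of their norms, so by monotone
  convergence the increments are summable almost everywhere. This yields a pointwise limit, and
  Fatou's lemma bounds its distance to \<open>v i\<close> by the tail of the series of
  norms.\<close>

lemma seminorm_complete_Lp_norm:
  fixes M :: "'m measure"
  assumes M: "complete_measure M" and q: "1 \<le> q"
  shows "seminorm_complete (Lp_norm (xnorm :: 'x::banach \<Rightarrow> ennreal) M q)"
  unfolding seminorm_complete_def
proof (intro allI impI)
  let ?L = "Lp_norm (xnorm :: 'x \<Rightarrow> ennreal) M q"
  let ?R = "Lp_norm (xnorm :: real \<Rightarrow> ennreal) M q"
  interpret L: ext_seminorm ?L using M q by (rule xnorm.ext_seminorm_Lp_norm)
  interpret R: ext_seminorm ?R using M q by (rule xnorm.ext_seminorm_Lp_norm)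
  fix v :: "nat \<Rightarrow> 'm \<Rightarrow> 'x"
  assume *: "(\<forall>i. ?L (v i) < \<infinity>) \<and> (\<Sum>i. ?L (v (Suc i) - v i)) < \<infinity>"
  define d where "d i x = v (Suc i) x - v i x" for i x
  have d: "v (Suc i) - v i = d i" for i by (auto simp: d_def)
  have smv: "strongly_measurable xnorm M (v i)" for i
    using * by (auto simp: Lp_norm_def split: if_splits)
  have smd: "strongly_measurable xnorm M (d i)" for i
    unfolding d_def by (intro xnorm.strongly_measurable_diff smv)
  obtain S where S: "(\<Sum>i. ?L (d i)) = ennreal S" "0 \<le> S"
    using * unfolding d by (metis less_top ennreal_cases infinity_ennreal_def)
  define h where "h n x = (\<Sum>i<n. norm (d i x))" for n x
  have h0: "h n x \<ge> 0" for n x by (simp add: h_def sum_nonneg)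
  have hm: "(\<integral>\<^sup>+ x. ennreal (h n x powr q) \<partial>M) \<le> ennreal (S powr q)" for n
  proof -
    have "?R (h n) = ?R (\<Sum>i<n. (\<lambda>x. norm (d i x)))"
      by (rule arg_cong[of _ _ ?R]) (auto simp: h_def sum_pointwise)
    also have "\<dots> \<le> (\<Sum>i<n. ?R (\<lambda>x. norm (d i x)))" by (rule R.sum_le)
    also have "\<dots> = (\<Sum>i<n. ?L (d i))"
      by (intro sum.cong refl) (simp add: Lp_norm_def smd strongly_measurable_norm xnorm_def)
    also have "\<dots> \<le> ennreal S" unfolding S(1)[symmetric] by (rule sum_le_suminf) auto
    finally have "?R (h n) \<le> ennreal S" .
    then show ?thesis using q S h0 by (simp add: Lp_norm_le_iff epowr_xnorm)
  qed
  have hmeas [measurable]: "h n \<in> borel_measurable M" for n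
  proof -
    have "(\<lambda>x. enn2real (xnorm (d i x))) \<in> borel_measurable M" for i
      using xnorm.borel_measurable_seminorm[OF M smd[of i]] by measurable
    then show ?thesis unfolding h_def xnorm_def by (intro borel_measurable_sum) simp
  qed
  have "(\<integral>\<^sup>+ x. (SUP n. ennreal (h n x powr q)) \<partial>M) = (SUP n. \<integral>\<^sup>+ x. ennreal (h n x powr q) \<partial>M)"
  proof (rule nn_integral_monotone_convergence_SUP)
    show "incseq (\<lambda>n x. ennreal (h n x powr q))"
      using q h0 by (auto intro!: incseq_SucI le_funI ennreal_leI powr_mono2 simp: h_def)
  qed measurable
  also have "\<dots> \<le> ennreal (S powr q)" by (rule SUP_least) (rule hm)
  finally have "(\<integral>\<^sup>+ x. (SUP n. ennreal (h n x powr q)) \<partial>M) \<noteq> \<infinity>" by (auto simp: top_unique)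
  then have AEfin: "AE x in M. (SUP n. ennreal (h n x powr q)) \<noteq> \<infinity>"
    by (intro nn_integral_PInf_AE) measurable
  define w where "w x = lim (\<lambda>n. v n x)" for x
  have conv: "AE x in M. (\<lambda>n. v n x) \<longlonglongrightarrow> w x"
    using AEfin
  proof eventually_elim
    case (elim x)
    then obtain B where B: "(SUP n. ennreal (h n x powr q)) = ennreal B" "0 \<le> B"
      by (metis infinity_ennreal_def ennreal_cases)
    have hB: "h n x \<le> B powr (1/q)" for n
    proof -
      have "ennreal (h n x powr q) \<le> ennreal B" unfolding B(1)[symmetric] by (rule SUP_upper) simp
      then have "h n x powr q \<le> B" using B(2) by simp
      then have "(h n x powr q) powr (1/q) \<le> B powr (1/q)" using q by (intro powr_mono2) auto
      then show ?thesis using q h0 by (simp add: powr_powr)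
    qed
    have "summable (\<lambda>i. norm (d i x))"
      using hB by (intro summableI_nonneg_bounded[where x="B powr (1/q)"]) (auto simp: h_def)
    then have "summable (\<lambda>i. d i x)" by (rule summable_norm_cancel)
    then have "convergent (\<lambda>n. \<Sum>i<n. d i x)" by (rule summable_iff_convergent[THEN iffD1])
    then have "convergent (\<lambda>n. v n x - v 0 x)" by (simp add: d_def sum_lessThan_telescope[of "\<lambda>i. v i x"])
    then obtain y where "(\<lambda>n. v n x - v 0 x) \<longlonglongrightarrow> y" unfolding convergent_def by blast
    from tendsto_add[OF this tendsto_const[of "v 0 x"]] have "(\<lambda>n. v n x) \<longlonglongrightarrow> y + v 0 x" by simp
    then show ?case unfolding w_def using convergent_LIMSEQ_iff convergentI by blast
  qed
  have tail: "?L (w - v i) \<le> (\<Sum>j. ?L (d (j + i)))" for i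
  proof -
    have "(\<Sum>j. ?L (d (j + i))) \<le> (\<Sum>j. ?L (d j))"
      by (subst (2) suminf_offset[of _ i]) (auto simp: add_increasing)
    then obtain b where b: "(\<Sum>j. ?L (d (j + i))) = ennreal b" "0 \<le> b"
      using S by (metis ennreal_cases ennreal_neq_top top_unique)
    have "?L (w - v i) \<le> ennreal b"
    proof (rule xnorm.Lp_norm_Fatou[OF M _ b(2)])
      show "0 < q" using q by simp
      show "?L (\<lambda>x. v (m + i) x - v i x) \<le> ennreal b" for m
      proof -
        have "?L (\<lambda>x. v (m + i) x - v i x) = ?L (\<Sum>j<m. d (j + i))"
          by (rule arg_cong[of _ _ ?L])
            (auto simp: d_def sum_pointwise sum_lessThan_telescope[of "\<lambda>j. v (j + i) _", simplified])
        also have "\<dots> \<le> (\<Sum>j<m. ?L (d (j + i)))" by (rule L.sum_le)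
        also have "\<dots> \<le> ennreal b" unfolding b(1)[symmetric] by (rule sum_le_suminf) auto
        finally show ?thesis .
      qed
      show "AE x in M. (\<lambda>m. xnorm ((w - v i) x - (v (m + i) x - v i x))) \<longlonglongrightarrow> 0"
        using conv
      proof eventually_elim
        case (elim x)
        have eq: "(w - v i) x - (v (m + i) x - v i x) = w x - v (m + i) x" for m by simp
        show ?case unfolding eq tendsto_xnorm_iff using elim by (rule LIMSEQ_ignore_initial_segment)
      qed
    qed
    then show ?thesis using b by simp
  qed
  show "\<exists>w. ?L w < \<infinity> \<and> (\<lambda>i. ?L (v i - w)) \<longlonglongrightarrow> 0"
  proof (intro exI conjI)
    have "?L (w - v 0) \<le> (\<Sum>j. ?L (d j))" using tail[of 0] by simp
    then have "?L (w - v 0) < \<infinity>" using S by (auto elim: order.strict_trans1)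
    then show "?L w < \<infinity>" using L.add_finite[of "w - v 0" "v 0"] * by simp
    have "(\<lambda>i. \<Sum>j. ?L (d (j + i))) \<longlonglongrightarrow> 0"
      by (rule ennreal_suminf_tail) (simp add: S)
    then show "(\<lambda>i. ?L (v i - w)) \<longlonglongrightarrow> 0"
      by (rule tendsto_sandwich[OF _ _ tendsto_const, rotated 2])
        (simp_all add: L.diff_commute[of "v _" w] tail)
  qed
qed

lemma ext_seminorm_Lq_dt_t: "1 \<le> q \<Longrightarrow> ext_seminorm (Lq_dt_t q :: (real \<Rightarrow> 'x::real_normed_vector) \<Rightarrow> ennreal)"
  using xnorm.ext_seminorm_Lp_norm[OF complete_measure_dt_t] by (simp add: Lq_dt_t_def[abs_def])

lemma seminorm_complete_Lq_dt_t: "1 \<le> q \<Longrightarrow> seminorm_complete (Lq_dt_t q :: (real \<Rightarrow> 'x::banach) \<Rightarrow> ennreal)"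
  using seminorm_complete_Lp_norm[OF complete_measure_dt_t] by (simp add: Lq_dt_t_def[abs_def])

lemma space_dt_t [simp]: "space dt_t = {0<..}"
  by (simp add: dt_t_def space_restrict_space)

lemma sets_dt_t: "sets dt_t = sets (lebesgue_on {0<..})"
  by (simp add: dt_t_def)

lemma strongly_measurable_dt_t_continuous:
  fixes g :: "real \<Rightarrow> 'x::real_normed_vector"
  assumes "continuous_on {0<..} g"
  shows "strongly_measurable xnorm dt_t g"
proof -
  \<comment> \<open>The interval from 0 to \<open>real n\<close> is cut into pieces of length
    \<open>1 / Suc n\<close>, each sampled at its right end point. The shift by \<open>Suc\<close>
    keeps the sample points positive, where \<open>g\<close> is continuous, and frees the index 0 to
    mark \<open>t \<ge> real n\<close>.\<close>
  define k where "k n t = (if t < real n then Suc (nat \<lfloor>real (Suc n) * t\<rfloor>) else 0)" for n t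
  have kmeas: "k n \<in> measurable dt_t (count_space UNIV)" for n
  proof -
    have "k n \<in> measurable borel (count_space UNIV)" unfolding k_def by measurable
    then have "k n \<in> measurable (lebesgue_on {0<..}) (count_space UNIV)"
      by (intro measurable_restrict_space1 measurable_completion) simp
    then show ?thesis by (simp add: measurable_cong_sets[OF sets_dt_t refl])
  qed
  have ksimple: "simple_function dt_t (k n)" for n
    unfolding simple_function_def
  proof (intro conjI ballI)
    have "k n t \<le> Suc (nat \<lfloor>real (Suc n) * real n\<rfloor>)" for t
      unfolding k_def by (auto intro!: nat_mono floor_mono mult_left_mono)
    then show "finite (k n ` space dt_t)"
      by (intro finite_subset[of "k n ` space dt_t" "{..Suc (nat \<lfloor>real (Suc n) * real n\<rfloor>)}"] finite_atMost)
        blast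
    show "k n -` {x} \<inter> space dt_t \<in> sets dt_t" for x
      using kmeas[of n] by (rule measurable_sets) simp
  qed
  define s where "s n t = (if k n t = 0 then 0 else g (real (k n t) / real (Suc n)))" for n t
  show ?thesis
  proof (rule xnorm.strongly_measurableI[of _ s])
    show "simple_function dt_t (s n)" for n
      unfolding s_def using ksimple[of n] by (rule simple_function_compose1)
    show "AE t in dt_t. (\<lambda>n. xnorm (g t - s n t)) \<longlonglongrightarrow> 0"
    proof (rule AE_I2)
      fix t :: real assume "t \<in> space dt_t"
      then have t: "t > 0" by simp
      let ?\<tau> = "\<lambda>n. real (Suc (nat \<lfloor>real (Suc n) * t\<rfloor>)) / real (Suc n)"
      have tau: "t \<le> ?\<tau> n" "?\<tau> n \<le> t + 1 / real (Suc n)" for n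
      proof -
        have fl: "0 \<le> \<lfloor>real (Suc n) * t\<rfloor>" using t by simp
        have F: "real (Suc (nat \<lfloor>real (Suc n) * t\<rfloor>)) = of_int \<lfloor>real (Suc n) * t\<rfloor> + 1" using fl by simp
        have fb: "of_int \<lfloor>real (Suc n) * t\<rfloor> \<le> real (Suc n) * t"
          "real (Suc n) * t \<le> of_int \<lfloor>real (Suc n) * t\<rfloor> + 1" by linarith+
        have "t \<le> (F + 1) / m \<and> (F + 1) / m \<le> t + 1 / m"
          if "F \<le> m * t" "m * t \<le> F + 1" "0 < m" for F m
          using that by (simp add: field_simps)
        from this[OF fb] show "t \<le> ?\<tau> n" "?\<tau> n \<le> t + 1 / real (Suc n)"
          unfolding F by simp_all
      qed
      have "(\<lambda>n. t + 1 / real (Suc n)) \<longlonglongrightarrow> t + 0"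
        by (intro tendsto_add tendsto_const LIMSEQ_Suc[OF lim_1_over_n])
      then have lim: "(\<lambda>n. t + 1 / real (Suc n)) \<longlonglongrightarrow> t" by (simp only: add_0_right)
      have "?\<tau> \<longlonglongrightarrow> t"
        by (rule tendsto_sandwich[OF _ _ tendsto_const lim])
          (rule always_eventually, rule allI, rule tau)+
      moreover have "isCont g t"
        using assms t by (simp add: continuous_on_eq_continuous_at)
      ultimately have "(\<lambda>n. g (?\<tau> n)) \<longlonglongrightarrow> g t" by (rule isCont_tendsto_compose[rotated])
      moreover have "\<forall>\<^sub>F n in sequentially. g (?\<tau> n) = s n t"
      proof -
        obtain m where m: "t < real m" using reals_Archimedean2 by blast
        show ?thesis using eventually_ge_at_top[of m]
          by eventually_elim (use m in \<open>auto simp: s_def k_def\<close>)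
      qed
      ultimately have "(\<lambda>n. s n t) \<longlonglongrightarrow> g t" by (simp add: tendsto_cong)
      then show "(\<lambda>n. xnorm (g t - s n t)) \<longlonglongrightarrow> 0" by (simp add: tendsto_xnorm_iff)
    qed
  qed simp
qed

lemma nn_integral_dt_t:
  assumes [measurable]: "f \<in> borel_measurable borel"
  shows "(\<integral>\<^sup>+ t. f t \<partial>dt_t) = (\<integral>\<^sup>+ t. ennreal (1 / t) * f t * indicator {0<..} t \<partial>lborel)"
proof -
  have "(\<integral>\<^sup>+ t. f t \<partial>dt_t) = (\<integral>\<^sup>+ t. ennreal (1 / t) * f t \<partial>lebesgue_on {0<..})"
    unfolding dt_t_def
    by (rule nn_integral_density) (auto intro!: measurable_restrict_space1 measurable_completion)
  also have "\<dots> = (\<integral>\<^sup>+ t. ennreal (1 / t) * f t * indicator {0<..} t \<partial>lebesgue)"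
    by (rule nn_integral_restrict_space) simp
  also have "\<dots> = (\<integral>\<^sup>+ t. ennreal (1 / t) * f t * indicator {0<..} t \<partial>lborel)"
    by (rule nn_integral_completion)
  finally show ?thesis .
qed

text \<open>Since \<open>t z / (t\<^sup>2 + z\<^sup>2) \<le> 1\<close>, its $q$-th power is at most its square, whose integral
  against $dt/t$ is elementary.\<close>
lemma Lq_dt_t_le:
  fixes g :: "real \<Rightarrow> 'x::real_normed_vector"
  assumes q: "2 \<le> q" and g: "strongly_measurable xnorm dt_t g" and z: "0 < z" and b: "0 \<le> b"
    and le: "\<And>t. 0 < t \<Longrightarrow> norm (g t) \<le> b * (t * z / (t\<^sup>2 + z\<^sup>2))"
  shows "Lq_dt_t q g \<le> ennreal b"
proof -
  have pos: "t\<^sup>2 + z\<^sup>2 > 0" for t using z by (simp add: add_nonneg_pos)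
  have u1: "t * z / (t\<^sup>2 + z\<^sup>2) \<le> 1" for t
  proof -
    have "0 \<le> (t - z / 2)\<^sup>2 + 3 / 4 * z\<^sup>2" by simp
    then have "t * z \<le> t\<^sup>2 + z\<^sup>2" by (simp add: power2_diff power_divide)
    then show ?thesis using pos[of t] by simp
  qed
  have bound: "ennreal (norm (g t) powr q) \<le> ennreal (b powr q) * ennreal ((t * z / (t\<^sup>2 + z\<^sup>2))\<^sup>2)" if "0 < t" for t
  proof -
    let ?u = "t * z / (t\<^sup>2 + z\<^sup>2)"
    have u0: "?u > 0" using that z pos[of t] by simp
    have "norm (g t) powr q \<le> (b * ?u) powr q" using le[OF that] q by (intro powr_mono2) auto
    also have "\<dots> = b powr q * ?u powr q" by (rule powr_mult)
    also have "\<dots> \<le> b powr q * ?u powr 2"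
      using u0 u1[of t] q by (intro mult_left_mono powr_mono') auto
    also have "\<dots> = b powr q * ?u\<^sup>2" using u0 by simp
    finally show ?thesis by (simp add: ennreal_mult[symmetric])
  qed
  have "(\<integral>\<^sup>+ t. ennreal ((t * z / (t\<^sup>2 + z\<^sup>2))\<^sup>2) \<partial>dt_t)
      = (\<integral>\<^sup>+ t. ennreal (1 / t) * ennreal ((t * z / (t\<^sup>2 + z\<^sup>2))\<^sup>2) * indicator {0<..} t \<partial>lborel)"
    by (rule nn_integral_dt_t) measurable
  also have "\<dots> \<le> (\<integral>\<^sup>+ t. ennreal (t * z\<^sup>2 / (t\<^sup>2 + z\<^sup>2)\<^sup>2) * indicator {0..} t \<partial>lborel)"
  proof (rule nn_integral_mono)
    fix t :: real
    show "ennreal (1 / t) * ennreal ((t * z / (t\<^sup>2 + z\<^sup>2))\<^sup>2) * indicator {0<..} t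
        \<le> ennreal (t * z\<^sup>2 / (t\<^sup>2 + z\<^sup>2)\<^sup>2) * indicator {0..} t"
    proof (cases "t > 0")
      case True
      have "1 / t * (t * z / (t\<^sup>2 + z\<^sup>2))\<^sup>2 = t * z\<^sup>2 / (t\<^sup>2 + z\<^sup>2)\<^sup>2"
        using True by (simp add: power_divide power_mult_distrib power2_eq_square)
      then show ?thesis using True by (simp add: ennreal_mult[symmetric] del: times_divide_eq_left)
    qed simp
  qed
  also have "\<dots> = ennreal (0 - (- (z\<^sup>2 / (2 * (0\<^sup>2 + z\<^sup>2)))))"
  proof (rule nn_integral_FTC_atLeast[where F="\<lambda>t. - (z\<^sup>2 / (2 * (t\<^sup>2 + z\<^sup>2)))"])
    show "((\<lambda>t. - (z\<^sup>2 / (2 * (t\<^sup>2 + z\<^sup>2)))) has_real_derivative t * z\<^sup>2 / (t\<^sup>2 + z\<^sup>2)\<^sup>2) (at t)" for t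
    proof -
      have S: "2 * (t\<^sup>2 + z\<^sup>2) \<noteq> 0" using pos[of t] by simp
      have der: "((\<lambda>t. 2 * (t\<^sup>2 + z\<^sup>2)) has_real_derivative 2 * (2 * t)) (at t)"
        by (auto intro!: derivative_eq_intros)
      have eq: "- ((0 * (2 * S) - a * (2 * (2 * t))) / (2 * S * (2 * S))) = t * a / S\<^sup>2"
        if "S \<noteq> 0" for S a :: real
        using that by (simp add: field_simps power2_eq_square)
      have "t\<^sup>2 + z\<^sup>2 \<noteq> 0" using less_imp_neq[OF pos[of t]] by (rule not_sym)
      from DERIV_minus[OF DERIV_divide[OF DERIV_const[of "z\<^sup>2"] der S]]
      show ?thesis unfolding eq[OF \<open>t\<^sup>2 + z\<^sup>2 \<noteq> 0\<close>] .
    qed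
    have "((\<lambda>t. z\<^sup>2 / (2 * (t\<^sup>2 + z\<^sup>2))) \<longlongrightarrow> 0) at_top"
    proof (rule tendsto_divide_0[OF tendsto_const])
      have "filterlim (\<lambda>t::real. t\<^sup>2 + z\<^sup>2) at_top at_top"
        by (subst add.commute, rule filterlim_tendsto_add_at_top[OF tendsto_const])
          (intro filterlim_pow_at_top filterlim_ident, simp)
      then show "filterlim (\<lambda>t::real. 2 * (t\<^sup>2 + z\<^sup>2)) at_infinity at_top"
        by (intro filterlim_at_top_imp_at_infinity filterlim_tendsto_pos_mult_at_top[OF tendsto_const]) auto
    qed
    from tendsto_minus[OF this] show "((\<lambda>t. - (z\<^sup>2 / (2 * (t\<^sup>2 + z\<^sup>2)))) \<longlongrightarrow> 0) at_top" by simp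
  qed auto
  also have "0 - (- (z\<^sup>2 / (2 * (0\<^sup>2 + z\<^sup>2)))) = (1 / 2 :: real)" using z by simp
  also have "ennreal (1 / 2) \<le> 1" by (subst ennreal_le_1) simp
  finally have I: "(\<integral>\<^sup>+ t. ennreal ((t * z / (t\<^sup>2 + z\<^sup>2))\<^sup>2) \<partial>dt_t) \<le> 1" .
  have "(\<integral>\<^sup>+ t. epowr (xnorm (g t)) q \<partial>dt_t) \<le> (\<integral>\<^sup>+ t. ennreal (b powr q) * ennreal ((t * z / (t\<^sup>2 + z\<^sup>2))\<^sup>2) \<partial>dt_t)"
    by (intro nn_integral_mono) (use bound in \<open>auto simp: epowr_xnorm\<close>)
  also have "\<dots> = ennreal (b powr q) * (\<integral>\<^sup>+ t. ennreal ((t * z / (t\<^sup>2 + z\<^sup>2))\<^sup>2) \<partial>dt_t)"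
  proof (rule nn_integral_cmult)
    have "(\<lambda>t. ennreal ((t * z / (t\<^sup>2 + z\<^sup>2))\<^sup>2)) \<in> borel_measurable (lebesgue_on {0<..})"
      by (intro measurable_restrict_space1 measurable_completion) simp
    then show "(\<lambda>t. ennreal ((t * z / (t\<^sup>2 + z\<^sup>2))\<^sup>2)) \<in> borel_measurable dt_t"
      by (simp add: measurable_cong_sets[OF sets_dt_t refl])
  qed
  also have "\<dots> \<le> ennreal (b powr q) * 1" by (intro mult_left_mono I) auto
  finally show ?thesis
    using q b g by (simp add: Lq_dt_t_def Lp_norm_le_iff)
qed

subsection \<open>The kernel $t \partial_t P_t$\<close>

text \<open>The radial profile of \<open>t \<partial>\<^sub>t P\<^sub>t\<close> in dimension \<open>d\<close>, without its normalising constant.\<close>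
definition profile :: "nat \<Rightarrow> real \<Rightarrow> real \<Rightarrow> real"
  where "profile d t w = t * ((w\<^sup>2 - real d * t\<^sup>2) * (t\<^sup>2 + w\<^sup>2) powr (- ((real d + 3) / 2)))"

lemma t_deriv_poisson_kernel:
  fixes z :: "'a::euclidean_space"
  assumes t: "0 < t"
  shows "t * deriv (\<lambda>u. poisson_kernel u z) t =
    1 / (\<integral>z. poisson_shape 1 (z::'a) \<partial>lebesgue) * profile DIM('a) t (norm z)"
proof -
  let ?e = "(real DIM('a) + 1) / 2"
  let ?S = "t\<^sup>2 + (norm z)\<^sup>2"
  let ?c = "1 / (\<integral>z. poisson_shape 1 (z::'a) \<partial>lebesgue)"
  have S: "0 < ?S" using t by (simp add: add_pos_nonneg)
  have "((\<lambda>u. u\<^sup>2 + (norm z)\<^sup>2) has_real_derivative 2 * t) (at t)"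
    by (auto intro!: derivative_eq_intros)
  from DERIV_fun_powr[OF this S, of "- ?e"]
  have "((\<lambda>u. (u\<^sup>2 + (norm z)\<^sup>2) powr (- ?e)) has_real_derivative - ?e * ?S powr (- ?e - 1) * (2 * t)) (at t)"
    by simp
  from DERIV_mult[OF DERIV_ident this]
  have "((\<lambda>u. u * (u\<^sup>2 + (norm z)\<^sup>2) powr (- ?e)) has_real_derivative
      1 * ?S powr (- ?e) + - ?e * ?S powr (- ?e - 1) * (2 * t) * t) (at t)"
    by simp
  note der = DERIV_cmult[OF this, of ?c]
  have "((\<lambda>u. poisson_kernel u z) has_real_derivative
      ?c * (1 * ?S powr (- ?e) + - ?e * ?S powr (- ?e - 1) * (2 * t) * t)) (at t)"
  proof -
    have "poisson_kernel u z = ?c * (u * (u\<^sup>2 + (norm z)\<^sup>2) powr (- ?e))" for u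
      by (simp only: poisson_kernel_def poisson_shape_def powr_minus divide_inverse[of u])
    then show ?thesis using der by (simp only: )
  qed
  then have dv: "deriv (\<lambda>u. poisson_kernel u z) t =
      ?c * (1 * ?S powr (- ?e) + - ?e * ?S powr (- ?e - 1) * (2 * t) * t)"
    by (rule DERIV_imp_deriv)
  have e1: "?S powr (- ?e) = ?S * ?S powr (- ?e - 1)"
    using S by (simp add: powr_diff)
  have e2: "- ?e - 1 = - ((real DIM('a) + 3) / 2)" by (simp add: field_simps)
  have alg: "t * (c * (1 * (S * A) + - e * A * (2 * t) * t)) = c * (t * ((n - k * t\<^sup>2) * A))"
    if "S = t\<^sup>2 + n" "e = (k + 1) / 2" for c S A e n k
    unfolding that by (simp add: field_simps power2_eq_square)
  have "t * deriv (\<lambda>u. poisson_kernel u z) t =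
      t * (?c * (1 * (?S * ?S powr (- ?e - 1)) + - ?e * ?S powr (- ?e - 1) * (2 * t) * t))"
    by (simp only: dv e1)
  also have "\<dots> = ?c * (t * (((norm z)\<^sup>2 - real DIM('a) * t\<^sup>2) * ?S powr (- ?e - 1)))"
    by (rule alg[OF refl refl])
  finally show ?thesis by (simp only: profile_def e2)
qed

lemma continuous_profile:
  "0 < t \<Longrightarrow> continuous_on UNIV (profile d t)"
  unfolding profile_def
  by (intro continuous_intros ballI) (metis add_pos_nonneg less_irrefl zero_le_power2 zero_less_power)

lemma continuous_profile_time:
  "continuous_on {0<..} (\<lambda>t. profile d t w)"
  unfolding profile_def
  by (intro continuous_intros ballI) (metis add_pos_nonneg greaterThan_iff less_irrefl zero_le_power2 zero_less_power)

text \<open>Since \<open>b \<le> S powr (1/2)\<close>, each power of \<open>b\<close> costs half a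
  power of \<open>S\<close>. With \<open>S = t\<^sup>2 + w\<^sup>2\<close> and \<open>b\<close>
  equal to \<open>t\<close> or \<open>w\<close>, this separates decay in time from decay in
  space.\<close>

lemma powr_split:
  fixes S b :: real
  assumes "0 \<le> b" "b\<^sup>2 \<le> S" "0 < S" "0 \<le> m"
  shows "S powr (- (k + m / 2)) * b powr m \<le> S powr (- k)"
proof -
  have "b powr m \<le> (S powr (1/2)) powr m"
  proof (rule powr_mono2)
    have "sqrt (b\<^sup>2) \<le> sqrt S" using assms(2) by (rule real_sqrt_le_mono)
    then show "b \<le> S powr (1 / 2)" using assms by (simp add: powr_half_sqrt)
  qed (use assms in auto)
  then have "S powr (- (k + m / 2)) * b powr m \<le> S powr (- (k + m / 2)) * S powr (m / 2)"
    by (intro mult_left_mono) (auto simp: powr_powr)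
  also have "\<dots> = S powr (- k)" by (simp add: powr_add[symmetric])
  finally show ?thesis .
qed

lemma profile_bound:
  assumes d: "1 \<le> d" and t: "0 < t"
  shows "\<bar>profile d t w\<bar> \<le> real d * t * (t\<^sup>2 + w\<^sup>2) powr (- ((real d + 1) / 2))"
proof -
  let ?S = "t\<^sup>2 + w\<^sup>2"
  have S: "0 < ?S" using t by (simp add: add_pos_nonneg)
  have "\<bar>w\<^sup>2 - real d * t\<^sup>2\<bar> \<le> real d * ?S"
  proof -
    have "w\<^sup>2 \<le> real d * w\<^sup>2" using d by (simp add: mult_le_cancel_right1)
    moreover have "0 \<le> real d * t\<^sup>2" "0 \<le> w\<^sup>2" by auto
    ultimately show ?thesis by (intro abs_leI; simp only: distrib_left; linarith)
  qed
  then have "\<bar>profile d t w\<bar> \<le> t * (real d * ?S * ?S powr (- ((real d + 3) / 2)))"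
    using t by (simp add: profile_def abs_mult mult_left_mono mult_right_mono)
  also have "?S * ?S powr (- ((real d + 3) / 2)) = ?S powr (- ((real d + 1) / 2))"
  proof -
    have "?S powr (- ((real d + 1) / 2)) = ?S powr (1 + - ((real d + 3) / 2))"
      by (rule arg_cong[where f="\<lambda>e. ?S powr e"]) (simp add: field_simps)
    then show ?thesis using S by (simp only: powr_add powr_one)
  qed
  then have "t * (real d * ?S * ?S powr (- ((real d + 3) / 2))) = real d * t * ?S powr (- ((real d + 1) / 2))"
    by (simp add: mult_ac)
  finally show ?thesis .
qed

lemma profile_le_time:
  assumes d: "1 \<le> d" and t: "0 < t"
  shows "\<bar>profile d t w\<bar> \<le> real d / t ^ d"
proof -
  let ?S = "t\<^sup>2 + w\<^sup>2"
  have S: "0 < ?S" using t by (simp add: add_pos_nonneg)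
  have "?S powr (- ((real d + 1) / 2)) * t powr (real d + 1) \<le> ?S powr (- 0)"
    using powr_split[of t ?S "real d + 1" 0] t S by simp
  then have "?S powr (- ((real d + 1) / 2)) \<le> 1 / t powr (real d + 1)"
    using t S by (simp add: field_simps)
  also have "\<dots> = 1 / (t * t ^ d)" using t by (simp add: powr_add powr_realpow mult.commute)
  finally have "real d * t * ?S powr (- ((real d + 1) / 2)) \<le> real d * t * (1 / (t * t ^ d))"
    using t by (intro mult_left_mono) auto
  then show ?thesis using profile_bound[OF d t, of w] t by simp
qed

lemma profile_le_space:
  assumes d: "1 \<le> d" and t: "0 < t" and w: "0 < w"
  shows "\<bar>profile d t w\<bar> \<le> real d / w ^ d * (t * w / (t\<^sup>2 + w\<^sup>2))"
proof -
  let ?S = "t\<^sup>2 + w\<^sup>2"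
  have S: "0 < ?S" using t by (simp add: add_pos_nonneg)
  \<comment> \<open>Only \<open>d - 1\<close> powers of \<open>w\<close> are taken out, so that one
    factor \<open>1 / ?S\<close> remains; together with \<open>t * w\<close> it forms the factor of
    bounded norm in L^q(dt/t).\<close>
  have "?S powr (- (1 + (real d - 1) / 2)) * w powr (real d - 1) \<le> ?S powr (- 1)"
    using w S d by (intro powr_split) auto
  moreover have "1 + (real d - 1) / 2 = (real d + 1) / 2" by (simp add: field_simps)
  moreover have "w powr (real d - 1) = w ^ d / w" using w by (simp add: powr_diff powr_realpow)
  moreover have "?S powr (- 1) = 1 / ?S" using S by (simp add: powr_minus divide_inverse)
  ultimately have "?S powr (- ((real d + 1) / 2)) * (w ^ d / w) \<le> 1 / ?S" by simp
  from mult_right_mono[OF this, of "w / w ^ d"]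
  have "?S powr (- ((real d + 1) / 2)) \<le> 1 / ?S * (w / w ^ d)" using w by simp
  then have "real d * t * ?S powr (- ((real d + 1) / 2)) \<le> real d * t * (1 / ?S * (w / w ^ d))"
    using t by (intro mult_left_mono) auto
  then show ?thesis using profile_bound[OF d t, of w] by (simp add: mult_ac)
qed

text \<open>The derivative bound of \<open>profile_deriv\<close> contributes
  \<open>2 * (1 + (real d + 3) / 2 * real d)\<close>; the remaining \<open>4 * 2 ^ d\<close> is the
  loss on replacing a distance by its lower bound \<open>w0 / 2\<close> in
  \<open>profile_diff\<close>.\<close>

definition profile_const :: "nat \<Rightarrow> real"
  where "profile_const d = 8 * 2 ^ d * (1 + (real d + 3) / 2 * real d)"

lemma profile_deriv:
  assumes d: "1 \<le> d" and t: "0 < t" and w: "0 < w"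
  obtains D where "(profile d t has_real_derivative D) (at w)"
    "\<bar>D\<bar> \<le> 2 * (1 + (real d + 3) / 2 * real d) * (t / (w ^ d * (t\<^sup>2 + w\<^sup>2)))"
proof -
  let ?S = "t\<^sup>2 + w\<^sup>2"
  let ?m = "(real d + 3) / 2"
  have S: "0 < ?S" using t by (simp add: add_pos_nonneg)
  have "((\<lambda>w. t\<^sup>2 + w\<^sup>2) has_real_derivative 2 * w) (at w)"
    by (auto intro!: derivative_eq_intros)
  from DERIV_fun_powr[OF this S, of "- ?m"]
  have a: "((\<lambda>w. (t\<^sup>2 + w\<^sup>2) powr (- ?m)) has_real_derivative - ?m * ?S powr (- ?m - 1) * (2 * w)) (at w)"
    by simp
  have b: "((\<lambda>w. w\<^sup>2 - real d * t\<^sup>2) has_real_derivative 2 * w) (at w)"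
    by (auto intro!: derivative_eq_intros)
  define D where "D = t * (2 * w * ?S powr (- ?m) + - ?m * ?S powr (- ?m - 1) * (2 * w) * (w\<^sup>2 - real d * t\<^sup>2))"
  have "(profile d t has_real_derivative D) (at w)"
    using DERIV_cmult[OF DERIV_mult[OF b a], of t] unfolding profile_def D_def by simp
  moreover have "\<bar>D\<bar> \<le> 2 * (1 + ?m * real d) * (t / (w ^ d * ?S))"
  proof -
    have le: "\<bar>w\<^sup>2 - real d * t\<^sup>2\<bar> \<le> real d * ?S"
    proof -
      have "w\<^sup>2 \<le> real d * w\<^sup>2" using d by (simp add: mult_le_cancel_right1)
      moreover have "0 \<le> real d * t\<^sup>2" "0 \<le> w\<^sup>2" by auto
      ultimately show ?thesis by (intro abs_leI; simp only: distrib_left; linarith)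
    qed
    have Sm: "?S powr (- ?m - 1) * ?S = ?S powr (- ?m)" using S by (simp add: powr_diff)
    have "\<bar>D\<bar> \<le> t * (2 * w * ?S powr (- ?m) + ?m * ?S powr (- ?m - 1) * (2 * w) * \<bar>w\<^sup>2 - real d * t\<^sup>2\<bar>)"
    proof -
      have tri: "\<bar>a + - m * B * (2 * w) * X\<bar> \<le> a + m * B * (2 * w) * \<bar>X\<bar>"
        if "0 \<le> a" "0 \<le> m" "0 \<le> B" for a m B X
        using abs_triangle_ineq[of a "- (m * B * (2 * w) * X)"] that w by (simp add: abs_mult)
      have "\<bar>D\<bar> = t * \<bar>2 * w * ?S powr (- ?m) + - ?m * ?S powr (- ?m - 1) * (2 * w) * (w\<^sup>2 - real d * t\<^sup>2)\<bar>"
        unfolding D_def by (subst abs_mult) (use t in simp)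
      also have "\<dots> \<le> t * (2 * w * ?S powr (- ?m) + ?m * ?S powr (- ?m - 1) * (2 * w) * \<bar>w\<^sup>2 - real d * t\<^sup>2\<bar>)"
        using t w by (intro mult_left_mono tri) auto
      finally show ?thesis .
    qed
    also have "\<dots> \<le> t * (2 * w * ?S powr (- ?m) + ?m * ?S powr (- ?m - 1) * (2 * w) * (real d * ?S))"
      using t w le by (intro mult_left_mono add_left_mono) auto
    also have "\<dots> = 2 * (1 + ?m * real d) * (t * w * ?S powr (- ?m))"
    proof -
      have "t * (2 * w * (A * S) + m * A * (2 * w) * (k * S)) = 2 * (1 + m * k) * (t * w * (A * S))" for A S m k
        by (simp add: algebra_simps)
      then show ?thesis unfolding Sm[symmetric] .
    qed
    also have "\<dots> \<le> 2 * (1 + ?m * real d) * (t / (w ^ d * ?S))"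
    proof (intro mult_left_mono)
      have "?S powr (- (1 + (real d + 1) / 2)) * w powr (real d + 1) \<le> ?S powr (- 1)"
        using w S by (intro powr_split) auto
      moreover have "1 + (real d + 1) / 2 = ?m" by (simp add: field_simps)
      moreover have "w powr (real d + 1) = w ^ d * w" using w by (simp add: powr_add powr_realpow)
      moreover have "?S powr (- 1) = 1 / ?S" using S by (simp add: powr_minus divide_inverse)
      ultimately have le: "?S powr (- ?m) * (w ^ d * w) \<le> 1 / ?S" by simp
      have "t * w * ?S powr (- ?m) = t / w ^ d * (?S powr (- ?m) * (w ^ d * w))" using w by simp
      also have "\<dots> \<le> t / w ^ d * (1 / ?S)" using le t w by (intro mult_left_mono) auto
      finally show "t * w * ?S powr (- ?m) \<le> t / (w ^ d * ?S)" by simp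
    qed auto
    finally show ?thesis .
  qed
  ultimately show ?thesis by (rule that)
qed

text \<open>Mean value inequality on the half-line above \<open>w0 / 2\<close>, which is convex and
  contains both points. The bound on the derivative decreases with the distance, so the lower end of
  the half-line is the worst case.\<close>

lemma profile_diff:
  assumes d: "1 \<le> d" and t: "0 < t" and w0: "0 < w0" and w: "w0 / 2 \<le> w" and w': "w0 / 2 \<le> w'"
  shows "\<bar>profile d t w - profile d t w'\<bar> \<le> profile_const d * \<bar>w - w'\<bar> / w0 ^ (d + 1) * (t * w0 / (t\<^sup>2 + w0\<^sup>2))"
proof -
  have der: "\<exists>D. (profile d t has_real_derivative D) (at v) \<and> \<bar>D\<bar> \<le> profile_const d * (t / (w0 ^ d * (t\<^sup>2 + w0\<^sup>2)))"
    if v: "w0 / 2 \<le> v" for v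
  proof -
    have v0: "0 < v" using v w0 by linarith
    obtain D where D: "(profile d t has_real_derivative D) (at v)"
      "\<bar>D\<bar> \<le> 2 * (1 + (real d + 3) / 2 * real d) * (t / (v ^ d * (t\<^sup>2 + v\<^sup>2)))"
      using profile_deriv[OF d t v0] by blast
    have "(w0 / 2) ^ d * ((t\<^sup>2 + w0\<^sup>2) / 4) \<le> v ^ d * (t\<^sup>2 + v\<^sup>2)"
    proof (intro mult_mono)
      show "(w0 / 2) ^ d \<le> v ^ d" using v w0 by (intro power_mono) auto
      have "(w0 / 2)\<^sup>2 \<le> v\<^sup>2" using v w0 by (intro power_mono) auto
      then show "(t\<^sup>2 + w0\<^sup>2) / 4 \<le> t\<^sup>2 + v\<^sup>2"
        using zero_le_power2[of t] by (simp add: power_divide, linarith)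
    qed (use v0 in auto)
    then have "t / (v ^ d * (t\<^sup>2 + v\<^sup>2)) \<le> t / ((w0 / 2) ^ d * ((t\<^sup>2 + w0\<^sup>2) / 4))"
    proof (rule divide_left_mono)
      have "0 < t\<^sup>2 + w0\<^sup>2" "0 < t\<^sup>2 + v\<^sup>2" using t by (simp_all add: add_pos_nonneg)
      then show "0 < v ^ d * (t\<^sup>2 + v\<^sup>2) * ((w0 / 2) ^ d * ((t\<^sup>2 + w0\<^sup>2) / 4))"
        using v0 w0 by simp
    qed (use t in simp)
    also have "\<dots> = 4 * 2 ^ d * (t / (w0 ^ d * (t\<^sup>2 + w0\<^sup>2)))" by (simp add: power_divide)
    finally have "2 * (1 + (real d + 3) / 2 * real d) * (t / (v ^ d * (t\<^sup>2 + v\<^sup>2)))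
        \<le> 2 * (1 + (real d + 3) / 2 * real d) * (4 * 2 ^ d * (t / (w0 ^ d * (t\<^sup>2 + w0\<^sup>2))))"
      by (intro mult_left_mono) auto
    also have "\<dots> = profile_const d * (t / (w0 ^ d * (t\<^sup>2 + w0\<^sup>2)))"
      by (simp add: profile_const_def)
    finally show ?thesis using D by auto
  qed
  have main: "\<bar>profile d t w - profile d t w'\<bar> \<le> profile_const d * (t / (w0 ^ d * (t\<^sup>2 + w0\<^sup>2))) * \<bar>w - w'\<bar>"
  proof -
    obtain D where D: "\<And>v. v \<in> {w0 / 2..} \<Longrightarrow> (profile d t has_real_derivative D v) (at v)"
      "\<And>v. v \<in> {w0 / 2..} \<Longrightarrow> \<bar>D v\<bar> \<le> profile_const d * (t / (w0 ^ d * (t\<^sup>2 + w0\<^sup>2)))"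
      using der by (metis atLeast_iff)
    show ?thesis
      using field_differentiable_bound[of "{w0 / 2..}" "profile d t" D
          "profile_const d * (t / (w0 ^ d * (t\<^sup>2 + w0\<^sup>2)))" w w'] D w w'
      by (auto intro: has_field_derivative_at_within)
  qed
  also have "\<dots> = profile_const d * \<bar>w - w'\<bar> / w0 ^ (d + 1) * (t * w0 / (t\<^sup>2 + w0\<^sup>2))"
    using w0 by simp
  finally show ?thesis .
qed

subsection \<open>The critical radius\<close>

lemma measure_lebesgue_ball:
  "measure lebesgue (ball (x::'a::euclidean_space) r) = r ^ DIM('a) * measure lebesgue (ball (0::'a) 1)"
  if "0 \<le> r"
  using that content_ball[of r x] content_ball[of 1 "0::'a"] by (simp add: mult.commute)

lemma measure_lebesgue_unit_ball_pos: "0 < measure lebesgue (ball (0::'a::euclidean_space) 1)"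
  using content_ball_pos[of 1 "0::'a"] by simp

locale reverse_Hoelder_weight =
  fixes V :: "'a::euclidean_space \<Rightarrow> real" and s C :: real
  assumes dim: "3 \<le> DIM('a)" and s: "real DIM('a) / 2 < s"
    and nonneg: "\<And>x. 0 \<le> V x"
    and integrable_ball: "\<And>x r. 0 < r \<Longrightarrow> integrable (lebesgue_on (ball x r)) V"
    and C: "0 \<le> C"
    and integrable_powr: "\<And>x r. 0 < r \<Longrightarrow> integrable (lebesgue_on (ball x r)) (\<lambda>y. V y powr s)"
    and reverse: "\<And>x r. 0 < r \<Longrightarrow>
       (1 / measure lebesgue (ball x r) * (\<integral>y. V y powr s \<partial>lebesgue_on (ball x r))) powr (1 / s)
         \<le> C / measure lebesgue (ball x r) * (\<integral>y. V y \<partial>lebesgue_on (ball x r))"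
    and nontrivial: "\<not> (AE x in lebesgue. V x = 0)"
begin

abbreviation \<nu> :: "'a set \<Rightarrow> real"
  where "\<nu> E \<equiv> \<integral>y. V y \<partial>lebesgue_on E"

abbreviation \<psi> :: "'a \<Rightarrow> real \<Rightarrow> real"
  where "\<psi> x r \<equiv> 1 / r ^ (DIM('a) - 2) * \<nu> (ball x r)"

lemma s_gt_1: "1 < s"
  using dim s by simp

lemma integrable_subset:
  assumes "0 < r" "E \<in> sets lebesgue" "E \<subseteq> ball x r"
  shows "integrable lebesgue (\<lambda>y. indicator E y *\<^sub>R V y)"
proof -
  have "integrable lebesgue (\<lambda>y. indicator E y *\<^sub>R (indicator (ball x r) y *\<^sub>R V y))"
    using integrable_ball[OF assms(1), of x]
    by (intro integrable_mult_indicator[OF assms(2)]) (simp add: integrable_restrict_space)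
  moreover have "(\<lambda>y. indicator E y *\<^sub>R (indicator (ball x r) y *\<^sub>R V y)) = (\<lambda>y. indicator E y *\<^sub>R V y)"
    using assms(3) by (auto simp: indicator_def fun_eq_iff)
  ultimately show ?thesis by simp
qed

lemma \<nu>_eq: "E \<in> sets lebesgue \<Longrightarrow> \<nu> E = (\<integral>y. indicator E y *\<^sub>R V y \<partial>lebesgue)"
  by (simp add: integral_restrict_space)

lemma \<nu>_nonneg: "0 \<le> \<nu> E"
  using nonneg by (simp add: integral_nonneg_AE)

lemma \<nu>_mono:
  assumes "0 < r" "E \<in> sets lebesgue" "F \<in> sets lebesgue" "E \<subseteq> F" "F \<subseteq> ball x r"
  shows "\<nu> E \<le> \<nu> F"
  unfolding \<nu>_eq[OF assms(2)] \<nu>_eq[OF assms(3)] using assms nonneg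
  by (intro integral_mono integrable_subset[OF assms(1), of _ x]) (auto simp: indicator_def)

text \<open>Splitting \<open>V\<close> at the level \<open>K\<close> times its mean replaces the use of Hoelder's inequality.\<close>
lemma \<nu>_subset_le:
  assumes r: "0 < r" and E: "E \<in> sets lebesgue" "E \<subseteq> ball x r" and K: "0 < K"
  shows "\<nu> E \<le> (K * (measure lebesgue E / measure lebesgue (ball x r)) + K powr (1 - s) * C powr s) * \<nu> (ball x r)"
proof -
  let ?B = "ball x r"
  define m where "m = measure lebesgue ?B"
  have m: "0 < m" unfolding m_def using r content_ball_pos[OF r, of x] by simp
  define a where "a = \<nu> ?B / m"
  have a0: "0 \<le> a" using \<nu>_nonneg m by (simp add: a_def)
  show ?thesis
  proof (cases "a = 0")
    case True
    then have "\<nu> ?B = 0" using m by (simp add: a_def)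
    moreover have "\<nu> E \<le> \<nu> ?B" using r E by (intro \<nu>_mono[of r _ _ x]) auto
    ultimately show ?thesis by simp
  next
    case False
    then have a: "0 < a" using a0 by simp
    let ?W = "\<integral>y. V y powr s \<partial>lebesgue_on ?B"
    have W0: "0 \<le> ?W" by (simp add: integral_nonneg_AE)
    have W: "?W \<le> m * (C * a) powr s"
    proof -
      have "(1 / m * ?W) powr (1 / s) \<le> C * a"
        using reverse[OF r, of x] by (simp add: m_def a_def)
      then have "((1 / m * ?W) powr (1 / s)) powr s \<le> (C * a) powr s"
        using s_gt_1 by (intro powr_mono2) auto
      then show ?thesis using m W0 s_gt_1 by (simp add: powr_powr field_simps)
    qed
    have pt: "V y \<le> K * a + (K * a) powr (1 - s) * V y powr s" for y
    proof (cases "V y \<le> K * a")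
      case True
      then show ?thesis by (simp add: add_increasing2)
    next
      case False
      then have v: "K * a < V y" "0 < V y" using mult_pos_pos[OF K a] by linarith+
      have "V y = V y powr (1 - s) * V y powr s" using v by (simp add: powr_add[symmetric])
      also have "\<dots> \<le> (K * a) powr (1 - s) * V y powr s"
        using v K a s_gt_1 by (intro mult_right_mono powr_mono2') auto
      finally show ?thesis using K a by (simp add: add_increasing)
    qed
    have fE: "emeasure lebesgue E < \<infinity>"
      using emeasure_mono[OF E(2), of lebesgue] emeasure_bounded_finite[OF bounded_ball, of x r]
      by (auto intro: order.strict_trans1)
    have iW: "integrable lebesgue (\<lambda>y. indicator ?B y *\<^sub>R V y powr s)"
      using integrable_powr[OF r, of x] by (simp add: integrable_restrict_space)
    have i1: "integrable lebesgue (\<lambda>y. indicator E y * (K * a))"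
      using E fE by simp
    have "\<nu> E \<le> (\<integral>y. indicator E y * (K * a) + (K * a) powr (1 - s) * (indicator ?B y *\<^sub>R V y powr s) \<partial>lebesgue)"
      unfolding \<nu>_eq[OF E(1)]
    proof (rule integral_mono)
      show "integrable lebesgue (\<lambda>y. indicator E y *\<^sub>R V y)" using r E by (rule integrable_subset)
      show "integrable lebesgue (\<lambda>y. indicator E y * (K * a) + (K * a) powr (1 - s) * (indicator ?B y *\<^sub>R V y powr s))"
        using i1 iW by (intro Bochner_Integration.integrable_add) auto
      show "indicator E y *\<^sub>R V y \<le> indicator E y * (K * a) + (K * a) powr (1 - s) * (indicator ?B y *\<^sub>R V y powr s)" for y
        using pt[of y] E(2) by (cases "y \<in> E") auto
    qed
    also have "\<dots> = measure lebesgue E * (K * a) + (K * a) powr (1 - s) * ?W"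
      using i1 iW E fE by (simp add: Bochner_Integration.integral_add integral_restrict_space)
    also have "\<dots> \<le> measure lebesgue E * (K * a) + (K * a) powr (1 - s) * (m * (C * a) powr s)"
      using W by (intro add_left_mono mult_left_mono) auto
    also have "\<dots> = (K * (measure lebesgue E / m) + K powr (1 - s) * C powr s) * (a * m)"
    proof -
      have "(K * a) powr (1 - s) * (C * a) powr s = K powr (1 - s) * C powr s * (a powr (1 - s) * a powr s)"
        using K a C by (simp add: powr_mult)
      also have "a powr (1 - s) * a powr s = a" using a by (simp add: powr_add[symmetric])
      finally show ?thesis using m by (simp add: field_simps)
    qed
    finally show ?thesis using m by (simp add: a_def m_def)
  qed
qed

text \<open>Comparing the masses of concentric balls through the exponent \<open>s\<close> gives the
  factor \<open>(r / R) powr (d - d / s)\<close>, with \<open>d\<close> the dimension; normalising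
  by \<open>r ^ (d - 2)\<close> leaves the exponent \<open>2 - d / s\<close>. It is positive because
  \<open>s > d / 2\<close>, and its positivity forces \<open>\<psi> x r\<close> to 0 as
  \<open>r\<close> shrinks and to infinity as \<open>r\<close> grows.\<close>

definition \<delta> :: real where "\<delta> = 2 - real DIM('a) / s"

lemma \<delta>_pos: "0 < \<delta>"
  using s s_gt_1 by (simp add: \<delta>_def field_simps)

definition C1 :: real where "C1 = 1 + C powr s"

lemma C1: "1 \<le> C1"
  by (simp add: C1_def)

lemma \<psi>_nonneg: "0 < r \<Longrightarrow> 0 \<le> \<psi> x r"
  using \<nu>_nonneg by simp

lemma \<psi>_growth:
  assumes r: "0 < r" "r \<le> R"
  shows "\<psi> x r \<le> C1 * (r / R) powr \<delta> * \<psi> x R"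
proof -
  let ?d = "real DIM('a)"
  have R: "0 < R" using r by simp
  \<comment> \<open>Balances the two terms of \<open>\<nu>_subset_le\<close>: both
    \<open>K * (r / R) powr ?d\<close> and \<open>K powr (1 - s)\<close> equal
    \<open>(r / R) powr (?d - ?d / s)\<close>.\<close>
  define K where "K = (R / r) powr (?d / s)"
  have K: "0 < K" using r R by (simp add: K_def)
  have q: "0 < r / R" using r R by simp
  have m: "measure lebesgue (ball x r) / measure lebesgue (ball x R) = (r / R) powr ?d"
  proof -
    have "(r / R) powr ?d = r ^ DIM('a) / R ^ DIM('a)" using q by (simp add: powr_realpow power_divide)
    then show ?thesis
      using r R measure_lebesgue_unit_ball_pos[where 'a='a]
        measure_lebesgue_ball[of r x] measure_lebesgue_ball[of R x] by simp
  qed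
  have Kq: "K = (r / R) powr (- ?d / s)"
  proof -
    have "(r / R) powr (- ?d / s) = inverse (inverse (R / r) powr (?d / s))"
      by (simp add: powr_minus)
    also have "\<dots> = (R / r) powr (?d / s)" using r R by (simp only: inverse_powr) simp
    finally show ?thesis by (simp add: K_def)
  qed
  have e1: "K * (r / R) powr ?d = (r / R) powr (?d - ?d / s)"
    unfolding Kq powr_add[symmetric] by (simp add: algebra_simps)
  have e2: "K powr (1 - s) = (r / R) powr (?d - ?d / s)"
  proof -
    have "- ?d / s * (1 - s) = ?d - ?d / s" using s_gt_1 by (simp add: field_simps)
    then show ?thesis by (simp only: Kq powr_powr)
  qed
  have "\<nu> (ball x r) \<le> (K * (measure lebesgue (ball x r) / measure lebesgue (ball x R)) + K powr (1 - s) * C powr s) * \<nu> (ball x R)"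
    using r R K by (intro \<nu>_subset_le) (auto intro: subset_ball)
  also have "\<dots> = C1 * (r / R) powr (?d - ?d / s) * \<nu> (ball x R)"
    unfolding m e1 e2 C1_def by (simp add: algebra_simps)
  finally have le: "\<nu> (ball x r) \<le> C1 * (r / R) powr (?d - ?d / s) * \<nu> (ball x R)" .
  have dd: "real (DIM('a) - 2) = ?d - 2" using dim by simp
  have split: "(r / R) powr (?d - ?d / s) = (r / R) powr \<delta> * (r ^ (DIM('a) - 2) / R ^ (DIM('a) - 2))"
  proof -
    have "r ^ (DIM('a) - 2) / R ^ (DIM('a) - 2) = (r / R) powr (?d - 2)"
      using q by (simp add: powr_realpow[symmetric] power_divide[symmetric] dd)
    then show ?thesis by (simp add: powr_add[symmetric] \<delta>_def)
  qed
  have "\<psi> x r \<le> 1 / r ^ (DIM('a) - 2) * (C1 * (r / R) powr (?d - ?d / s) * \<nu> (ball x R))"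
    using le r by (intro mult_left_mono) auto
  also have "\<dots> = C1 * (r / R) powr \<delta> * \<psi> x R"
    unfolding split using r R by (simp add: field_simps)
  finally show ?thesis .
qed

text \<open>A shell with a small fraction of the volume carries at most half of the mass, so
  shrinking the radius by a fixed factor below 1 loses at most a factor 2; iteration reaches any
  fixed ratio. The ratio 12 is the one that \<open>critical_radius_comparable\<close> uses.\<close>

lemma doubling:
  obtains D where "1 \<le> D" "\<And>x R. 0 < R \<Longrightarrow> \<nu> (ball x R) \<le> D * \<nu> (ball x (R / 12))"
proof -
  \<comment> \<open>Makes the second coefficient in \<open>\<nu>_subset_le\<close> at most 1/4; the
    summand 1 keeps the base positive when \<open>C = 0\<close>.\<close>
  define K where "K = (4 * C powr s + 1) powr (1 / (s - 1))"
  have base: "1 \<le> 4 * C powr s + 1" by simp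
  have K1: "1 \<le> K" unfolding K_def using base s_gt_1 by (intro ge_one_powr_ge_zero) auto
  have "K powr (1 - s) = (4 * C powr s + 1) powr (-1)"
  proof -
    have "1 / (s - 1) * (1 - s) = -1" using s_gt_1 by (simp add: field_simps)
    then show ?thesis by (simp add: K_def powr_powr)
  qed
  also have "\<dots> = 1 / (4 * C powr s + 1)" using base by (simp add: powr_minus_divide)
  finally have "K powr (1 - s) * C powr s = C powr s / (4 * C powr s + 1)" by simp
  also have "\<dots> \<le> 1 / 4"
  proof (subst pos_divide_le_eq)
    show "C powr s \<le> 1 / 4 * (4 * C powr s + 1)" by (simp add: distrib_left)
  qed (use base in linarith)
  finally have Ks: "K powr (1 - s) * C powr s \<le> 1 / 4" .
  \<comment> \<open>The shell outside radius \<open>\<theta> * R\<close> then has relative volume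
    \<open>1 / (4 * K)\<close>, so that the first coefficient in \<open>\<nu>_subset_le\<close> is
    1/4 as well.\<close>
  define \<theta> where "\<theta> = (1 - 1 / (4 * K)) powr (1 / real DIM('a))"
  have in01: "0 < 1 - 1 / (4 * K)" "1 - 1 / (4 * K) < 1" using K1 by (auto simp: field_simps)
  have th: "0 < \<theta>" "\<theta> < 1"
    using in01 dim powr_less_mono2[of "1 / real DIM('a)" "1 - 1 / (4 * K)" 1] by (auto simp: \<theta>_def)
  have thd: "\<theta> ^ DIM('a) = 1 - 1 / (4 * K)"
    using in01 dim by (simp add: \<theta>_def powr_realpow[symmetric] powr_powr)
  have step: "\<nu> (ball x R) \<le> 2 * \<nu> (ball x (\<theta> * R))" if R: "0 < R" for x R
  proof -
    let ?E = "ball x R - ball x (\<theta> * R)"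
    have sub: "ball x (\<theta> * R) \<subseteq> ball x R" using th R by (intro subset_ball) (simp add: mult_le_cancel_right1)
    have E: "?E \<in> sets lebesgue" "?E \<subseteq> ball x R" by auto
    have fin: "emeasure lebesgue (ball x R) \<noteq> \<infinity>"
      using emeasure_bounded_finite[OF bounded_ball, of x R] by simp
    have "measure lebesgue ?E = measure lebesgue (ball x R) - measure lebesgue (ball x (\<theta> * R))"
      using sub fin by (intro measure_Diff) auto
    also have "\<dots> = (1 - \<theta> ^ DIM('a)) * measure lebesgue (ball x R)"
      using R th measure_lebesgue_ball[of R x] measure_lebesgue_ball[of "\<theta> * R" x]
      by (simp add: algebra_simps power_mult_distrib)
    finally have "measure lebesgue ?E / measure lebesgue (ball x R) = 1 / (4 * K)"
      using content_ball_pos[OF R, of x] by (simp add: thd)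
    then have "\<nu> ?E \<le> (K * (1 / (4 * K)) + K powr (1 - s) * C powr s) * \<nu> (ball x R)"
      using \<nu>_subset_le[OF R E, of K] K1 by simp
    also have "\<dots> \<le> (1 / 4 + 1 / 4) * \<nu> (ball x R)"
      using Ks K1 \<nu>_nonneg by (intro mult_right_mono add_mono) auto
    finally have "\<nu> ?E \<le> 1 / 2 * \<nu> (ball x R)" by simp
    moreover have "\<nu> (ball x R) = \<nu> ?E + \<nu> (ball x (\<theta> * R))"
    proof -
      have "(\<lambda>y. indicator (ball x R) y *\<^sub>R V y) =
          (\<lambda>y. indicator ?E y *\<^sub>R V y + indicator (ball x (\<theta> * R)) y *\<^sub>R V y)"
        using sub by (auto simp: indicator_def fun_eq_iff)
      then show ?thesis
        using R E sub by (simp only: \<nu>_eq sets_lborel sets_completionI_sets borel_open open_ball)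
          (intro Bochner_Integration.integral_add integrable_subset[OF R, of _ x], auto)
    qed
    ultimately show ?thesis by simp
  qed
  have iter: "\<nu> (ball x R) \<le> 2 ^ n * \<nu> (ball x (\<theta> ^ n * R))" if R: "0 < R" for x R n
  proof (induction n)
    case (Suc n)
    have "\<nu> (ball x (\<theta> ^ n * R)) \<le> 2 * \<nu> (ball x (\<theta> * (\<theta> ^ n * R)))"
      using th R by (intro step) simp
    then have "2 ^ n * \<nu> (ball x (\<theta> ^ n * R)) \<le> 2 ^ n * (2 * \<nu> (ball x (\<theta> * (\<theta> ^ n * R))))"
      by (intro mult_left_mono) auto
    from order_trans[OF Suc this] show ?case by (simp only: power_Suc mult_ac)
  qed simp
  obtain n where n: "\<theta> ^ n < 1 / 12" using real_arch_pow_inv[of "1/12" \<theta>] th by auto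
  show ?thesis
  proof
    show "(1::real) \<le> 2 ^ n" by simp
    show "\<nu> (ball x R) \<le> 2 ^ n * \<nu> (ball x (R / 12))" if R: "0 < R" for x R
    proof -
      have "\<nu> (ball x (\<theta> ^ n * R)) \<le> \<nu> (ball x (R / 12))"
        using R n by (intro \<nu>_mono[of "R / 12" _ _ x] subset_ball) auto
      then have "2 ^ n * \<nu> (ball x (\<theta> ^ n * R)) \<le> 2 ^ n * \<nu> (ball x (R / 12))"
        by (intro mult_left_mono) auto
      from order_trans[OF iter[OF R, of x n] this] show ?thesis .
    qed
  qed
qed

definition admissible :: "'a \<Rightarrow> real set" where "admissible x = {r. r > 0 \<and> \<psi> x r \<le> 1}"

lemma critical_radius_eq: "critical_radius V x = Sup (admissible x)"
  by (simp add: critical_radius_def admissible_def)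

lemma small_powr:
  assumes "0 < A" obtains e :: real where "0 < e" "e \<le> 1" "A * e powr \<delta> \<le> 1"
proof
  let ?e = "min 1 ((1 / A) powr (1 / \<delta>))"
  show "0 < ?e" "?e \<le> 1" using assms by auto
  have "A * ?e powr \<delta> \<le> A * ((1 / A) powr (1 / \<delta>)) powr \<delta>"
    using assms \<delta>_pos by (intro mult_left_mono powr_mono2) auto
  also have "\<dots> = 1" using assms \<delta>_pos by (simp add: powr_powr)
  finally show "A * ?e powr \<delta> \<le> 1" .
qed

lemma admissible_nonempty: "admissible x \<noteq> {}"
proof -
  obtain e where e: "0 < e" "e \<le> 1" "(C1 * (\<psi> x 1 + 1)) * e powr \<delta> \<le> 1"
    using small_powr[of "C1 * (\<psi> x 1 + 1)"] C1 \<psi>_nonneg[of 1 x] by auto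
  have "\<psi> x e \<le> C1 * (e / 1) powr \<delta> * \<psi> x 1" using e by (intro \<psi>_growth) auto
  also have "\<dots> \<le> C1 * e powr \<delta> * (\<psi> x 1 + 1)"
    using C1 \<psi>_nonneg[of 1 x] by (intro mult_mono) auto
  also have "\<dots> \<le> 1" using e(3) by (simp add: mult_ac)
  finally show ?thesis using e by (auto simp: admissible_def)
qed

text \<open>This is where \<open>V\<close> must not vanish almost everywhere: some ball at
  \<open>x\<close> has positive mass, and by \<open>\<psi>_growth\<close> the quantity
  \<open>\<psi> x r\<close> then exceeds 1 for all large \<open>r\<close>.\<close>

lemma bdd_above_admissible: "bdd_above (admissible x)"
proof -
  obtain R where R: "0 < R" "0 < \<nu> (ball x R)"
  proof (rule ccontr)
    assume "\<not> thesis"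
    note none = that
    have "\<not> 0 < \<nu> (ball x R)" if "0 < R" for R
      using none[OF that] \<open>\<not> thesis\<close> by blast
    then have 0: "\<nu> (ball x R) = 0" if "0 < R" for R
      using that \<nu>_nonneg[of "ball x R"] by (meson antisym not_le)
    have "AE y in lebesgue. \<forall>n. y \<in> ball x (real (Suc n)) \<longrightarrow> V y = 0"
      unfolding AE_all_countable
    proof
      fix n
      have "AE y in lebesgue_on (ball x (real (Suc n))). V y = 0"
        using integral_nonneg_eq_0_iff_AE[OF integrable_ball[of "real (Suc n)" x]] nonneg 0[of "real (Suc n)"] by simp
      then show "AE y in lebesgue. y \<in> ball x (real (Suc n)) \<longrightarrow> V y = 0"
        by (simp add: AE_restrict_space_iff)
    qed
    then have "AE y in lebesgue. V y = 0"
    proof eventually_elim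
      case (elim y)
      obtain n where "dist x y < real n" using reals_Archimedean2 by blast
      then have "y \<in> ball x (real (Suc n))" by simp
      then show ?case using elim by blast
    qed
    then show False using nontrivial by simp
  qed
  have p: "0 < \<psi> x R" using R by simp
  show ?thesis
  proof (rule bdd_aboveI)
    fix r assume "r \<in> admissible x"
    then have r: "0 < r" "\<psi> x r \<le> 1" by (auto simp: admissible_def)
    show "r \<le> max R (R * (C1 / \<psi> x R) powr (1 / \<delta>))"
    proof (cases "r \<le> R")
      case False
      have "\<psi> x R \<le> C1 * (R / r) powr \<delta> * \<psi> x r" using False R by (intro \<psi>_growth) auto
      also have "\<dots> \<le> C1 * (R / r) powr \<delta> * 1" using r C1 by (intro mult_left_mono) auto
      finally have "\<psi> x R \<le> C1 * (R / r) powr \<delta>" by simp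
      then have "(r / R) powr \<delta> \<le> C1 / \<psi> x R"
        using p r(1) R(1) by (simp add: powr_divide field_simps)
      then have "((r / R) powr \<delta>) powr (1 / \<delta>) \<le> (C1 / \<psi> x R) powr (1 / \<delta>)"
        using \<delta>_pos by (intro powr_mono2) auto
      then have "r / R \<le> (C1 / \<psi> x R) powr (1 / \<delta>)"
        using \<delta>_pos r R by (simp add: powr_powr)
      then have "r \<le> R * (C1 / \<psi> x R) powr (1 / \<delta>)" using R by (simp add: field_simps)
      then show ?thesis by simp
    qed simp
  qed
qed

lemma critical_radius_pos: "0 < critical_radius V x"
proof -
  obtain r where "r \<in> admissible x" using admissible_nonempty by blast
  then show ?thesis using cSup_upper[OF _ bdd_above_admissible, of r x]
    by (auto simp: critical_radius_eq admissible_def)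
qed

lemma gt_1_of_gt_critical_radius: "critical_radius V x < r \<Longrightarrow> 1 < \<psi> x r"
  using cSup_upper[OF _ bdd_above_admissible, of r x] critical_radius_pos[of x]
  by (force simp: critical_radius_eq admissible_def)

lemma le_critical_radius: "0 < r \<Longrightarrow> \<psi> x r \<le> 1 \<Longrightarrow> r \<le> critical_radius V x"
  using cSup_upper[OF _ bdd_above_admissible, of r x] by (simp add: critical_radius_eq admissible_def)

text \<open>For the upper bound at \<open>y\<close>: beyond the critical radius the mass at
  \<open>x\<close> exceeds the threshold, a ball at \<open>y\<close> inherits that mass, and growth
  excludes much larger admissible radii. For the lower bound: an almost critical radius at
  \<open>x\<close> bounds the mass near \<open>y\<close> by doubling, and growth brings
  \<open>\<psi> y\<close> below 1 at a fixed fraction of the radius.\<close>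

lemma critical_radius_comparable:
  obtains C0 where "1 \<le> C0"
    "\<And>x y. dist x y \<le> 2 * critical_radius V x \<Longrightarrow>
       critical_radius V x \<le> C0 * critical_radius V y \<and> critical_radius V y \<le> C0 * critical_radius V x"
proof -
  let ?\<rho> = "critical_radius V"
  let ?k = "DIM('a) - 2"
  obtain D where D: "1 \<le> D" "\<And>x R. 0 < R \<Longrightarrow> \<nu> (ball x R) \<le> D * \<nu> (ball x (R / 12))"
    using doubling by blast
  obtain e where e: "0 < e" "e \<le> 1" "(C1 * D) * e powr \<delta> \<le> 1"
    using small_powr[of "C1 * D"] C1 D(1) by auto
  define c where "c = 4 * (C1 * 2 ^ ?k) powr (1 / \<delta>) + 4"
  have upper: "?\<rho> y \<le> c * ?\<rho> x" if xy: "dist x y \<le> 2 * ?\<rho> x" for x y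
    unfolding critical_radius_eq[of y]
  proof (rule cSup_least[OF admissible_nonempty])
    define R where "R = ?\<rho> x"
    have R: "0 < R" using critical_radius_pos by (simp add: R_def)
    fix r assume "r \<in> admissible y"
    then have r: "0 < r" "\<psi> y r \<le> 1" by (auto simp: admissible_def)
    show "r \<le> c * ?\<rho> x"
    proof (cases "r \<le> 4 * R")
      case True
      have "4 * R \<le> c * R" using R by (intro mult_right_mono) (auto simp: c_def)
      then show ?thesis using True by (simp add: R_def)
    next
      case False
      have "1 < \<psi> x (2 * R)" using R by (intro gt_1_of_gt_critical_radius) (simp add: R_def)
      then have "(2 * R) ^ ?k < \<nu> (ball x (2 * R))" using R by (simp add: field_simps)
      also have "\<dots> \<le> \<nu> (ball y (4 * R))"
      proof -
        have "ball x (2 * R) \<subseteq> ball y (4 * R)"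
        proof
          fix z assume "z \<in> ball x (2 * R)"
          then show "z \<in> ball y (4 * R)"
            using xy dist_triangle[of y z x] by (simp add: R_def dist_commute)
        qed
        then show ?thesis using R by (intro \<nu>_mono[of "4 * R" _ _ y]) auto
      qed
      also have "\<dots> = (4 * R) ^ ?k * \<psi> y (4 * R)" using R by simp
      also have "\<dots> \<le> (4 * R) ^ ?k * (C1 * (4 * R / r) powr \<delta> * \<psi> y r)"
        using R False by (intro mult_left_mono \<psi>_growth) auto
      also have "\<dots> \<le> (4 * R) ^ ?k * (C1 * (4 * R / r) powr \<delta> * 1)"
        using R r C1 by (intro mult_left_mono) auto
      also have "\<dots> = (2 * R) ^ ?k * (2 ^ ?k * (C1 * (4 * R / r) powr \<delta>))"
      proof -
        have "4 * R = 2 * (2 * R)" by simp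
        then have "(4 * R) ^ ?k = 2 ^ ?k * (2 * R) ^ ?k" by (metis power_mult_distrib)
        then show ?thesis by (simp only: mult_ac mult_1_right)
      qed
      finally have "1 < 2 ^ ?k * (C1 * (4 * R / r) powr \<delta>)" using R by simp
      then have "(r / (4 * R)) powr \<delta> < C1 * 2 ^ ?k"
        using R r by (simp add: powr_divide field_simps)
      then have "((r / (4 * R)) powr \<delta>) powr (1 / \<delta>) \<le> (C1 * 2 ^ ?k) powr (1 / \<delta>)"
        using \<delta>_pos by (intro powr_mono2) auto
      then have "r / (4 * R) \<le> (C1 * 2 ^ ?k) powr (1 / \<delta>)"
        using \<delta>_pos r R by (simp add: powr_powr)
      then have "r \<le> 4 * (C1 * 2 ^ ?k) powr (1 / \<delta>) * R" using R by (simp add: field_simps)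
      also have "\<dots> \<le> c * R" using R by (intro mult_right_mono) (auto simp: c_def)
      finally show ?thesis by (simp add: R_def)
    qed
  qed
  have lower: "e * ?\<rho> x \<le> ?\<rho> y" if xy: "dist x y \<le> 2 * ?\<rho> x" for x y
  proof (rule le_critical_radius)
    define R where "R = ?\<rho> x"
    have R: "0 < R" using critical_radius_pos by (simp add: R_def)
    show "0 < e * ?\<rho> x" using R e by (simp add: R_def)
    \<comment> \<open>The supremum is not known to be attained, so an admissible \<open>r0\<close>
      within a factor 2 of it is taken. The ball of radius \<open>4 * R\<close> at \<open>y\<close>
      lies within distance \<open>6 * R < 12 * r0\<close> of \<open>x\<close>, whence the ratio 12
      in \<open>doubling\<close>.\<close>
    obtain r0 where r0: "r0 \<in> admissible x" "R / 2 < r0"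
      using less_cSup_iff[OF admissible_nonempty bdd_above_admissible, of "R / 2" x] R
      by (auto simp: R_def critical_radius_eq)
    have r0': "0 < r0" "\<psi> x r0 \<le> 1" "r0 \<le> R"
      using r0 le_critical_radius[of r0 x] by (auto simp: admissible_def R_def)
    have "\<nu> (ball y (4 * R)) \<le> \<nu> (ball x (12 * r0))"
    proof -
      have "ball y (4 * R) \<subseteq> ball x (12 * r0)"
      proof
        fix z assume "z \<in> ball y (4 * R)"
        then show "z \<in> ball x (12 * r0)"
          using xy dist_triangle[of x z y] r0(2) by (simp add: R_def)
      qed
      then show ?thesis using r0' by (intro \<nu>_mono[of "12 * r0" _ _ x]) auto
    qed
    also have "\<dots> \<le> D * \<nu> (ball x r0)" using D(2)[of "12 * r0" x] r0' by simp
    also have "\<dots> \<le> D * r0 ^ ?k" using r0' D(1) by (intro mult_left_mono) (auto simp: field_simps)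
    also have "\<dots> \<le> D * R ^ ?k" using r0' D(1) by (intro mult_left_mono power_mono) auto
    finally have "\<nu> (ball y (4 * R)) \<le> D * R ^ ?k" .
    also have "\<dots> \<le> D * (4 * R) ^ ?k" using R D(1) by (intro mult_left_mono power_mono) auto
    finally have 4: "\<psi> y (4 * R) \<le> D" using R by (simp add: field_simps)
    have "\<psi> y (e * R) \<le> C1 * (e * R / (4 * R)) powr \<delta> * \<psi> y (4 * R)"
      using R e by (intro \<psi>_growth) auto
    also have "\<dots> \<le> C1 * e powr \<delta> * D"
      using 4 C1 R e \<delta>_pos \<psi>_nonneg[of "4 * R" y]
      by (intro mult_mono powr_mono2) (auto simp: mult_nonneg_nonneg)
    also have "\<dots> \<le> 1" using e(3) by (simp add: mult_ac)
    finally show "\<psi> y (e * ?\<rho> x) \<le> 1" by (simp add: R_def)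
  qed
  have c: "1 \<le> c" by (simp add: c_def add_increasing)
  show ?thesis
  proof
    show "1 \<le> max c (1 / e)" using c by simp
    fix x y assume xy: "dist x y \<le> 2 * ?\<rho> x"
    have "?\<rho> x \<le> 1 / e * ?\<rho> y" using lower[OF xy] e by (simp add: field_simps)
    also have "\<dots> \<le> max c (1 / e) * ?\<rho> y"
      using critical_radius_pos[of y] by (intro mult_right_mono) auto
    finally have 1: "?\<rho> x \<le> max c (1 / e) * ?\<rho> y" .
    have "?\<rho> y \<le> c * ?\<rho> x" using upper[OF xy] .
    also have "\<dots> \<le> max c (1 / e) * ?\<rho> x"
      using critical_radius_pos[of x] by (intro mult_right_mono) auto
    finally show "?\<rho> x \<le> max c (1 / e) * ?\<rho> y \<and> ?\<rho> y \<le> max c (1 / e) * ?\<rho> x" using 1 by simp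
  qed
qed

end

lemma reverse_Hoelder_critical_radius:
  fixes V :: "'a::euclidean_space \<Rightarrow> real"
  assumes "3 \<le> DIM('a)" "real DIM('a) / 2 < s" "reverse_Hoelder s V" "\<not> (AE x in lebesgue. V x = 0)"
  obtains C0 where "1 \<le> C0" "\<And>x. 0 < critical_radius V x"
    "\<And>x y. dist x y \<le> 2 * critical_radius V x \<Longrightarrow> critical_radius V x \<le> C0 * critical_radius V y"
    "\<And>x y. dist x y \<le> 2 * critical_radius V x \<Longrightarrow> critical_radius V y \<le> C0 * critical_radius V x"
proof -
  obtain C where C: "\<And>x r. 0 < r \<Longrightarrow>
       integrable (lebesgue_on (ball x r)) (\<lambda>y. V y powr s) \<and>
       (1 / measure lebesgue (ball x r) * (\<integral>y. V y powr s \<partial>lebesgue_on (ball x r))) powr (1 / s)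
         \<le> C / measure lebesgue (ball x r) * (\<integral>y. V y \<partial>lebesgue_on (ball x r))"
    using assms(3) unfolding reverse_Hoelder_def by blast
  have V: "\<And>x. 0 \<le> V x" "\<And>x r. 0 < r \<Longrightarrow> integrable (lebesgue_on (ball x r)) V"
    using assms(3) unfolding reverse_Hoelder_def by blast+
  \<comment> \<open>\<open>reverse_Hoelder\<close> leaves the sign of its constant open, whereas the
    estimates take powers of it.\<close>
  interpret reverse_Hoelder_weight V s "max C 0"
  proof
    show "(1 / measure lebesgue (ball x r) * (\<integral>y. V y powr s \<partial>lebesgue_on (ball x r))) powr (1 / s)
         \<le> max C 0 / measure lebesgue (ball x r) * (\<integral>y. V y \<partial>lebesgue_on (ball x r))" if "0 < r" for x r
      using V(1) by (intro order_trans[OF conjunct2[OF C[OF that]]] mult_right_mono divide_right_mono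
          integral_nonneg_AE) auto
  qed (use assms V C in auto)
  show ?thesis using critical_radius_comparable critical_radius_pos that by metis
qed

subsection \<open>The John--Nirenberg inequality\<close>

text \<open>Half-open, so that the dyadic children of a cube partition it exactly and integrals over
  them add up.\<close>

definition cube :: "'a::euclidean_space \<Rightarrow> real \<Rightarrow> 'a set"
  where "cube a h = {x. \<forall>i\<in>Basis. a \<bullet> i \<le> x \<bullet> i \<and> x \<bullet> i < a \<bullet> i + h}"

text \<open>The children are indexed by the set \<open>J\<close> of coordinates in which the upper
  half is taken.\<close>

definition corner :: "'a::euclidean_space \<Rightarrow> real \<Rightarrow> 'a set \<Rightarrow> 'a"
  where "corner a h J = a + (h / 2) *\<^sub>R \<Sum>J"

lemma corner_inner:
  assumes "i \<in> Basis" "J \<subseteq> Basis"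
  shows "corner a h J \<bullet> i = a \<bullet> i + (if i \<in> J then h / 2 else 0)"
proof -
  have "\<Sum>J \<bullet> i = (\<Sum>j\<in>J. if j = i then 1 else 0)"
    unfolding inner_sum_left using assms by (intro sum.cong) (auto simp: inner_Basis)
  also have "\<dots> = (if i \<in> J then 1 else 0)"
    using finite_subset[OF assms(2) finite_Basis] by simp
  finally show ?thesis by (simp add: corner_def inner_add_left)
qed

lemma cube_borel: "cube a h \<in> sets borel"
  unfolding cube_def by measurable

lemma cube_lebesgue [measurable, simp]: "cube a h \<in> sets lebesgue"
  using cube_borel[of a h] by (metis sets_completionI_sets sets_lborel)

lemma emeasure_cube:
  assumes "0 \<le> h"
  shows "emeasure lebesgue (cube (a::'a::euclidean_space) h) = ennreal (h ^ DIM('a))"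
proof (rule antisym)
  let ?b = "a + h *\<^sub>R One"
  have b: "?b \<bullet> i = a \<bullet> i + h" if "i \<in> Basis" for i using that by (simp add: inner_add_left)
  have prod: "(\<Prod>i\<in>Basis. (?b - a) \<bullet> i) = h ^ DIM('a)" by simp
  have "emeasure lborel (cube a h) \<le> emeasure lborel (cbox a ?b)"
    by (intro emeasure_mono) (auto simp: cube_def mem_box b less_imp_le)
  also have "\<dots> = ennreal (h ^ DIM('a))" using assms prod by (subst emeasure_lborel_cbox) (auto simp: b)
  finally show "emeasure lebesgue (cube a h) \<le> ennreal (h ^ DIM('a))" by (simp add: cube_borel)
  have "ennreal (h ^ DIM('a)) = emeasure lborel (box a ?b)"
    using assms prod by (subst emeasure_lborel_box) (auto simp: b)
  also have "\<dots> \<le> emeasure lborel (cube a h)"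
    by (intro emeasure_mono) (auto simp: cube_def mem_box b less_imp_le cube_borel[unfolded cube_def])
  finally show "ennreal (h ^ DIM('a)) \<le> emeasure lebesgue (cube a h)" by (simp add: cube_borel)
qed

lemma measure_cube: "0 \<le> h \<Longrightarrow> measure lebesgue (cube (a::'a::euclidean_space) h) = h ^ DIM('a)"
  using emeasure_cube[of h a] by (simp add: measure_def)

lemma cube_eq_Union_children:
  assumes "0 < h"
  shows "cube a h = (\<Union>J\<in>Pow Basis. cube (corner a h J) (h / 2))"
proof (intro equalityI subsetI)
  fix x assume x: "x \<in> cube a h"
  let ?J = "{i\<in>Basis. a \<bullet> i + h / 2 \<le> x \<bullet> i}"
  have "x \<in> cube (corner a h ?J) (h / 2)"
    unfolding cube_def
  proof (intro CollectI ballI)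
    fix i :: 'a assume i: "i \<in> Basis"
    have "corner a h ?J \<bullet> i = a \<bullet> i + (if i \<in> ?J then h / 2 else 0)"
      using i by (intro corner_inner) auto
    moreover have "a \<bullet> i \<le> x \<bullet> i" "x \<bullet> i < a \<bullet> i + h" using x i by (simp_all add: cube_def)
    moreover have "i \<in> ?J \<longleftrightarrow> a \<bullet> i + h / 2 \<le> x \<bullet> i" using i by simp
    ultimately show "corner a h ?J \<bullet> i \<le> x \<bullet> i \<and> x \<bullet> i < corner a h ?J \<bullet> i + h / 2"
      by (smt (verit) field_sum_of_halves)
  qed
  then show "x \<in> (\<Union>J\<in>Pow Basis. cube (corner a h J) (h / 2))"
    by (rule UN_I[rotated]) simp
next
  fix x assume "x \<in> (\<Union>J\<in>Pow Basis. cube (corner a h J) (h / 2))"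
  then obtain J where J: "J \<subseteq> Basis" "x \<in> cube (corner a h J) (h / 2)" by blast
  show "x \<in> cube a h" unfolding cube_def
  proof (intro CollectI ballI)
    fix i :: 'a assume i: "i \<in> Basis"
    have "corner a h J \<bullet> i = a \<bullet> i + (if i \<in> J then h / 2 else 0)"
      using i J(1) by (rule corner_inner)
    moreover have "corner a h J \<bullet> i \<le> x \<bullet> i" "x \<bullet> i < corner a h J \<bullet> i + h / 2"
      using J(2) i by (auto simp: cube_def)
    ultimately show "a \<bullet> i \<le> x \<bullet> i \<and> x \<bullet> i < a \<bullet> i + h"
      using assms by (smt (verit) field_sum_of_halves)
  qed
qed

lemma disjoint_children: "disjoint_family_on (\<lambda>J. cube (corner a h J) (h / 2)) (Pow Basis)"
  unfolding disjoint_family_on_def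
proof (intro ballI impI)
  fix J K :: "'a set" assume JK: "J \<in> Pow Basis" "K \<in> Pow Basis" "J \<noteq> K"
  then obtain i where i: "i \<in> Basis" "i \<in> J \<longleftrightarrow> i \<notin> K" by blast
  show "cube (corner a h J) (h / 2) \<inter> cube (corner a h K) (h / 2) = {}"
  proof (rule equals0I)
    fix x assume x: "x \<in> cube (corner a h J) (h / 2) \<inter> cube (corner a h K) (h / 2)"
    have "corner a h L \<bullet> i = a \<bullet> i + (if i \<in> L then h / 2 else 0)" if "L \<in> Pow Basis" for L
      using i(1) that by (intro corner_inner) auto
    from this[OF JK(1)] this[OF JK(2)]
    have "corner a h J \<bullet> i = a \<bullet> i + (if i \<in> J then h / 2 else 0)"
      "corner a h K \<bullet> i = a \<bullet> i + (if i \<in> J then 0 else h / 2)" using i(2) by auto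
    moreover have "corner a h J \<bullet> i \<le> x \<bullet> i" "x \<bullet> i < corner a h J \<bullet> i + h / 2"
      "corner a h K \<bullet> i \<le> x \<bullet> i" "x \<bullet> i < corner a h K \<bullet> i + h / 2"
      using x i(1) by (simp_all add: cube_def)
    ultimately show False by (cases "i \<in> J") simp_all
  qed
qed

lemma sum_children_volume:
  fixes h c :: real
  shows
  "(\<Sum>J\<in>Pow (Basis::'a::euclidean_space set). (h / 2) ^ DIM('a) * c) = h ^ DIM('a) * c"
  by (simp add: card_Pow power_divide)

text \<open>Recursion through the children, from the large cube down, in place of an explicit family
  of dyadic cubes: the John--Nirenberg induction descends one generation at a time and meets the
  subcubes only in such sums.\<close>

primrec dyadic_sum :: "nat \<Rightarrow> ('a::euclidean_space \<Rightarrow> real \<Rightarrow> real) \<Rightarrow> 'a \<Rightarrow> real \<Rightarrow> real"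
  where
    "dyadic_sum 0 F a h = F a h"
  | "dyadic_sum (Suc n) F a h = (\<Sum>J\<in>Pow Basis. dyadic_sum n F (corner a h J) (h / 2))"

lemma dyadic_sum_mono:
  assumes "\<And>a h. 0 < h \<Longrightarrow> F a h \<le> G a h" "0 < h"
  shows "dyadic_sum n F a h \<le> dyadic_sum n G a h"
  using assms(2) by (induction n arbitrary: a h) (auto intro!: sum_mono assms(1))

lemma dyadic_sum_add:
  "dyadic_sum n (\<lambda>a h. F a h + G a h) a h = dyadic_sum n F a h + dyadic_sum n G a h"
  by (induction n arbitrary: a h) (simp_all add: sum.distrib)

lemma dyadic_sum_cmult:
  "dyadic_sum n (\<lambda>a h. c * F a h) a h = c * dyadic_sum n F a h"
  by (induction n arbitrary: a h) (simp_all add: sum_distrib_left)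

lemma dyadic_sum_additive:
  assumes "\<And>a h. 0 < h \<Longrightarrow> (\<Sum>J\<in>Pow Basis. F (corner a h J) (h / 2)) = F a h" "0 < h"
  shows "dyadic_sum n F a h = F a h"
  using assms(2) by (induction n arbitrary: a h) (simp_all add: assms(1))

lemma set_integral_children:
  fixes f :: "'a::euclidean_space \<Rightarrow> real"
  assumes "0 < h" "set_integrable lebesgue (cube a h) f"
  shows "(\<Sum>J\<in>Pow Basis. LINT x:cube (corner a h J) (h / 2)|lebesgue. f x) = (LINT x:cube a h|lebesgue. f x)"
  unfolding cube_eq_Union_children[OF assms(1), of a]
proof (rule set_integral_finite_Union[symmetric])
  fix J :: "'a set" assume "J \<in> Pow Basis"
  then show "set_integrable lebesgue (cube (corner a h J) (h / 2)) f"
    by (intro set_integrable_subset[OF assms(2)]) (auto simp: cube_eq_Union_children[OF assms(1), of a])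
qed (auto intro: disjoint_children)

lemma powr_add_le_two_powr:
  fixes a b p :: real
  assumes "0 \<le> a" "0 \<le> b" "0 \<le> p"
  shows "(a + b) powr p \<le> 2 powr p * (a powr p + b powr p)"
proof -
  have "(a + b) powr p \<le> (2 * max a b) powr p" using assms by (intro powr_mono2) auto
  also have "\<dots> = 2 powr p * max a b powr p" by (rule powr_mult)
  also have "max a b powr p \<le> a powr p + b powr p" by (auto simp: max_def)
  finally show ?thesis by (simp add: mult_left_mono)
qed

text \<open>Equal to \<open>2 powr p * (A' + B')\<close> for the constants \<open>A'\<close> and
  \<open>B'\<close> of the locale below; \<open>l\<close> is the threshold of the same name
  there.\<close>

definition JN_const :: "nat \<Rightarrow> real \<Rightarrow> real"
  where "JN_const d p = (let l = 2 powr p + 1 in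
    2 powr p * (l powr p + 2 powr p * (l powr p + (l + 2 ^ d) powr p)))"

lemma JN_const_nonneg: "0 \<le> JN_const d p"
  by (simp add: JN_const_def Let_def)

text \<open>The bound \<open>M\<close> is qualitative: it makes all integrals exist, but
  \<open>JN_const\<close> does not involve it, so that it can be removed by truncation. Oscillation
  is measured about any constant; passing to the mean doubles it, and the normalisation by 1/2 turns
  this into an average oscillation of at most 1 about means (\<open>y_mean\<close>).\<close>

locale bounded_mean_oscillation =
  fixes u :: "'a::euclidean_space \<Rightarrow> real" and M p :: real
  assumes u_meas: "u \<in> borel_measurable lebesgue" and u_bound: "\<And>x. \<bar>u x\<bar> \<le> M"
    and p: "1 \<le> p"
    and osc: "\<And>a h. 0 < h \<Longrightarrow> \<exists>k. (LINT x:cube a h|lebesgue. \<bar>u x - k\<bar>) \<le> h ^ DIM('a) / 2"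
begin

lemma integrable_bounded:
  fixes f :: "'a \<Rightarrow> real"
  assumes "f \<in> borel_measurable lebesgue" "\<And>x. \<bar>f x\<bar> \<le> B" "0 < h"
  shows "set_integrable lebesgue (cube a h) f"
  unfolding set_integrable_def
proof (rule integrableI_bounded_set[where A="cube a h" and B=B])
  show "emeasure lebesgue (cube a h) < \<infinity>" using emeasure_cube[of h a] assms(3) by simp
  show "(\<lambda>x. indicator (cube a h) x *\<^sub>R f x) \<in> borel_measurable lebesgue"
    by (intro borel_measurable_scaleR borel_measurable_indicator cube_lebesgue assms(1))
qed (use assms(2) in \<open>auto simp: indicator_def\<close>)

lemma M_nonneg: "0 \<le> M"
  using u_bound[of 0] by simp

lemma int_u: "0 < h \<Longrightarrow> set_integrable lebesgue (cube a h) u"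
  using u_meas u_bound by (rule integrable_bounded)

lemma int_abs_diff: "0 < h \<Longrightarrow> set_integrable lebesgue (cube a h) (\<lambda>x. \<bar>u x - c\<bar>)"
proof (rule integrable_bounded[where B="M + \<bar>c\<bar>"])
  show "\<bar>\<bar>u x - c\<bar>\<bar> \<le> M + \<bar>c\<bar>" for x using u_bound[of x] by linarith
qed (use u_meas in measurable)

lemma int_const: "0 < h \<Longrightarrow> set_integrable lebesgue (cube (a::'a) h) (\<lambda>x. c :: real)"
  using integrable_bounded[of "\<lambda>_. c" "\<bar>c\<bar>" h a] by simp

lemma LINT_const: "0 < h \<Longrightarrow> (LINT x:cube (a::'a) h|lebesgue. c) = h ^ DIM('a) * (c::real)"
  using emeasure_cube[of h a] measure_cube[of h a]
  by (subst set_integral_const) auto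

definition m :: "'a \<Rightarrow> real \<Rightarrow> real" where "m a h = (LINT x:cube a h|lebesgue. u x) / h ^ DIM('a)"

definition y :: "real \<Rightarrow> 'a \<Rightarrow> real \<Rightarrow> real" where "y c a h = (LINT x:cube a h|lebesgue. \<bar>u x - c\<bar>)"

lemma y_nonneg: "0 \<le> y c a h"
  unfolding y_def set_lebesgue_integral_def by (intro integral_nonneg_AE) auto

lemma mean_close:
  assumes h: "0 < h"
  shows "\<bar>m a h - c\<bar> * h ^ DIM('a) \<le> y c a h"
proof -
  have "(m a h - c) * h ^ DIM('a) = (LINT x:cube a h|lebesgue. u x) - (LINT x:cube a h|lebesgue. c)"
    using h by (simp add: m_def LINT_const field_simps)
  also have "\<dots> = (LINT x:cube a h|lebesgue. u x - c)"
    using h by (intro set_integral_diff(2)[symmetric] int_u int_const)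
  finally have "\<bar>m a h - c\<bar> * h ^ DIM('a) = \<bar>LINT x:cube a h|lebesgue. u x - c\<bar>"
    using h by (metis abs_mult abs_of_pos zero_less_power)
  also have "\<dots> \<le> y c a h"
    unfolding y_def
    using set_integral_norm_bound[OF set_integral_diff(1)[OF int_u[OF h] int_const[OF h]], of a c] by simp
  finally show ?thesis .
qed

lemma y_shift:
  assumes h: "0 < h"
  shows "y c a h \<le> y k a h + \<bar>k - c\<bar> * h ^ DIM('a)"
proof -
  have "y c a h \<le> (LINT x:cube a h|lebesgue. \<bar>u x - k\<bar> + \<bar>k - c\<bar>)"
    unfolding y_def using h
    by (intro set_integral_mono int_abs_diff set_integral_add(1) int_const) auto
  also have "\<dots> = y k a h + \<bar>k - c\<bar> * h ^ DIM('a)"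
    unfolding y_def using h by (subst set_integral_add(2)) (auto intro: int_abs_diff int_const simp: LINT_const)
  finally show ?thesis .
qed

lemma y_mean_le: "0 < h \<Longrightarrow> y (m a h) a h \<le> 2 * y k a h"
  using y_shift[of h "m a h" a k] mean_close[of h a k] by (simp add: abs_minus_commute)

lemma y_mean: "0 < h \<Longrightarrow> y (m a h) a h \<le> h ^ DIM('a)"
proof -
  assume h: "0 < h"
  obtain k where "y k a h \<le> h ^ DIM('a) / 2" using osc[OF h, of a] by (auto simp: y_def)
  then show ?thesis using y_mean_le[OF h, of a k] by simp
qed

lemma y_children: "0 < h \<Longrightarrow> (\<Sum>J\<in>Pow Basis. y c (corner a h J) (h / 2)) = y c a h"
  unfolding y_def by (intro set_integral_children int_abs_diff)

lemma y_child_le: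
  assumes "0 < h" "J \<subseteq> Basis"
  shows "y c (corner a h J) (h / 2) \<le> y c a h"
proof -
  have "y c (corner a h J) (h / 2) \<le> (\<Sum>J\<in>Pow Basis. y c (corner a h J) (h / 2))"
    using assms(2) y_nonneg by (intro member_le_sum) auto
  then show ?thesis using y_children[OF assms(1)] by simp
qed

lemma mean_child_close:
  assumes h: "0 < h" and J: "J \<subseteq> Basis"
  shows "\<bar>m (corner a h J) (h / 2) - m a h\<bar> \<le> 2 ^ DIM('a)"
proof -
  have "\<bar>m (corner a h J) (h / 2) - m a h\<bar> * (h / 2) ^ DIM('a) \<le> y (m a h) (corner a h J) (h / 2)"
    using h by (intro mean_close) simp
  also have "\<dots> \<le> h ^ DIM('a)" using y_child_le[OF h J] y_mean[OF h] by (meson order_trans)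
  finally show ?thesis using h by (simp add: power_divide field_simps)
qed

text \<open>The threshold satisfies \<open>B' + 2 powr p * B' = l * B'\<close>. On a child whose
  mean is farther than \<open>l\<close> from \<open>c\<close>, the contribution is at most
  \<open>B' + 2 powr p * B'\<close> times the volume, and this is covered by \<open>B' * y c\<close>
  of that child. The same \<open>B'\<close> thus survives to the next generation, which closes the
  induction of \<open>I_le\<close>.\<close>

definition l :: real where "l = 2 powr p + 1"
definition A' :: real where "A' = l powr p"
definition B' :: real where "B' = 2 powr p * (A' + (l + 2 ^ DIM('a)) powr p)"

text \<open>A Riemann sum of generation \<open>n\<close> for the integral of
  \<open>\<bar>u x - c\<bar> powr p\<close>, with \<open>u\<close> replaced by its mean on each
  subcube.\<close>

abbreviation I :: "real \<Rightarrow> nat \<Rightarrow> 'a \<Rightarrow> real \<Rightarrow> real"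
  where "I c n \<equiv> dyadic_sum n (\<lambda>a h. h ^ DIM('a) * \<bar>m a h - c\<bar> powr p)"

lemma I_shift:
  assumes h: "0 < h"
  shows "I c n a h \<le> 2 powr p * I c' n a h + 2 powr p * (h ^ DIM('a) * \<bar>c' - c\<bar> powr p)"
proof -
  have "I c n a h \<le> dyadic_sum n (\<lambda>a h. 2 powr p * (h ^ DIM('a) * \<bar>m a h - c'\<bar> powr p) +
      2 powr p * (h ^ DIM('a) * \<bar>c' - c\<bar> powr p)) a h"
  proof (rule dyadic_sum_mono[OF _ h])
    fix a and h :: real assume h: "0 < h"
    have "\<bar>m a h - c\<bar> powr p \<le> (\<bar>m a h - c'\<bar> + \<bar>c' - c\<bar>) powr p" using p by (intro powr_mono2) auto
    also have "\<dots> \<le> 2 powr p * (\<bar>m a h - c'\<bar> powr p + \<bar>c' - c\<bar> powr p)"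
      using p by (intro powr_add_le_two_powr) auto
    finally have "h ^ DIM('a) * \<bar>m a h - c\<bar> powr p \<le> h ^ DIM('a) * (2 powr p * (\<bar>m a h - c'\<bar> powr p + \<bar>c' - c\<bar> powr p))"
      using h by (intro mult_left_mono) auto
    then show "h ^ DIM('a) * \<bar>m a h - c\<bar> powr p \<le> 2 powr p * (h ^ DIM('a) * \<bar>m a h - c'\<bar> powr p) +
      2 powr p * (h ^ DIM('a) * \<bar>c' - c\<bar> powr p)" by (simp add: algebra_simps)
  qed
  also have "\<dots> = 2 powr p * I c' n a h + 2 powr p * (h ^ DIM('a) * \<bar>c' - c\<bar> powr p)"
    unfolding dyadic_sum_add dyadic_sum_cmult
    by (subst (2) dyadic_sum_additive[OF _ h]) (simp_all only: sum_children_volume)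
  finally show ?thesis .
qed

text \<open>
  Instead of stopping the dyadic subdivision at the first cube whose mean is far from \<open>c\<close>, the
  contribution of such a cube is paid for by the term \<open>y c a h\<close>, which is additive over
  subdivisions and at least \<open>l\<close> times the volume of every such cube.
\<close>
lemma I_le:
  assumes "0 < h" "\<bar>m a h - c\<bar> \<le> l"
  shows "I c n a h \<le> A' * h ^ DIM('a) + B' * y c a h"
  using assms
proof (induction n arbitrary: a h c)
  case 0
  have "h ^ DIM('a) * \<bar>m a h - c\<bar> powr p \<le> h ^ DIM('a) * A'"
    unfolding A'_def using 0 p by (intro mult_left_mono powr_mono2) auto
  moreover have "0 \<le> B' * y c a h" using y_nonneg by (simp add: B'_def A'_def)
  ultimately show ?case by (simp add: mult.commute)
next
  case (Suc n)
  let ?d = "DIM('a)"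
  have A0: "0 \<le> A'" "0 \<le> B'" by (simp_all add: B'_def A'_def)
  have child: "I c n (corner a h J) (h / 2) \<le> A' * (h / 2) ^ ?d + B' * y c (corner a h J) (h / 2)"
    if J: "J \<in> Pow Basis" for J
  proof -
    let ?b = "corner a h J" and ?k = "h / 2"
    have k: "0 < ?k" using Suc.prems by simp
    show ?thesis
    proof (cases "\<bar>m ?b ?k - c\<bar> \<le> l")
      case True
      then show ?thesis using Suc.IH[OF k] by blast
    next
      case False
      have up: "\<bar>m ?b ?k - c\<bar> \<le> l + 2 ^ ?d"
        using mean_child_close[OF Suc.prems(1), of J a] J Suc.prems(2) by simp
      \<comment> \<open>The centre is moved to the child's own mean, for which the hypothesis on the
        centre is trivial and the oscillation is at most the volume; \<open>I_shift\<close> then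
        returns to \<open>c\<close>.\<close>
      have "I (m ?b ?k) n ?b ?k \<le> A' * ?k ^ ?d + B' * y (m ?b ?k) ?b ?k"
        by (rule Suc.IH[OF k]) (simp add: l_def add_nonneg_nonneg)
      also have "\<dots> \<le> A' * ?k ^ ?d + B' * ?k ^ ?d"
        using y_mean[OF k] A0 by (intro add_left_mono mult_left_mono) auto
      finally have IH: "I (m ?b ?k) n ?b ?k \<le> (A' + B') * ?k ^ ?d" by (simp add: algebra_simps)
      have "\<bar>m ?b ?k - c\<bar> powr p \<le> (l + 2 ^ ?d) powr p" using up p by (intro powr_mono2) auto
      then have "I c n ?b ?k \<le> 2 powr p * ((A' + B') * ?k ^ ?d) + 2 powr p * (?k ^ ?d * (l + 2 ^ ?d) powr p)"
        using IH k by (intro order_trans[OF I_shift[OF k, where c=c and n=n and a="?b" and c'="m ?b ?k"]] add_mono mult_left_mono) auto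
      also have "\<dots> = (B' + 2 powr p * B') * ?k ^ ?d" by (simp add: B'_def algebra_simps)
      also have "\<dots> = B' * (l * ?k ^ ?d)" by (simp add: l_def algebra_simps)
      also have "\<dots> \<le> B' * (\<bar>m ?b ?k - c\<bar> * ?k ^ ?d)"
        using False k A0 by (intro mult_left_mono mult_right_mono) auto
      also have "\<dots> \<le> B' * y c ?b ?k" using A0 by (intro mult_left_mono mean_close k) auto
      also have "\<dots> \<le> A' * ?k ^ ?d + B' * y c ?b ?k" using A0 k by simp
      finally show ?thesis .
    qed
  qed
  have "I c (Suc n) a h \<le> (\<Sum>J\<in>Pow Basis. A' * (h / 2) ^ ?d + B' * y c (corner a h J) (h / 2))"
    unfolding dyadic_sum.simps by (intro sum_mono child)
  also have "\<dots> = A' * h ^ ?d + B' * y c a h"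
    using sum_children_volume[where 'a='a, of h A'] y_children[OF Suc.prems(1), of c a]
    by (simp add: sum.distrib sum_distrib_left[symmetric] mult.commute)
  finally show ?case .
qed

abbreviation osc_sum :: "nat \<Rightarrow> 'a \<Rightarrow> real \<Rightarrow> real"
  where "osc_sum n \<equiv> dyadic_sum n (\<lambda>a h. y (m a h) a h)"

text \<open>On a subcube where \<open>g\<close> varies by at most \<open>e\<close>, the oscillation
  of \<open>u\<close> about a value of \<open>g\<close> is at most the integral of
  \<open>\<bar>u x - g x\<bar> + e\<close>; the factor 2 is the price of passing to the mean of
  \<open>u\<close>.\<close>

lemma osc_sum_le:
  fixes g :: "'a \<Rightarrow> real"
  assumes g: "g \<in> borel_measurable lebesgue" "\<And>x. \<bar>g x\<bar> \<le> B" and h: "0 < h"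
    and cont: "\<And>x z. x \<in> cube a h \<Longrightarrow> z \<in> cube a h \<Longrightarrow> (\<forall>i\<in>Basis. \<bar>(x - z) \<bullet> i\<bar> \<le> h / 2 ^ n) \<Longrightarrow> \<bar>g x - g z\<bar> \<le> e"
  shows "osc_sum n a h \<le> 2 * (LINT x:cube a h|lebesgue. \<bar>u x - g x\<bar>) + 2 * e * h ^ DIM('a)"
  using h cont
proof (induction n arbitrary: a h)
  case 0
  have int: "set_integrable lebesgue (cube a h) (\<lambda>x. \<bar>u x - g x\<bar>)"
  proof (rule integrable_bounded[where B="M + B"])
    show "\<bar>\<bar>u x - g x\<bar>\<bar> \<le> M + B" for x using u_bound[of x] g(2)[of x] by linarith
  qed (use u_meas g 0 in measurable)
  have acube: "a \<in> cube a h" using 0 by (auto simp: cube_def)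
  have "y (g a) a h \<le> (LINT x:cube a h|lebesgue. \<bar>u x - g x\<bar> + e)"
    unfolding y_def
  proof (intro set_integral_mono int_abs_diff set_integral_add(1) int_const int 0(1))
    fix x assume x: "x \<in> cube a h"
    have "\<bar>g x - g a\<bar> \<le> e"
      using x acube by (intro 0(2)) (auto simp: cube_def inner_diff_left abs_le_iff algebra_simps less_imp_le)
    then show "\<bar>u x - g a\<bar> \<le> \<bar>u x - g x\<bar> + e" by linarith
  qed
  also have "\<dots> = (LINT x:cube a h|lebesgue. \<bar>u x - g x\<bar>) + e * h ^ DIM('a)"
    using 0(1) int by (subst set_integral_add(2)) (auto intro: int_const simp: LINT_const)
  finally show ?case using y_mean_le[OF 0(1), of a "g a"] by simp
next
  case (Suc n)
  have int: "set_integrable lebesgue (cube a h) (\<lambda>x. \<bar>u x - g x\<bar>)"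
  proof (rule integrable_bounded[where B="M + B"])
    show "\<bar>\<bar>u x - g x\<bar>\<bar> \<le> M + B" for x using u_bound[of x] g(2)[of x] by linarith
  qed (use u_meas g Suc in measurable)
  have "osc_sum (Suc n) a h \<le> (\<Sum>J\<in>Pow Basis. 2 * (LINT x:cube (corner a h J) (h / 2)|lebesgue. \<bar>u x - g x\<bar>) +
      2 * e * (h / 2) ^ DIM('a))"
    unfolding dyadic_sum.simps
  proof (intro sum_mono Suc.IH)
    fix J :: "'a set" and x z
    assume "J \<in> Pow Basis" "x \<in> cube (corner a h J) (h / 2)" "z \<in> cube (corner a h J) (h / 2)"
      and "\<forall>i\<in>Basis. \<bar>(x - z) \<bullet> i\<bar> \<le> h / 2 / 2 ^ n"
    then show "\<bar>g x - g z\<bar> \<le> e"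
      by (intro Suc.prems(2)) (auto simp: cube_eq_Union_children[OF Suc.prems(1), of a])
  qed (use Suc.prems in simp)
  also have "\<dots> = 2 * (LINT x:cube a h|lebesgue. \<bar>u x - g x\<bar>) + 2 * e * h ^ DIM('a)"
    using sum_children_volume[where 'a='a, of h "2 * e"] set_integral_children[OF Suc.prems(1) int]
    by (simp add: sum.distrib sum_distrib_left[symmetric] mult.commute)
  finally show ?case .
qed

text \<open>An integrated form of Lebesgue's differentiation theorem: dyadic means converge to
  \<open>u\<close> in L^1 on the cube. It follows by approximating \<open>u\<close> with functions
  that are uniformly continuous on the closed cube.\<close>

lemma osc_sum_small:
  assumes h: "0 < h" and e: "0 < e"
  shows "\<exists>n. osc_sum n a h \<le> e"
proof -
  have "u measurable_on UNIV"
    using u_meas measurable_on_iff_borel_measurable[of UNIV u] by simp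
  then obtain N g where g: "negligible N" "\<And>n::nat. continuous_on UNIV (g n)" "\<And>x. x \<notin> N \<Longrightarrow> (\<lambda>n. g n x) \<longlonglongrightarrow> u x"
    unfolding measurable_on_def by auto
  \<comment> \<open>Clamping to the interval from \<open>- M\<close> to \<open>M\<close> respects
    the convergence to \<open>u\<close>, whose values lie there, and gives the majorant
    \<open>2 * M\<close>.\<close>
  define g' where "g' n x = max (- M) (min M (g n x))" for n x
  have cont: "continuous_on UNIV (g' n)" for n
    unfolding g'_def by (intro continuous_intros g)
  then have gm: "g' n \<in> borel_measurable lebesgue" for n
    using borel_measurable_continuous_onI[OF cont[of n]] by (intro measurable_completion) simp
  have gb: "\<bar>g' n x\<bar> \<le> M" for n x using M_nonneg by (auto simp: g'_def)
  have glim: "(\<lambda>n. g' n x) \<longlonglongrightarrow> u x" if "x \<notin> N" for x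
  proof -
    have "(\<lambda>n. max (- M) (min M (g n x))) \<longlonglongrightarrow> max (- M) (min M (u x))"
      by (intro tendsto_intros g that)
    moreover have "max (- M) (min M (u x)) = u x" using u_bound[of x] by auto
    ultimately show ?thesis by (simp add: g'_def)
  qed
  have "(\<lambda>n. LINT x:cube a h|lebesgue. \<bar>u x - g' n x\<bar>) \<longlonglongrightarrow> (LINT x:cube a h|lebesgue. 0)"
    unfolding set_lebesgue_integral_def
  proof (rule integral_dominated_convergence[where w="\<lambda>x. indicator (cube a h) x *\<^sub>R (2 * M)"])
    show "integrable lebesgue (\<lambda>x. indicator (cube a h) x *\<^sub>R (2 * M))"
      using int_const[OF h, of a "2 * M"] by (simp only: set_integrable_def)
    show "AE x in lebesgue. (\<lambda>n. indicator (cube a h) x *\<^sub>R \<bar>u x - g' n x\<bar>) \<longlonglongrightarrow> indicator (cube a h) x *\<^sub>R 0"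
    proof (rule AE_I'[of N])
      show "N \<in> null_sets lebesgue" using g(1) by (simp add: negligible_iff_null_sets)
      show "{x \<in> space lebesgue. \<not> (\<lambda>n. indicator (cube a h) x *\<^sub>R \<bar>u x - g' n x\<bar>) \<longlonglongrightarrow> indicator (cube a h) x *\<^sub>R 0} \<subseteq> N"
      proof (rule subsetI, rule ccontr)
        fix x
        assume x: "x \<in> {x \<in> space lebesgue. \<not> (\<lambda>n. indicator (cube a h) x *\<^sub>R \<bar>u x - g' n x\<bar>) \<longlonglongrightarrow> indicator (cube a h) x *\<^sub>R 0}"
          "x \<notin> N"
        from tendsto_scaleR[OF tendsto_const[of "indicator (cube a h) x :: real"]
            tendsto_rabs[OF tendsto_diff[OF tendsto_const[of "u x"] glim[OF x(2)]]]] x(1)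
        show False by simp
      qed
    qed
    show "AE x in lebesgue. norm (indicator (cube a h) x *\<^sub>R \<bar>u x - g' n x\<bar>) \<le> indicator (cube a h) x *\<^sub>R (2 * M)" for n
    proof (rule AE_I2)
      fix x
      have "\<bar>u x - g' n x\<bar> \<le> 2 * M" using u_bound[of x] gb[of n x] by linarith
      then show "norm (indicator (cube a h) x *\<^sub>R \<bar>u x - g' n x\<bar>) \<le> indicator (cube a h) x *\<^sub>R (2 * M)"
        by (auto simp: indicator_def)
    qed
    show "(\<lambda>x. indicator (cube a h) x *\<^sub>R \<bar>u x - g' n x\<bar>) \<in> borel_measurable lebesgue" for n
      using u_meas gm[of n] by measurable
  qed simp
  then have "(\<lambda>n. LINT x:cube a h|lebesgue. \<bar>u x - g' n x\<bar>) \<longlonglongrightarrow> 0"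
    by (simp add: set_lebesgue_integral_def)
  then have "\<forall>\<^sub>F n in sequentially. (LINT x:cube a h|lebesgue. \<bar>u x - g' n x\<bar>) < e / 4"
    using e by (intro order_tendstoD) auto
  then obtain k where k: "(LINT x:cube a h|lebesgue. \<bar>u x - g' k x\<bar>) < e / 4"
    by (auto simp: eventually_sequentially)
  define e' where "e' = e / (4 * h ^ DIM('a))"
  have e': "0 < e'" using e h by (simp add: e'_def)
  let ?C = "cbox a (a + h *\<^sub>R One)"
  have sub: "cube a h \<subseteq> ?C"
    by (auto simp: cube_def mem_box inner_add_left less_imp_le)
  have "uniformly_continuous_on ?C (g' k)"
    using cont[of k] by (intro compact_uniformly_continuous) (auto intro: continuous_on_subset)
  then obtain \<delta> where \<delta>: "0 < \<delta>" "\<And>x z. x \<in> ?C \<Longrightarrow> z \<in> ?C \<Longrightarrow> dist z x < \<delta> \<Longrightarrow> dist (g' k z) (g' k x) < e'"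
    unfolding uniformly_continuous_on_def using e' by metis
  obtain n where n: "(1/2) ^ n < \<delta> / (h * real DIM('a))"
    using real_arch_pow_inv[of "\<delta> / (h * real DIM('a))" "1/2"] \<delta>(1) h by auto
  have "osc_sum n a h \<le> 2 * (LINT x:cube a h|lebesgue. \<bar>u x - g' k x\<bar>) + 2 * e' * h ^ DIM('a)"
  proof (rule osc_sum_le[OF gm gb h])
    fix x z assume xz: "x \<in> cube a h" "z \<in> cube a h" "\<forall>i\<in>Basis. \<bar>(x - z) \<bullet> i\<bar> \<le> h / 2 ^ n"
    have "norm (x - z) \<le> (\<Sum>i\<in>Basis. \<bar>(x - z) \<bullet> i\<bar>)" by (rule norm_le_l1)
    also have "\<dots> \<le> (\<Sum>i\<in>(Basis::'a set). h / 2 ^ n)" using xz by (intro sum_mono) auto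
    also have "\<dots> = (1/2) ^ n * (h * real DIM('a))" by (simp add: power_divide)
    also have "\<dots> < \<delta>" using n h by (simp add: field_simps)
    finally have "dist x z < \<delta>" by (simp add: dist_norm)
    then show "\<bar>g' k x - g' k z\<bar> \<le> e'"
      using \<delta>(2)[of z x] xz sub by (simp add: dist_real_def subset_iff less_imp_le)
  qed
  also have "\<dots> \<le> e" using k h e by (simp add: e'_def field_simps)
  finally show ?thesis by blast
qed

lemma John_Nirenberg:
  assumes h: "0 < h" and c: "y c a h \<le> h ^ DIM('a)"
  shows "(LINT x:cube a h|lebesgue. \<bar>u x - c\<bar> powr p) \<le> JN_const DIM('a) p * h ^ DIM('a)"
proof -
  let ?d = "DIM('a)"
  define F where "F a h = (LINT x:cube a h|lebesgue. \<bar>u x - c\<bar> powr p)" for a h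
  have intF: "set_integrable lebesgue (cube a h) (\<lambda>x. \<bar>u x - c\<bar> powr p)" if "0 < h" for a h
  proof (rule integrable_bounded[where B="(M + \<bar>c\<bar>) powr p"])
    show "\<bar>\<bar>u x - c\<bar> powr p\<bar> \<le> (M + \<bar>c\<bar>) powr p" for x
      using u_bound[of x] p by (auto intro!: powr_mono2)
  qed (use u_meas that in measurable)
  \<comment> \<open>This factor grows with the bound \<open>M\<close>, but it only multiplies
    \<open>osc_sum n\<close>, which becomes arbitrarily small while the bound on
    \<open>I c n\<close> is uniform in \<open>n\<close>.\<close>
  let ?L = "2 powr p * (2 * M) powr (p - 1)"
  have mM: "\<bar>m a h\<bar> \<le> M" if "0 < h" for a h
  proof -
    have "\<bar>m a h - 0\<bar> * h ^ ?d \<le> y 0 a h" using that by (rule mean_close)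
    also have "\<dots> \<le> (LINT x:cube a h|lebesgue. M)"
      unfolding y_def using that u_bound by (intro set_integral_mono int_abs_diff int_const) auto
    also have "\<dots> = M * h ^ ?d" using that by (simp add: LINT_const)
    finally show ?thesis using that by simp
  qed
  have F_le: "F a h \<le> 2 powr p * (h ^ ?d * \<bar>m a h - c\<bar> powr p) + ?L * y (m a h) a h" if h: "0 < h" for a h
  proof -
    have "F a h \<le> (LINT x:cube a h|lebesgue. 2 powr p * \<bar>m a h - c\<bar> powr p + ?L * \<bar>u x - m a h\<bar>)"
      unfolding F_def
    proof (intro set_integral_mono intF set_integral_add(1) int_const set_integrable_mult_right int_abs_diff h)
      fix x
      \<comment> \<open>Bounding the power \<open>p - 1\<close> by \<open>2 * M\<close> leaves the
        first power, whose integral is the oscillation \<open>y (m a h) a h\<close>.\<close>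
      have v: "\<bar>u x - m a h\<bar> powr p \<le> (2 * M) powr (p - 1) * \<bar>u x - m a h\<bar>"
      proof (cases "u x = m a h")
        case False
        have "\<bar>u x - m a h\<bar> powr p = \<bar>u x - m a h\<bar> powr (p - 1) * \<bar>u x - m a h\<bar>"
          using False by (simp add: powr_diff)
        also have "\<dots> \<le> (2 * M) powr (p - 1) * \<bar>u x - m a h\<bar>"
          using u_bound[of x] mM[OF h, of a] p by (intro mult_right_mono powr_mono2) linarith+
        finally show ?thesis .
      qed (use p in simp)
      have "\<bar>u x - c\<bar> powr p \<le> (\<bar>m a h - c\<bar> + \<bar>u x - m a h\<bar>) powr p" using p by (intro powr_mono2) auto
      also have "\<dots> \<le> 2 powr p * (\<bar>m a h - c\<bar> powr p + \<bar>u x - m a h\<bar> powr p)"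
        using p by (intro powr_add_le_two_powr) auto
      also have "\<dots> \<le> 2 powr p * (\<bar>m a h - c\<bar> powr p + (2 * M) powr (p - 1) * \<bar>u x - m a h\<bar>)"
        using v by (intro mult_left_mono add_left_mono) auto
      finally show "\<bar>u x - c\<bar> powr p \<le> 2 powr p * \<bar>m a h - c\<bar> powr p + ?L * \<bar>u x - m a h\<bar>"
        by (simp add: algebra_simps)
    qed
    also have "\<dots> = 2 powr p * (h ^ ?d * \<bar>m a h - c\<bar> powr p) + ?L * y (m a h) a h"
      unfolding y_def using h
      by (subst set_integral_add(2)) (auto intro!: int_const set_integrable_mult_right int_abs_diff simp: LINT_const)
    finally show ?thesis .
  qed
  have bound: "F a h \<le> 2 powr p * I c n a h + ?L * osc_sum n a h" for n
  proof -
    have "F a h = dyadic_sum n F a h"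
      by (rule dyadic_sum_additive[symmetric, OF _ h]) (auto simp: F_def intro!: set_integral_children intF)
    also have "\<dots> \<le> dyadic_sum n (\<lambda>a h. 2 powr p * (h ^ ?d * \<bar>m a h - c\<bar> powr p) + ?L * y (m a h) a h) a h"
      using F_le h by (intro dyadic_sum_mono) auto
    finally show ?thesis by (simp only: dyadic_sum_add dyadic_sum_cmult)
  qed
  have ml: "\<bar>m a h - c\<bar> \<le> l"
  proof -
    have "\<bar>m a h - c\<bar> * h ^ ?d \<le> 1 * h ^ ?d" using mean_close[OF h, of a c] c by simp
    then have "\<bar>m a h - c\<bar> \<le> 1" using h by simp
    then show ?thesis by (simp add: l_def add_increasing)
  qed
  have Iub: "I c n a h \<le> (A' + B') * h ^ ?d" for n
  proof -
    have "I c n a h \<le> A' * h ^ ?d + B' * y c a h" using h ml by (rule I_le)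
    also have "\<dots> \<le> A' * h ^ ?d + B' * h ^ ?d"
      using c by (intro add_left_mono mult_left_mono) (auto simp: B'_def A'_def)
    finally show ?thesis by (simp add: algebra_simps)
  qed
  have "F a h \<le> 2 powr p * ((A' + B') * h ^ ?d) + e" if e: "0 < e" for e
  proof -
    obtain n where n: "osc_sum n a h \<le> e / (?L + 1)"
      using osc_sum_small[OF h, of "e / (?L + 1)"] e by (auto simp: add_nonneg_pos)
    have "F a h \<le> 2 powr p * I c n a h + ?L * osc_sum n a h" by (rule bound)
    also have "\<dots> \<le> 2 powr p * ((A' + B') * h ^ ?d) + ?L * (e / (?L + 1))"
      using n Iub by (intro add_mono mult_left_mono) auto
    also have "?L * (e / (?L + 1)) \<le> e"
    proof -
      have "x * (e / (x + 1)) \<le> e" if "0 \<le> x" for x :: real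
        using that e by (simp add: field_simps)
      then show ?thesis by simp
    qed
    finally show ?thesis by simp
  qed
  then have "F a h \<le> 2 powr p * ((A' + B') * h ^ ?d)" by (rule field_le_epsilon)
  then show ?thesis
    by (simp add: F_def JN_const_def Let_def B'_def A'_def l_def mult.assoc)
qed

end

text \<open>Clamping to the interval from \<open>- n\<close> to \<open>n\<close> is 1-Lipschitz, so
  both oscillation hypotheses persist when \<open>k\<close> and \<open>c\<close> are clamped too.
  The resulting bound does not depend on \<open>n\<close>, and Fatou's lemma removes the
  clamp.\<close>

lemma John_Nirenberg_cube:
  fixes u :: "'a::euclidean_space \<Rightarrow> real"
  assumes u: "u \<in> borel_measurable lebesgue" and p: "1 \<le> p"
    and osc: "\<And>a h. 0 < h \<Longrightarrow> \<exists>k. (\<integral>\<^sup>+ x. ennreal \<bar>u x - k\<bar> * indicator (cube a h) x \<partial>lebesgue) \<le> ennreal (h ^ DIM('a) / 2)"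
    and h: "0 < h" and c: "(\<integral>\<^sup>+ x. ennreal \<bar>u x - c\<bar> * indicator (cube a h) x \<partial>lebesgue) \<le> ennreal (h ^ DIM('a))"
  shows "(\<integral>\<^sup>+ x. ennreal (\<bar>u x - c\<bar> powr p) * indicator (cube a h) x \<partial>lebesgue) \<le> ennreal (JN_const DIM('a) p * h ^ DIM('a))"
proof -
  define \<tau> where "\<tau> n v = max (- real n) (min (real n) v)" for n v
  have tau_lip: "\<bar>\<tau> n v - \<tau> n w\<bar> \<le> \<bar>v - w\<bar>" for n v w by (auto simp: \<tau>_def)
  have tau_bound: "\<bar>\<tau> n v\<bar> \<le> real n" for n v by (auto simp: \<tau>_def)
  have tau_meas [measurable]: "(\<lambda>x. \<tau> n (u x)) \<in> borel_measurable lebesgue" for n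
    using u unfolding \<tau>_def by measurable
  have transfer: "(LINT x:cube a h|lebesgue. \<bar>\<tau> n (u x) - \<tau> n k\<bar>) \<le> r"
    if "(\<integral>\<^sup>+ x. ennreal \<bar>u x - k\<bar> * indicator (cube a h) x \<partial>lebesgue) \<le> ennreal r" "0 \<le> r" for n k r a h
    unfolding set_lebesgue_integral_def
  proof (rule integral_real_bounded[OF that(2)])
    have "(\<integral>\<^sup>+ x. ennreal (indicator (cube a h) x *\<^sub>R \<bar>\<tau> n (u x) - \<tau> n k\<bar>) \<partial>lebesgue) \<le>
        (\<integral>\<^sup>+ x. ennreal \<bar>u x - k\<bar> * indicator (cube a h) x \<partial>lebesgue)"
      using tau_lip by (intro nn_integral_mono) (auto simp: indicator_def intro!: ennreal_leI)
    then show "(\<integral>\<^sup>+ x. ennreal (indicator (cube a h) x *\<^sub>R \<bar>\<tau> n (u x) - \<tau> n k\<bar>) \<partial>lebesgue) \<le> ennreal r"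
      using that(1) by (rule order_trans)
  qed
  have bound: "(\<integral>\<^sup>+ x. ennreal (\<bar>\<tau> n (u x) - \<tau> n c\<bar> powr p) * indicator (cube a h) x \<partial>lebesgue)
      \<le> ennreal (JN_const DIM('a) p * h ^ DIM('a))" for n
  proof -
    interpret bounded_mean_oscillation "\<lambda>x. \<tau> n (u x)" "real n" p
    proof
      show "\<exists>k. (LINT x:cube a h|lebesgue. \<bar>\<tau> n (u x) - k\<bar>) \<le> h ^ DIM('a) / 2" if "0 < h" for a and h :: real
        using osc[OF that, of a] transfer[of _ a h "h ^ DIM('a) / 2" n] that by auto
    qed (use p tau_bound tau_meas in auto)
    have y: "y (\<tau> n c) a h \<le> h ^ DIM('a)"
      unfolding y_def using c h by (intro transfer) auto
    have int: "integrable lebesgue (\<lambda>x. indicator (cube a h) x *\<^sub>R \<bar>\<tau> n (u x) - \<tau> n c\<bar> powr p)"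
    proof (rule integrable_bounded[of "\<lambda>x. \<bar>\<tau> n (u x) - \<tau> n c\<bar> powr p" "(2 * real n) powr p" h a, unfolded set_integrable_def])
      show "\<bar>\<bar>\<tau> n (u x) - \<tau> n c\<bar> powr p\<bar> \<le> (2 * real n) powr p" for x
      proof -
        have "\<bar>\<tau> n (u x) - \<tau> n c\<bar> \<le> 2 * real n" using tau_bound[of n "u x"] tau_bound[of n c] by linarith
        then show ?thesis using p by (simp add: powr_mono2)
      qed
      show "(\<lambda>x. \<bar>\<tau> n (u x) - \<tau> n c\<bar> powr p) \<in> borel_measurable lebesgue" by measurable
    qed (rule h)
    have "(\<integral>\<^sup>+ x. ennreal (\<bar>\<tau> n (u x) - \<tau> n c\<bar> powr p) * indicator (cube a h) x \<partial>lebesgue)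
        = (\<integral>\<^sup>+ x. ennreal (indicator (cube a h) x *\<^sub>R \<bar>\<tau> n (u x) - \<tau> n c\<bar> powr p) \<partial>lebesgue)"
      by (intro nn_integral_cong) (auto simp: indicator_def)
    also have "\<dots> = ennreal (LINT x:cube a h|lebesgue. \<bar>\<tau> n (u x) - \<tau> n c\<bar> powr p)"
      unfolding set_lebesgue_integral_def using int by (intro nn_integral_eq_integral) (auto simp: indicator_def)
    also have "\<dots> \<le> ennreal (JN_const DIM('a) p * h ^ DIM('a))"
      using John_Nirenberg[OF h y] by (rule ennreal_leI)
    finally show ?thesis .
  qed
  have "(\<integral>\<^sup>+ x. ennreal (\<bar>u x - c\<bar> powr p) * indicator (cube a h) x \<partial>lebesgue) =
      (\<integral>\<^sup>+ x. liminf (\<lambda>n. ennreal (\<bar>\<tau> n (u x) - \<tau> n c\<bar> powr p) * indicator (cube a h) x) \<partial>lebesgue)"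
  proof (rule nn_integral_cong)
    fix x
    obtain n0 where n0: "max \<bar>u x\<bar> \<bar>c\<bar> < real n0" using reals_Archimedean2 by blast
    have "\<forall>\<^sub>F n in sequentially. ennreal (\<bar>\<tau> n (u x) - \<tau> n c\<bar> powr p) * indicator (cube a h) x =
        ennreal (\<bar>u x - c\<bar> powr p) * indicator (cube a h) x"
      using eventually_ge_at_top[of n0]
    proof eventually_elim
      case (elim n)
      then have "\<bar>u x\<bar> \<le> real n" "\<bar>c\<bar> \<le> real n" using n0 by auto
      then have "\<tau> n (u x) = u x" "\<tau> n c = c" by (auto simp: \<tau>_def)
      then show ?case by simp
    qed
    then have "(\<lambda>n. ennreal (\<bar>\<tau> n (u x) - \<tau> n c\<bar> powr p) * indicator (cube a h) x)
        \<longlonglongrightarrow> ennreal (\<bar>u x - c\<bar> powr p) * indicator (cube a h) x"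
      by (rule tendsto_eventually)
    then show "ennreal (\<bar>u x - c\<bar> powr p) * indicator (cube a h) x =
        liminf (\<lambda>n. ennreal (\<bar>\<tau> n (u x) - \<tau> n c\<bar> powr p) * indicator (cube a h) x)"
      by (auto dest!: lim_imp_Liminf[rotated])
  qed
  also have "\<dots> \<le> liminf (\<lambda>n. \<integral>\<^sup>+ x. ennreal (\<bar>\<tau> n (u x) - \<tau> n c\<bar> powr p) * indicator (cube a h) x \<partial>lebesgue)"
    by (rule nn_integral_liminf) measurable
  also have "\<dots> \<le> limsup (\<lambda>n. \<integral>\<^sup>+ x. ennreal (\<bar>\<tau> n (u x) - \<tau> n c\<bar> powr p) * indicator (cube a h) x \<partial>lebesgue)"
    by (rule Liminf_le_Limsup) simp
  also have "\<dots> \<le> ennreal (JN_const DIM('a) p * h ^ DIM('a))"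
    by (rule Limsup_bounded) (simp add: bound)
  finally show ?thesis .
qed

lemma cube_subset_ball:
  assumes "0 < h"
  shows "cube (a::'a::euclidean_space) h \<subseteq> ball a (h * real DIM('a))"
proof
  fix x assume x: "x \<in> cube a h"
  have "norm (x - a) \<le> (\<Sum>i\<in>Basis. \<bar>(x - a) \<bullet> i\<bar>)" by (rule norm_le_l1)
  also have "\<dots> < (\<Sum>i\<in>(Basis::'a set). h)"
    using x by (intro sum_strict_mono) (auto simp: cube_def inner_diff_left)
  also have "\<dots> = h * real DIM('a)" by simp
  finally show "x \<in> ball a (h * real DIM('a))" by (simp add: dist_norm norm_minus_commute)
qed

lemma ball_subset_cube:
  "ball (x::'a::euclidean_space) r \<subseteq> cube (x - r *\<^sub>R One) (2 * r)"
proof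
  fix z assume z: "z \<in> ball x r"
  show "z \<in> cube (x - r *\<^sub>R One) (2 * r)" unfolding cube_def
  proof (intro CollectI ballI)
    fix i :: 'a assume i: "i \<in> Basis"
    have "\<bar>(z - x) \<bullet> i\<bar> \<le> norm (z - x)" using i by (rule Basis_le_norm)
    also have "\<dots> < r" using z by (simp add: dist_norm norm_minus_commute)
    finally show "(x - r *\<^sub>R One) \<bullet> i \<le> z \<bullet> i \<and> z \<bullet> i < (x - r *\<^sub>R One) \<bullet> i + 2 * r"
      using i by (simp add: inner_diff_left abs_less_iff)
  qed
qed

lemma emeasure_lebesgue_ball:
  assumes "0 \<le> r"
  shows "emeasure lebesgue (ball (x::'a::euclidean_space) r) = ennreal (r ^ DIM('a) * measure lebesgue (ball (0::'a) 1))"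
proof -
  have "emeasure lebesgue (ball x r) = ennreal (measure lebesgue (ball x r))"
    using emeasure_bounded_finite[OF bounded_ball, of x r] by (intro emeasure_eq_ennreal_measure) simp
  then show ?thesis
    using content_ball[OF assms, of x] content_ball[of 1 "0::'a"] by (simp add: mult.commute)
qed

lemma John_Nirenberg_ball:
  fixes p :: real
  assumes p: "1 \<le> p"
  obtains K where "0 \<le> K"
    "\<And>(u :: 'a::euclidean_space \<Rightarrow> real) A x r. u \<in> borel_measurable lebesgue \<Longrightarrow> 0 < A \<Longrightarrow> 0 < r \<Longrightarrow>
      (\<And>z s. 0 < s \<Longrightarrow> \<exists>k. (\<integral>\<^sup>+ y. ennreal \<bar>u y - k\<bar> * indicator (ball z s) y \<partial>lebesgue) \<le> ennreal (A * s ^ DIM('a))) \<Longrightarrow>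
      (\<integral>\<^sup>+ y. ennreal \<bar>u y\<bar> * indicator (ball x r) y \<partial>lebesgue) \<le> ennreal (A * r ^ DIM('a)) \<Longrightarrow>
      (\<integral>\<^sup>+ y. ennreal (\<bar>u y\<bar> powr p) * indicator (ball x r) y \<partial>lebesgue) \<le> ennreal (K * A powr p * r ^ DIM('a))"
proof -
  let ?d = "DIM('a)"
  define \<omega> where "\<omega> = measure lebesgue (ball (0::'a) 1)"
  have w: "0 < \<omega>" unfolding \<omega>_def using content_ball_pos[of 1 "0::'a"] by simp
  \<comment> \<open>Passing from the ball of radius \<open>r\<close> to the cube of side
    \<open>2 * r\<close> around it, and on to a ball of radius \<open>2 * r * real ?d\<close> around
    the cube, multiplies \<open>r ^ ?d\<close> by \<open>D\<close>.\<close>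
  define D where "D = (2 * real ?d) ^ ?d"
  have D: "1 \<le> D" unfolding D_def using DIM_positive[where 'a='a] by (intro one_le_power) linarith
  \<comment> \<open>After division by \<open>A * L\<close>, the summand \<open>2 * D\<close> brings
    the oscillation on every cube below half its volume; the next one absorbs the constant
    \<open>k\<close> about which \<open>u\<close> oscillates on the large ball.\<close>
  define L where "L = 2 * D + 2 ^ ?d * (1 + D) / \<omega> + 1"
  have L: "0 < L" "2 * D \<le> L" using D w by (auto simp: L_def intro!: add_nonneg_pos)
  define K where "K = JN_const ?d p * 2 ^ ?d * L powr p"
  show ?thesis
  proof
    show "0 \<le> K" using JN_const_nonneg by (simp add: K_def)
    fix u :: "'a \<Rightarrow> real" and A x r
    assume u: "u \<in> borel_measurable lebesgue" and A: "0 < A" and r: "0 < r"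
      and osc: "\<And>z s. 0 < s \<Longrightarrow> \<exists>k. (\<integral>\<^sup>+ y. ennreal \<bar>u y - k\<bar> * indicator (ball z s) y \<partial>lebesgue) \<le> ennreal (A * s ^ ?d)"
      and base: "(\<integral>\<^sup>+ y. ennreal \<bar>u y\<bar> * indicator (ball x r) y \<partial>lebesgue) \<le> ennreal (A * r ^ ?d)"
    note [measurable] = u
    define v where "v y = u y / (A * L)" for y
    have AL: "0 < A * L" using A L by simp
    have v_meas [measurable]: "v \<in> borel_measurable lebesgue" unfolding v_def by measurable
    have scale: "(\<integral>\<^sup>+ y. ennreal \<bar>v y - k / (A * L)\<bar> * indicator S y \<partial>lebesgue) =
        ennreal (1 / (A * L)) * (\<integral>\<^sup>+ y. ennreal \<bar>u y - k\<bar> * indicator S y \<partial>lebesgue)"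
      if [measurable]: "S \<in> sets lebesgue" for k S
    proof -
      have "ennreal \<bar>v y - k / (A * L)\<bar> * indicator S y = ennreal (1 / (A * L)) * (ennreal \<bar>u y - k\<bar> * indicator S y)" for y
      proof -
        have "\<bar>v y - k / (A * L)\<bar> = 1 / (A * L) * \<bar>u y - k\<bar>"
          using AL by (simp add: v_def diff_divide_distrib[symmetric] abs_divide)
        then have "ennreal \<bar>v y - k / (A * L)\<bar> = ennreal (1 / (A * L)) * ennreal \<bar>u y - k\<bar>"
          using AL by (simp only: ennreal_mult'')
        then show ?thesis by (simp add: mult.assoc)
      qed
      then show ?thesis by (simp add: nn_integral_cmult)
    qed
    have vosc: "\<exists>k. (\<integral>\<^sup>+ y. ennreal \<bar>v y - k\<bar> * indicator (cube a h) y \<partial>lebesgue) \<le> ennreal (h ^ ?d / 2)"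
      if h: "0 < h" for a h
    proof -
      have hd: "0 < h * real ?d" using h by simp
      obtain k where k: "(\<integral>\<^sup>+ y. ennreal \<bar>u y - k\<bar> * indicator (ball a (h * real ?d)) y \<partial>lebesgue) \<le> ennreal (A * (h * real ?d) ^ ?d)"
        using osc[OF hd, of a] by blast
      have "(\<integral>\<^sup>+ y. ennreal \<bar>v y - k / (A * L)\<bar> * indicator (cube a h) y \<partial>lebesgue)
          = ennreal (1 / (A * L)) * (\<integral>\<^sup>+ y. ennreal \<bar>u y - k\<bar> * indicator (cube a h) y \<partial>lebesgue)"
        by (rule scale) simp
      also have "\<dots> \<le> ennreal (1 / (A * L)) * (\<integral>\<^sup>+ y. ennreal \<bar>u y - k\<bar> * indicator (ball a (h * real ?d)) y \<partial>lebesgue)"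
        using cube_subset_ball[OF h, of a]
        by (intro mult_left_mono nn_integral_mono) (auto simp: indicator_def)
      also have "\<dots> \<le> ennreal (1 / (A * L)) * ennreal (A * (h * real ?d) ^ ?d)"
        by (intro mult_left_mono k) auto
      also have "\<dots> = ennreal ((h * real ?d) ^ ?d / L)"
        using A L h by (simp add: ennreal_mult[symmetric])
      also have "\<dots> \<le> ennreal (h ^ ?d / 2)"
      proof (rule ennreal_leI)
        have "2 * real ?d ^ ?d \<le> L"
        proof -
          have "real ?d ^ ?d \<le> D" unfolding D_def by (intro power_mono) auto
          then show ?thesis using L by linarith
        qed
        then have "h ^ ?d * (2 * real ?d ^ ?d) \<le> h ^ ?d * L" using h by (intro mult_left_mono) auto
        then show "(h * real ?d) ^ ?d / L \<le> h ^ ?d / 2" using L by (simp add: power_mult_distrib field_simps)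
      qed
      finally show ?thesis by blast
    qed
    let ?a = "x - r *\<^sub>R One" and ?h = "2 * r"
    have h: "0 < ?h" using r by simp
    let ?R = "?h * real ?d"
    have R: "0 < ?R" using r by simp
    have RD: "?R ^ ?d = D * r ^ ?d" by (simp add: D_def power_mult_distrib mult_ac)
    obtain k where k: "(\<integral>\<^sup>+ y. ennreal \<bar>u y - k\<bar> * indicator (ball ?a ?R) y \<partial>lebesgue) \<le> ennreal (A * ?R ^ ?d)"
      using osc[OF R, of ?a] by blast
    have sub: "ball x r \<subseteq> cube ?a ?h" "cube ?a ?h \<subseteq> ball ?a ?R"
      using ball_subset_cube[of x r] cube_subset_ball[OF h, of ?a] by auto
    have [measurable]: "ball x r \<in> sets lebesgue" "ball ?a ?R \<in> sets lebesgue" by simp_all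
    have eB: "emeasure lebesgue (ball x r) = ennreal (r ^ ?d * \<omega>)"
      using r emeasure_lebesgue_ball[of r x] by (simp only: \<omega>_def)
    \<comment> \<open>On the large ball \<open>u\<close> is close in mean to some constant
      \<open>k\<close>; on \<open>ball x r\<close> it is also close to 0, so \<open>k\<close> itself
      must be small.\<close>
    have kb: "\<bar>k\<bar> \<le> A * (1 + D) / \<omega>"
    proof -
      have "ennreal \<bar>k\<bar> * emeasure lebesgue (ball x r) = (\<integral>\<^sup>+ y. ennreal \<bar>k\<bar> * indicator (ball x r) y \<partial>lebesgue)"
        by (rule nn_integral_cmult_indicator[symmetric]) simp
      also have "\<dots> \<le> (\<integral>\<^sup>+ y. ennreal \<bar>u y\<bar> * indicator (ball x r) y + ennreal \<bar>u y - k\<bar> * indicator (ball x r) y \<partial>lebesgue)"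
      proof (intro nn_integral_mono)
        fix y
        have "ennreal \<bar>k\<bar> \<le> ennreal (\<bar>u y\<bar> + \<bar>u y - k\<bar>)" by (intro ennreal_leI) linarith
        then show "ennreal \<bar>k\<bar> * indicator (ball x r) y \<le> ennreal \<bar>u y\<bar> * indicator (ball x r) y + ennreal \<bar>u y - k\<bar> * indicator (ball x r) y"
          by (auto simp: indicator_def)
      qed
      also have "\<dots> = (\<integral>\<^sup>+ y. ennreal \<bar>u y\<bar> * indicator (ball x r) y \<partial>lebesgue) + (\<integral>\<^sup>+ y. ennreal \<bar>u y - k\<bar> * indicator (ball x r) y \<partial>lebesgue)"
        by (rule nn_integral_add) measurable
      also have "\<dots> \<le> ennreal (A * r ^ ?d) + (\<integral>\<^sup>+ y. ennreal \<bar>u y - k\<bar> * indicator (ball ?a ?R) y \<partial>lebesgue)"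
        using sub by (intro add_mono base nn_integral_mono mult_left_mono indicator_leI) (blast | simp)+
      also have "\<dots> \<le> ennreal (A * r ^ ?d) + ennreal (A * ?R ^ ?d)" by (intro add_left_mono k)
      also have "\<dots> = ennreal (A * (1 + D) * r ^ ?d)"
        unfolding RD using A r D by (subst ennreal_plus[symmetric]) (auto simp: algebra_simps)
      finally have "ennreal \<bar>k\<bar> * ennreal (r ^ ?d * \<omega>) \<le> ennreal (A * (1 + D) * r ^ ?d)"
        unfolding eB .
      moreover have "ennreal (\<bar>k\<bar> * (r ^ ?d * \<omega>)) = ennreal \<bar>k\<bar> * ennreal (r ^ ?d * \<omega>)"
        using r w by (intro ennreal_mult) auto
      ultimately have "ennreal (\<bar>k\<bar> * (r ^ ?d * \<omega>)) \<le> ennreal (A * (1 + D) * r ^ ?d)" by (simp only:)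
      then have "\<bar>k\<bar> * (r ^ ?d * \<omega>) \<le> A * (1 + D) * r ^ ?d"
        using A D r by (subst (asm) ennreal_le_iff) auto
      then have "\<bar>k\<bar> * \<omega> \<le> A * (1 + D)" using r by (simp add: mult_ac)
      then show ?thesis using w by (simp add: field_simps)
    qed
    have vbase: "(\<integral>\<^sup>+ y. ennreal \<bar>v y - 0\<bar> * indicator (cube ?a ?h) y \<partial>lebesgue) \<le> ennreal (?h ^ ?d)"
    proof -
      have "(\<integral>\<^sup>+ y. ennreal \<bar>v y - 0\<bar> * indicator (cube ?a ?h) y \<partial>lebesgue) =
          ennreal (1 / (A * L)) * (\<integral>\<^sup>+ y. ennreal \<bar>u y\<bar> * indicator (cube ?a ?h) y \<partial>lebesgue)"
        using scale[of "cube ?a ?h" 0] by simp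
      also have "(\<integral>\<^sup>+ y. ennreal \<bar>u y\<bar> * indicator (cube ?a ?h) y \<partial>lebesgue) \<le>
          (\<integral>\<^sup>+ y. ennreal \<bar>u y - k\<bar> * indicator (ball ?a ?R) y + ennreal \<bar>k\<bar> * indicator (cube ?a ?h) y \<partial>lebesgue)"
      proof (intro nn_integral_mono)
        fix y
        have "ennreal \<bar>u y\<bar> \<le> ennreal (\<bar>u y - k\<bar> + \<bar>k\<bar>)" by (intro ennreal_leI) linarith
        then show "ennreal \<bar>u y\<bar> * indicator (cube ?a ?h) y \<le> ennreal \<bar>u y - k\<bar> * indicator (ball ?a ?R) y + ennreal \<bar>k\<bar> * indicator (cube ?a ?h) y"
          using sub(2) by (cases "y \<in> cube ?a ?h") auto
      qed
      also have "\<dots> = (\<integral>\<^sup>+ y. ennreal \<bar>u y - k\<bar> * indicator (ball ?a ?R) y \<partial>lebesgue) + ennreal \<bar>k\<bar> * emeasure lebesgue (cube ?a ?h)"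
        by (subst nn_integral_add) (auto simp: nn_integral_cmult_indicator)
      also have "\<dots> \<le> ennreal (A * ?R ^ ?d) + ennreal (A * (1 + D) / \<omega>) * ennreal (?h ^ ?d)"
        unfolding emeasure_cube[OF less_imp_le[OF h], of ?a]
        using k kb by (intro add_mono mult_mono ennreal_leI) auto
      also have "\<dots> = ennreal (A * (D + 2 ^ ?d * (1 + D) / \<omega>) * r ^ ?d)"
        unfolding RD using A r D w
        by (subst ennreal_mult[symmetric], simp, simp, subst ennreal_plus[symmetric])
          (auto simp: algebra_simps power_mult_distrib add_divide_distrib)
      also have "ennreal (1 / (A * L)) * \<dots> = ennreal ((D + 2 ^ ?d * (1 + D) / \<omega>) / L * r ^ ?d)"
        using A L D w r by (subst ennreal_mult[symmetric]) auto
      also have "\<dots> \<le> ennreal (?h ^ ?d)"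
      proof (rule ennreal_leI)
        have "(D + 2 ^ ?d * (1 + D) / \<omega>) / L \<le> 1"
          using L D w by (simp add: L_def)
        then have "(D + 2 ^ ?d * (1 + D) / \<omega>) / L * r ^ ?d \<le> 1 * r ^ ?d"
          using r by (intro mult_right_mono) auto
        also have "\<dots> \<le> ?h ^ ?d" using r by (simp add: power_mult_distrib mult_le_cancel_right1)
        finally show "(D + 2 ^ ?d * (1 + D) / \<omega>) / L * r ^ ?d \<le> ?h ^ ?d" .
      qed
      finally show ?thesis by (simp add: mult_left_mono)
    qed
    have "(\<integral>\<^sup>+ y. ennreal (\<bar>u y\<bar> powr p) * indicator (ball x r) y \<partial>lebesgue) \<le>
        (\<integral>\<^sup>+ y. ennreal ((A * L) powr p) * (ennreal (\<bar>v y - 0\<bar> powr p) * indicator (cube ?a ?h) y) \<partial>lebesgue)"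
    proof (intro nn_integral_mono)
      fix y
      have "u y = A * L * v y" using A L by (simp add: v_def)
      then have "\<bar>u y\<bar> powr p = (A * L) powr p * \<bar>v y\<bar> powr p"
        using A L by (simp add: abs_mult powr_mult)
      then show "ennreal (\<bar>u y\<bar> powr p) * indicator (ball x r) y \<le>
          ennreal ((A * L) powr p) * (ennreal (\<bar>v y - 0\<bar> powr p) * indicator (cube ?a ?h) y)"
        using sub(1) by (auto simp: indicator_def ennreal_mult)
    qed
    also have "\<dots> = ennreal ((A * L) powr p) * (\<integral>\<^sup>+ y. ennreal (\<bar>v y - 0\<bar> powr p) * indicator (cube ?a ?h) y \<partial>lebesgue)"
      by (rule nn_integral_cmult) measurable
    also have "\<dots> \<le> ennreal ((A * L) powr p) * ennreal (JN_const ?d p * ?h ^ ?d)"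
      by (intro mult_left_mono John_Nirenberg_cube v_meas p vosc h vbase) auto
    also have "\<dots> = ennreal (K * A powr p * r ^ ?d)"
      using A L JN_const_nonneg r
      by (subst ennreal_mult[symmetric]) (auto simp: K_def powr_mult power_mult_distrib mult_ac)
    finally show "(\<integral>\<^sup>+ y. ennreal (\<bar>u y\<bar> powr p) * indicator (ball x r) y \<partial>lebesgue) \<le> ennreal (K * A powr p * r ^ ?d)" .
  qed
qed

subsection \<open>Integration against the kernel\<close>

definition bump :: "real \<Rightarrow> real \<Rightarrow> real" where "bump w t = t * w / (t\<^sup>2 + w\<^sup>2)"

lemma bump_nonneg: "0 < t \<Longrightarrow> 0 < w \<Longrightarrow> 0 \<le> bump w t"
  by (simp add: bump_def)

text \<open>The width is fixed at \<open>w\<close> for all points at distance at least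
  \<open>w / 2\<close>, so that integration over such points leaves a fixed function of
  \<open>t\<close>.\<close>

lemma profile_le_bump:
  assumes d: "1 \<le> d" and t: "0 < t" and w: "0 < w" and v: "w / 2 \<le> v"
  shows "\<bar>profile d t v\<bar> \<le> 8 * 2 ^ d * real d / w ^ d * bump w t"
proof -
  obtain k where k: "d = Suc k" using d by (cases d) auto
  have v0: "0 < v" using w v by linarith
  have S: "0 < t\<^sup>2 + v\<^sup>2" "0 < t\<^sup>2 + w\<^sup>2" using t by (simp_all add: add_pos_nonneg)
  have "\<bar>profile d t v\<bar> \<le> real d / v ^ d * (t * v / (t\<^sup>2 + v\<^sup>2))"
    using profile_le_space[OF d t v0] .
  also have "\<dots> = real d * t / (v ^ k * (t\<^sup>2 + v\<^sup>2))" using v0 by (simp add: k)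
  also have "\<dots> \<le> real d * t / ((w / 2) ^ k * ((t\<^sup>2 + w\<^sup>2) / 4))"
  proof (rule divide_left_mono)
    show "(w / 2) ^ k * ((t\<^sup>2 + w\<^sup>2) / 4) \<le> v ^ k * (t\<^sup>2 + v\<^sup>2)"
    proof (intro mult_mono)
      show "(w / 2) ^ k \<le> v ^ k" using v w by (intro power_mono) auto
      have "(w / 2)\<^sup>2 \<le> v\<^sup>2" using v w by (intro power_mono) auto
      then show "(t\<^sup>2 + w\<^sup>2) / 4 \<le> t\<^sup>2 + v\<^sup>2"
        using zero_le_power2[of t] by (simp add: power_divide, linarith)
    qed (use v0 in auto)
  qed (use t v0 w S in auto)
  also have "\<dots> = 4 * 2 ^ k * (real d * t / (w ^ k * (t\<^sup>2 + w\<^sup>2)))" by (simp add: power_divide)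
  also have "\<dots> \<le> 8 * 2 ^ d * (real d * t / (w ^ k * (t\<^sup>2 + w\<^sup>2)))"
    using t w S by (intro mult_right_mono) (auto simp: k)
  also have "\<dots> = 8 * 2 ^ d * real d / w ^ d * bump w t"
    using w by (simp add: k bump_def)
  finally show ?thesis .
qed

definition kern :: "real \<Rightarrow> 'a::euclidean_space \<Rightarrow> real"
  where "kern t z = t * deriv (\<lambda>u. poisson_kernel u z) t"

text \<open>One constant for both the size and the regularity of the kernel, hence the sum. The
  absolute value takes the normalising integral as it stands.\<close>

definition kern_const :: "'a::euclidean_space itself \<Rightarrow> real"
  where "kern_const _ = \<bar>1 / (\<integral>z. poisson_shape 1 (z::'a) \<partial>lebesgue)\<bar> *
    (8 * 2 ^ DIM('a) * real DIM('a) + profile_const DIM('a))"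

lemma profile_const_nonneg: "0 \<le> profile_const d"
  by (simp add: profile_const_def)

lemma kern_const_nonneg: "0 \<le> kern_const TYPE('a::euclidean_space)"
  using profile_const_nonneg by (simp add: kern_const_def)

lemma DIM_ge_1: "1 \<le> DIM('a::euclidean_space)"
  using DIM_positive[where 'a='a] by linarith

text \<open>With \<open>y = 0\<close> this converts a bound on the profile into one on the kernel;
  with \<open>y\<close> another value of the profile it does so for a difference.\<close>

lemma kern_le_aux:
  fixes z z' :: "'a::euclidean_space"
  assumes t: "0 < t" and b: "0 \<le> b" "0 \<le> K"
    and le: "\<bar>profile DIM('a) t (norm z) - y\<bar> \<le> K * b" and K: "K \<le> 8 * 2 ^ DIM('a) * real DIM('a) + profile_const DIM('a)"
  shows "\<bar>kern t z - 1 / (\<integral>z. poisson_shape 1 (z::'a) \<partial>lebesgue) * y\<bar> \<le> kern_const TYPE('a) * b"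
proof -
  let ?c = "1 / (\<integral>z. poisson_shape 1 (z::'a) \<partial>lebesgue)"
  have "kern t z - ?c * y = ?c * (profile DIM('a) t (norm z) - y)"
    unfolding kern_def t_deriv_poisson_kernel[OF t] by (simp only: right_diff_distrib)
  then have "\<bar>kern t z - ?c * y\<bar> = \<bar>?c\<bar> * \<bar>profile DIM('a) t (norm z) - y\<bar>"
    by (simp only: abs_mult)
  also have "\<dots> \<le> \<bar>?c\<bar> * ((8 * 2 ^ DIM('a) * real DIM('a) + profile_const DIM('a)) * b)"
    using le K b by (intro mult_left_mono order_trans[OF le] mult_right_mono) auto
  finally show ?thesis by (simp add: kern_const_def)
qed

lemma kern_le_time:
  fixes z :: "'a::euclidean_space"
  assumes t: "0 < t"
  shows "\<bar>kern t z\<bar> \<le> kern_const TYPE('a) / t ^ DIM('a)"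
proof -
  have "\<bar>profile DIM('a) t (norm z) - 0\<bar> \<le> real DIM('a) * (1 / t ^ DIM('a))"
    using profile_le_time[OF DIM_ge_1 t] by simp
  moreover have "real DIM('a) \<le> 8 * 2 ^ DIM('a) * real DIM('a) + profile_const DIM('a)"
  proof -
    have "1 * real DIM('a) \<le> (8 * 2 ^ DIM('a)) * real DIM('a)"
      by (intro mult_right_mono) (auto intro: order_trans[of _ "8 * 1"] mult_left_mono)
    then show ?thesis using profile_const_nonneg[of "DIM('a)"] by linarith
  qed
  ultimately have "\<bar>kern t z - 1 / (\<integral>z. poisson_shape 1 (z::'a) \<partial>lebesgue) * 0\<bar> \<le> kern_const TYPE('a) * (1 / t ^ DIM('a))"
    using t by (intro kern_le_aux) auto
  then show ?thesis by simp
qed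

lemma kern_le:
  fixes z :: "'a::euclidean_space"
  assumes t: "0 < t" and w: "0 < w" "w / 2 \<le> norm z"
  shows "\<bar>kern t z\<bar> \<le> kern_const TYPE('a) / w ^ DIM('a) * bump w t"
proof -
  have "\<bar>profile DIM('a) t (norm z) - 0\<bar> \<le> (8 * 2 ^ DIM('a) * real DIM('a)) * (1 / w ^ DIM('a) * bump w t)"
    using profile_le_bump[OF DIM_ge_1 t w(1,2)] by simp
  then have "\<bar>kern t z - 1 / (\<integral>z. poisson_shape 1 (z::'a) \<partial>lebesgue) * 0\<bar> \<le> kern_const TYPE('a) * (1 / w ^ DIM('a) * bump w t)"
    using t profile_const_nonneg[of "DIM('a)"] bump_nonneg[OF t w(1)] w(1) by (intro kern_le_aux) auto
  then show ?thesis by simp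
qed

lemma kern_diff_le:
  fixes z z' :: "'a::euclidean_space"
  assumes t: "0 < t" and w: "0 < w" "norm z = w" "norm (z - z') \<le> w / 2"
  shows "\<bar>kern t z - kern t z'\<bar> \<le> kern_const TYPE('a) * norm (z - z') / w ^ (DIM('a) + 1) * bump w t"
proof -
  have n: "w / 2 \<le> norm z'" "\<bar>norm z - norm z'\<bar> \<le> norm (z - z')"
    using w norm_triangle_ineq3[of z z'] by (auto simp: field_simps abs_le_iff)
  have "\<bar>profile DIM('a) t (norm z) - profile DIM('a) t (norm z')\<bar> \<le>
      profile_const DIM('a) * \<bar>norm z - norm z'\<bar> / w ^ (DIM('a) + 1) * bump w t"
    unfolding bump_def using n w t by (intro profile_diff DIM_ge_1) auto
  also have "\<dots> \<le> profile_const DIM('a) * norm (z - z') / w ^ (DIM('a) + 1) * bump w t"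
    using n w t profile_const_nonneg[of "DIM('a)"]
    by (intro mult_right_mono divide_right_mono mult_left_mono bump_nonneg) auto
  finally have "\<bar>profile DIM('a) t (norm z) - profile DIM('a) t (norm z')\<bar> \<le>
      profile_const DIM('a) * (norm (z - z') / w ^ (DIM('a) + 1) * bump w t)" by simp
  then have "\<bar>kern t z - 1 / (\<integral>z. poisson_shape 1 (z::'a) \<partial>lebesgue) * profile DIM('a) t (norm z')\<bar>
      \<le> kern_const TYPE('a) * (norm (z - z') / w ^ (DIM('a) + 1) * bump w t)"
    using t profile_const_nonneg[of "DIM('a)"] bump_nonneg[OF t w(1)] w(1) by (intro kern_le_aux) auto
  then show ?thesis unfolding kern_def[of t z'] t_deriv_poisson_kernel[OF t] by simp
qed

lemma borel_measurable_kern_borel: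
  fixes x :: "'a::euclidean_space"
  assumes t: "0 < t"
  shows "(\<lambda>y. kern t (x - y)) \<in> borel_measurable borel"
proof -
  have "(\<lambda>y. kern t (x - y)) = (\<lambda>y. 1 / (\<integral>z. poisson_shape 1 (z::'a) \<partial>lebesgue) * profile DIM('a) t (norm (x - y)))"
    unfolding kern_def t_deriv_poisson_kernel[OF t] ..
  moreover have "continuous_on UNIV (\<lambda>y. profile DIM('a) t (norm (x - y)))"
    by (rule continuous_on_compose2[OF continuous_profile[OF t, of "DIM('a)"] _ subset_UNIV])
      (intro continuous_intros)
  ultimately have "continuous_on UNIV (\<lambda>y. kern t (x - y))"
    by (simp only:) (intro continuous_intros)
  then show ?thesis by (rule borel_measurable_continuous_onI)
qed

lemma borel_measurable_kern:
  "0 < t \<Longrightarrow> (\<lambda>y. kern t (x - y)) \<in> borel_measurable lebesgue"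
  using borel_measurable_kern_borel by (intro measurable_completion) simp

lemma kern_tendsto:
  assumes "u \<longlonglongrightarrow> t" "0 < t" "\<And>n. 0 < u n"
  shows "(\<lambda>n. kern (u n) z) \<longlonglongrightarrow> kern t z"
  unfolding kern_def t_deriv_poisson_kernel[OF assms(2)] t_deriv_poisson_kernel[OF assms(3)]
  using continuous_on_tendsto_compose[OF continuous_profile_time assms(1), of _ "norm z"] assms
  by (intro tendsto_mult tendsto_const) auto

section \<open>The kernel acting on integrable functions\<close>

definition L1 :: "('a::euclidean_space \<Rightarrow> 'x::banach) \<Rightarrow> bool"
  where "L1 g \<longleftrightarrow> strongly_measurable xnorm lebesgue g \<and> (\<integral>\<^sup>+ y. xnorm (g y) \<partial>lebesgue) < \<infinity>"

text \<open>The truncation is carried by \<open>g\<close> and not by the domain of integration, so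
  that pieces cut at different radii can be added and subtracted.\<close>

definition kint :: "('a::euclidean_space \<Rightarrow> 'x::banach) \<Rightarrow> 'a \<Rightarrow> real \<Rightarrow> 'x"
  where "kint g x t = bochner xnorm lebesgue (\<lambda>y. kern t (x - y) *\<^sub>R g y)"

lemma has_bochner_unique:
  fixes v w :: "'x::real_normed_vector"
  assumes "complete_measure M" "has_bochner xnorm M f v" "has_bochner xnorm M f w"
  shows "v = w"
  using xnorm.has_bochner_bound[OF assms(1) xnorm.has_bochner_diff[OF assms]] by simp

lemma borel_measurable_xnorm:
  "strongly_measurable xnorm lebesgue f \<Longrightarrow> (\<lambda>y. xnorm (f y)) \<in> borel_measurable lebesgue"
  by (rule xnorm.borel_measurable_seminorm[OF complete_measure_lebesgue])

lemma xnorm_scaleR: "xnorm (c *\<^sub>R v) = ennreal \<bar>c\<bar> * xnorm v"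
  by (rule xnorm.scale)

lemma L1_add: "L1 f \<Longrightarrow> L1 g \<Longrightarrow> L1 (\<lambda>y. f y + g y)"
  unfolding L1_def
  using xnorm.nn_integral_triangle[OF complete_measure_lebesgue, of f g]
  by (auto intro: xnorm.strongly_measurable_add order.strict_trans1)

lemma L1_scaleR: "L1 f \<Longrightarrow> L1 (\<lambda>y. c *\<^sub>R f y)"
  unfolding L1_def
  by (auto intro: xnorm.strongly_measurable_scaleR
      simp: xnorm_scaleR nn_integral_cmult borel_measurable_xnorm ennreal_mult_less_top)

lemma L1_diff: "L1 f \<Longrightarrow> L1 g \<Longrightarrow> L1 (\<lambda>y. f y - g y)"
  using L1_add[of f "\<lambda>y. (-1) *\<^sub>R g y"] L1_scaleR[of g "-1"] by simp

lemma L1_indicator: "S \<in> sets lebesgue \<Longrightarrow> L1 f \<Longrightarrow> L1 (\<lambda>y. indicator S y *\<^sub>R f y)"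
  unfolding L1_def
proof (elim conjE, intro conjI)
  assume S: "S \<in> sets lebesgue" and f: "strongly_measurable xnorm lebesgue f" "(\<integral>\<^sup>+ y. xnorm (f y) \<partial>lebesgue) < \<infinity>"
  show "strongly_measurable xnorm lebesgue (\<lambda>y. indicator S y *\<^sub>R f y)"
    using S f by (intro xnorm.strongly_measurable_mult) auto
  have "(\<integral>\<^sup>+ y. xnorm (indicator S y *\<^sub>R f y) \<partial>lebesgue) \<le> (\<integral>\<^sup>+ y. xnorm (f y) \<partial>lebesgue)"
    by (intro nn_integral_mono) (auto simp: indicator_def)
  then show "(\<integral>\<^sup>+ y. xnorm (indicator S y *\<^sub>R f y) \<partial>lebesgue) < \<infinity>" using f(2) by (rule order.strict_trans1)
qed

lemma L1_zero: "L1 (\<lambda>_. 0)"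
  by (simp add: L1_def)

lemma L1_sum: "(\<And>i. i \<in> A \<Longrightarrow> L1 (f i)) \<Longrightarrow> L1 (\<lambda>y. \<Sum>i\<in>A. f i y)"
  by (induction A rule: infinite_finite_induct) (auto intro: L1_add L1_zero)

lemma has_bochner_kint:
  fixes g :: "'a::euclidean_space \<Rightarrow> 'x::banach"
  assumes g: "L1 g" and t: "0 < t"
  shows "has_bochner xnorm lebesgue (\<lambda>y. kern t (x - y) *\<^sub>R g y) (kint g x t)"
  unfolding kint_def
proof (rule xnorm.has_bochner_bochner[OF complete_measure_lebesgue seminorm_complete_xnorm])
  have sm: "strongly_measurable xnorm lebesgue g" and fin: "(\<integral>\<^sup>+ y. xnorm (g y) \<partial>lebesgue) < \<infinity>"
    using g by (auto simp: L1_def)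
  show "strongly_measurable xnorm lebesgue (\<lambda>y. kern t (x - y) *\<^sub>R g y)"
    by (intro xnorm.strongly_measurable_mult borel_measurable_kern t sm)
  have "(\<integral>\<^sup>+ y. xnorm (kern t (x - y) *\<^sub>R g y) \<partial>lebesgue) \<le>
      (\<integral>\<^sup>+ y. ennreal (kern_const TYPE('a) / t ^ DIM('a)) * xnorm (g y) \<partial>lebesgue)"
    unfolding xnorm_scaleR by (intro nn_integral_mono mult_right_mono ennreal_leI kern_le_time t) auto
  also have "\<dots> = ennreal (kern_const TYPE('a) / t ^ DIM('a)) * (\<integral>\<^sup>+ y. xnorm (g y) \<partial>lebesgue)"
    by (intro nn_integral_cmult borel_measurable_xnorm sm)
  also have "\<dots> < \<infinity>" using fin by (simp add: ennreal_mult_less_top)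
  finally show "(\<integral>\<^sup>+ y. xnorm (kern t (x - y) *\<^sub>R g y) \<partial>lebesgue) < \<infinity>" .
qed

lemma kint_eqI:
  assumes "has_bochner xnorm lebesgue (\<lambda>y. kern t (x - y) *\<^sub>R g y) v" "L1 g" "0 < t"
  shows "kint g x t = v"
  using has_bochner_unique[OF complete_measure_lebesgue has_bochner_kint assms(1)] assms by simp

lemma kint_add:
  assumes f: "L1 f" and g: "L1 g" and t: "0 < t"
  shows "kint (\<lambda>y. f y + g y) x t = kint f x t + kint g x t"
proof (rule kint_eqI[OF _ L1_add[OF f g] t])
  show "has_bochner xnorm lebesgue (\<lambda>y. kern t (x - y) *\<^sub>R (f y + g y)) (kint f x t + kint g x t)"
    using xnorm.has_bochner_add[OF complete_measure_lebesgue has_bochner_kint[OF f t, of x] has_bochner_kint[OF g t, of x]]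
    by (simp add: scaleR_add_right)
qed

lemma kint_scaleR:
  assumes f: "L1 f" and t: "0 < t"
  shows "kint (\<lambda>y. c *\<^sub>R f y) x t = c *\<^sub>R kint f x t"
proof (rule kint_eqI[OF _ L1_scaleR[OF f] t])
  show "has_bochner xnorm lebesgue (\<lambda>y. kern t (x - y) *\<^sub>R (c *\<^sub>R f y)) (c *\<^sub>R kint f x t)"
    using xnorm.has_bochner_scaleR[OF has_bochner_kint[OF f t, of x] complete_measure_lebesgue, of c]
    by (simp add: mult.commute)
qed

lemma kint_diff: "L1 f \<Longrightarrow> L1 g \<Longrightarrow> 0 < t \<Longrightarrow> kint (\<lambda>y. f y - g y) x t = kint f x t - kint g x t"
  using kint_add[of f "\<lambda>y. (-1) *\<^sub>R g y" t x] kint_scaleR[of g t "-1" x] L1_scaleR[of g "-1"] by simp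

lemma kint_zero: "0 < t \<Longrightarrow> kint (\<lambda>_. 0) x t = 0"
  using xnorm.has_bochner_zero by (intro kint_eqI L1_zero) auto

lemma kint_sum:
  "(\<And>i. i \<in> A \<Longrightarrow> L1 (f i)) \<Longrightarrow> 0 < t \<Longrightarrow> kint (\<lambda>y. \<Sum>i\<in>A. f i y) x t = (\<Sum>i\<in>A. kint (f i) x t)"
  by (induction A rule: infinite_finite_induct) (auto simp: kint_zero kint_add L1_sum)

lemma kint_cong_AE:
  assumes "L1 f" "AE y in lebesgue. f y = g y" "0 < t"
  shows "L1 g" "kint g x t = kint f x t"
proof -
  have sm: "strongly_measurable xnorm lebesgue g"
    using assms(1,2) unfolding L1_def by (auto intro!: xnorm.strongly_measurable_cong_AE[of lebesgue f g])
  moreover have "(\<integral>\<^sup>+ y. xnorm (g y) \<partial>lebesgue) = (\<integral>\<^sup>+ y. xnorm (f y) \<partial>lebesgue)"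
    using assms(2) by (intro nn_integral_cong_AE) auto
  ultimately show g: "L1 g" using assms(1) by (simp add: L1_def)
  show "kint g x t = kint f x t"
  proof (rule kint_eqI[OF _ g assms(3)])
    show "has_bochner xnorm lebesgue (\<lambda>y. kern t (x - y) *\<^sub>R g y) (kint f x t)"
      by (rule xnorm.has_bochner_cong_AE[OF complete_measure_lebesgue has_bochner_kint[OF assms(1,3), of x]])
        (use assms(2) in auto)
  qed
qed

lemma xnorm_kint_le:
  assumes "L1 g" "0 < t"
  shows "xnorm (kint g x t) \<le> (\<integral>\<^sup>+ y. ennreal \<bar>kern t (x - y)\<bar> * xnorm (g y) \<partial>lebesgue)"
  using xnorm.has_bochner_bound[OF complete_measure_lebesgue has_bochner_kint[OF assms]]
  by (simp add: xnorm_scaleR)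

lemma xnorm_kint_diff_le:
  assumes "L1 g" "0 < t"
  shows "xnorm (kint g x t - kint g x' t) \<le> (\<integral>\<^sup>+ y. ennreal \<bar>kern t (x - y) - kern t (x' - y)\<bar> * xnorm (g y) \<partial>lebesgue)"
  using xnorm.has_bochner_bound[OF complete_measure_lebesgue
      xnorm.has_bochner_diff[OF complete_measure_lebesgue has_bochner_kint[OF assms] has_bochner_kint[OF assms]]]
  by (simp add: xnorm_scaleR scaleR_diff_left[symmetric])

text \<open>Continuity in \<open>t\<close> is the source of strong measurability with respect to
  \<open>dt_t\<close>. The kernel is bounded as long as \<open>t\<close> stays away from 0, and a
  sequence of positive times with a positive limit does, so dominated convergence applies.\<close>

lemma kint_continuous:
  fixes g :: "'a::euclidean_space \<Rightarrow> 'x::banach"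
  assumes g: "L1 g"
  shows "continuous_on {0<..} (kint g x)"
proof (rule continuous_on_sequentiallyI)
  fix u :: "nat \<Rightarrow> real" and t assume u: "\<forall>n. u n \<in> {0<..}" "t \<in> {0<..}" "u \<longlonglongrightarrow> t"
  then have u0: "0 < u n" and t: "0 < t" for n by auto
  have sm: "strongly_measurable xnorm lebesgue g" and fin: "(\<integral>\<^sup>+ y. xnorm (g y) \<partial>lebesgue) < \<infinity>"
    using g by (auto simp: L1_def)
  note [measurable] = borel_measurable_kern borel_measurable_xnorm[OF sm]
  let ?h = "\<lambda>n y. ennreal \<bar>kern (u n) (x - y) - kern t (x - y)\<bar> * xnorm (g y)"
  have le: "xnorm (kint g x t - kint g x (u n)) \<le> (\<integral>\<^sup>+ y. ?h n y \<partial>lebesgue)" for n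
    using xnorm.has_bochner_bound[OF complete_measure_lebesgue
      xnorm.has_bochner_diff[OF complete_measure_lebesgue has_bochner_kint[OF g u0[of n], of x] has_bochner_kint[OF g t, of x]]]
    by (simp add: xnorm_scaleR scaleR_diff_left[symmetric] xnorm.diff_commute)
  obtain t0 where t0: "0 < t0" "t0 \<le> t" "\<And>n. t0 \<le> u n"
  proof -
    have "\<forall>\<^sub>F n in sequentially. t / 2 < u n" using u(3) t by (intro order_tendstoD) auto
    then obtain m where m: "\<And>n. m \<le> n \<Longrightarrow> t / 2 < u n" by (auto simp: eventually_sequentially)
    let ?t0 = "Min (insert (t / 2) (u ` {..<m}))"
    have "?t0 \<le> u n" for n using m[of n] by (cases "n < m") (auto simp: Min_le_iff)
    moreover have "0 < ?t0" using t u0 by auto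
    moreover have "?t0 \<le> t" using t by (auto simp: Min_le_iff)
    ultimately show ?thesis using that by blast
  qed
  let ?B = "2 * (kern_const TYPE('a) / t0 ^ DIM('a))"
  have kb: "\<bar>kern s z\<bar> \<le> kern_const TYPE('a) / t0 ^ DIM('a)" if "t0 \<le> s" for s and z :: 'a
  proof -
    have "\<bar>kern s z\<bar> \<le> kern_const TYPE('a) / s ^ DIM('a)" using that t0 by (intro kern_le_time) simp
    also have "\<dots> \<le> kern_const TYPE('a) / t0 ^ DIM('a)"
      using that t0 kern_const_nonneg[where 'a='a] by (intro divide_left_mono power_mono mult_pos_pos) auto
    finally show ?thesis .
  qed
  have "(\<lambda>n. \<integral>\<^sup>+ y. ?h n y \<partial>lebesgue) \<longlonglongrightarrow> (\<integral>\<^sup>+ y. 0 \<partial>(lebesgue :: 'a measure))"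
  proof (rule nn_integral_dominated_convergence[where w="\<lambda>y. ennreal ?B * xnorm (g y)"])
    show "?h n \<in> borel_measurable lebesgue" for n using u0[of n] t by measurable
    show "(\<lambda>y. ennreal ?B * xnorm (g y)) \<in> borel_measurable lebesgue" by measurable
    have "(\<integral>\<^sup>+ y. ennreal ?B * xnorm (g y) \<partial>lebesgue) = ennreal ?B * (\<integral>\<^sup>+ y. xnorm (g y) \<partial>lebesgue)"
      by (rule nn_integral_cmult) measurable
    then show "(\<integral>\<^sup>+ y. ennreal ?B * xnorm (g y) \<partial>lebesgue) < \<infinity>" using fin by (simp add: ennreal_mult_less_top)
    show "AE y in lebesgue. ?h n y \<le> ennreal ?B * xnorm (g y)" for n
    proof (rule AE_I2)
      fix y
      have "\<bar>kern (u n) (x - y) - kern t (x - y)\<bar> \<le> ?B"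
        using kb[OF t0(3)[of n], of "x - y"] kb[OF t0(2), of "x - y"] by linarith
      then show "?h n y \<le> ennreal ?B * xnorm (g y)" by (intro mult_right_mono ennreal_leI) auto
    qed
    show "AE y in lebesgue. (\<lambda>n. ?h n y) \<longlonglongrightarrow> 0"
    proof (rule AE_I2)
      fix y
      have "(\<lambda>n. \<bar>kern (u n) (x - y) - kern t (x - y)\<bar>) \<longlonglongrightarrow> \<bar>kern t (x - y) - kern t (x - y)\<bar>"
        by (intro tendsto_intros kern_tendsto u t u0)
      then have "(\<lambda>n. ennreal \<bar>kern (u n) (x - y) - kern t (x - y)\<bar>) \<longlonglongrightarrow> 0"
        using tendsto_ennrealI by fastforce
      from ennreal_tendsto_cmult[OF _ this, of "xnorm (g y)"]
      show "(\<lambda>n. ?h n y) \<longlonglongrightarrow> 0" by (simp add: mult.commute)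
    qed
  qed simp
  then have lim: "(\<lambda>n. \<integral>\<^sup>+ y. ?h n y \<partial>lebesgue) \<longlonglongrightarrow> 0" by simp
  have "(\<lambda>n. xnorm (kint g x t - kint g x (u n))) \<longlonglongrightarrow> 0"
    by (rule tendsto_sandwich[OF _ _ tendsto_const lim]) (simp_all add: le)
  then show "(\<lambda>n. kint g x (u n)) \<longlonglongrightarrow> kint g x t" by (simp add: tendsto_xnorm_iff)
qed

lemma Lq_dt_t_cong:
  assumes "\<And>t. 0 < t \<Longrightarrow> g t = h t"
  shows "Lq_dt_t q g = Lq_dt_t q h"
proof -
  have "AE t in dt_t. xnorm (g t - h t) = 0" "AE t in dt_t. xnorm (h t - g t) = 0"
    using assms by (auto intro!: AE_I2)
  then have "strongly_measurable xnorm dt_t g \<longleftrightarrow> strongly_measurable xnorm dt_t h"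
    using xnorm.strongly_measurable_cong_AE by blast
  moreover have "(\<integral>\<^sup>+ t. epowr (xnorm (g t)) q \<partial>dt_t) = (\<integral>\<^sup>+ t. epowr (xnorm (h t)) q \<partial>dt_t)"
    using assms by (intro nn_integral_cong) simp
  ultimately show ?thesis by (simp add: Lq_dt_t_def Lp_norm_def)
qed

lemma Lq_dt_t_bump:
  fixes h :: "real \<Rightarrow> 'x::real_normed_vector"
  assumes q: "2 \<le> q" and h: "continuous_on {0<..} h" and b: "0 \<le> b" and w: "0 < w"
    and le: "\<And>t. 0 < t \<Longrightarrow> xnorm (h t) \<le> ennreal (b * bump w t)"
  shows "Lq_dt_t q h \<le> ennreal b"
proof (rule Lq_dt_t_le[OF q strongly_measurable_dt_t_continuous[OF h] w b])
  fix t :: real assume t: "0 < t"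
  show "norm (h t) \<le> b * (t * w / (t\<^sup>2 + w\<^sup>2))"
    using le[OF t] mult_nonneg_nonneg[OF b bump_nonneg[OF t w]]
    unfolding xnorm_def by (subst (asm) ennreal_le_iff) (simp_all add: bump_def)
qed

text \<open>\<open>T_loc\<close> is a chosen value of an integral over a ball. Since
  \<open>xnorm\<close> vanishes only at 0, that value is unique, and extension by zero identifies it
  with an integral over the whole space.\<close>

lemma T_loc_eq_kint:
  fixes f :: "'a::euclidean_space \<Rightarrow> 'x::banach"
  assumes f: "L1 (\<lambda>y. indicator (cball x (\<rho> x)) y *\<^sub>R f y)" and t: "0 < t"
  shows "T_loc \<rho> f x t = kint (\<lambda>y. indicator (cball x (\<rho> x)) y *\<^sub>R f y) x t"
proof -
  let ?S = "cball x (\<rho> x)"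
  let ?g = "\<lambda>y. indicator ?S y *\<^sub>R f y"
  have S: "?S \<in> sets lebesgue" by simp
  have M: "complete_measure (lebesgue_on ?S)"
    using complete_measure_lebesgue S by (rule complete_measure_restrict_space)
  have hg: "has_bochner xnorm lebesgue (\<lambda>y. kern t (x - y) *\<^sub>R ?g y) (kint ?g x t)"
    using f t by (rule has_bochner_kint)
  have sm: "strongly_measurable xnorm (lebesgue_on ?S) (\<lambda>y. kern t (x - y) *\<^sub>R f y)"
  proof (rule xnorm.strongly_measurable_cong_AE)
    show "strongly_measurable xnorm (lebesgue_on ?S) (\<lambda>y. kern t (x - y) *\<^sub>R ?g y)"
      using hg S by (intro xnorm.strongly_measurable_restrict) (auto simp: has_bochner_def)
    show "AE y in lebesgue_on ?S. xnorm (kern t (x - y) *\<^sub>R f y - kern t (x - y) *\<^sub>R ?g y) = 0"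
      by (auto intro!: AE_I2 simp: space_restrict_space)
  qed
  have "(\<integral>\<^sup>+ y. xnorm (kern t (x - y) *\<^sub>R f y) \<partial>lebesgue_on ?S) =
      (\<integral>\<^sup>+ y. xnorm (kern t (x - y) *\<^sub>R ?g y) \<partial>lebesgue)"
    by (subst nn_integral_restrict_space) (auto intro!: nn_integral_cong simp: indicator_def)
  also have "\<dots> < \<infinity>"
  proof -
    have "(\<integral>\<^sup>+ y. xnorm (kern t (x - y) *\<^sub>R ?g y) \<partial>lebesgue) \<le>
        (\<integral>\<^sup>+ y. ennreal (kern_const TYPE('a) / t ^ DIM('a)) * xnorm (?g y) \<partial>lebesgue)"
      unfolding xnorm_scaleR[of "kern _ _"] by (intro nn_integral_mono mult_right_mono ennreal_leI kern_le_time t) auto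
    also have "\<dots> = ennreal (kern_const TYPE('a) / t ^ DIM('a)) * (\<integral>\<^sup>+ y. xnorm (?g y) \<partial>lebesgue)"
      using f by (intro nn_integral_cmult borel_measurable_xnorm) (auto simp: L1_def)
    also have "\<dots> < \<infinity>" using f by (simp add: ennreal_mult_less_top L1_def)
    finally show ?thesis .
  qed
  finally have fin: "(\<integral>\<^sup>+ y. xnorm (kern t (x - y) *\<^sub>R f y) \<partial>lebesgue_on ?S) < \<infinity>" .
  have "has_bochner xnorm (lebesgue_on ?S) (\<lambda>y. kern t (x - y) *\<^sub>R f y) (T_loc \<rho> f x t)"
    unfolding T_loc_def kern_def[symmetric]
    by (rule xnorm.has_bochner_bochner[OF M seminorm_complete_xnorm sm fin])
  from xnorm.has_bochner_extend[OF S this]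
  have "has_bochner xnorm lebesgue (\<lambda>y. kern t (x - y) *\<^sub>R ?g y) (T_loc \<rho> f x t)"
    by (simp add: mult.commute)
  from has_bochner_unique[OF complete_measure_lebesgue this hg] show ?thesis .
qed

text \<open>A linearised Hoelder inequality for sets of finite measure: when \<open>u\<close> has
  size about \<open>A\<close> in L^p, both terms integrate to about \<open>A\<close> times the
  measure.\<close>

lemma le_add_epowr:
  assumes "1 \<le> p" "0 < A"
  shows "u \<le> ennreal A + ennreal (A powr (1 - p)) * epowr u p"
proof (cases u)
  case (real v)
  have "v \<le> A + A powr (1 - p) * v powr p"
  proof (cases "v \<le> A")
    case True
    then show ?thesis by (simp add: add_increasing2)
  next
    case False
    then have "v = v powr (1 - p) * v powr p" using assms by (simp add: powr_add[symmetric])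
    also have "\<dots> \<le> A powr (1 - p) * v powr p"
      using False assms by (intro mult_right_mono powr_mono2') auto
    finally show ?thesis using assms by simp
  qed
  then show ?thesis using real assms
    by (simp add: epowr_ennreal ennreal_mult[symmetric] ennreal_leI del: ennreal_plus flip: ennreal_plus)
qed (use assms in \<open>simp add: epowr_def ennreal_mult_top\<close>)

lemma nn_integral_kernel_le:
  fixes g :: "'a::euclidean_space \<Rightarrow> 'x::banach"
  assumes g: "L1 g" and b: "AE y in lebesgue. g y \<noteq> 0 \<longrightarrow> h y \<le> b"
  shows "(\<integral>\<^sup>+ y. ennreal (h y) * xnorm (g y) \<partial>lebesgue) \<le> ennreal b * (\<integral>\<^sup>+ y. xnorm (g y) \<partial>lebesgue)"
proof -
  have "(\<integral>\<^sup>+ y. ennreal (h y) * xnorm (g y) \<partial>lebesgue) \<le> (\<integral>\<^sup>+ y. ennreal b * xnorm (g y) \<partial>lebesgue)"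
  proof (rule nn_integral_mono_AE)
    show "AE y in lebesgue. ennreal (h y) * xnorm (g y) \<le> ennreal b * xnorm (g y)"
      using b
    proof eventually_elim
      case (elim y)
      then show ?case by (cases "g y = 0") (auto intro: mult_right_mono ennreal_leI)
    qed
  qed
  also have "\<dots> = ennreal b * (\<integral>\<^sup>+ y. xnorm (g y) \<partial>lebesgue)"
    using g by (intro nn_integral_cmult borel_measurable_xnorm) (simp add: L1_def)
  finally show ?thesis .
qed

lemma xnorm_kint_le_const:
  assumes "L1 g" "0 < t" "AE y in lebesgue. g y \<noteq> 0 \<longrightarrow> \<bar>kern t (x - y)\<bar> \<le> b"
  shows "xnorm (kint g x t) \<le> ennreal b * (\<integral>\<^sup>+ y. xnorm (g y) \<partial>lebesgue)"
  using xnorm_kint_le[OF assms(1,2)] nn_integral_kernel_le[OF assms(1,3)] by (rule order_trans)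

text \<open>The vanishing integral of \<open>g\<close> allows any constant \<open>k\<close> to be
  subtracted from the kernel.\<close>

lemma xnorm_kint_cancel_le_const:
  assumes "L1 g" "0 < t" "has_bochner xnorm lebesgue g 0"
    "AE y in lebesgue. g y \<noteq> 0 \<longrightarrow> \<bar>kern t (x - y) - k\<bar> \<le> b"
  shows "xnorm (kint g x t) \<le> ennreal b * (\<integral>\<^sup>+ y. xnorm (g y) \<partial>lebesgue)"
proof -
  have "has_bochner xnorm lebesgue (\<lambda>y. kern t (x - y) *\<^sub>R g y - k *\<^sub>R g y) (kint g x t - k *\<^sub>R 0)"
    by (intro xnorm.has_bochner_diff xnorm.has_bochner_scaleR complete_measure_lebesgue has_bochner_kint assms)
  from xnorm.has_bochner_bound[OF complete_measure_lebesgue this]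
  have "xnorm (kint g x t) \<le> (\<integral>\<^sup>+ y. ennreal \<bar>kern t (x - y) - k\<bar> * xnorm (g y) \<partial>lebesgue)"
    by (simp add: xnorm_scaleR scaleR_diff_left[symmetric])
  then show ?thesis using nn_integral_kernel_le[OF assms(1,4)] by (rule order_trans)
qed

lemma ennreal_le_suminf: "f k \<le> (\<Sum>k. f k :: ennreal)"
  using sum_le_suminf[of f "{k}"] by simp

text \<open>Where \<open>dist x x0\<close> lies between \<open>2 ^ k * r\<close> and
  \<open>2 ^ (k + 1) * r\<close>, the integrand is at most
  \<open>r / (2 ^ k * r) ^ (DIM('a) + 1)\<close>. Integrated over the larger ball this gives the
  volume of the unit ball times \<open>2 ^ DIM('a) / 2 ^ k\<close>, which is summable in
  \<open>k\<close>.\<close>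

lemma nn_integral_tail_le:
  fixes x0 :: "'a::euclidean_space"
  assumes r: "0 < r"
  shows "(\<integral>\<^sup>+ x. ennreal (r / dist x x0 ^ (DIM('a) + 1)) * indicator (- ball x0 (2 * r)) x \<partial>lebesgue)
    \<le> ennreal (2 * 2 ^ DIM('a) * measure lebesgue (ball (0::'a) 1))"
proof -
  let ?d = "DIM('a)" and ?\<omega> = "measure lebesgue (ball (0::'a) 1)"
  let ?F = "\<lambda>k x. ennreal (r / (2 ^ k * r) ^ (?d + 1)) * indicator (ball x0 (2 ^ (k + 1) * r)) x"
  have "(\<integral>\<^sup>+ x. ennreal (r / dist x x0 ^ (?d + 1)) * indicator (- ball x0 (2 * r)) x \<partial>lebesgue)
      \<le> (\<integral>\<^sup>+ x. (\<Sum>k. ?F k x) \<partial>lebesgue)"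
  proof (rule nn_integral_mono)
    fix x
    show "ennreal (r / dist x x0 ^ (?d + 1)) * indicator (- ball x0 (2 * r)) x \<le> (\<Sum>k. ?F k x)"
    proof (cases "x \<in> ball x0 (2 * r)")
      case False
      define z where "z = dist x x0"
      have z: "2 * r \<le> z" using False by (simp add: z_def dist_commute)
      obtain n where n: "z / r < 2 ^ n" using real_arch_pow[of 2 "z / r"] by auto
      then have ex: "\<exists>n. z < 2 ^ n * r" using r by (auto simp: field_simps)
      define m where "m = (LEAST n. z < 2 ^ n * r)"
      have m: "z < 2 ^ m * r" unfolding m_def using ex by (rule LeastI_ex)
      have "m \<noteq> 0" using m z r by (intro notI) simp
      then obtain k where k: "m = Suc k" by (cases m) auto
      have zk: "2 ^ k * r \<le> z"
        using not_less_Least[of k "\<lambda>n. z < 2 ^ n * r"] k by (simp add: m_def[symmetric])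
      have "r / z ^ (?d + 1) \<le> r / (2 ^ k * r) ^ (?d + 1)"
        using zk r z by (intro divide_left_mono power_mono mult_pos_pos zero_less_power) auto
      moreover have "x \<in> ball x0 (2 ^ (k + 1) * r)" using m by (simp add: k z_def dist_commute)
      ultimately have "ennreal (r / z ^ (?d + 1)) \<le> ?F k x" by (simp add: ennreal_leI del: power_Suc power_Suc2)
      also have "\<dots> \<le> (\<Sum>k. ?F k x)"
        by (rule ennreal_le_suminf)
      finally show ?thesis by (simp add: z_def indicator_def)
    qed simp
  qed
  also have "\<dots> = (\<Sum>k. \<integral>\<^sup>+ x. ?F k x \<partial>lebesgue)"
    by (rule nn_integral_suminf)
      (rule borel_measurable_times_ennreal[OF borel_measurable_const borel_measurable_indicator], simp)
  also have "\<dots> = (\<Sum>k. ennreal (2 ^ ?d * ?\<omega> * (1 / 2) ^ k))"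
  proof (rule suminf_cong)
    fix k
    have "(\<integral>\<^sup>+ x. ?F k x \<partial>lebesgue) = ennreal (r / (2 ^ k * r) ^ (?d + 1)) * emeasure lebesgue (ball x0 (2 ^ (k + 1) * r))"
      by (rule nn_integral_cmult_indicator) simp
    also have "\<dots> = ennreal (r / (2 ^ k * r) ^ (?d + 1)) * ennreal ((2 ^ (k + 1) * r) ^ ?d * ?\<omega>)"
      using r by (subst emeasure_lebesgue_ball) auto
    also have "\<dots> = ennreal (r / (2 ^ k * r) ^ (?d + 1) * ((2 ^ (k + 1) * r) ^ ?d * ?\<omega>))"
      using r by (intro ennreal_mult[symmetric]) auto
    also have "r / (2 ^ k * r) ^ (?d + 1) * ((2 ^ (k + 1) * r) ^ ?d * ?\<omega>) = 2 ^ ?d * ?\<omega> * (1 / 2) ^ k"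
    proof -
      have "2 ^ (k + 1) * r = 2 * (2 ^ k * r)" by simp
      then have "(2 ^ (k + 1) * r) ^ ?d = 2 ^ ?d * (2 ^ k * r) ^ ?d"
        by (simp only: power_mult_distrib[of 2 "2 ^ k * r"])
      moreover have "r / (2 ^ k * r) ^ (?d + 1) = (1 / 2) ^ k / (2 ^ k * r) ^ ?d"
        using r by (simp add: power_divide)
      ultimately show ?thesis using r by simp
    qed
    finally show "(\<integral>\<^sup>+ x. ?F k x \<partial>lebesgue) = ennreal (2 ^ ?d * ?\<omega> * (1 / 2) ^ k)" .
  qed
  also have "\<dots> = ennreal (\<Sum>k. 2 ^ ?d * ?\<omega> * (1 / 2) ^ k)"
    by (intro suminf_ennreal2 summable_mult summable_geometric) auto
  also have "(\<Sum>k. 2 ^ ?d * ?\<omega> * (1 / 2 :: real) ^ k) = 2 * 2 ^ ?d * ?\<omega>"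
    by (subst suminf_mult) (auto intro: summable_geometric simp: suminf_geometric)
  finally show ?thesis .
qed

section \<open>Setting common to the two endpoint estimates\<close>

locale local_square_function =
  fixes \<rho> :: "'a::euclidean_space \<Rightarrow> real"
    and T :: "('a \<Rightarrow> 'x::banach) \<Rightarrow> 'a \<Rightarrow> real \<Rightarrow> 'x"
    and q p C C0 \<kappa> \<omega> :: real and d :: nat
  assumes \<kappa>_def: "\<kappa> = kern_const TYPE('a)" and \<omega>_def: "\<omega> = measure lebesgue (ball (0::'a) 1)"
    and d_def: "d = DIM('a)"
    and T_def: "T = T_loc \<rho>" and q: "2 \<le> q" and p: "1 < p" and C: "0 \<le> C"
    and bounded: "\<And>f. Lp_norm xnorm lebesgue p f < \<infinity> \<Longrightarrow>
      Lp_norm (Lq_dt_t q) lebesgue p (T f) \<le> ennreal C * Lp_norm xnorm lebesgue p f"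
    and rho_pos: "\<And>x. 0 < \<rho> x" and C0: "1 \<le> C0"
    and comparable1: "\<And>x y. dist x y \<le> 2 * \<rho> x \<Longrightarrow> \<rho> x \<le> C0 * \<rho> y"
    and comparable2: "\<And>x y. dist x y \<le> 2 * \<rho> x \<Longrightarrow> \<rho> y \<le> C0 * \<rho> x"
begin

abbreviation N :: "(real \<Rightarrow> 'x) \<Rightarrow> ennreal" where "N \<equiv> Lq_dt_t q"

sublocale N: ext_seminorm N
  using q by (intro ext_seminorm_Lq_dt_t) simp

abbreviation cut :: "'a \<Rightarrow> ('a \<Rightarrow> 'x) \<Rightarrow> 'a \<Rightarrow> 'x" where "cut x f \<equiv> \<lambda>y. indicator (cball x (\<rho> x)) y *\<^sub>R f y"

lemma \<kappa>_nonneg: "0 \<le> \<kappa>" unfolding \<kappa>_def by (rule kern_const_nonneg)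

lemmas kernel_le_time = kern_le_time[where 'a='a, folded \<kappa>_def]
lemmas kernel_le = kern_le[where 'a='a, folded \<kappa>_def]
lemmas kernel_diff_le = kern_diff_le[where 'a='a, folded \<kappa>_def]
lemmas emeasure_ball_eq = emeasure_lebesgue_ball[where 'a='a, folded \<omega>_def]
lemmas measure_ball_eq = measure_lebesgue_ball[where 'a='a, folded \<omega>_def]
lemmas tail_le = nn_integral_tail_le[where 'a='a, folded \<omega>_def]

lemma \<omega>_pos: "0 < \<omega>" unfolding \<omega>_def using content_ball_pos[of 1 "0::'a"] by simp

lemma N_complete: "seminorm_complete N"
  using q by (intro seminorm_complete_Lq_dt_t) simp

lemma T_eq: "L1 (cut x f) \<Longrightarrow> 0 < t \<Longrightarrow> T f x t = kint (cut x f) x t"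
  unfolding T_def by (rule T_loc_eq_kint)

lemma cut_L1: "L1 f \<Longrightarrow> L1 (cut x f)"
  by (rule L1_indicator) auto

lemma T_continuous:
  assumes "L1 (cut x f)"
  shows "continuous_on {0<..} (T f x)"
  by (rule continuous_on_eq[OF kint_continuous[OF assms, of x]]) (simp add: T_eq[OF assms])

lemma nn_integral_cut_le: "(\<integral>\<^sup>+ y. xnorm (cut x f y) \<partial>lebesgue) \<le> (\<integral>\<^sup>+ y. xnorm (f y) \<partial>lebesgue)"
  by (intro nn_integral_mono) (auto simp: indicator_def)

text \<open>Here \<open>A\<close> is the height of \<open>f\<close> and \<open>m\<close> the size of
  the set on which it lives. Measurability of \<open>T f\<close> comes with the L^p bound; the
  estimate of the integral combines that bound with \<open>le_add_epowr\<close> at the same height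
  \<open>A\<close>, so that the powers of \<open>A\<close> cancel to a single factor.\<close>

lemma T_local:
  assumes f: "strongly_measurable xnorm lebesgue f" and A: "0 < A" and m: "0 \<le> m"
    and I: "(\<integral>\<^sup>+ y. ennreal (norm (f y) powr p) \<partial>lebesgue) \<le> ennreal (A powr p * m)"
  shows "strongly_measurable N lebesgue (T f)"
    and "E \<in> sets lebesgue \<Longrightarrow> emeasure lebesgue E \<le> ennreal e \<Longrightarrow> 0 \<le> e \<Longrightarrow>
      (\<integral>\<^sup>+ x. N (T f x) * indicator E x \<partial>lebesgue) \<le> ennreal (A * (e + C powr p * m))"
proof -
  have pm: "(m powr (1 / p)) powr p = m" using p m by (simp add: powr_powr)
  have b: "Lp_norm xnorm lebesgue p f \<le> ennreal (A * m powr (1 / p))"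
    using f I A p by (subst Lp_norm_le_iff) (auto simp: epowr_xnorm powr_mult pm)
  then have "Lp_norm xnorm lebesgue p f < \<infinity>" by (rule order.strict_trans1) simp
  from bounded[OF this] have "Lp_norm N lebesgue p (T f) \<le> ennreal C * ennreal (A * m powr (1 / p))"
    by (rule order_trans) (intro mult_left_mono b, simp)
  also have "\<dots> = ennreal (C * (A * m powr (1 / p)))" using C A by (simp add: ennreal_mult)
  finally have Lp: "Lp_norm N lebesgue p (T f) \<le> ennreal (C * (A * m powr (1 / p)))" .
  have Tf: "strongly_measurable N lebesgue (T f)"
    and TI: "(\<integral>\<^sup>+ x. epowr (N (T f x)) p \<partial>lebesgue) \<le> ennreal ((C * (A * m powr (1 / p))) powr p)"
    using Lp A C p by (simp_all add: Lp_norm_le_iff)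
  show "strongly_measurable N lebesgue (T f)" by (rule Tf)
  assume E: "E \<in> sets lebesgue" and e: "emeasure lebesgue E \<le> ennreal e" "0 \<le> e"
  have [measurable]: "(\<lambda>x. N (T f x)) \<in> borel_measurable lebesgue" "E \<in> sets lebesgue"
    using N.borel_measurable_seminorm[OF complete_measure_lebesgue Tf] E by auto
  have "(\<integral>\<^sup>+ x. N (T f x) * indicator E x \<partial>lebesgue) \<le>
      (\<integral>\<^sup>+ x. ennreal A * indicator E x + ennreal (A powr (1 - p)) * epowr (N (T f x)) p \<partial>lebesgue)"
    using le_add_epowr[of p A] p A by (intro nn_integral_mono) (auto simp: indicator_def)
  also have "\<dots> = ennreal A * emeasure lebesgue E + ennreal (A powr (1 - p)) * (\<integral>\<^sup>+ x. epowr (N (T f x)) p \<partial>lebesgue)"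
    by (simp add: nn_integral_add nn_integral_cmult nn_integral_cmult_indicator)
  also have "\<dots> \<le> ennreal A * ennreal e + ennreal (A powr (1 - p)) * ennreal ((C * (A * m powr (1 / p))) powr p)"
    by (intro add_mono mult_left_mono e TI) auto
  also have "\<dots> = ennreal (A * e + A powr (1 - p) * (C * (A * m powr (1 / p))) powr p)"
    using A e by (simp add: ennreal_mult[symmetric] del: ennreal_plus flip: ennreal_plus)
  also have "A powr (1 - p) * (C * (A * m powr (1 / p))) powr p = A * (C powr p * m)"
  proof -
    have "A powr (1 - p) * (C * (A * m powr (1 / p))) powr p = (A powr (1 - p) * A powr p) * (C powr p * m)"
      by (simp add: powr_mult pm)
    also have "A powr (1 - p) * A powr p = A" using A by (simp add: powr_add[symmetric])
    finally show ?thesis .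
  qed
  finally show "(\<integral>\<^sup>+ x. N (T f x) * indicator E x \<partial>lebesgue) \<le> ennreal (A * (e + C powr p * m))"
    by (simp add: distrib_left)
qed

subsection \<open>Atoms\<close>

lemma atom_L1:
  assumes a: "H1_atom \<rho> xnorm x0 r a"
  shows "L1 a" "(\<integral>\<^sup>+ y. xnorm (a y) \<partial>lebesgue) \<le> 1"
    "AE y in lebesgue. a y \<noteq> 0 \<longrightarrow> dist y x0 < r" "0 < r"
proof -
  have sm: "strongly_measurable xnorm lebesgue a" and r: "0 < r"
    and supp: "AE x in lebesgue. x \<notin> ball x0 r \<longrightarrow> xnorm (a x) = 0"
    and bd: "AE x in lebesgue. xnorm (a x) \<le> ennreal (1 / measure lebesgue (ball x0 r))"
    using a by (auto simp: H1_atom_def)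
  have m: "0 < measure lebesgue (ball x0 r)" using content_ball_pos[OF r, of x0] by simp
  have em: "emeasure lebesgue (ball x0 r) = ennreal (measure lebesgue (ball x0 r))"
    using emeasure_bounded_finite[OF bounded_ball, of x0 r] by (intro emeasure_eq_ennreal_measure) simp
  have "(\<integral>\<^sup>+ y. xnorm (a y) \<partial>lebesgue) \<le> (\<integral>\<^sup>+ y. ennreal (1 / measure lebesgue (ball x0 r)) * indicator (ball x0 r) y \<partial>lebesgue)"
  proof (rule nn_integral_mono_AE)
    show "AE y in lebesgue. xnorm (a y) \<le> ennreal (1 / measure lebesgue (ball x0 r)) * indicator (ball x0 r) y"
      using supp bd by eventually_elim (auto simp: indicator_def)
  qed
  also have "\<dots> = ennreal (1 / measure lebesgue (ball x0 r)) * emeasure lebesgue (ball x0 r)"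
    by (rule nn_integral_cmult_indicator) simp
  also have "\<dots> = ennreal (1 / measure lebesgue (ball x0 r) * measure lebesgue (ball x0 r))"
    unfolding em using m by (intro ennreal_mult[symmetric]) auto
  also have "\<dots> = 1" using m by simp
  finally show I: "(\<integral>\<^sup>+ y. xnorm (a y) \<partial>lebesgue) \<le> 1" .
  then show "L1 a" using sm by (auto simp: L1_def elim: order.strict_trans1)
  show "AE y in lebesgue. a y \<noteq> 0 \<longrightarrow> dist y x0 < r"
    using supp by eventually_elim (auto simp: dist_commute)
  show "0 < r" by (rule r)
qed

lemma atom_disjoint:
  assumes a: "H1_atom \<rho> xnorm x0 r a" and far: "\<rho> x + r \<le> dist x x0"
  shows "N (T a x) = 0"
proof -
  note A = atom_L1[OF a]
  have "AE y in lebesgue. cut x a y = 0"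
    using A(3)
  proof eventually_elim
    case (elim y)
    show ?case
    proof (cases "a y = 0")
      case False
      then have "\<rho> x < dist x y" using elim far dist_triangle[of x x0 y] by (simp add: dist_commute)
      then show ?thesis by simp
    qed simp
  qed
  then have eq: "AE y in lebesgue. (\<lambda>_. 0) y = cut x a y" by eventually_elim simp
  have "T a x t = 0" if t: "0 < t" for t
    using kint_cong_AE(2)[OF L1_zero eq t, of x] T_eq[OF cut_L1[OF A(1)] t] kint_zero[OF t, of x] by simp
  then have "N (T a x) = N (\<lambda>_. 0)" by (rule Lq_dt_t_cong)
  also have "\<dots> = 0" using N.zero by (simp add: zero_fun_def)
  finally show ?thesis .
qed

text \<open>Every point of the atom's ball is at least half as far from \<open>x\<close> as the
  centre, so the width can be fixed at \<open>dist x x0\<close>.\<close>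

lemma atom_size:
  assumes a: "H1_atom \<rho> xnorm x0 r a" and far: "2 * r \<le> dist x x0"
  shows "N (T a x) \<le> ennreal (\<kappa> / dist x x0 ^ DIM('a))"
proof -
  note A = atom_L1[OF a]
  let ?z = "dist x x0"
  have z: "0 < ?z" using far A(4) by linarith
  have L: "L1 (cut x a)" using A(1) by (rule cut_L1)
  show ?thesis
  proof (rule Lq_dt_t_bump[OF q T_continuous[OF L] _ z])
    show "0 \<le> \<kappa> / ?z ^ DIM('a)" using \<kappa>_nonneg by simp
    fix t :: real assume t: "0 < t"
    have "AE y in lebesgue. cut x a y \<noteq> 0 \<longrightarrow> \<bar>kern t (x - y)\<bar> \<le> \<kappa> / ?z ^ DIM('a) * bump ?z t"
      using A(3)
    proof eventually_elim
      case (elim y)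
      show ?case
      proof
        assume "cut x a y \<noteq> 0"
        then have "dist y x0 < r" using elim by auto
        then have "?z / 2 \<le> norm (x - y)"
          using far dist_triangle[of x x0 y] by (simp add: dist_norm[symmetric])
        then show "\<bar>kern t (x - y)\<bar> \<le> \<kappa> / ?z ^ DIM('a) * bump ?z t" using t z by (intro kernel_le)
      qed
    qed
    from xnorm_kint_le_const[OF L t this]
    have "xnorm (T a x t) \<le> ennreal (\<kappa> / ?z ^ DIM('a) * bump ?z t) * (\<integral>\<^sup>+ y. xnorm (cut x a y) \<partial>lebesgue)"
      using T_eq[OF L t] by simp
    also have "\<dots> \<le> ennreal (\<kappa> / ?z ^ DIM('a) * bump ?z t) * 1"
      using nn_integral_cut_le[of x a] A(2) by (intro mult_left_mono order_trans[OF nn_integral_cut_le]) auto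
    finally show "xnorm (T a x t) \<le> ennreal (\<kappa> / ?z ^ DIM('a) * bump ?z t)" by simp
  qed
qed

text \<open>The atom's ball lies inside the truncation at \<open>x\<close>, so cutting leaves the
  atom and its vanishing integral intact; the value of the kernel at the centre is then
  subtracted.\<close>

lemma atom_smooth:
  assumes a: "H1_atom \<rho> xnorm x0 r a" and r: "r < \<rho> x0" and far: "2 * r \<le> dist x x0" and near: "dist x x0 + r \<le> \<rho> x"
  shows "N (T a x) \<le> ennreal (\<kappa> * (r / dist x x0 ^ (DIM('a) + 1)))"
proof -
  note A = atom_L1[OF a]
  have cancel: "has_bochner xnorm lebesgue a 0" using a r by (simp add: H1_atom_def)
  let ?z = "dist x x0"
  have z: "0 < ?z" using far A(4) by linarith
  have L: "L1 (cut x a)" using A(1) by (rule cut_L1)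
  have eq: "AE y in lebesgue. cut x a y = a y"
    using A(3)
  proof eventually_elim
    case (elim y)
    show ?case
    proof (cases "a y = 0")
      case False
      then have "dist x y \<le> \<rho> x" using elim near dist_triangle[of x y x0] by (simp add: dist_commute)
      then show ?thesis by simp
    qed simp
  qed
  show ?thesis
  proof (rule Lq_dt_t_bump[OF q T_continuous[OF L] _ z])
    show "0 \<le> \<kappa> * (r / ?z ^ (DIM('a) + 1))" using \<kappa>_nonneg A(4) by simp
    fix t :: real assume t: "0 < t"
    have "AE y in lebesgue. a y \<noteq> 0 \<longrightarrow> \<bar>kern t (x - y) - kern t (x - x0)\<bar> \<le> \<kappa> * (r / ?z ^ (DIM('a) + 1)) * bump ?z t"
      using A(3)
    proof eventually_elim
      case (elim y)
      show ?case
      proof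
        assume "a y \<noteq> 0"
        then have y: "norm (y - x0) < r" using elim by (simp add: dist_norm)
        have "\<bar>kern t (x - x0) - kern t (x - y)\<bar> \<le> \<kappa> * norm ((x - x0) - (x - y)) / ?z ^ (DIM('a) + 1) * bump ?z t"
          using y far z t by (intro kernel_diff_le) (auto simp: dist_norm)
        also have "\<dots> \<le> \<kappa> * r / ?z ^ (DIM('a) + 1) * bump ?z t"
          using y z t \<kappa>_nonneg by (intro mult_right_mono divide_right_mono mult_left_mono bump_nonneg) auto
        finally show "\<bar>kern t (x - y) - kern t (x - x0)\<bar> \<le> \<kappa> * (r / ?z ^ (DIM('a) + 1)) * bump ?z t"
          by (simp add: abs_minus_commute)
      qed
    qed
    from xnorm_kint_cancel_le_const[OF A(1) t cancel this]
    have "xnorm (kint a x t) \<le> ennreal (\<kappa> * (r / ?z ^ (DIM('a) + 1)) * bump ?z t) * (\<integral>\<^sup>+ y. xnorm (a y) \<partial>lebesgue)" .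
    also have "\<dots> \<le> ennreal (\<kappa> * (r / ?z ^ (DIM('a) + 1)) * bump ?z t) * 1"
      by (intro mult_left_mono A(2)) auto
    finally show "xnorm (T a x t) \<le> ennreal (\<kappa> * (r / ?z ^ (DIM('a) + 1)) * bump ?z t)"
      using T_eq[OF L t] kint_cong_AE(2)[OF L eq t, of x] by simp
  qed
qed

text \<open>An atom has height \<open>1 / m\<close> on a set of measure \<open>m\<close>; these
  factors cancel, so the bound is the same for all balls.\<close>

lemma atom_Lp:
  assumes a: "H1_atom \<rho> xnorm x0 r a"
  shows "strongly_measurable N lebesgue (T a)"
    and "1 \<le> L \<Longrightarrow> (\<integral>\<^sup>+ x. N (T a x) * indicator (ball x0 (L * r)) x \<partial>lebesgue) \<le> ennreal (L ^ DIM('a) + C powr p)"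
proof -
  have sm: "strongly_measurable xnorm lebesgue a" and r: "0 < r"
    and supp: "AE x in lebesgue. x \<notin> ball x0 r \<longrightarrow> xnorm (a x) = 0"
    and bd: "AE x in lebesgue. xnorm (a x) \<le> ennreal (1 / measure lebesgue (ball x0 r))"
    using a by (auto simp: H1_atom_def)
  define m where "m = measure lebesgue (ball x0 r)"
  have m: "0 < m" unfolding m_def using content_ball_pos[OF r, of x0] by simp
  have em: "emeasure lebesgue (ball x0 r) = ennreal m"
    unfolding m_def using emeasure_bounded_finite[OF bounded_ball, of x0 r] by (intro emeasure_eq_ennreal_measure) simp
  have "(\<integral>\<^sup>+ y. ennreal (norm (a y) powr p) \<partial>lebesgue) \<le> (\<integral>\<^sup>+ y. ennreal ((1 / m) powr p) * indicator (ball x0 r) y \<partial>lebesgue)"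
  proof (rule nn_integral_mono_AE)
    show "AE y in lebesgue. ennreal (norm (a y) powr p) \<le> ennreal ((1 / m) powr p) * indicator (ball x0 r) y"
      using supp bd
    proof eventually_elim
      case (elim y)
      have "norm (a y) \<le> 1 / m" using elim(2) m unfolding xnorm_def m_def[symmetric] by simp
      then have "norm (a y) powr p \<le> (1 / m) powr p" using p by (intro powr_mono2) auto
      then show ?case using elim(1) p by (auto simp: indicator_def intro: ennreal_leI)
    qed
  qed
  also have "\<dots> = ennreal ((1 / m) powr p) * emeasure lebesgue (ball x0 r)"
    by (rule nn_integral_cmult_indicator) simp
  also have "\<dots> = ennreal ((1 / m) powr p * m)"
    unfolding em using m by (intro ennreal_mult[symmetric]) auto
  finally have I: "(\<integral>\<^sup>+ y. ennreal (norm (a y) powr p) \<partial>lebesgue) \<le> ennreal ((1 / m) powr p * m)" .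
  have m1: "0 < 1 / m" using m by simp
  show "strongly_measurable N lebesgue (T a)" using T_local(1)[OF sm m1 less_imp_le[OF m] I] .
  assume L: "1 \<le> L"
  have "emeasure lebesgue (ball x0 (L * r)) \<le> ennreal (L ^ DIM('a) * m)"
    using L r measure_ball_eq[of r x0] emeasure_ball_eq[of "L * r" x0]
    by (simp add: m_def power_mult_distrib mult.assoc)
  from T_local(2)[OF sm m1 less_imp_le[OF m] I _ this] L m
  have "(\<integral>\<^sup>+ x. N (T a x) * indicator (ball x0 (L * r)) x \<partial>lebesgue) \<le> ennreal (1 / m * (L ^ DIM('a) * m + C powr p * m))"
    by simp
  also have "1 / m * (L ^ DIM('a) * m + C powr p * m) = L ^ DIM('a) + C powr p"
    using m by (simp add: field_simps)
  finally show "(\<integral>\<^sup>+ x. N (T a x) * indicator (ball x0 (L * r)) x \<partial>lebesgue) \<le> ennreal (L ^ DIM('a) + C powr p)" .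
qed

text \<open>The first two summands come from the L^p estimate near the ball, the third from
  cancellation farther out (\<open>tail_le\<close>), the last from the size of the kernel at
  distances of order \<open>\<rho> x0\<close> times the volume of the ball of radius
  \<open>3 * C0 * \<rho> x0\<close>; there the powers of \<open>\<rho> x0\<close> cancel.\<close>

definition K_atom :: real where
  "K_atom = (3 * C0) ^ d + C powr p + \<kappa> * (2 * 2 ^ d * \<omega>) + \<kappa> * (2 * C0) ^ d * (3 * C0) ^ d * \<omega>"

lemma K_atom_ge: "(3 * C0) ^ d + C powr p \<le> K_atom" "0 \<le> K_atom"
  using \<kappa>_nonneg \<omega>_pos C0 by (auto simp: K_atom_def intro!: add_nonneg_nonneg mult_nonneg_nonneg)

lemma atom_bound:
  assumes a: "H1_atom \<rho> xnorm x0 r a"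
  shows "(\<integral>\<^sup>+ x. N (T a x) \<partial>lebesgue) \<le> ennreal K_atom"
proof -
  note A = atom_L1[OF a]
  have r: "0 < r" by (rule A(4))
  \<comment> \<open>If the atom's ball is neither inside nor outside the truncation,
    \<open>dist x x0\<close> and \<open>\<rho> x\<close> differ by less than \<open>r\<close>, which
    is at most half of \<open>dist x x0\<close>. Hence these two are comparable, and then
    \<open>\<rho> x\<close> is comparable with \<open>\<rho> x0\<close>.\<close>
  have between: "dist x x0 < 3 * C0 * \<rho> x0 \<and> \<rho> x0 \<le> 2 * C0 * dist x x0"
    if far: "2 * r \<le> dist x x0" and n: "\<not> \<rho> x + r \<le> dist x x0" "\<not> dist x x0 + r \<le> \<rho> x" for x
  proof -
    have h: "dist x x0 \<le> 2 * \<rho> x" "\<rho> x \<le> 3 / 2 * dist x x0" using far n r by auto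
    have 1: "\<rho> x \<le> C0 * \<rho> x0" "\<rho> x0 \<le> C0 * \<rho> x" using comparable1[OF h(1)] comparable2[OF h(1)] .
    have "\<rho> x0 \<le> C0 * (3 / 2 * dist x x0)" using 1(2) h(2) C0 by (meson mult_left_mono order_trans zero_le_one)
    also have "\<dots> \<le> C0 * (2 * dist x x0)" using C0 by (intro mult_left_mono) auto
    finally have 2: "\<rho> x0 \<le> 2 * C0 * dist x x0" by simp
    have "0 < C0 * \<rho> x0" using C0 rho_pos by simp
    then have "dist x x0 < 3 * (C0 * \<rho> x0)" using h(1) 1(1) by linarith
    then show ?thesis using 2 by simp
  qed
  show ?thesis
  proof (cases "r < \<rho> x0")
    case False
    \<comment> \<open>An atom on a large ball need not have cancellation, but truncation confines
      \<open>T a\<close>. If \<open>x\<close> could see the ball, then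
      \<open>dist x x0 \<le> 2 * \<rho> x\<close>, so
      \<open>\<rho> x \<le> C0 * \<rho> x0 \<le> C0 * r\<close>, and \<open>x\<close> would be
      closer than \<open>3 * C0 * r\<close>.\<close>
    have zero: "N (T a x) = 0" if x: "x \<notin> ball x0 (3 * C0 * r)" for x
    proof -
      have z: "3 * C0 * r \<le> dist x x0" using x by (simp add: dist_commute)
      have r3: "3 * r \<le> 3 * C0 * r" using r C0 by simp
      show ?thesis
      proof (rule atom_disjoint[OF a], rule ccontr)
        assume n: "\<not> \<rho> x + r \<le> dist x x0"
        have h: "dist x x0 \<le> 2 * \<rho> x" using n z r3 rho_pos[of x] by linarith
        have "\<rho> x \<le> C0 * \<rho> x0" using comparable1[OF h] .
        also have "\<dots> \<le> C0 * r" using False C0 by (intro mult_left_mono) auto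
        finally have "dist x x0 \<le> 2 * (C0 * r)" using h by simp
        moreover have "0 < C0 * r" using C0 r by simp
        ultimately show False using z by simp
      qed
    qed
    have "(\<integral>\<^sup>+ x. N (T a x) \<partial>lebesgue) = (\<integral>\<^sup>+ x. N (T a x) * indicator (ball x0 (3 * C0 * r)) x \<partial>lebesgue)"
    proof (rule nn_integral_cong)
      fix x
      show "N (T a x) = N (T a x) * indicator (ball x0 (3 * C0 * r)) x"
        using zero[of x] by (cases "x \<in> ball x0 (3 * C0 * r)") simp_all
    qed
    also have "\<dots> \<le> ennreal ((3 * C0) ^ DIM('a) + C powr p)"
      using C0 by (intro atom_Lp(2)[OF a]) simp
    also have "\<dots> \<le> ennreal K_atom" using K_atom_ge(1) by (intro ennreal_leI) (simp add: d_def)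
    finally show ?thesis .
  next
    case True
    let ?D = "\<kappa> * (2 * C0 / \<rho> x0) ^ DIM('a)"
    let ?g1 = "\<lambda>x. N (T a x) * indicator (ball x0 (2 * r)) x"
    let ?g2 = "\<lambda>x. ennreal \<kappa> * (ennreal (r / dist x x0 ^ (DIM('a) + 1)) * indicator (- ball x0 (2 * r)) x)"
    let ?g3 = "\<lambda>x. ennreal ?D * indicator (ball x0 (3 * C0 * \<rho> x0)) x"
    have Tm: "(\<lambda>x. N (T a x)) \<in> borel_measurable lebesgue"
      by (rule N.borel_measurable_seminorm[OF complete_measure_lebesgue atom_Lp(1)[OF a]])
    have D0: "0 \<le> ?D" using \<kappa>_nonneg C0 rho_pos[of x0] by simp
    have B: "ball x0 (2 * r) \<in> sets lebesgue" "- ball x0 (2 * r) \<in> sets lebesgue"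
      "ball x0 (3 * C0 * \<rho> x0) \<in> sets lebesgue" by auto
    have dm: "(\<lambda>x. r / dist x x0 ^ (DIM('a) + 1)) \<in> borel_measurable lebesgue"
      by (intro measurable_completion) measurable
    have m1: "?g1 \<in> borel_measurable lebesgue" using Tm B by measurable
    have m2: "(\<lambda>x. ennreal (r / dist x x0 ^ (DIM('a) + 1)) * indicator (- ball x0 (2 * r)) x) \<in> borel_measurable lebesgue"
      using dm B(2) by (intro borel_measurable_times_ennreal borel_measurable_indicator measurable_compose[OF dm measurable_ennreal])
    have m2': "?g2 \<in> borel_measurable lebesgue"
      by (rule borel_measurable_times_ennreal[OF borel_measurable_const m2])
    have m3: "?g3 \<in> borel_measurable lebesgue" using B(3) by (intro borel_measurable_times_ennreal borel_measurable_indicator) auto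
    have "(\<integral>\<^sup>+ x. N (T a x) \<partial>lebesgue) \<le> (\<integral>\<^sup>+ x. ?g1 x + (?g2 x + ?g3 x) \<partial>lebesgue)"
    proof (rule nn_integral_mono)
      fix x
      show "N (T a x) \<le> ?g1 x + (?g2 x + ?g3 x)"
      proof (cases "x \<in> ball x0 (2 * r)")
        case True
        then show ?thesis by simp
      next
        case False
        then have far: "2 * r \<le> dist x x0" by (simp add: dist_commute)
        consider "\<rho> x + r \<le> dist x x0" | "dist x x0 + r \<le> \<rho> x"
          | "\<not> \<rho> x + r \<le> dist x x0" "\<not> dist x x0 + r \<le> \<rho> x" by blast
        then show ?thesis
        proof cases
          case 1
          then show ?thesis using atom_disjoint[OF a] by simp
        next
          case 2
          have "N (T a x) \<le> ?g2 x"
            using atom_smooth[OF a \<open>r < \<rho> x0\<close> far 2] False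
            unfolding ennreal_mult'[OF \<kappa>_nonneg] by simp
          then show ?thesis by (simp add: add_increasing add_increasing2)
        next
          case 3
          have b: "dist x x0 < 3 * C0 * \<rho> x0" "\<rho> x0 \<le> 2 * C0 * dist x x0" using between[OF far 3] by auto
          have z: "0 < dist x x0" using far r by linarith
          have "N (T a x) \<le> ennreal (\<kappa> / dist x x0 ^ DIM('a))" by (rule atom_size[OF a far])
          also have "\<dots> \<le> ennreal ?D"
          proof (rule ennreal_leI)
            have "1 / dist x x0 \<le> 2 * C0 / \<rho> x0" using b(2) z rho_pos[of x0] by (simp add: field_simps)
            then have "(1 / dist x x0) ^ DIM('a) \<le> (2 * C0 / \<rho> x0) ^ DIM('a)" using z by (intro power_mono) auto
            then show "\<kappa> / dist x x0 ^ DIM('a) \<le> ?D"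
              using \<kappa>_nonneg mult_left_mono[of "(1 / dist x x0) ^ DIM('a)" "(2 * C0 / \<rho> x0) ^ DIM('a)" \<kappa>]
              by (simp add: power_divide)
          qed
          also have "\<dots> = ?g3 x" using b(1) by (simp add: dist_commute)
          finally show ?thesis by (simp add: add_increasing)
        qed
      qed
    qed
    also have "\<dots> = (\<integral>\<^sup>+ x. ?g1 x \<partial>lebesgue) + ((\<integral>\<^sup>+ x. ?g2 x \<partial>lebesgue) + (\<integral>\<^sup>+ x. ?g3 x \<partial>lebesgue))"
      by (simp only: nn_integral_add[OF m1 borel_measurable_add[OF m2' m3]] nn_integral_add[OF m2' m3])
    also have "\<dots> \<le> ennreal (2 ^ DIM('a) + C powr p) + (ennreal (\<kappa> * (2 * 2 ^ DIM('a) * \<omega>)) + ennreal (?D * ((3 * C0 * \<rho> x0) ^ DIM('a) * \<omega>)))"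
    proof (intro add_mono)
      show "(\<integral>\<^sup>+ x. ?g1 x \<partial>lebesgue) \<le> ennreal (2 ^ DIM('a) + C powr p)"
        by (intro atom_Lp(2)[OF a]) simp
      have "(\<integral>\<^sup>+ x. ?g2 x \<partial>lebesgue) = ennreal \<kappa> * (\<integral>\<^sup>+ x. ennreal (r / dist x x0 ^ (DIM('a) + 1)) * indicator (- ball x0 (2 * r)) x \<partial>lebesgue)"
        using m2 by (rule nn_integral_cmult)
      also have "\<dots> \<le> ennreal \<kappa> * ennreal (2 * 2 ^ DIM('a) * \<omega>)"
        by (intro mult_left_mono tail_le r) auto
      also have "\<dots> = ennreal (\<kappa> * (2 * 2 ^ DIM('a) * \<omega>))"
        using \<kappa>_nonneg \<omega>_pos by (intro ennreal_mult[symmetric]) auto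
      finally show "(\<integral>\<^sup>+ x. ?g2 x \<partial>lebesgue) \<le> ennreal (\<kappa> * (2 * 2 ^ DIM('a) * \<omega>))" .
      have "(\<integral>\<^sup>+ x. ?g3 x \<partial>lebesgue) = ennreal ?D * emeasure lebesgue (ball x0 (3 * C0 * \<rho> x0))"
        using B(3) by (rule nn_integral_cmult_indicator)
      also have "\<dots> = ennreal ?D * ennreal ((3 * C0 * \<rho> x0) ^ DIM('a) * \<omega>)"
        using C0 rho_pos[of x0] by (subst emeasure_ball_eq) auto
      also have "\<dots> = ennreal (?D * ((3 * C0 * \<rho> x0) ^ DIM('a) * \<omega>))"
        using D0 C0 rho_pos[of x0] \<omega>_pos by (intro ennreal_mult[symmetric]) auto
      finally show "(\<integral>\<^sup>+ x. ?g3 x \<partial>lebesgue) \<le> ennreal (?D * ((3 * C0 * \<rho> x0) ^ DIM('a) * \<omega>))" by simp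
    qed
    also have "\<dots> = ennreal (2 ^ DIM('a) + C powr p + (\<kappa> * (2 * 2 ^ DIM('a) * \<omega>) + ?D * ((3 * C0 * \<rho> x0) ^ DIM('a) * \<omega>)))"
      using D0 \<kappa>_nonneg \<omega>_pos C0 rho_pos[of x0] by (simp del: times_divide_eq_right)
    also have "\<dots> \<le> ennreal K_atom"
    proof (rule ennreal_leI)
      have "?D * ((3 * C0 * \<rho> x0) ^ DIM('a) * \<omega>) = \<kappa> * (2 * C0) ^ DIM('a) * (3 * C0) ^ DIM('a) * \<omega>"
        using rho_pos[of x0] by (simp add: power_mult_distrib power_divide)
      moreover have "(2::real) ^ DIM('a) \<le> (3 * C0) ^ DIM('a)" using C0 by (intro power_mono) auto
      ultimately show "2 ^ DIM('a) + C powr p + (\<kappa> * (2 * 2 ^ DIM('a) * \<omega>) + ?D * ((3 * C0 * \<rho> x0) ^ DIM('a) * \<omega>)) \<le> K_atom"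
        unfolding K_atom_def unfolding d_def by linarith
    qed
    finally show ?thesis .
  qed
qed

text \<open>Convergence of the atomic series in L^1 does not by itself pass through
  \<open>T\<close>. For each fixed \<open>t\<close>, however, the kernel is bounded, so the partial
  sums \<open>U n x t\<close> converge to \<open>T f x t\<close> at every \<open>x\<close>;
  separately, the bound on atoms makes the series of norms \<open>G\<close> finite almost
  everywhere. Fatou's lemma in \<open>t\<close> joins the two into convergence in L^q(dt/t).\<close>

lemma T_H1:
  assumes c: "summable (\<lambda>j::nat. \<bar>c j\<bar>)" and a: "\<And>j. \<exists>x0 r. H1_atom \<rho> xnorm x0 r (a j)"
    and lim: "(\<lambda>n. Lp_norm xnorm lebesgue 1 (\<lambda>x. f x - (\<Sum>j<n. c j *\<^sub>R a j x))) \<longlonglongrightarrow> 0"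
  shows "Lp_norm N lebesgue 1 (T f) \<le> ennreal (K_atom * (\<Sum>j. \<bar>c j\<bar>))"
proof -
  define S where "S n x = (\<Sum>j<n. c j *\<^sub>R a j x)" for n x
  have La: "L1 (a j)" for j using a[of j] atom_L1(1) by blast
  have LS: "L1 (S n)" for n unfolding S_def by (intro L1_sum L1_scaleR La)
  have "\<forall>\<^sub>F n in sequentially. Lp_norm xnorm lebesgue 1 (\<lambda>x. f x - S n x) < \<infinity>"
    unfolding S_def using lim by (rule order_tendstoD) simp
  then obtain n0 where n0: "\<And>n. n0 \<le> n \<Longrightarrow> Lp_norm xnorm lebesgue 1 (\<lambda>x. f x - S n x) < \<infinity>"
    by (auto simp: eventually_sequentially)
  have "L1 (\<lambda>x. f x - S n0 x)"
    using n0[of n0] unfolding L1_def Lp_norm_one by (simp split: if_splits)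
  from L1_add[OF this LS[of n0]] have Lf: "L1 f" by simp
  have LfS: "L1 (\<lambda>x. f x - S n x)" for n by (rule L1_diff[OF Lf LS])
  have lim': "(\<lambda>n. \<integral>\<^sup>+ x. xnorm (f x - S n x) \<partial>lebesgue) \<longlonglongrightarrow> 0"
    using lim LfS unfolding Lp_norm_one S_def[symmetric] by (simp add: L1_def)
  define U where "U n = (\<lambda>x. \<Sum>j<n. c j *\<^sub>R T (a j) x)" for n
  have Ta: "strongly_measurable N lebesgue (T (a j))" for j using a[of j] atom_Lp(1) by blast
  have sU: "strongly_measurable N lebesgue (U n)" for n
    unfolding U_def by (intro N.strongly_measurable_sum N.strongly_measurable_scaleR Ta)
  have U_apply: "U n x t = (\<Sum>j<n. c j *\<^sub>R T (a j) x t)" for n x t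
    by (simp add: U_def sum_pointwise scaleR_fun_def)
  have TU: "T f x t - U n x t = kint (cut x (\<lambda>y. f y - S n y)) x t" if t: "0 < t" for n x t
  proof -
    have "U n x t = (\<Sum>j<n. kint (\<lambda>y. c j *\<^sub>R cut x (a j) y) x t)"
      unfolding U_apply by (intro sum.cong refl) (simp only: T_eq[OF cut_L1[OF La] t] kint_scaleR[OF cut_L1[OF La] t])
    also have "\<dots> = kint (\<lambda>y. \<Sum>j<n. c j *\<^sub>R cut x (a j) y) x t"
      by (intro kint_sum[symmetric] L1_scaleR cut_L1 La t)
    also have "(\<lambda>y. \<Sum>j<n. c j *\<^sub>R cut x (a j) y) = cut x (S n)"
      by (auto simp: S_def scaleR_sum_right fun_eq_iff mult.commute)
    finally have "T f x t - U n x t = kint (\<lambda>y. cut x f y - cut x (S n) y) x t"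
      using T_eq[OF cut_L1[OF Lf] t] kint_diff[OF cut_L1[OF Lf] cut_L1[OF LS] t] by simp
    then show ?thesis by (simp add: scaleR_diff_right)
  qed
  have pt: "(\<lambda>n. xnorm (T f x t - U n x t)) \<longlonglongrightarrow> 0" if t: "0 < t" for x t
  proof (rule tendsto_sandwich[OF _ _ tendsto_const])
    let ?b = "\<kappa> / t ^ DIM('a)"
    have "xnorm (T f x t - U n x t) \<le> ennreal ?b * (\<integral>\<^sup>+ y. xnorm (f y - S n y) \<partial>lebesgue)" for n
    proof -
      have "xnorm (T f x t - U n x t) \<le> ennreal ?b * (\<integral>\<^sup>+ y. xnorm (cut x (\<lambda>y. f y - S n y) y) \<partial>lebesgue)"
        unfolding TU[OF t] by (rule xnorm_kint_le_const[OF cut_L1[OF LfS] t]) (use kernel_le_time[OF t] in auto)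
      also have "\<dots> \<le> ennreal ?b * (\<integral>\<^sup>+ y. xnorm (f y - S n y) \<partial>lebesgue)"
        by (intro mult_left_mono nn_integral_cut_le) auto
      finally show ?thesis .
    qed
    then show "\<forall>\<^sub>F n in sequentially. xnorm (T f x t - U n x t) \<le> ennreal ?b * (\<integral>\<^sup>+ y. xnorm (f y - S n y) \<partial>lebesgue)"
      by simp
    show "(\<lambda>n. ennreal ?b * (\<integral>\<^sup>+ y. xnorm (f y - S n y) \<partial>lebesgue)) \<longlonglongrightarrow> 0"
      using ennreal_tendsto_cmult[OF _ lim', of "ennreal ?b"] by simp
  qed simp
  define G where "G x = (\<Sum>j. ennreal \<bar>c j\<bar> * N (T (a j) x))" for x
  have NTm: "(\<lambda>x. N (T (a j) x)) \<in> borel_measurable lebesgue" for j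
    by (rule N.borel_measurable_seminorm[OF complete_measure_lebesgue Ta])
  have sumc: "(\<Sum>j. ennreal (\<bar>c j\<bar> * K_atom)) = ennreal (K_atom * (\<Sum>j. \<bar>c j\<bar>))"
  proof -
    have "(\<Sum>j. ennreal (\<bar>c j\<bar> * K_atom)) = ennreal (\<Sum>j. \<bar>c j\<bar> * K_atom)"
      using c K_atom_ge(2) by (intro suminf_ennreal2 summable_mult2) auto
    then show ?thesis using c by (simp add: suminf_mult2[symmetric] mult.commute)
  qed
  have IG: "(\<integral>\<^sup>+ x. G x \<partial>lebesgue) \<le> ennreal (K_atom * (\<Sum>j. \<bar>c j\<bar>))"
  proof -
    have "(\<integral>\<^sup>+ x. G x \<partial>lebesgue) = (\<Sum>j. \<integral>\<^sup>+ x. ennreal \<bar>c j\<bar> * N (T (a j) x) \<partial>lebesgue)"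
      unfolding G_def by (rule nn_integral_suminf) (intro borel_measurable_times_ennreal NTm, simp)
    also have "\<dots> = (\<Sum>j. ennreal \<bar>c j\<bar> * (\<integral>\<^sup>+ x. N (T (a j) x) \<partial>lebesgue))"
      by (intro suminf_cong nn_integral_cmult NTm)
    also have "\<dots> \<le> (\<Sum>j. ennreal (\<bar>c j\<bar> * K_atom))"
    proof (intro suminf_le)
      fix j
      have "(\<integral>\<^sup>+ x. N (T (a j) x) \<partial>lebesgue) \<le> ennreal K_atom" using a[of j] atom_bound by blast
      then show "ennreal \<bar>c j\<bar> * (\<integral>\<^sup>+ x. N (T (a j) x) \<partial>lebesgue) \<le> ennreal (\<bar>c j\<bar> * K_atom)"
        using K_atom_ge(2) by (simp add: ennreal_mult mult_left_mono)
    qed auto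
    also have "\<dots> = ennreal (K_atom * (\<Sum>j. \<bar>c j\<bar>))" by (rule sumc)
    finally show ?thesis .
  qed
  have Gm: "G \<in> borel_measurable lebesgue"
  proof -
    note [measurable] = NTm
    show ?thesis unfolding G_def by measurable
  qed
  have tail: "N (T f x - U n x) \<le> (\<Sum>j. ennreal \<bar>c (j + n)\<bar> * N (T (a (j + n)) x))" if fin: "G x < \<infinity>" for x n
  proof -
    have "(\<Sum>j. ennreal \<bar>c (j + n)\<bar> * N (T (a (j + n)) x)) \<le> G x"
      unfolding G_def by (subst (2) suminf_offset[of _ n]) (auto simp: add_increasing)
    then have "(\<Sum>j. ennreal \<bar>c (j + n)\<bar> * N (T (a (j + n)) x)) < top"
      using fin by (simp add: order.strict_trans1)
    then obtain b where b: "(\<Sum>j. ennreal \<bar>c (j + n)\<bar> * N (T (a (j + n)) x)) = ennreal b" "0 \<le> b"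
      by (cases "\<Sum>j. ennreal \<bar>c (j + n)\<bar> * N (T (a (j + n)) x)") auto
    have "N (T f x - U n x) \<le> ennreal b"
      unfolding Lq_dt_t_def
    proof (rule xnorm.Lp_norm_Fatou[OF complete_measure_dt_t _ b(2)])
      show "0 < q" using q by simp
      show "Lp_norm xnorm dt_t q (U (m + n) x - U n x) \<le> ennreal b" for m
      proof -
        have "U (m + n) x = U n x + (\<Sum>j<m. c (j + n) *\<^sub>R T (a (j + n)) x)"
          by (induction m) (simp_all add: U_def add_ac)
        then have "N (U (m + n) x - U n x) = N (\<Sum>j<m. c (j + n) *\<^sub>R T (a (j + n)) x)" by simp
        also have "\<dots> \<le> (\<Sum>j<m. N (c (j + n) *\<^sub>R T (a (j + n)) x))" by (rule N.sum_le)
        also have "\<dots> = (\<Sum>j<m. ennreal \<bar>c (j + n)\<bar> * N (T (a (j + n)) x))" by (simp only: N.scale)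
        also have "\<dots> \<le> ennreal b" unfolding b(1)[symmetric] by (rule sum_le_suminf) auto
        finally show ?thesis by (simp add: Lq_dt_t_def)
      qed
      show "AE t in dt_t. (\<lambda>m. xnorm ((T f x - U n x) t - (U (m + n) x - U n x) t)) \<longlonglongrightarrow> 0"
      proof (rule AE_I2)
        fix t :: real assume "t \<in> space dt_t"
        then have t: "0 < t" by simp
        show "(\<lambda>m. xnorm ((T f x - U n x) t - (U (m + n) x - U n x) t)) \<longlonglongrightarrow> 0"
          using LIMSEQ_ignore_initial_segment[OF pt[OF t, of x], of n] by simp
      qed
    qed
    then show ?thesis using b by simp
  qed
  have Gfin: "AE x in lebesgue. G x < \<infinity>"
  proof -
    have "(\<integral>\<^sup>+ x. G x \<partial>lebesgue) < \<infinity>" using IG by (rule order.strict_trans1) simp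
    then show ?thesis using nn_integral_PInf_AE[OF Gm] by (simp add: less_top)
  qed
  have sm: "strongly_measurable N lebesgue (T f)"
  proof (rule N.strongly_measurable_limit[OF complete_measure_lebesgue sU])
    show "AE x in lebesgue. (\<lambda>n. N (T f x - U n x)) \<longlonglongrightarrow> 0"
      using Gfin
    proof eventually_elim
      case (elim x)
      have "(\<lambda>n. \<Sum>j. ennreal \<bar>c (j + n)\<bar> * N (T (a (j + n)) x)) \<longlonglongrightarrow> 0"
        using ennreal_suminf_tail[of "\<lambda>j. ennreal \<bar>c j\<bar> * N (T (a j) x)"] elim by (simp add: G_def)
      then show ?case
        by (rule tendsto_sandwich[OF _ _ tendsto_const, rotated 2]) (simp_all add: tail[OF elim])
    qed
  qed
  have "(\<integral>\<^sup>+ x. N (T f x) \<partial>lebesgue) \<le> (\<integral>\<^sup>+ x. G x \<partial>lebesgue)"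
  proof (rule nn_integral_mono_AE)
    show "AE x in lebesgue. N (T f x) \<le> G x"
      using Gfin
    proof eventually_elim
      case (elim x)
      have "U 0 x = 0" by (simp add: U_def)
      then show ?case using tail[OF elim, of 0] by (simp add: G_def)
    qed
  qed
  then show ?thesis using IG sm by (simp add: Lp_norm_one)
qed

end

subsection \<open>Functions of bounded mean oscillation\<close>

lemma Lq_dt_t_mono:
  fixes h :: "real \<Rightarrow> 'x::real_normed_vector" and G :: "real \<Rightarrow> real"
  assumes q: "0 < q" and h: "continuous_on {0<..} h" and G: "continuous_on {0<..} G"
    and le: "\<And>t. 0 < t \<Longrightarrow> xnorm (h t) \<le> xnorm (G t)"
  shows "Lq_dt_t q h \<le> Lq_dt_t q G"
proof -
  have "(\<integral>\<^sup>+ t. epowr (xnorm (h t)) q \<partial>dt_t) \<le> (\<integral>\<^sup>+ t. epowr (xnorm (G t)) q \<partial>dt_t)"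
    using le q by (intro nn_integral_mono epowr_mono) auto
  then show ?thesis
    using strongly_measurable_dt_t_continuous[OF h] strongly_measurable_dt_t_continuous[OF G] q
    by (simp add: Lq_dt_t_def Lp_norm_def epowr_mono)
qed

lemma continuous_bump: "0 < w \<Longrightarrow> continuous_on {0<..} (bump w)"
  unfolding bump_def
  by (intro continuous_intros ballI) (metis add_pos_nonneg greaterThan_iff less_irrefl zero_le_power2 zero_less_power)

lemma Lq_dt_t_bump_sum:
  fixes h :: "real \<Rightarrow> 'x::real_normed_vector"
  assumes q: "2 \<le> q" and h: "continuous_on {0<..} h"
    and b: "\<And>i. i \<in> I \<Longrightarrow> 0 \<le> b i" and w: "\<And>i. i \<in> I \<Longrightarrow> 0 < w i"
    and le: "\<And>t. 0 < t \<Longrightarrow> xnorm (h t) \<le> ennreal (\<Sum>i\<in>I. b i * bump (w i) t)"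
  shows "Lq_dt_t q h \<le> ennreal (\<Sum>i\<in>I. b i)"
proof -
  interpret R: ext_seminorm "Lq_dt_t q :: (real \<Rightarrow> real) \<Rightarrow> ennreal"
    using q by (intro ext_seminorm_Lq_dt_t) simp
  have nn: "0 \<le> b i * bump (w i) t" if "i \<in> I" "0 < t" for i t
    using b[OF that(1)] bump_nonneg[OF that(2) w[OF that(1)]] by simp
  have cont: "continuous_on {0<..} (\<lambda>t. b i * bump (w i) t)" if "i \<in> I" for i
    using continuous_bump[OF w[OF that]] by (intro continuous_intros)
  have "Lq_dt_t q h \<le> Lq_dt_t q (\<lambda>t. \<Sum>i\<in>I. b i * bump (w i) t)"
  proof (rule Lq_dt_t_mono[OF _ h])
    show "xnorm (h t) \<le> xnorm (\<Sum>i\<in>I. b i * bump (w i) t)" if "0 < t" for t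
      using le[OF that] nn[OF _ that] by (simp add: xnorm_def sum_nonneg)
    show "continuous_on {0<..} (\<lambda>t. \<Sum>i\<in>I. b i * bump (w i) t)"
      using cont by (intro continuous_on_sum) auto
  qed (use q in simp)
  also have "(\<lambda>t. \<Sum>i\<in>I. b i * bump (w i) t) = (\<Sum>i\<in>I. (\<lambda>t. b i * bump (w i) t))"
    by (simp add: fun_eq_iff sum_pointwise)
  also have "Lq_dt_t q \<dots> \<le> (\<Sum>i\<in>I. Lq_dt_t q (\<lambda>t. b i * bump (w i) t))" by (rule R.sum_le)
  also have "\<dots> \<le> (\<Sum>i\<in>I. ennreal (b i))"
  proof (rule sum_mono)
    fix i assume i: "i \<in> I"
    show "Lq_dt_t q (\<lambda>t. b i * bump (w i) t) \<le> ennreal (b i)"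
      using nn[OF i] by (intro Lq_dt_t_bump[OF q cont[OF i] b[OF i] w[OF i]]) (simp add: xnorm_def)
  qed
  also have "\<dots> = ennreal (\<Sum>i\<in>I. b i)" using b by (simp add: sum_ennreal)
  finally show ?thesis .
qed

text \<open>Fixes the width on a dyadic annulus at the cost of a factor 2.\<close>

lemma bump_le_double:
  assumes "0 < t" "0 < v" "v \<le> z" "z \<le> 2 * v"
  shows "bump z t \<le> 2 * bump v t"
proof -
  have "t * z / (t\<^sup>2 + z\<^sup>2) \<le> t * (2 * v) / (t\<^sup>2 + v\<^sup>2)"
  proof (rule frac_le)
    have "v\<^sup>2 \<le> z\<^sup>2" using assms by (intro power_mono) auto
    then show "t\<^sup>2 + v\<^sup>2 \<le> t\<^sup>2 + z\<^sup>2" by simp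
    show "0 < t\<^sup>2 + v\<^sup>2" using assms by (simp add: add_pos_nonneg)
  qed (use assms in auto)
  then show ?thesis by (simp add: bump_def mult.left_commute)
qed

text \<open>The factor \<open>1 / 2 ^ k\<close> is the gain from the regularity of the kernel on the
  \<open>k\<close>-th annulus, and \<open>real k + 2\<close> accounts for the drift of the means
  after \<open>k\<close> doublings. The exact value of the sum is the form that induction can
  prove.\<close>

lemma sum_linear_geometric: "(\<Sum>k<n. (real k + 2) / 2 ^ k) \<le> 6"
proof -
  have "(\<Sum>k<n. (real k + 2) / 2 ^ k) = 6 - (2 * real n + 6) / 2 ^ n"
  proof (induction n)
    case (Suc n)
    have "(\<Sum>k<Suc n. (real k + 2) / 2 ^ k) = 6 - (2 * real n + 6) / 2 ^ n + (real n + 2) / 2 ^ n"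
      by (simp add: Suc)
    also have "\<dots> = 6 - (2 * real (Suc n) + 6) / 2 ^ Suc n" by (simp add: field_simps)
    finally show ?case .
  qed simp
  then show ?thesis by simp
qed

text \<open>Up to the volume of the unit ball, the left side is the volume of the shell swept by a
  sphere of radius \<open>R\<close> when its centre moves by up to \<open>r\<close>. For
  \<open>s = r / R\<close>, an induction bounds \<open>(1 + s) ^ d\<close> from above and
  Bernoulli's inequality bounds \<open>(1 - s) ^ d\<close> from below, both linearly in
  \<open>s\<close>.\<close>

lemma power_shell_le:
  fixes R r :: real
  assumes "0 < r" "r \<le> R"
  shows "(R + r) ^ d - (R - r) ^ d \<le> r / R * (2 * 2 ^ d) * R ^ d"
proof -
  define s where "s = r / R"
  have R: "0 < R" using assms by simp
  have s: "0 \<le> s" "s \<le> 1" using assms by (auto simp: s_def)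
  have up: "(1 + s) ^ k \<le> 1 + s * (2 ^ k - 1)" for k
  proof (induction k)
    case (Suc k)
    have "(1 + s) ^ Suc k \<le> (1 + s) * (1 + s * (2 ^ k - 1))" using Suc s by (simp add: mult_left_mono)
    also have "\<dots> = 1 + s + s * (2 ^ k - 1) + s * (s * (2 ^ k - 1))" by (simp add: algebra_simps)
    also have "s * (s * (2 ^ k - 1)) \<le> 1 * (s * (2 ^ k - 1))" using s by (intro mult_right_mono) auto
    finally show ?case by (simp add: algebra_simps)
  qed simp
  have "1 + real d * (- s) \<le> (1 + - s) ^ d" using s by (intro Bernoulli_inequality) auto
  then have "(1 + s) ^ d - (1 - s) ^ d \<le> s * (2 ^ d - 1) + real d * s" using up[of d] by simp
  also have "real d * s \<le> 2 ^ d * s" using s by (intro mult_right_mono) (auto intro: less_imp_le of_nat_less_two_power)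
  finally have "(1 + s) ^ d - (1 - s) ^ d \<le> s * (2 * 2 ^ d)" using s by (simp add: algebra_simps)
  then have "((1 + s) ^ d - (1 - s) ^ d) * R ^ d \<le> s * (2 * 2 ^ d) * R ^ d"
    using R by (intro mult_right_mono) auto
  moreover have "((1 + s) ^ d - (1 - s) ^ d) * R ^ d = (R + r) ^ d - (R - r) ^ d"
  proof -
    have eq: "R + r = (1 + s) * R" "R - r = (1 - s) * R" using R by (auto simp: s_def field_simps)
    have "(R + r) ^ d = (1 + s) ^ d * R ^ d" by (simp only: eq(1) power_mult_distrib)
    moreover have "(R - r) ^ d = (1 - s) ^ d * R ^ d" by (simp only: eq(2) power_mult_distrib)
    ultimately show ?thesis by (simp only: left_diff_distrib)
  qed
  ultimately show ?thesis by (simp add: s_def)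
qed

lemma AE_imp_ex:
  assumes "AE x in M. P x" "emeasure M (space M) \<noteq> 0"
  shows "\<exists>x\<in>space M. P x"
proof (rule ccontr)
  assume "\<not> ?thesis"
  then have "AE x in M. False" using assms(1) AE_space by (auto elim: eventually_elim2)
  then have "ae_filter M = bot" by (rule eventually_False[THEN iffD1])
  then show False using assms(2) by (simp add: ae_filter_eq_bot_iff)
qed

text \<open>The kernel depends on \<open>x - y\<close> only, so for a ball that moves with the point
  the integral of a constant does not change. The translation is carried out for
  \<open>lborel\<close>: the integrands are Borel measurable, and their integrals over
  \<open>lebesgue\<close> are the same.\<close>

lemma kint_translate_ball:
  fixes x x0 :: "'a::euclidean_space" and m :: "'x::banach"
  assumes t: "0 < t" and R: "0 < R"
  shows "L1 (\<lambda>y. indicator (ball x R) y *\<^sub>R m)"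
    and "kint (\<lambda>y. indicator (ball x R) y *\<^sub>R m) x t = kint (\<lambda>y. indicator (ball x0 R) y *\<^sub>R m) x0 t"
proof -
  have L: "L1 (\<lambda>y. indicator (ball z R) y *\<^sub>R m)" for z :: 'a
    unfolding L1_def
  proof
    show "strongly_measurable xnorm lebesgue (\<lambda>y. indicator (ball z R) y *\<^sub>R m)"
      by (intro xnorm.strongly_measurable_mult xnorm.strongly_measurable_const borel_measurable_indicator) simp_all
    have "(\<integral>\<^sup>+ y. xnorm (indicator (ball z R) y *\<^sub>R m) \<partial>lebesgue) = (\<integral>\<^sup>+ y. xnorm m * indicator (ball z R) y \<partial>lebesgue)"
      by (intro nn_integral_cong) (auto simp: indicator_def)
    also have "\<dots> = xnorm m * emeasure lebesgue (ball z R)" by (rule nn_integral_cmult_indicator) simp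
    also have "\<dots> < \<infinity>" using emeasure_bounded_finite[OF bounded_ball, of z R] by (simp add: ennreal_mult_less_top)
    finally show "(\<integral>\<^sup>+ y. xnorm (indicator (ball z R) y *\<^sub>R m) \<partial>lebesgue) < \<infinity>" .
  qed
  then show "L1 (\<lambda>y. indicator (ball x R) y *\<^sub>R m)" .
  let ?H = "\<lambda>(z::'a) y. kern t (z - y) * indicator (ball z R) y :: real"
  have Hm: "?H z \<in> borel_measurable lebesgue" for z
    using borel_measurable_kern[OF t, of z] by (intro borel_measurable_times borel_measurable_indicator) auto
  have Hint: "integrable lebesgue (?H z)" for z
  proof (rule integrableI_bounded_set[where A="ball z R" and B="kern_const TYPE('a) / t ^ DIM('a)"])
    show "AE y\<in>ball z R in lebesgue. norm (?H z y) \<le> kern_const TYPE('a) / t ^ DIM('a)"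
    proof (rule AE_I2, rule impI)
      fix y assume "y \<in> ball z R"
      then show "norm (?H z y) \<le> kern_const TYPE('a) / t ^ DIM('a)"
        using kern_le_time[OF t, of "z - y"] by simp
    qed
  qed (use Hm emeasure_bounded_finite[OF bounded_ball, of z R] in auto)
  have eq: "kint (\<lambda>y. indicator (ball z R) y *\<^sub>R m) z t = (\<integral>y. ?H z y \<partial>lebesgue) *\<^sub>R m" for z
  proof (rule kint_eqI[OF _ L t])
    have "has_bochner xnorm lebesgue (\<lambda>y. ?H z y *\<^sub>R m) ((\<integral>y. ?H z y \<partial>lebesgue) *\<^sub>R m)"
      by (intro xnorm.has_bochner_scaleR_const complete_measure_lebesgue has_bochner_integral_integrable Hint) simp
    then show "has_bochner xnorm lebesgue (\<lambda>y. kern t (z - y) *\<^sub>R indicator (ball z R) y *\<^sub>R m) ((\<integral>y. ?H z y \<partial>lebesgue) *\<^sub>R m)"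
      by simp
  qed
  have Hb: "?H z \<in> borel_measurable borel" for z
    using borel_measurable_kern_borel[OF t, of z] by (intro borel_measurable_times borel_measurable_indicator) auto
  have "(\<integral>y. ?H x y \<partial>lebesgue) = (\<integral>y. ?H x y \<partial>lborel)"
    using Hb by (intro integral_completion) simp
  also have "\<dots> = (\<integral>y. ?H x y \<partial>distr lborel borel ((+) (x - x0)))"
    by (simp only: lborel_distr_plus)
  also have "\<dots> = (\<integral>y. ?H x ((x - x0) + y) \<partial>lborel)"
    using Hb by (intro integral_distr) auto
  also have "(\<lambda>y. ?H x ((x - x0) + y)) = ?H x0"
    by (auto simp: fun_eq_iff indicator_def dist_norm algebra_simps)
  also have "(\<integral>y. ?H x0 y \<partial>lborel) = (\<integral>y. ?H x0 y \<partial>lebesgue)"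
    using Hb by (intro integral_completion[symmetric]) simp
  finally have "(\<integral>y. ?H x y \<partial>lebesgue) = (\<integral>y. ?H x0 y \<partial>lebesgue)" .
  then show "kint (\<lambda>y. indicator (ball x R) y *\<^sub>R m) x t = kint (\<lambda>y. indicator (ball x0 R) y *\<^sub>R m) x0 t"
    unfolding eq by simp
qed

text \<open>\<open>A\<close> is meant to contain the volume of the unit ball, so that bounds on
  averages read \<open>A * r ^ d\<close>. Oscillation is taken about some constant \<open>m\<close>,
  one good choice for each ball; the ball mean is a candidate.\<close>

locale local_square_function_BMO = local_square_function \<rho> T q p C C0 \<kappa> \<omega> d
  for \<rho> :: "'a::euclidean_space \<Rightarrow> real" and T :: "('a \<Rightarrow> 'x::banach) \<Rightarrow> 'a \<Rightarrow> real \<Rightarrow> 'x"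
    and q p C C0 \<kappa> \<omega> :: real and d :: nat +
  fixes KJ A :: real and f :: "'a \<Rightarrow> 'x"
  assumes KJ: "0 \<le> KJ"
    "\<And>(u :: 'a \<Rightarrow> real) A x r. u \<in> borel_measurable lebesgue \<Longrightarrow> 0 < A \<Longrightarrow> 0 < r \<Longrightarrow>
      (\<And>z s. 0 < s \<Longrightarrow> \<exists>k. (\<integral>\<^sup>+ y. ennreal \<bar>u y - k\<bar> * indicator (ball z s) y \<partial>lebesgue) \<le> ennreal (A * s ^ DIM('a))) \<Longrightarrow>
      (\<integral>\<^sup>+ y. ennreal \<bar>u y\<bar> * indicator (ball x r) y \<partial>lebesgue) \<le> ennreal (A * r ^ DIM('a)) \<Longrightarrow>
      (\<integral>\<^sup>+ y. ennreal (\<bar>u y\<bar> powr p) * indicator (ball x r) y \<partial>lebesgue) \<le> ennreal (KJ * A powr p * r ^ DIM('a))"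
    and A: "0 < A"
    and f_L1: "\<And>x r. 0 < r \<Longrightarrow> L1 (\<lambda>y. indicator (ball x r) y *\<^sub>R f y)"
    and f_osc: "\<And>x r. 0 < r \<Longrightarrow> \<exists>m. (\<integral>\<^sup>+ y. xnorm (f y - m) * indicator (ball x r) y \<partial>lebesgue) \<le> ennreal (A * r ^ d)"
    and f_big: "\<And>x r. 0 < r \<Longrightarrow> \<rho> x \<le> r \<Longrightarrow> (\<integral>\<^sup>+ y. xnorm (f y) * indicator (ball x r) y \<partial>lebesgue) \<le> ennreal (A * r ^ d)"
begin

lemma f_measurable: "strongly_measurable xnorm lebesgue f"
proof (rule xnorm.strongly_measurable_limit[OF complete_measure_lebesgue])
  show "strongly_measurable xnorm lebesgue (\<lambda>y. indicator (ball 0 (real (Suc n))) y *\<^sub>R f y)" for n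
    using f_L1[of "real (Suc n)" 0] by (simp add: L1_def)
  show "AE x in lebesgue. (\<lambda>n. xnorm (f x - indicator (ball 0 (real (Suc n))) x *\<^sub>R f x)) \<longlonglongrightarrow> 0"
  proof (rule AE_I2)
    fix x :: 'a
    obtain n0 where n0: "norm x < real n0" using reals_Archimedean2 by blast
    have "\<forall>\<^sub>F n in sequentially. xnorm (f x - indicator (ball 0 (real (Suc n))) x *\<^sub>R f x) = 0"
      using eventually_ge_at_top[of n0]
    proof eventually_elim
      case (elim n)
      then have "x \<in> ball 0 (real (Suc n))" using n0 by simp
      then show ?case by simp
    qed
    then show "(\<lambda>n. xnorm (f x - indicator (ball 0 (real (Suc n))) x *\<^sub>R f x)) \<longlonglongrightarrow> 0"
      by (rule tendsto_eventually)
  qed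
qed

lemma f_diff_measurable: "strongly_measurable xnorm lebesgue (\<lambda>y. f y - m)"
  by (intro xnorm.strongly_measurable_diff f_measurable xnorm.strongly_measurable_const) simp

lemma f_diff_norm_measurable: "(\<lambda>y. norm (f y - m)) \<in> borel_measurable lebesgue"
proof -
  have "(\<lambda>y. enn2real (xnorm (f y - m))) \<in> borel_measurable lebesgue"
    using borel_measurable_xnorm[OF f_diff_measurable] by measurable
  then show ?thesis by (simp add: xnorm_def)
qed

lemma f_diff_xnorm_measurable: "(\<lambda>y. xnorm (f y - m)) \<in> borel_measurable lebesgue"
  by (rule borel_measurable_xnorm[OF f_diff_measurable])

lemma ball_L1: "0 < r \<Longrightarrow> L1 (\<lambda>y. indicator (ball x r) y *\<^sub>R (f y - m))"
  using L1_diff[OF f_L1 kint_translate_ball(1)[of 1 r x m], of r x] by (simp add: scaleR_diff_right)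

text \<open>The scalar John--Nirenberg inequality is applied to \<open>norm (f y - m)\<close>: by
  the reverse triangle inequality, its oscillation about \<open>norm (m' - m)\<close> is at most
  that of \<open>f\<close> about \<open>m'\<close>.\<close>

lemma f_JN:
  assumes r: "0 < r" and m: "(\<integral>\<^sup>+ y. xnorm (f y - m) * indicator (ball x r) y \<partial>lebesgue) \<le> ennreal (A * r ^ d)"
  shows "(\<integral>\<^sup>+ y. ennreal (norm (indicator (ball x r) y *\<^sub>R (f y - m)) powr p) \<partial>lebesgue) \<le> ennreal (A powr p * (KJ * r ^ d))"
proof -
  have "(\<integral>\<^sup>+ y. ennreal (\<bar>norm (f y - m)\<bar> powr p) * indicator (ball x r) y \<partial>lebesgue) \<le> ennreal (KJ * A powr p * r ^ DIM('a))"
  proof (rule KJ(2)[OF f_diff_norm_measurable A r])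
    fix z :: 'a and s :: real assume s: "0 < s"
    obtain m' where m': "(\<integral>\<^sup>+ y. xnorm (f y - m') * indicator (ball z s) y \<partial>lebesgue) \<le> ennreal (A * s ^ d)"
      using f_osc[OF s] by blast
    have "(\<integral>\<^sup>+ y. ennreal \<bar>norm (f y - m) - norm (m' - m)\<bar> * indicator (ball z s) y \<partial>lebesgue) \<le>
        (\<integral>\<^sup>+ y. xnorm (f y - m') * indicator (ball z s) y \<partial>lebesgue)"
    proof (intro nn_integral_mono mult_right_mono)
      fix y
      have "\<bar>norm (f y - m) - norm (m' - m)\<bar> \<le> norm (f y - m')"
        using norm_triangle_ineq3[of "f y - m" "m' - m"] by simp
      then show "ennreal \<bar>norm (f y - m) - norm (m' - m)\<bar> \<le> xnorm (f y - m')"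
        by (simp add: xnorm_def ennreal_leI)
    qed simp
    then show "\<exists>k. (\<integral>\<^sup>+ y. ennreal \<bar>norm (f y - m) - k\<bar> * indicator (ball z s) y \<partial>lebesgue) \<le> ennreal (A * s ^ DIM('a))"
      using m' unfolding d_def by (meson order_trans)
  next
    show "(\<integral>\<^sup>+ y. ennreal \<bar>norm (f y - m)\<bar> * indicator (ball x r) y \<partial>lebesgue) \<le> ennreal (A * r ^ DIM('a))"
      using m by (simp add: xnorm_def d_def)
  qed
  moreover have "(\<integral>\<^sup>+ y. ennreal (norm (indicator (ball x r) y *\<^sub>R (f y - m)) powr p) \<partial>lebesgue) =
      (\<integral>\<^sup>+ y. ennreal (\<bar>norm (f y - m)\<bar> powr p) * indicator (ball x r) y \<partial>lebesgue)"
    using p by (intro nn_integral_cong) (auto simp: indicator_def)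
  moreover have "KJ * A powr p * r ^ DIM('a) = A powr p * (KJ * r ^ d)"
    unfolding d_def by (simp only: mult_ac)
  ultimately show ?thesis by (simp only:)
qed

lemma T_ball:
  assumes r: "0 < r" and m: "(\<integral>\<^sup>+ y. xnorm (f y - m) * indicator (ball x r) y \<partial>lebesgue) \<le> ennreal (A * r ^ d)"
  shows "strongly_measurable N lebesgue (T (\<lambda>y. indicator (ball x r) y *\<^sub>R (f y - m)))"
    and "0 < s \<Longrightarrow> (\<integral>\<^sup>+ z. N (T (\<lambda>y. indicator (ball x r) y *\<^sub>R (f y - m)) z) * indicator (ball x0 s) z \<partial>lebesgue)
      \<le> ennreal (A * (s ^ d * \<omega> + C powr p * (KJ * r ^ d)))"
proof -
  have sm: "strongly_measurable xnorm lebesgue (\<lambda>y. indicator (ball x r) y *\<^sub>R (f y - m))"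
    by (intro xnorm.strongly_measurable_mult f_diff_measurable borel_measurable_indicator) simp
  have nn: "0 \<le> KJ * r ^ d" using KJ r by simp
  show "strongly_measurable N lebesgue (T (\<lambda>y. indicator (ball x r) y *\<^sub>R (f y - m)))"
    by (rule T_local(1)[OF sm A nn f_JN[OF assms]])
  assume s: "0 < s"
  show "(\<integral>\<^sup>+ z. N (T (\<lambda>y. indicator (ball x r) y *\<^sub>R (f y - m)) z) * indicator (ball x0 s) z \<partial>lebesgue)
      \<le> ennreal (A * (s ^ d * \<omega> + C powr p * (KJ * r ^ d)))"
  proof (rule T_local(2)[OF sm A nn f_JN[OF assms]])
    show "emeasure lebesgue (ball x0 s) \<le> ennreal (s ^ d * \<omega>)"
      using s by (subst emeasure_ball_eq) (simp_all add: d_def)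
    show "0 \<le> s ^ d * \<omega>" using s \<omega>_pos by simp
  qed simp
qed

definition K1 :: real where "K1 = \<omega> + C powr p * (KJ * (3 * C0) ^ d)"

lemma K1_nonneg: "0 \<le> K1"
  using \<omega>_pos KJ C0 by (simp add: K1_def)

lemma cut_f_L1: "L1 (cut x f)"
proof -
  have "cut x f = cut x (\<lambda>y. indicator (ball x (2 * \<rho> x)) y *\<^sub>R f y)"
    using rho_pos[of x] by (auto simp: fun_eq_iff indicator_def)
  moreover have "L1 (cut x (\<lambda>y. indicator (ball x (2 * \<rho> x)) y *\<^sub>R f y))"
    using rho_pos[of x] by (intro cut_L1 f_L1) simp
  ultimately show ?thesis by simp
qed

text \<open>In a ball of radius at least the critical radius of its centre, every truncation has
  radius at most \<open>C0 * r\<close> and stays in the ball of radius \<open>3 * C0 * r\<close>, so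
  \<open>f\<close> may be cut to that ball beforehand. The term \<open>f y - 0\<close> is the case
  \<open>m = 0\<close> of \<open>T_ball\<close>.\<close>

lemma T_large_eq:
  assumes r: "\<rho> x0 \<le> r" and x: "x \<in> ball x0 r"
  shows "N (T f x - T (\<lambda>y. indicator (ball x0 (3 * C0 * r)) y *\<^sub>R (f y - 0)) x) = 0"
proof -
  have r0: "0 < r" using r rho_pos[of x0] by linarith
  \<comment> \<open>If \<open>x0\<close> is within \<open>2 * \<rho> x\<close>, comparability
    applies; otherwise \<open>\<rho> x\<close> is smaller than half the distance and hence than
    \<open>r\<close>.\<close>
  have rx: "\<rho> x \<le> C0 * r"
  proof (cases "dist x x0 \<le> 2 * \<rho> x")
    case True
    have "\<rho> x \<le> C0 * \<rho> x0" using comparable1[OF True] .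
    also have "\<dots> \<le> C0 * r" using r C0 by (intro mult_left_mono) auto
    finally show ?thesis .
  next
    case False
    then have "\<rho> x \<le> 1 * r" using x rho_pos[of x] by (simp add: dist_commute)
    also have "\<dots> \<le> C0 * r" using C0 r0 by (intro mult_right_mono) auto
    finally show ?thesis .
  qed
  have sub: "cball x (\<rho> x) \<subseteq> ball x0 (3 * C0 * r)"
  proof
    fix y assume "y \<in> cball x (\<rho> x)"
    then have "dist x0 y < r + C0 * r" using x rx dist_triangle[of x0 y x] by simp
    moreover have "r \<le> C0 * r" using C0 r0 by simp
    moreover have "0 < C0 * r" using C0 r0 by simp
    ultimately show "y \<in> ball x0 (3 * C0 * r)" by simp
  qed
  have eq: "cut x f = cut x (\<lambda>y. indicator (ball x0 (3 * C0 * r)) y *\<^sub>R (f y - 0))"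
    using sub by (auto simp: fun_eq_iff indicator_def)
  have "T f x t = T (\<lambda>y. indicator (ball x0 (3 * C0 * r)) y *\<^sub>R (f y - 0)) x t" if "0 < t" for t
    using T_eq[OF cut_f_L1 that, of x] T_eq[OF cut_f_L1[of x, unfolded eq] that] eq by simp
  then have "N (T f x - T (\<lambda>y. indicator (ball x0 (3 * C0 * r)) y *\<^sub>R (f y - 0)) x) = N (\<lambda>_. 0)"
    by (intro Lq_dt_t_cong) simp
  also have "\<dots> = 0" using N.zero by (simp add: zero_fun_def)
  finally show ?thesis .
qed

lemma T_large:
  assumes r: "\<rho> x0 \<le> r"
  shows "strongly_measurable N (lebesgue_on (ball x0 r)) (T f)"
    and "(\<integral>\<^sup>+ x. N (T f x) * indicator (ball x0 r) x \<partial>lebesgue) \<le> ennreal (A * r ^ d * K1)"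
proof -
  let ?R = "3 * C0 * r"
  let ?f = "\<lambda>y. indicator (ball x0 ?R) y *\<^sub>R (f y - 0)"
  have r0: "0 < r" using r rho_pos[of x0] by linarith
  have rC: "r \<le> C0 * r" using C0 r0 by simp
  have R: "0 < ?R" "\<rho> x0 \<le> ?R" using rC r0 r by linarith+
  have m: "(\<integral>\<^sup>+ y. xnorm (f y - 0) * indicator (ball x0 ?R) y \<partial>lebesgue) \<le> ennreal (A * ?R ^ d)"
    using f_big[OF R] by simp
  note Tf = T_ball[OF R(1) m]
  have AE: "AE x in lebesgue_on (ball x0 r). N (T f x - T ?f x) = 0"
    using T_large_eq[OF r] by (intro AE_I2) (simp add: space_restrict_space)
  show "strongly_measurable N (lebesgue_on (ball x0 r)) (T f)"
    by (rule N.strongly_measurable_cong_AE[OF N.strongly_measurable_restrict[OF _ Tf(1)] AE]) simp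
  have "(\<integral>\<^sup>+ x. N (T f x) * indicator (ball x0 r) x \<partial>lebesgue) \<le> (\<integral>\<^sup>+ x. N (T ?f x) * indicator (ball x0 r) x \<partial>lebesgue)"
  proof (rule nn_integral_mono)
    fix x
    show "N (T f x) * indicator (ball x0 r) x \<le> N (T ?f x) * indicator (ball x0 r) x"
      using T_large_eq[OF r, of x] N.le_diff_add[of "T f x" "T ?f x"] by (cases "x \<in> ball x0 r") auto
  qed
  also have "\<dots> \<le> ennreal (A * (r ^ d * \<omega> + C powr p * (KJ * ?R ^ d)))" using r0 by (rule Tf(2))
  also have "A * (r ^ d * \<omega> + C powr p * (KJ * ?R ^ d)) = A * r ^ d * K1"
    by (simp add: K1_def power_mult_distrib algebra_simps)
  finally show "(\<integral>\<^sup>+ x. N (T f x) * indicator (ball x0 r) x \<partial>lebesgue) \<le> ennreal (A * r ^ d * K1)" .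
qed

text \<open>Every ball is enlarged to at least its critical radius, where \<open>T_large\<close>
  applies.\<close>

lemma T_ball_measurable:
  "strongly_measurable N (lebesgue_on (ball x0 r)) (T f)"
proof -
  let ?R = "max r (\<rho> x0)"
  have "strongly_measurable N (restrict_space (lebesgue_on (ball x0 ?R)) (ball x0 r)) (T f)"
    by (intro N.strongly_measurable_restrict T_large(1)) (auto simp: sets_restrict_space)
  moreover have "restrict_space (lebesgue_on (ball x0 ?R)) (ball x0 r) = lebesgue_on (ball x0 r)"
    by (subst restrict_restrict_space) (auto intro!: arg_cong[where f="restrict_space lebesgue"])
  ultimately show ?thesis by simp
qed

lemma T_ball_finite:
  "(\<integral>\<^sup>+ x. N (T f x) \<partial>lebesgue_on (ball x0 r)) < \<infinity>"
proof -
  let ?R = "max r (\<rho> x0)"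
  have "(\<integral>\<^sup>+ x. N (T f x) \<partial>lebesgue_on (ball x0 r)) = (\<integral>\<^sup>+ x. N (T f x) * indicator (ball x0 r) x \<partial>lebesgue)"
    by (rule nn_integral_restrict_space) simp
  also have "\<dots> \<le> (\<integral>\<^sup>+ x. N (T f x) * indicator (ball x0 ?R) x \<partial>lebesgue)"
    by (intro nn_integral_mono mult_left_mono indicator_leI) auto
  also have "\<dots> \<le> ennreal (A * ?R ^ d * K1)" by (rule T_large(2)) simp
  also have "\<dots> < \<infinity>" by simp
  finally show ?thesis .
qed

text \<open>The usual factor 2 for replacing an arbitrary constant by the mean.
  \<open>ball_mean\<close> rests on a chosen value, determined only up to \<open>N\<close>-null
  vectors, and it is controlled through \<open>has_bochner_bound_const\<close>.\<close>

lemma T_mean_oscillation: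
  assumes r: "0 < r" and c: "N c < \<infinity>"
  shows "(\<integral>\<^sup>+ x. N (T f x - ball_mean N x0 r (T f)) \<partial>lebesgue_on (ball x0 r)) \<le> 2 * (\<integral>\<^sup>+ x. N (T f x - c) \<partial>lebesgue_on (ball x0 r))"
proof -
  let ?M = "lebesgue_on (ball x0 r)"
  have M: "complete_measure ?M" by (intro complete_measure_restrict_space complete_measure_lebesgue) simp
  define \<mu> where "\<mu> = measure lebesgue (ball x0 r)"
  have mu: "0 < \<mu>" unfolding \<mu>_def using content_ball_pos[OF r, of x0] by simp
  have em: "emeasure lebesgue (ball x0 r) = ennreal \<mu>"
    unfolding \<mu>_def using emeasure_bounded_finite[OF bounded_ball, of x0 r] by (intro emeasure_eq_ennreal_measure) simp
  have eM: "emeasure ?M (space ?M) = ennreal \<mu>"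
  proof -
    have "emeasure ?M (space ?M) = emeasure lebesgue (ball x0 r)"
      by (simp add: emeasure_restrict_space space_restrict_space)
    then show ?thesis by (simp only: em)
  qed
  have mM: "measure ?M (space ?M) = \<mu>" unfolding measure_def eM using mu by simp
  define v where "v = bochner N ?M (T f)"
  have hv: "has_bochner N ?M (T f) v"
    unfolding v_def by (rule N.has_bochner_bochner[OF M N_complete T_ball_measurable T_ball_finite])
  have "N (v - \<mu> *\<^sub>R c) \<le> (\<integral>\<^sup>+ x. N (T f x - c) \<partial>?M)"
    using N.has_bochner_bound_const[OF M hv c] eM mM by simp
  have bm: "ball_mean N x0 r (T f) = (1 / \<mu>) *\<^sub>R v" by (simp add: ball_mean_def v_def \<mu>_def)
  have cm: "ennreal \<mu> * N (c - ball_mean N x0 r (T f)) \<le> (\<integral>\<^sup>+ x. N (T f x - c) \<partial>?M)"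
  proof -
    have "\<mu> *\<^sub>R (c - ball_mean N x0 r (T f)) = \<mu> *\<^sub>R c - v"
      unfolding bm using mu by (simp only: scaleR_diff_right scaleR_scaleR) simp
    then have "ennreal \<mu> * N (c - ball_mean N x0 r (T f)) = N (\<mu> *\<^sub>R c - v)"
      using N.scale[of \<mu> "c - ball_mean N x0 r (T f)"] mu by simp
    also have "\<dots> = N (v - \<mu> *\<^sub>R c)" by (rule N.diff_commute)
    finally show ?thesis using \<open>N (v - \<mu> *\<^sub>R c) \<le> (\<integral>\<^sup>+ x. N (T f x - c) \<partial>?M)\<close> by simp
  qed
  have "(\<integral>\<^sup>+ x. N (T f x - ball_mean N x0 r (T f)) \<partial>?M) \<le> (\<integral>\<^sup>+ x. N (T f x - c) + N (c - ball_mean N x0 r (T f)) \<partial>?M)"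
    by (intro nn_integral_mono N.diff_triangle)
  also have "\<dots> = (\<integral>\<^sup>+ x. N (T f x - c) \<partial>?M) + N (c - ball_mean N x0 r (T f)) * emeasure ?M (space ?M)"
    by (subst nn_integral_add)
      (auto intro!: N.borel_measurable_seminorm[OF M] N.strongly_measurable_diff T_ball_measurable N.strongly_measurable_const c)
  also have "\<dots> \<le> (\<integral>\<^sup>+ x. N (T f x - c) \<partial>?M) + (\<integral>\<^sup>+ x. N (T f x - c) \<partial>?M)"
    using cm unfolding eM by (intro add_left_mono) (simp add: mult.commute)
  finally show ?thesis by (simp only: mult_2)
qed

end

section \<open>Balls much smaller than the critical radius\<close>

context local_square_function_BMO
begin

lemma mean_diff_le:
  assumes a: "0 < a" and X: "0 \<le> X" "0 \<le> Y"
    and m: "(\<integral>\<^sup>+ y. xnorm (f y - m) * indicator (ball x a) y \<partial>lebesgue) \<le> ennreal X"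
    and m': "(\<integral>\<^sup>+ y. xnorm (f y - m') * indicator (ball x a) y \<partial>lebesgue) \<le> ennreal Y"
  shows "norm (m - m') * (a ^ d * \<omega>) \<le> X + Y"
proof -
  have B: "ball x a \<in> sets lebesgue" by simp
  have meas: "(\<lambda>y. xnorm (f y - m) * indicator (ball x a) y) \<in> borel_measurable lebesgue" for m
    using B by (intro borel_measurable_times_ennreal f_diff_xnorm_measurable borel_measurable_indicator)
  have "xnorm (m - m') * emeasure lebesgue (ball x a) = (\<integral>\<^sup>+ y. xnorm (m - m') * indicator (ball x a) y \<partial>lebesgue)"
    using B by (rule nn_integral_cmult_indicator[symmetric])
  also have "\<dots> \<le> (\<integral>\<^sup>+ y. xnorm (f y - m) * indicator (ball x a) y + xnorm (f y - m') * indicator (ball x a) y \<partial>lebesgue)"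
  proof (rule nn_integral_mono)
    fix y
    have "xnorm (m - m') \<le> xnorm (f y - m) + xnorm (f y - m')"
      using xnorm.diff_triangle[of m m' "f y"] by (simp add: xnorm.diff_commute)
    then show "xnorm (m - m') * indicator (ball x a) y \<le> xnorm (f y - m) * indicator (ball x a) y + xnorm (f y - m') * indicator (ball x a) y"
      by (simp add: distrib_right[symmetric] mult_right_mono)
  qed
  also have "\<dots> = (\<integral>\<^sup>+ y. xnorm (f y - m) * indicator (ball x a) y \<partial>lebesgue) + (\<integral>\<^sup>+ y. xnorm (f y - m') * indicator (ball x a) y \<partial>lebesgue)"
    by (rule nn_integral_add[OF meas meas])
  also have "\<dots> \<le> ennreal X + ennreal Y" using m m' by (rule add_mono)
  finally have "ennreal (norm (m - m')) * ennreal (a ^ d * \<omega>) \<le> ennreal X + ennreal Y"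
    using emeasure_ball_eq[OF less_imp_le[OF a], of x] by (simp only: xnorm_def d_def)
  then have "ennreal (norm (m - m') * (a ^ d * \<omega>)) \<le> ennreal (X + Y)"
    using X by (simp only: ennreal_mult'[OF norm_ge_zero] ennreal_plus)
  then show ?thesis using X by (subst (asm) ennreal_le_iff) auto
qed

lemma osc_change_mean:
  assumes a: "0 < a" and X: "0 \<le> X" "norm (m - m') * \<omega> \<le> Y"
    and m: "(\<integral>\<^sup>+ y. xnorm (f y - m) * indicator (ball x a) y \<partial>lebesgue) \<le> ennreal X"
  shows "(\<integral>\<^sup>+ y. xnorm (f y - m') * indicator (ball x a) y \<partial>lebesgue) \<le> ennreal (X + a ^ d * Y)"
proof -
  have B: "ball x a \<in> sets lebesgue" by simp
  have meas: "(\<lambda>y. xnorm (f y - m) * indicator (ball x a) y) \<in> borel_measurable lebesgue" for m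
    using B by (intro borel_measurable_times_ennreal f_diff_xnorm_measurable borel_measurable_indicator)
  have cmeas: "(\<lambda>y. xnorm (m - m') * indicator (ball x a) y) \<in> borel_measurable lebesgue"
    by (rule borel_measurable_times_ennreal[OF borel_measurable_const borel_measurable_indicator[OF B]])
  have "(\<integral>\<^sup>+ y. xnorm (f y - m') * indicator (ball x a) y \<partial>lebesgue) \<le>
      (\<integral>\<^sup>+ y. xnorm (f y - m) * indicator (ball x a) y + xnorm (m - m') * indicator (ball x a) y \<partial>lebesgue)"
    by (intro nn_integral_mono) (simp add: distrib_right[symmetric] mult_right_mono xnorm.diff_triangle)
  also have "\<dots> = (\<integral>\<^sup>+ y. xnorm (f y - m) * indicator (ball x a) y \<partial>lebesgue) + (\<integral>\<^sup>+ y. xnorm (m - m') * indicator (ball x a) y \<partial>lebesgue)"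
    by (rule nn_integral_add[OF meas cmeas])
  also have "(\<integral>\<^sup>+ y. xnorm (m - m') * indicator (ball x a) y \<partial>lebesgue) = xnorm (m - m') * emeasure lebesgue (ball x a)"
    using B by (rule nn_integral_cmult_indicator)
  also have "\<dots> = ennreal (a ^ d * (norm (m - m') * \<omega>))"
    using emeasure_ball_eq[OF less_imp_le[OF a], of x] ennreal_mult'[OF norm_ge_zero[of "m - m'"], of "a ^ d * \<omega>"]
    by (simp only: xnorm_def d_def mult.left_commute)
  also have "(\<integral>\<^sup>+ y. xnorm (f y - m) * indicator (ball x a) y \<partial>lebesgue) + \<dots> \<le> ennreal X + ennreal (a ^ d * Y)"
    using X a by (intro add_mono m ennreal_leI mult_left_mono) auto
  also have "\<dots> = ennreal (X + a ^ d * Y)"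
  proof (rule ennreal_plus[symmetric])
    have "0 \<le> norm (m - m') * \<omega>" using \<omega>_pos by simp
    then show "0 \<le> a ^ d * Y" using X a by simp
  qed (rule X)
  finally show ?thesis .
qed

text \<open>\<open>Q\<close> dominates \<open>1 + 2 ^ d\<close>, the cost of one doubling for the
  mean, and \<open>1 + (4 * C0) ^ d\<close>, the cost of comparing the last mean with 0 on a ball of
  critical size.\<close>

definition Q :: real where "Q = 2 + (4 * C0) ^ d + 2 ^ d"
text \<open>In order: the annuli, with 6 from \<open>sum_linear_geometric\<close>; the part beyond
  \<open>R\<close>; and the shell that appears when the ball carrying the constant is moved.\<close>

definition K2 :: real where "K2 = \<kappa> * (6 * (2 ^ d * (1 + 2 ^ d)) + (8 * C0\<^sup>2) ^ d + 2 * 2 ^ d * Q)"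
text \<open>The first two summands come from \<open>T_ball\<close> on the double ball, the last from
  the pointwise bound \<open>A * K2\<close> integrated over the ball.\<close>

definition K3 :: real where "K3 = \<omega> + C powr p * (KJ * 2 ^ d) + K2 * \<omega>"

lemma Q_nonneg: "0 \<le> Q" using C0 by (simp add: Q_def)
lemma K2_nonneg: "0 \<le> K2" using \<kappa>_nonneg Q_nonneg by (simp add: K2_def)
lemma K3_nonneg: "0 \<le> K3" using K2_nonneg \<omega>_pos KJ by (simp add: K3_def)

text \<open>
  The part of \<open>f\<close> on which the cancellation of the kernel in \<open>x\<close> is used: an annulus between the
  ball itself and a ball of radius comparable to the critical radius.
\<close>
lemma annulus_bound:
  fixes x0 :: 'a and n :: nat
  defines "s \<equiv> \<lambda>r k. 2 ^ k * (2 * r) :: real"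
  assumes r: "0 < r" and t: "0 < t" and x: "dist x x0 < r"
    and osc: "\<And>k. (\<integral>\<^sup>+ y. xnorm (f y - m) * indicator (ball x0 (s r k)) y \<partial>lebesgue) \<le> ennreal (A * s r k ^ d * (1 + real k * (1 + 2 ^ d)))"
  defines "g \<equiv> \<lambda>y. indicator (ball x0 (s r n)) y *\<^sub>R (f y - m) - indicator (ball x0 (2 * r)) y *\<^sub>R (f y - m)"
  shows "L1 g" and "xnorm (kint g x t - kint g x0 t) \<le>
    ennreal (\<Sum>k<n. A * (\<kappa> * (2 ^ d * (1 + 2 ^ d)) * ((real k + 2) / 2 ^ k)) * bump (s r k) t)"
proof -
  have s_pos: "0 < s r k" for k using r by (simp add: s_def)
  show g: "L1 g" unfolding g_def using r s_pos by (intro L1_diff ball_L1) simp_all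
  let ?c = "\<lambda>k. 2 * \<kappa> * r / s r k ^ (d + 1) * bump (s r k) t"
  have c0: "0 \<le> ?c k" for k
    using \<kappa>_nonneg r s_pos[of k] bump_nonneg[OF t s_pos[of k]] by simp
  let ?h = "\<lambda>k y. ennreal (?c k) * (xnorm (f y - m) * indicator (ball x0 (s r (Suc k))) y)"
  have hm: "(\<lambda>y. xnorm (f y - m) * indicator (ball x0 (s r (Suc k))) y) \<in> borel_measurable lebesgue" for k
    by (intro borel_measurable_times_ennreal f_diff_xnorm_measurable borel_measurable_indicator) simp
  have "xnorm (kint g x t - kint g x0 t) \<le> (\<integral>\<^sup>+ y. ennreal \<bar>kern t (x - y) - kern t (x0 - y)\<bar> * xnorm (g y) \<partial>lebesgue)"
    by (rule xnorm_kint_diff_le[OF g t])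
  also have "\<dots> \<le> (\<integral>\<^sup>+ y. (\<Sum>k<n. ?h k y) \<partial>lebesgue)"
  proof (rule nn_integral_mono)
    fix y
    show "ennreal \<bar>kern t (x - y) - kern t (x0 - y)\<bar> * xnorm (g y) \<le> (\<Sum>k<n. ?h k y)"
    proof (cases "g y = 0")
      case False
      define z where "z = dist x0 y"
      have "s r 0 \<le> s r n" "s r 0 = 2 * r" using r by (simp_all add: s_def)
      then have zn: "s r 0 \<le> z" "z < s r n" and gy: "g y = f y - m"
        using False by (cases "y \<in> ball x0 (2 * r)"; cases "y \<in> ball x0 (s r n)"; simp add: g_def z_def)+
      \<comment> \<open>Locates the annulus of \<open>y\<close>: for \<open>j = Suc k\<close> the
        distance \<open>z\<close> lies between \<open>s r k\<close> and \<open>s r (Suc k)\<close>.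
        That \<open>j\<close> is positive uses that \<open>g\<close> vanishes on the ball of radius
        \<open>s r 0 = 2 * r\<close>.\<close>
      define j where "j = (LEAST k. z < s r k)"
      have j: "z < s r j" unfolding j_def using zn(2) by (rule LeastI)
      have jn: "j \<le> n" unfolding j_def using zn(2) by (rule Least_le)
      have "j \<noteq> 0" using j zn(1) by (intro notI) simp
      then obtain k where k: "j = Suc k" by (cases j) auto
      have zk: "s r k \<le> z" using not_less_Least[of k "\<lambda>k. z < s r k"] k by (simp add: j_def[symmetric])
      have z2: "z \<le> 2 * s r k" using j by (simp add: k s_def)
      have zpos: "0 < z" using zk s_pos[of k] by linarith
      have "2 * r \<le> z" using zn(1) by (simp add: s_def)
      then have "norm ((x0 - y) - (x - y)) \<le> z / 2" using x by (simp add: dist_norm norm_minus_commute)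
      then have "\<bar>kern t (x0 - y) - kern t (x - y)\<bar> \<le> \<kappa> * norm ((x0 - y) - (x - y)) / z ^ (DIM('a) + 1) * bump z t"
        using t zpos by (intro kernel_diff_le) (auto simp: z_def dist_norm)
      also have "\<dots> \<le> \<kappa> * r / s r k ^ (d + 1) * (2 * bump (s r k) t)"
      proof (intro mult_mono frac_le)
        show "s r k ^ (d + 1) \<le> z ^ (DIM('a) + 1)"
          unfolding d_def using zk s_pos[of k] by (intro power_mono) auto
        show "bump z t \<le> 2 * bump (s r k) t" using t s_pos[of k] zk z2 by (rule bump_le_double)
        show "norm ((x0 - y) - (x - y)) \<le> r" using x by (simp add: dist_norm norm_minus_commute)
      qed (use \<kappa>_nonneg r s_pos[of k] bump_nonneg[OF t zpos] in auto)
      finally have "\<bar>kern t (x - y) - kern t (x0 - y)\<bar> \<le> ?c k" by (simp add: abs_minus_commute mult_ac)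
      then have "ennreal \<bar>kern t (x - y) - kern t (x0 - y)\<bar> * xnorm (g y) \<le> ennreal (?c k) * xnorm (f y - m)"
        unfolding gy by (intro mult_right_mono ennreal_leI) auto
      also have "\<dots> = ?h k y" using j by (simp add: k z_def)
      also have "\<dots> \<le> (\<Sum>k<n. ?h k y)"
        using jn k by (intro member_le_sum) auto
      finally show ?thesis .
    qed simp
  qed
  also have "\<dots> = (\<Sum>k<n. \<integral>\<^sup>+ y. ?h k y \<partial>lebesgue)"
    by (rule nn_integral_sum) (rule borel_measurable_times_ennreal[OF borel_measurable_const hm])
  also have "\<dots> = (\<Sum>k<n. ennreal (?c k) * (\<integral>\<^sup>+ y. xnorm (f y - m) * indicator (ball x0 (s r (Suc k))) y \<partial>lebesgue))"
    by (intro sum.cong refl nn_integral_cmult hm)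
  also have "\<dots> \<le> (\<Sum>k<n. ennreal (A * (\<kappa> * (2 ^ d * (1 + 2 ^ d)) * ((real k + 2) / 2 ^ k)) * bump (s r k) t))"
  proof (rule sum_mono)
    fix k
    let ?X = "A * s r (Suc k) ^ d * (1 + real (Suc k) * (1 + 2 ^ d))"
    have "ennreal (?c k) * (\<integral>\<^sup>+ y. xnorm (f y - m) * indicator (ball x0 (s r (Suc k))) y \<partial>lebesgue) \<le> ennreal (?c k) * ennreal ?X"
      by (intro mult_left_mono osc) simp
    also have "\<dots> = ennreal (?c k * ?X)" by (rule ennreal_mult'[symmetric, OF c0])
    also have "\<dots> \<le> ennreal (A * (\<kappa> * (2 ^ d * (1 + 2 ^ d)) * ((real k + 2) / 2 ^ k)) * bump (s r k) t)"
    proof (rule ennreal_leI)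
      have ss: "s r (Suc k) ^ d = 2 ^ d * s r k ^ d"
      proof -
        have "s r (Suc k) = 2 * s r k" by (simp add: s_def)
        then show ?thesis by (simp only: power_mult_distrib)
      qed
      have q: "2 * r / s r k = 1 / 2 ^ k" using r by (simp add: s_def)
      have "?c k * ?X = (2 * r / s r k) * (\<kappa> * 2 ^ d * A * bump (s r k) t) * (1 + real (Suc k) * (1 + 2 ^ d)) * (s r k ^ d / s r k ^ d)"
        unfolding ss by simp
      also have "\<dots> = (1 / 2 ^ k) * (\<kappa> * 2 ^ d * A * bump (s r k) t) * (1 + real (Suc k) * (1 + 2 ^ d))"
        unfolding q using s_pos[of k] by simp
      also have "\<dots> \<le> (1 / 2 ^ k) * (\<kappa> * 2 ^ d * A * bump (s r k) t) * ((1 + 2 ^ d) * (real k + 2))"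
        using \<kappa>_nonneg A bump_nonneg[OF t s_pos[of k]]
        by (intro mult_left_mono) (auto simp: algebra_simps)
      also have "\<dots> = A * (\<kappa> * (2 ^ d * (1 + 2 ^ d)) * ((real k + 2) / 2 ^ k)) * bump (s r k) t" by simp
      finally show "?c k * ?X \<le> A * (\<kappa> * (2 ^ d * (1 + 2 ^ d)) * ((real k + 2) / 2 ^ k)) * bump (s r k) t" .
    qed
    finally show "ennreal (?c k) * (\<integral>\<^sup>+ y. xnorm (f y - m) * indicator (ball x0 (s r (Suc k))) y \<partial>lebesgue)
        \<le> ennreal (A * (\<kappa> * (2 ^ d * (1 + 2 ^ d)) * ((real k + 2) / 2 ^ k)) * bump (s r k) t)" .
  qed
  also have "\<dots> = ennreal (\<Sum>k<n. A * (\<kappa> * (2 ^ d * (1 + 2 ^ d)) * ((real k + 2) / 2 ^ k)) * bump (s r k) t)"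
    using A \<kappa>_nonneg bump_nonneg[OF t s_pos] by (intro sum_ennreal) simp
  finally show "xnorm (kint g x t - kint g x0 t) \<le>
    ennreal (\<Sum>k<n. A * (\<kappa> * (2 ^ d * (1 + 2 ^ d)) * ((real k + 2) / 2 ^ k)) * bump (s r k) t)" .
qed

text \<open>By \<open>kint_translate_ball\<close>, the value at \<open>x0\<close> is also the value
  at \<open>x\<close> for the ball centred at \<open>x\<close>. The difference is therefore an
  integral at \<open>x\<close> over the two crescents between the balls; these lie in a shell of
  relative volume of order \<open>r / R\<close>, at distance at least \<open>R / 2\<close> from
  \<open>x\<close>.\<close>

lemma shell_bound:
  fixes m :: 'x and x x0 :: 'a
  assumes r: "0 < r" "2 * r \<le> R" and t: "0 < t" and x: "dist x x0 < r"
    and m: "norm m * \<omega> * (r / R) \<le> Y"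
  shows "xnorm (kint (\<lambda>y. indicator (ball x0 R) y *\<^sub>R m) x t - kint (\<lambda>y. indicator (ball x0 R) y *\<^sub>R m) x0 t)
    \<le> ennreal (\<kappa> * (2 * 2 ^ d * Y) * bump R t)"
proof -
  have R: "0 < R" using r by linarith
  note tr = kint_translate_ball[OF t R]
  let ?e = "\<lambda>y. indicator (ball x0 R) y *\<^sub>R m - indicator (ball x R) y *\<^sub>R m"
  let ?S = "ball x0 (R + r) - ball x0 (R - r)"
  have e: "L1 ?e" by (intro L1_diff tr(1))
  have eS: "dist x0 y < R + r \<and> R - r \<le> dist x0 y \<and> R / 2 \<le> norm (x - y)" if "?e y \<noteq> 0" for y
  proof -
    have "(dist x0 y < R \<and> R \<le> dist x y) \<or> (dist x y < R \<and> R \<le> dist x0 y)"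
      using that by (auto simp: indicator_def split: if_splits)
    moreover have "dist x0 y \<le> dist x y + r" "dist x y \<le> dist x0 y + r"
      using x dist_triangle[of x0 y x] dist_triangle[of x y x0] by (auto simp: dist_commute)
    ultimately show ?thesis using r by (auto simp: dist_norm[symmetric])
  qed
  have "kint (\<lambda>y. indicator (ball x0 R) y *\<^sub>R m) x t - kint (\<lambda>y. indicator (ball x0 R) y *\<^sub>R m) x0 t = kint ?e x t"
    using kint_diff[OF tr(1)[of x0 m] tr(1)[of x m] t, of x] tr(2)[of x m x0] by simp
  also have "xnorm (kint ?e x t) \<le> ennreal (\<kappa> / R ^ DIM('a) * bump R t) * (\<integral>\<^sup>+ y. xnorm (?e y) \<partial>lebesgue)"
  proof (rule xnorm_kint_le_const[OF e t], rule AE_I2, rule impI)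
    fix y assume "?e y \<noteq> 0"
    from eS[OF this] have "R / 2 \<le> norm (x - y)" by (elim conjE)
    then show "\<bar>kern t (x - y)\<bar> \<le> \<kappa> / R ^ DIM('a) * bump R t" using t R by (intro kernel_le)
  qed
  also have "(\<integral>\<^sup>+ y. xnorm (?e y) \<partial>lebesgue) \<le> ennreal (norm m * (r / R * (2 * 2 ^ d) * R ^ d * \<omega>))"
  proof -
    have "(\<integral>\<^sup>+ y. xnorm (?e y) \<partial>lebesgue) \<le> (\<integral>\<^sup>+ y. xnorm m * indicator ?S y \<partial>lebesgue)"
    proof (rule nn_integral_mono)
      fix y
      show "xnorm (?e y) \<le> xnorm m * indicator ?S y"
      proof (cases "?e y = 0")
        case True
        show ?thesis unfolding True by simp
      next
        case False
        then have "y \<in> ?S" using eS[OF False] by simp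
        moreover have "xnorm (?e y) \<le> xnorm m" by (auto simp: indicator_def)
        ultimately show ?thesis by simp
      qed
    qed
    also have "\<dots> = xnorm m * emeasure lebesgue ?S" by (rule nn_integral_cmult_indicator) auto
    also have "emeasure lebesgue ?S = emeasure lebesgue (ball x0 (R + r)) - emeasure lebesgue (ball x0 (R - r))"
    proof (rule emeasure_Diff)
      show "emeasure lebesgue (ball x0 (R - r)) \<noteq> \<infinity>"
        using emeasure_bounded_finite[OF bounded_ball, of x0 "R - r"] by simp
      show "ball x0 (R - r) \<subseteq> ball x0 (R + r)" using r by (intro subset_ball) simp
    qed auto
    also have "\<dots> = ennreal (((R + r) ^ d - (R - r) ^ d) * \<omega>)"
      using r \<omega>_pos emeasure_ball_eq[of "R + r" x0] emeasure_ball_eq[of "R - r" x0]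
      by (simp add: d_def ennreal_minus left_diff_distrib)
    also have "xnorm m * \<dots> \<le> xnorm m * ennreal (r / R * (2 * 2 ^ d) * R ^ d * \<omega>)"
      using power_shell_le[of r R d] r \<omega>_pos by (intro mult_left_mono ennreal_leI mult_right_mono) auto
    also have "\<dots> = ennreal (norm m * (r / R * (2 * 2 ^ d) * R ^ d * \<omega>))"
      unfolding xnorm_def by (rule ennreal_mult'[symmetric]) simp
    finally show ?thesis .
  qed
  also have "ennreal (\<kappa> / R ^ DIM('a) * bump R t) * ennreal (norm m * (r / R * (2 * 2 ^ d) * R ^ d * \<omega>))
      = ennreal (\<kappa> / R ^ DIM('a) * bump R t * (norm m * (r / R * (2 * 2 ^ d) * R ^ d * \<omega>)))"
    using \<kappa>_nonneg R bump_nonneg[OF t R] by (intro ennreal_mult'[symmetric]) simp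
  also have "\<dots> \<le> ennreal (\<kappa> * (2 * 2 ^ d * Y) * bump R t)"
  proof (rule ennreal_leI)
    have "\<kappa> / R ^ DIM('a) * bump R t * (norm m * (r / R * (2 * 2 ^ d) * R ^ d * \<omega>)) =
        \<kappa> * bump R t * (2 * 2 ^ d) * (norm m * \<omega> * (r / R))"
      using R by (simp add: d_def)
    also have "\<dots> \<le> \<kappa> * bump R t * (2 * 2 ^ d) * Y"
      using \<kappa>_nonneg bump_nonneg[OF t R] by (intro mult_left_mono m) simp
    finally show "\<kappa> / R ^ DIM('a) * bump R t * (norm m * (r / R * (2 * 2 ^ d) * R ^ d * \<omega>)) \<le> \<kappa> * (2 * 2 ^ d * Y) * bump R t"
      by (simp add: mult_ac)
  qed
  finally show ?thesis by (simp add: mult_left_mono)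
qed

text \<open>\<open>2 * C0 * R \<le> \<rho> x0\<close> yields \<open>2 * R \<le> \<rho> x\<close> at
  every nearby \<open>x\<close>, so the ball of radius \<open>R\<close> lies inside all these
  truncations. The rest of the cut function changes with \<open>x\<close> without control, but it
  lives at distances of order \<open>R\<close>, within a ball of radius at most
  \<open>8 * C0\<^sup>2 * R\<close>, where the size of the kernel suffices.\<close>

lemma far_bound:
  assumes R: "0 < R" "2 * C0 * R \<le> \<rho> x0" "\<rho> x0 \<le> 4 * C0 * R" and r: "0 < r" "2 * r \<le> R" and t: "0 < t" and x: "dist x x0 < r"
  defines "h \<equiv> \<lambda>y. cut x f y - indicator (ball x0 R) y *\<^sub>R f y"
  shows "L1 h" "ball x0 R \<subseteq> cball x (\<rho> x)" "xnorm (kint h x t) \<le> ennreal (A * (\<kappa> * (8 * C0\<^sup>2) ^ d) * bump R t)"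
proof -
  show h: "L1 h" unfolding h_def by (intro L1_diff cut_f_L1 f_L1 R)
  have CR: "R \<le> C0 * R" using C0 R by simp
  have dx: "dist x0 x \<le> 2 * \<rho> x0"
  proof -
    have "dist x0 x < R" using x r by (simp add: dist_commute)
    then show ?thesis using CR R by linarith
  qed
  have rho: "\<rho> x0 \<le> C0 * \<rho> x" "\<rho> x \<le> C0 * \<rho> x0" using comparable1[OF dx] comparable2[OF dx] .
  have "C0 * (2 * R) \<le> C0 * \<rho> x" using R(2) rho(1) by linarith
  then have rx: "2 * R \<le> \<rho> x" using C0 by simp
  show sub: "ball x0 R \<subseteq> cball x (\<rho> x)"
  proof
    fix y assume "y \<in> ball x0 R"
    then have "dist x y < r + R" using x dist_triangle[of x y x0] by simp
    then show "y \<in> cball x (\<rho> x)" using rx r by simp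
  qed
  let ?P = "2 * C0 * \<rho> x0"
  have Crho: "\<rho> x0 \<le> C0 * \<rho> x0" using C0 rho_pos[of x0] by simp
  have P: "0 < ?P" "\<rho> x0 \<le> ?P" using rho_pos[of x0] Crho by linarith+
  have hy: "R \<le> dist x0 y \<and> y \<in> ball x0 ?P \<and> h y = f y" if "h y \<noteq> 0" for y
  proof -
    have "y \<in> ball x0 R \<Longrightarrow> y \<in> cball x (\<rho> x)" using sub by blast
    then have y: "y \<in> cball x (\<rho> x)" "y \<notin> ball x0 R"
      using that by (cases "y \<in> ball x0 R"; cases "y \<in> cball x (\<rho> x)"; simp add: h_def)+
    have "dist x0 y < r + C0 * \<rho> x0" using y(1) x rho(2) dist_triangle[of x0 y x] by (simp add: dist_commute)
    moreover have "r < \<rho> x0" using r R CR by linarith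
    ultimately have "y \<in> ball x0 ?P" using Crho by simp
    then show ?thesis using y by (simp add: h_def)
  qed
  have far: "R / 2 \<le> norm (x - y)" if "h y \<noteq> 0" for y
    using hy[OF that] x r dist_triangle[of x0 y x] by (simp add: dist_norm[symmetric] dist_commute)
  have "xnorm (kint h x t) \<le> ennreal (\<kappa> / R ^ DIM('a) * bump R t) * (\<integral>\<^sup>+ y. xnorm (h y) \<partial>lebesgue)"
    using far t R by (intro xnorm_kint_le_const[OF h t] AE_I2 impI kernel_le)
  also have "\<dots> \<le> ennreal (\<kappa> / R ^ DIM('a) * bump R t) * ennreal (A * ?P ^ d)"
  proof (intro mult_left_mono)
    have "(\<integral>\<^sup>+ y. xnorm (h y) \<partial>lebesgue) \<le> (\<integral>\<^sup>+ y. xnorm (f y) * indicator (ball x0 ?P) y \<partial>lebesgue)"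
    proof (rule nn_integral_mono)
      fix y
      show "xnorm (h y) \<le> xnorm (f y) * indicator (ball x0 ?P) y"
        using hy[of y] by (cases "h y = 0") auto
    qed
    also have "\<dots> \<le> ennreal (A * ?P ^ d)" by (rule f_big[OF P])
    finally show "(\<integral>\<^sup>+ y. xnorm (h y) \<partial>lebesgue) \<le> ennreal (A * ?P ^ d)" .
  qed simp
  also have "\<dots> = ennreal (\<kappa> / R ^ DIM('a) * bump R t * (A * ?P ^ d))"
    using \<kappa>_nonneg R bump_nonneg[OF t R(1)] by (intro ennreal_mult'[symmetric]) simp
  also have "\<dots> \<le> ennreal (A * (\<kappa> * (8 * C0\<^sup>2) ^ d) * bump R t)"
  proof (rule ennreal_leI)
    have "2 * C0 * \<rho> x0 \<le> 2 * C0 * (4 * C0 * R)" using R C0 by (intro mult_left_mono) auto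
    then have "?P \<le> 8 * C0\<^sup>2 * R" by (simp add: power2_eq_square)
    then have "?P ^ d \<le> (8 * C0\<^sup>2 * R) ^ d" using less_imp_le[OF P(1)] by (rule power_mono)
    also have "\<dots> = (8 * C0\<^sup>2) ^ d * R ^ d" by (rule power_mult_distrib)
    finally have "?P ^ d \<le> (8 * C0\<^sup>2) ^ d * R ^ d" .
    then have "\<kappa> / R ^ DIM('a) * bump R t * (A * ?P ^ d) \<le> \<kappa> / R ^ DIM('a) * bump R t * (A * ((8 * C0\<^sup>2) ^ d * R ^ d))"
      using \<kappa>_nonneg R A bump_nonneg[OF t R(1)] by (intro mult_left_mono) auto
    also have "\<dots> = A * (\<kappa> * (8 * C0\<^sup>2) ^ d) * bump R t" using R by (simp add: d_def)
    finally show "\<kappa> / R ^ DIM('a) * bump R t * (A * ?P ^ d) \<le> A * (\<kappa> * (8 * C0\<^sup>2) ^ d) * bump R t" .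
  qed
  finally show "xnorm (kint h x t) \<le> ennreal (A * (\<kappa> * (8 * C0\<^sup>2) ^ d) * bump R t)" .
qed

text \<open>The radius sought comes one step before the first doubling of \<open>2 * r\<close> that
  passes \<open>\<rho> x0 / (2 * C0)\<close>; the assumption on \<open>r\<close> says that
  \<open>2 * r\<close> itself has not passed it.\<close>

lemma dyadic_radius:
  assumes r: "0 < r" "4 * C0 * r \<le> \<rho> x0"
  obtains n where "2 * C0 * (2 ^ n * (2 * r)) \<le> \<rho> x0" "\<rho> x0 \<le> 4 * C0 * (2 ^ n * (2 * r))"
proof -
  let ?s = "\<lambda>k. 2 * C0 * (2 ^ k * (2 * r))"
  have c: "0 < 4 * C0 * r" using C0 r by simp
  obtain k where "\<rho> x0 / (4 * C0 * r) < 2 ^ k" using real_arch_pow[of 2 "\<rho> x0 / (4 * C0 * r)"] by auto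
  then have "\<rho> x0 < 2 ^ k * (4 * C0 * r)" using c by (simp only: pos_divide_less_eq)
  then have ex: "\<exists>k. \<rho> x0 < ?s k" by (intro exI[of _ k]) (simp add: mult_ac)
  define j where "j = (LEAST k. \<rho> x0 < ?s k)"
  have j: "\<rho> x0 < ?s j" unfolding j_def using ex by (rule LeastI_ex)
  have "j \<noteq> 0" using j r(2) by (intro notI) simp
  then obtain n where n: "j = Suc n" by (cases j) auto
  have "n < (LEAST k. \<rho> x0 < ?s k)" using n unfolding j_def by (simp only: lessI)
  then have "\<not> \<rho> x0 < ?s n" by (rule not_less_Least)
  then have "?s n \<le> \<rho> x0" by (simp only: not_less)
  moreover have "\<rho> x0 \<le> 4 * C0 * (2 ^ n * (2 * r))" using j by (simp add: n)
  ultimately show ?thesis by (rule that)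
qed

lemma small_ball:
  assumes r: "0 < r" "4 * C0 * r \<le> \<rho> x0"
  obtains c where "N c < \<infinity>"
    "(\<integral>\<^sup>+ x. N (T f x - c) \<partial>lebesgue_on (ball x0 r)) \<le> ennreal (A * r ^ d * K3)"
proof -
  obtain n where n: "2 * C0 * (2 ^ n * (2 * r)) \<le> \<rho> x0" "\<rho> x0 \<le> 4 * C0 * (2 ^ n * (2 * r))"
    using dyadic_radius[OF r] .
  define s where "s k = 2 ^ k * (2 * r)" for k :: nat
  define R where "R = s n"
  have s_pos: "0 < s k" for k using r by (simp add: s_def)
  have R: "0 < R" "2 * C0 * R \<le> \<rho> x0" "\<rho> x0 \<le> 4 * C0 * R" using n s_pos[of n] by (simp_all add: R_def s_def)
  have rR: "2 * r \<le> R" using r by (simp add: R_def s_def)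
  have "\<exists>m. \<forall>k. (\<integral>\<^sup>+ y. xnorm (f y - m k) * indicator (ball x0 (s k)) y \<partial>lebesgue) \<le> ennreal (A * s k ^ d)"
    using f_osc[OF s_pos] by (intro choice) blast
  then obtain m where m: "\<And>k. (\<integral>\<^sup>+ y. xnorm (f y - m k) * indicator (ball x0 (s k)) y \<partial>lebesgue) \<le> ennreal (A * s k ^ d)"
    by blast
  have s_Suc: "s (Suc k) ^ d = 2 ^ d * s k ^ d" for k
  proof -
    have "s (Suc k) = 2 * s k" by (simp add: s_def)
    then show ?thesis by (simp only: power_mult_distrib)
  qed
  have As: "0 \<le> A * s k ^ d" for k using A s_pos[of k] by simp
  have step: "norm (m (Suc k) - m k) * \<omega> \<le> A * (1 + 2 ^ d)" for k
  proof -
    have "ball x0 (s k) \<subseteq> ball x0 (s (Suc k))" using r by (intro subset_ball) (simp add: s_def)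
    then have "(\<integral>\<^sup>+ y. xnorm (f y - m (Suc k)) * indicator (ball x0 (s k)) y \<partial>lebesgue) \<le> ennreal (A * s (Suc k) ^ d)"
      by (intro order_trans[OF _ m[of "Suc k"]] nn_integral_mono mult_left_mono indicator_leI) (blast | simp)+
    from mean_diff_le[OF s_pos[of k] As As this m[of k]]
    have "norm (m (Suc k) - m k) * \<omega> * s k ^ d \<le> A * (1 + 2 ^ d) * s k ^ d"
      unfolding s_Suc by (simp add: algebra_simps)
    then show ?thesis using s_pos[of k] by simp
  qed
  have tele: "norm (m k - m 0) * \<omega> \<le> real k * (A * (1 + 2 ^ d))" for k
  proof (induction k)
    case (Suc k)
    have "norm (m (Suc k) - m 0) \<le> norm (m (Suc k) - m k) + norm (m k - m 0)"
      using norm_triangle_ineq[of "m (Suc k) - m k" "m k - m 0"] by simp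
    then have "norm (m (Suc k) - m 0) * \<omega> \<le> norm (m (Suc k) - m k) * \<omega> + norm (m k - m 0) * \<omega>"
      using \<omega>_pos by (simp add: distrib_right[symmetric])
    then show ?case using step[of k] Suc by (simp add: algebra_simps)
  qed simp
  have osc: "(\<integral>\<^sup>+ y. xnorm (f y - m 0) * indicator (ball x0 (s k)) y \<partial>lebesgue) \<le> ennreal (A * s k ^ d * (1 + real k * (1 + 2 ^ d)))" for k
    using osc_change_mean[OF s_pos[of k] As tele m[of k]] by (simp add: algebra_simps)
  \<comment> \<open>The chain of means ends at radius \<open>R\<close>. As \<open>4 * C0 * R\<close>
    is at least \<open>\<rho> x0\<close>, \<open>f_big\<close> bounds the average of
    \<open>f\<close> itself there, which bounds \<open>m n\<close>; the chain then leads back to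
    \<open>m 0\<close>.\<close>
  have m0: "norm (m 0) * \<omega> \<le> A * ((real n + 1) * Q)"
  proof -
    have "(\<integral>\<^sup>+ y. xnorm (f y - 0) * indicator (ball x0 R) y \<partial>lebesgue) \<le> (\<integral>\<^sup>+ y. xnorm (f y) * indicator (ball x0 (4 * C0 * R)) y \<partial>lebesgue)"
    proof (intro nn_integral_mono)
      fix y
      have "R \<le> 4 * C0 * R" using C0 R by simp
      then show "xnorm (f y - 0) * indicator (ball x0 R) y \<le> xnorm (f y) * indicator (ball x0 (4 * C0 * R)) y"
        by (auto simp: indicator_def)
    qed
    also have "\<dots> \<le> ennreal (A * (4 * C0 * R) ^ d)"
      using R C0 by (intro f_big) simp_all
    finally have z: "(\<integral>\<^sup>+ y. xnorm (f y - 0) * indicator (ball x0 R) y \<partial>lebesgue) \<le> ennreal (A * (4 * C0 * R) ^ d)" .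
    have "0 \<le> A * (4 * C0 * R) ^ d" using A C0 R by simp
    from mean_diff_le[OF R(1) As[of n, folded R_def] this m[of n, folded R_def] z]
    have "norm (m n) * \<omega> * R ^ d \<le> A * (1 + (4 * C0) ^ d) * R ^ d"
      by (simp add: R_def[symmetric] algebra_simps power_mult_distrib)
    then have mn: "norm (m n) * \<omega> \<le> A * (1 + (4 * C0) ^ d)" using R by simp
    have "norm (m 0) \<le> norm (m n) + norm (m n - m 0)" using norm_triangle_ineq4[of "m n" "m n - m 0"] by simp
    then have "norm (m 0) * \<omega> \<le> norm (m n) * \<omega> + norm (m n - m 0) * \<omega>"
      using \<omega>_pos by (simp add: distrib_right[symmetric])
    also have "\<dots> \<le> A * (1 + (4 * C0) ^ d) + real n * (A * (1 + 2 ^ d))" using mn tele[of n] by (rule add_mono)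
    also have "\<dots> = A * ((1 + (4 * C0) ^ d) + real n * (1 + 2 ^ d))" by (simp add: algebra_simps)
    also have "\<dots> \<le> A * ((real n + 1) * Q)"
    proof (rule mult_left_mono)
      have "real n * (1 + 2 ^ d) \<le> real n * Q" using C0 by (intro mult_left_mono) (auto simp: Q_def)
      moreover have "1 + (4 * C0) ^ d \<le> Q" by (simp add: Q_def)
      ultimately show "(1 + (4 * C0) ^ d) + real n * (1 + 2 ^ d) \<le> (real n + 1) * Q" by (simp add: distrib_right)
    qed (use A in simp)
    finally show ?thesis .
  qed
  \<comment> \<open>Since \<open>R = 2 ^ n * (2 * r)\<close>, the ratio \<open>r / R\<close> equals
    \<open>1 / (2 * 2 ^ n)\<close> and outweighs the factor \<open>real n + 1\<close> in
    \<open>m0\<close>.\<close>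
  have m0R: "norm (m 0) * \<omega> * (r / R) \<le> A * Q"
  proof -
    have rR': "r / R = 1 / (2 * 2 ^ n)" using r by (simp add: R_def s_def)
    have "real n + 1 \<le> 2 * 2 ^ n" using of_nat_less_two_power[of n, where 'a=real] one_le_power[of "2::real" n] by linarith
    then have q: "(real n + 1) * (1 / (2 * 2 ^ n)) \<le> 1" by simp
    have "norm (m 0) * \<omega> * (r / R) \<le> A * ((real n + 1) * Q) * (1 / (2 * 2 ^ n))"
      unfolding rR' using m0 by (intro mult_right_mono) auto
    also have "\<dots> = A * Q * ((real n + 1) * (1 / (2 * 2 ^ n)))" by simp
    also have "\<dots> \<le> A * Q * 1" using q A Q_nonneg by (intro mult_left_mono) auto
    finally show ?thesis by simp
  qed
  have s0: "s 0 = 2 * r" by (simp add: s_def)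
  have m2r: "(\<integral>\<^sup>+ y. xnorm (f y - m 0) * indicator (ball x0 (2 * r)) y \<partial>lebesgue) \<le> ennreal (A * (2 * r) ^ d)"
    using m[of 0] by (simp only: s0)
  have r2: "0 < 2 * r" using r by simp
  let ?f1 = "\<lambda>y. indicator (ball x0 (2 * r)) y *\<^sub>R (f y - m 0)"
  let ?fR = "\<lambda>y. indicator (ball x0 R) y *\<^sub>R f y"
  let ?g = "\<lambda>y. indicator (ball x0 R) y *\<^sub>R (f y - m 0) - ?f1 y"
  let ?b = "\<lambda>y. indicator (ball x0 R) y *\<^sub>R m 0"
  note Tf1 = T_ball[OF r2 m2r]
  \<comment> \<open>The values at the centre of the two parts that are handled by differences, the
    annulus and the constant. The local part and the part beyond \<open>R\<close> are bounded
    without subtraction.\<close>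
  define c where "c t = kint ?g x0 t + kint ?b x0 t" for t
  have gL: "L1 ?g" using R r2 by (intro L1_diff ball_L1) simp_all
  have f1L: "L1 ?f1" using r2 by (rule ball_L1)
  have bL: "L1 ?b" by (rule kint_translate_ball(1)[of 1]) (use R in simp_all)
  have cut1: "cut x ?f1 = ?f1" if x: "dist x x0 < r" for x
    using far_bound(2)[OF R r(1) rR zero_less_one x] rR
    by (auto simp: fun_eq_iff indicator_def subset_iff)
  have key: "N (T f x - T ?f1 x - c) \<le> ennreal (A * K2)" if x: "dist x x0 < r" for x
  proof -
    let ?h = "\<lambda>y. cut x f y - ?fR y"
    have hL: "L1 ?h" by (rule far_bound(1)[OF R r(1) rR zero_less_one x])
    have split: "(T f x - T ?f1 x - c) t = kint ?h x t + (kint ?g x t - kint ?g x0 t) + (kint ?b x t - kint ?b x0 t)" if t: "0 < t" for t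
    proof -
      have "cut x f = (\<lambda>y. ?h y + ((?f1 y + ?g y) + ?b y))"
        by (simp add: fun_eq_iff scaleR_diff_right)
      then have "T f x t = kint ?h x t + ((kint ?f1 x t + kint ?g x t) + kint ?b x t)"
        using T_eq[OF cut_f_L1 t, of x] kint_add[OF hL L1_add[OF L1_add[OF f1L gL] bL] t, of x]
          kint_add[OF L1_add[OF f1L gL] bL t, of x] kint_add[OF f1L gL t, of x] by simp
      moreover have "T ?f1 x t = kint ?f1 x t" using T_eq[of x ?f1 t] cut1[OF x] f1L t by simp
      ultimately show ?thesis by (simp add: c_def)
    qed
    \<comment> \<open>The indices below \<open>n\<close> belong to the annuli; the last one collects
      both terms of width \<open>R = s n\<close>, the part beyond \<open>R\<close> and the moved
      ball.\<close>
    let ?bk = "\<lambda>k. if k < n then A * (\<kappa> * (2 ^ d * (1 + 2 ^ d)) * ((real k + 2) / 2 ^ k))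
      else A * (\<kappa> * (8 * C0\<^sup>2) ^ d) + \<kappa> * (2 * 2 ^ d * (A * Q))"
    have bk0: "0 \<le> ?bk k" for k using A \<kappa>_nonneg Q_nonneg by simp
    have cont: "continuous_on {0<..} (T f x - T ?f1 x - c)"
    proof -
      have T1: "continuous_on {0<..} (T ?f1 x)" by (intro T_continuous cut_L1 f1L)
      have "continuous_on {0<..} (\<lambda>t. T f x t - T ?f1 x t - c t)"
        unfolding c_def by (intro continuous_intros T1 T_continuous[OF cut_f_L1] kint_continuous gL bL)
      then show ?thesis by (simp add: fun_diff_def)
    qed
    have "N (T f x - T ?f1 x - c) \<le> ennreal (\<Sum>k\<le>n. ?bk k)"
    proof (rule Lq_dt_t_bump_sum[OF q cont, where w=s])
      fix t :: real assume t: "0 < t"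
      have b0: "0 \<le> bump (s k) t" for k using t s_pos by (rule bump_nonneg)
      let ?X = "A * (\<kappa> * (8 * C0\<^sup>2) ^ d) * bump R t"
      let ?Y = "\<Sum>k<n. A * (\<kappa> * (2 ^ d * (1 + 2 ^ d)) * ((real k + 2) / 2 ^ k)) * bump (s k) t"
      let ?Z = "\<kappa> * (2 * 2 ^ d * (A * Q)) * bump R t"
      have nn: "0 \<le> ?X" "0 \<le> ?Y" "0 \<le> ?Z"
        using A \<kappa>_nonneg Q_nonneg b0 by (auto simp: R_def intro!: sum_nonneg)
      have "xnorm ((T f x - T ?f1 x - c) t) \<le> xnorm (kint ?h x t) + xnorm (kint ?g x t - kint ?g x0 t) + xnorm (kint ?b x t - kint ?b x0 t)"
        unfolding split[OF t] by (meson add_right_mono order_trans xnorm.triangle)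
      also have "\<dots> \<le> ennreal ?X + ennreal ?Y + ennreal ?Z"
      proof (intro add_mono)
        show "xnorm (kint ?h x t) \<le> ennreal ?X" by (rule far_bound(3)[OF R r(1) rR t x])
        show "xnorm (kint ?g x t - kint ?g x0 t) \<le> ennreal ?Y"
          using annulus_bound(2)[OF r(1) t x osc[unfolded s_def], of n] by (simp only: R_def s_def)
        show "xnorm (kint ?b x t - kint ?b x0 t) \<le> ennreal ?Z" by (rule shell_bound[OF r(1) rR t x m0R])
      qed
      also have "\<dots> = ennreal (?X + ?Y + ?Z)" using nn by (simp only: ennreal_plus add_nonneg_nonneg)
      also have "?X + ?Y + ?Z = (\<Sum>k\<le>n. ?bk k * bump (s k) t)"
        by (simp add: lessThan_Suc_atMost[symmetric] R_def distrib_right)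
      finally show "xnorm ((T f x - T ?f1 x - c) t) \<le> ennreal (\<Sum>k\<le>n. ?bk k * bump (s k) t)" .
    qed (use s_pos bk0 in auto)
    also have "\<dots> \<le> ennreal (A * K2)"
    proof (rule ennreal_leI)
      have "(\<Sum>k\<le>n. ?bk k) = A * (\<kappa> * (2 ^ d * (1 + 2 ^ d))) * (\<Sum>k<n. (real k + 2) / 2 ^ k) + (A * (\<kappa> * (8 * C0\<^sup>2) ^ d) + \<kappa> * (2 * 2 ^ d * (A * Q)))"
        by (simp add: lessThan_Suc_atMost[symmetric] sum_distrib_left mult.assoc)
      also have "\<dots> \<le> A * (\<kappa> * (2 ^ d * (1 + 2 ^ d))) * 6 + (A * (\<kappa> * (8 * C0\<^sup>2) ^ d) + \<kappa> * (2 * 2 ^ d * (A * Q)))"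
        using A \<kappa>_nonneg by (intro add_right_mono mult_left_mono sum_linear_geometric) auto
      also have "\<dots> = A * K2" by (simp add: K2_def algebra_simps)
      finally show "(\<Sum>k\<le>n. ?bk k) \<le> A * K2" .
    qed
    finally show ?thesis .
  qed
  let ?M = "lebesgue_on (ball x0 r)"
  \<comment> \<open>\<open>c\<close> is made of integrals at the single point \<open>x0\<close>,
    about which almost everywhere statements say nothing. But \<open>T f x\<close> and
    \<open>T ?f1 x\<close> have finite norm at some \<open>x\<close> of the ball, and
    \<open>key\<close> at that \<open>x\<close> carries finiteness over to \<open>c\<close>.\<close>
  have "N c < \<infinity>"
  proof -
    have "AE x in ?M. N (T ?f1 x) < \<infinity>"
      by (intro N.strongly_measurable_AE_finite N.strongly_measurable_restrict Tf1(1)) simp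
    with N.strongly_measurable_AE_finite[OF T_ball_measurable[of x0 r]]
    have "AE x in ?M. N (T f x) < \<infinity> \<and> N (T ?f1 x) < \<infinity>" by eventually_elim simp
    moreover have "emeasure ?M (space ?M) \<noteq> 0"
    proof -
      have "emeasure ?M (space ?M) = emeasure lebesgue (ball x0 r)"
        by (simp add: emeasure_restrict_space space_restrict_space)
      moreover have "emeasure lebesgue (ball x0 r) = ennreal (r ^ DIM('a) * \<omega>)"
        using r by (intro emeasure_ball_eq) simp
      ultimately show ?thesis using r \<omega>_pos by simp
    qed
    ultimately obtain x where x: "x \<in> space ?M" "N (T f x) < \<infinity>" "N (T ?f1 x) < \<infinity>"
      using AE_imp_ex[where M="?M"] by blast
    have "dist x x0 < r" using x(1) by (simp add: space_restrict_space dist_commute)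
    then have "N (T f x - T ?f1 x - c) < \<infinity>" using key[of x] by (auto elim: order.strict_trans1)
    from N.diff_finite[OF N.diff_finite[OF x(2,3)] this] show ?thesis by simp
  qed
  moreover have "(\<integral>\<^sup>+ x. N (T f x - c) \<partial>?M) \<le> ennreal (A * r ^ d * K3)"
  proof -
    have B: "ball x0 r \<in> sets lebesgue" by simp
    have Tm: "(\<lambda>x. N (T ?f1 x) * indicator (ball x0 r) x) \<in> borel_measurable lebesgue"
      using N.borel_measurable_seminorm[OF complete_measure_lebesgue Tf1(1)] B
      by (intro borel_measurable_times_ennreal borel_measurable_indicator)
    have "(\<integral>\<^sup>+ x. N (T f x - c) \<partial>?M) = (\<integral>\<^sup>+ x. N (T f x - c) * indicator (ball x0 r) x \<partial>lebesgue)"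
      by (rule nn_integral_restrict_space) simp
    also have "\<dots> \<le> (\<integral>\<^sup>+ x. N (T ?f1 x) * indicator (ball x0 r) x + ennreal (A * K2) * indicator (ball x0 r) x \<partial>lebesgue)"
    proof (rule nn_integral_mono)
      fix x
      show "N (T f x - c) * indicator (ball x0 r) x \<le> N (T ?f1 x) * indicator (ball x0 r) x + ennreal (A * K2) * indicator (ball x0 r) x"
      proof (cases "x \<in> ball x0 r")
        case True
        have "T f x - c = T ?f1 x + (T f x - T ?f1 x - c)" by simp
        then have "N (T f x - c) \<le> N (T ?f1 x) + N (T f x - T ?f1 x - c)"
          using N.triangle[of "T ?f1 x" "T f x - T ?f1 x - c"] by (simp only:)
        also have "\<dots> \<le> N (T ?f1 x) + ennreal (A * K2)"
          using True by (intro add_left_mono key) (simp add: dist_commute)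
        finally show ?thesis using True by simp
      qed simp
    qed
    also have "\<dots> = (\<integral>\<^sup>+ x. N (T ?f1 x) * indicator (ball x0 r) x \<partial>lebesgue) + (\<integral>\<^sup>+ x. ennreal (A * K2) * indicator (ball x0 r) x \<partial>lebesgue)"
      by (rule nn_integral_add[OF Tm borel_measurable_times_ennreal[OF borel_measurable_const borel_measurable_indicator[OF B]]])
    also have "(\<integral>\<^sup>+ x. ennreal (A * K2) * indicator (ball x0 r) x \<partial>lebesgue) = ennreal (A * K2) * emeasure lebesgue (ball x0 r)"
      using B by (rule nn_integral_cmult_indicator)
    also have "\<dots> = ennreal (A * K2) * ennreal (r ^ d * \<omega>)"
      using emeasure_ball_eq[OF less_imp_le[OF r(1)], of x0] by (simp only: d_def)
    also have "\<dots> = ennreal (A * K2 * (r ^ d * \<omega>))"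
      using A K2_nonneg by (intro ennreal_mult'[symmetric]) simp
    also have "(\<integral>\<^sup>+ x. N (T ?f1 x) * indicator (ball x0 r) x \<partial>lebesgue) + \<dots> \<le>
        ennreal (A * (r ^ d * \<omega> + C powr p * (KJ * (2 * r) ^ d))) + ennreal (A * K2 * (r ^ d * \<omega>))"
      by (intro add_right_mono Tf1(2) r)
    also have "\<dots> = ennreal (A * (r ^ d * \<omega> + C powr p * (KJ * (2 * r) ^ d)) + A * K2 * (r ^ d * \<omega>))"
      using A K2_nonneg KJ(1) \<omega>_pos r by (intro ennreal_plus[symmetric]) simp_all
    also have "A * (r ^ d * \<omega> + C powr p * (KJ * (2 * r) ^ d)) + A * K2 * (r ^ d * \<omega>) = A * r ^ d * K3"
      by (simp add: K3_def power_mult_distrib algebra_simps)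
    finally show ?thesis .
  qed
  ultimately show ?thesis by (rule that)
qed

text \<open>Large enough for the three cases of \<open>T_BMO\<close>: oscillation on small balls,
  oscillation on the other balls by way of the ball of radius \<open>4 * C0 * r\<close>, and
  averages over balls of at least critical radius.\<close>

definition K4 :: real where "K4 = 2 * K3 + 2 * ((4 * C0) ^ d * K1)"

lemma ennreal_ball_average_le:
  assumes r: "0 < r" and I: "I \<le> ennreal (A * r ^ d * K)" and K: "0 \<le> K" "K \<le> K4"
  shows "I / emeasure lebesgue (ball (x::'a) r) \<le> ennreal (A / \<omega> * K4)"
proof -
  have "I / emeasure lebesgue (ball x r) \<le> ennreal (A * r ^ d * K) / ennreal (r ^ d * \<omega>)"
    using emeasure_ball_eq[OF less_imp_le[OF r], of x] I by (simp only: d_def divide_right_mono_ennreal)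
  also have "\<dots> = ennreal (A * r ^ d * K / (r ^ d * \<omega>))"
    using A r K \<omega>_pos by (intro divide_ennreal) auto
  also have "A * r ^ d * K / (r ^ d * \<omega>) = A / \<omega> * K" using r by simp
  also have "ennreal (A / \<omega> * K) \<le> ennreal (A / \<omega> * K4)"
    using A \<omega>_pos K by (intro ennreal_leI mult_left_mono) auto
  finally show ?thesis .
qed

lemma T_BMO: "BMO_norm \<rho> N (T f) \<le> ennreal (A / \<omega> * K4)"
  unfolding BMO_norm_def
proof (rule Inf_lower, rule CollectI, intro conjI allI impI)
  show "locally_integrable N (T f)"
    unfolding locally_integrable_def Lp_norm_one using T_ball_measurable T_ball_finite by simp
next
  fix x :: 'a and r :: real assume r: "0 < r"
  let ?I = "\<integral>\<^sup>+ y. N (T f y - ball_mean N x r (T f)) \<partial>lebesgue_on (ball x r)"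
  have large: "(4 * C0) ^ d * K1 \<ge> 0" using C0 K1_nonneg by simp
  show "?I / emeasure lebesgue (ball x r) \<le> ennreal (A / \<omega> * K4)"
  proof (cases "4 * C0 * r \<le> \<rho> x")
    case True
    obtain c where c: "N c < \<infinity>" "(\<integral>\<^sup>+ x. N (T f x - c) \<partial>lebesgue_on (ball x r)) \<le> ennreal (A * r ^ d * K3)"
      using small_ball[OF r True] .
    have "?I \<le> 2 * (\<integral>\<^sup>+ y. N (T f y - c) \<partial>lebesgue_on (ball x r))" by (rule T_mean_oscillation[OF r c(1)])
    also have "\<dots> \<le> 2 * ennreal (A * r ^ d * K3)" by (intro mult_left_mono c) simp
    also have "\<dots> = ennreal (A * r ^ d * (2 * K3))"
      using A r K3_nonneg by (simp add: ennreal_mult mult_ac)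
    finally show ?thesis
      by (rule ennreal_ball_average_le[OF r]) (use K3_nonneg large in \<open>auto simp: K4_def\<close>)
  next
    case False
    \<comment> \<open>The enlarged ball has at least critical radius, so \<open>T f\<close> itself
      is bounded in mean there and 0 serves as the constant.\<close>
    let ?R = "4 * C0 * r"
    have R: "\<rho> x \<le> ?R" "r \<le> ?R" using False C0 r by auto
    have "(\<integral>\<^sup>+ y. N (T f y - 0) \<partial>lebesgue_on (ball x r)) = (\<integral>\<^sup>+ y. N (T f y) * indicator (ball x r) y \<partial>lebesgue)"
      by (subst nn_integral_restrict_space) simp_all
    also have "\<dots> \<le> (\<integral>\<^sup>+ y. N (T f y) * indicator (ball x ?R) y \<partial>lebesgue)"
      using subset_ball[OF R(2), of x] by (intro nn_integral_mono mult_left_mono indicator_leI) (blast | simp)+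
    also have "\<dots> \<le> ennreal (A * ?R ^ d * K1)" by (rule T_large(2)[OF R(1)])
    finally have "(\<integral>\<^sup>+ y. N (T f y - 0) \<partial>lebesgue_on (ball x r)) \<le> ennreal (A * ?R ^ d * K1)" .
    then have "?I \<le> 2 * ennreal (A * ?R ^ d * K1)"
      by (intro order_trans[OF T_mean_oscillation[OF r, of 0] mult_left_mono]) simp_all
    also have "\<dots> = ennreal (2 * (A * ?R ^ d * K1))" by (simp add: ennreal_mult')
    also have "2 * (A * ?R ^ d * K1) = A * r ^ d * (2 * ((4 * C0) ^ d * K1))" by (simp add: power_mult_distrib)
    finally show ?thesis
      by (rule ennreal_ball_average_le[OF r]) (use K3_nonneg large in \<open>auto simp: K4_def\<close>)
  qed
next
  fix x :: 'a and r :: real assume r: "0 < r" "\<rho> x \<le> r"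
  have "(\<integral>\<^sup>+ y. N (T f y) \<partial>lebesgue_on (ball x r)) = (\<integral>\<^sup>+ y. N (T f y) * indicator (ball x r) y \<partial>lebesgue)"
    by (rule nn_integral_restrict_space) simp
  also have "\<dots> \<le> ennreal (A * r ^ d * K1)" by (rule T_large(2)[OF r(2)])
  finally show "(\<integral>\<^sup>+ y. N (T f y) \<partial>lebesgue_on (ball x r)) / emeasure lebesgue (ball x r) \<le> ennreal (A / \<omega> * K4)"
  proof (rule ennreal_ball_average_le[OF r(1)])
    have "1 * K1 \<le> (4 * C0) ^ d * K1" using C0 K1_nonneg by (intro mult_right_mono one_le_power) auto
    then show "K1 \<le> K4" using K3_nonneg K1_nonneg by (simp add: K4_def)
  qed (rule K1_nonneg)
qed

end

text \<open>The norms of the Hardy space and of bounded mean oscillation are infima and may be 0.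
  For any positive \<open>A\<close> strictly above the norm there is a decomposition, or a constant,
  below \<open>A\<close>; letting \<open>A\<close> tend to the norm gives the bound.\<close>

lemma maps_boundedlyI:
  assumes "0 \<le> K" "\<And>f A. 0 < A \<Longrightarrow> nE f < ennreal A \<Longrightarrow> nF (T f) \<le> ennreal (K * A)"
  shows "maps_boundedly T nE nF"
  unfolding maps_boundedly_def
proof (intro exI[of _ K] conjI allI impI)
  fix f assume "nE f < \<infinity>"
  then obtain a where a: "nE f = ennreal a" "0 \<le> a" by (cases "nE f") auto
  show "nF (T f) \<le> ennreal K * nE f"
  proof (rule ennreal_le_epsilon)
    fix e :: real assume e: "0 < e"
    define \<delta> where "\<delta> = e / (K + 1)"
    have \<delta>: "0 < \<delta>" "K * \<delta> \<le> e" using e assms(1) by (auto simp: \<delta>_def field_simps)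
    have "nF (T f) \<le> ennreal (K * (a + \<delta>))"
      using a \<delta> by (intro assms(2)) (auto simp: ennreal_less_iff)
    also have "\<dots> \<le> ennreal (K * a + e)" using \<delta> by (intro ennreal_leI) (simp add: distrib_left)
    also have "\<dots> = ennreal K * nE f + ennreal e" using a assms(1) e by (simp add: ennreal_mult)
    finally show "nF (T f) \<le> ennreal K * nE f + ennreal e" .
  qed
qed (rule assms(1))

theorem theorem3p9:
  fixes V :: "'a::euclidean_space \<Rightarrow> real"
    and \<rho> :: "'a \<Rightarrow> real"
    and T :: "('a \<Rightarrow> 'x::banach) \<Rightarrow> 'a \<Rightarrow> real \<Rightarrow> 'x"
    and s q :: real
  assumes "DIM('a) \<ge> 3"
    and "s > real DIM('a) / 2"
    and "reverse_Hoelder s V"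
    and "\<not> (AE x in lebesgue. V x = 0)"
    and "2 \<le> q"
  defines "\<rho> \<equiv> critical_radius V"
    and "T \<equiv> T_loc \<rho>"
  assumes "\<exists>p>1. maps_boundedly T (Lp_norm xnorm lebesgue p) (Lp_norm (Lq_dt_t q) lebesgue p)"
  shows "maps_boundedly T (BMO_norm \<rho> xnorm) (BMO_norm \<rho> (Lq_dt_t q)) \<and>
    maps_boundedly T (H1_norm \<rho> xnorm) (Lp_norm (Lq_dt_t q) lebesgue 1)"
proof -
  obtain p C where p: "1 < p" and C: "0 \<le> C"
    and bounded: "\<And>f. Lp_norm xnorm lebesgue p f < \<infinity> \<Longrightarrow>
      Lp_norm (Lq_dt_t q) lebesgue p (T f) \<le> ennreal C * Lp_norm xnorm lebesgue p f"
    using assms(8) unfolding maps_boundedly_def by blast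
  obtain C0 where C0: "1 \<le> C0" "\<And>x. 0 < \<rho> x"
    "\<And>x y. dist x y \<le> 2 * \<rho> x \<Longrightarrow> \<rho> x \<le> C0 * \<rho> y" "\<And>x y. dist x y \<le> 2 * \<rho> x \<Longrightarrow> \<rho> y \<le> C0 * \<rho> x"
    using reverse_Hoelder_critical_radius[OF assms(1-4)] unfolding \<rho>_def by blast
  define \<kappa> where "\<kappa> = kern_const TYPE('a)"
  define \<omega> where "\<omega> = measure lebesgue (ball (0::'a) 1)"
  interpret S: local_square_function \<rho> T q p C C0 \<kappa> \<omega> "DIM('a)"
    using assms(5) p C bounded C0 by unfold_locales (auto simp: \<kappa>_def \<omega>_def T_def)
  obtain KJ where KJ: "0 \<le> KJ"
    "\<And>(u :: 'a \<Rightarrow> real) A x r. u \<in> borel_measurable lebesgue \<Longrightarrow> 0 < A \<Longrightarrow> 0 < r \<Longrightarrow>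
      (\<And>z s. 0 < s \<Longrightarrow> \<exists>k. (\<integral>\<^sup>+ y. ennreal \<bar>u y - k\<bar> * indicator (ball z s) y \<partial>lebesgue) \<le> ennreal (A * s ^ DIM('a))) \<Longrightarrow>
      (\<integral>\<^sup>+ y. ennreal \<bar>u y\<bar> * indicator (ball x r) y \<partial>lebesgue) \<le> ennreal (A * r ^ DIM('a)) \<Longrightarrow>
      (\<integral>\<^sup>+ y. ennreal (\<bar>u y\<bar> powr p) * indicator (ball x r) y \<partial>lebesgue) \<le> ennreal (KJ * A powr p * r ^ DIM('a))"
    using John_Nirenberg_ball[OF less_imp_le[OF p], where 'a='a] by blast
  show ?thesis
  proof
    show "maps_boundedly T (H1_norm \<rho> xnorm) (Lp_norm (Lq_dt_t q) lebesgue 1)"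
    proof (rule maps_boundedlyI[OF S.K_atom_ge(2)])
      fix f :: "'a \<Rightarrow> 'x" and A :: real assume "0 < A" "H1_norm \<rho> xnorm f < ennreal A"
      then obtain c a where ca: "summable (\<lambda>j::nat. \<bar>c j :: real\<bar>)" "\<And>j. \<exists>x0 r. H1_atom \<rho> xnorm x0 r (a j)"
        "(\<lambda>n. Lp_norm xnorm lebesgue 1 (\<lambda>x. f x - (\<Sum>j<n. c j *\<^sub>R a j x))) \<longlonglongrightarrow> 0"
        "ennreal (\<Sum>j. \<bar>c j\<bar>) < ennreal A"
        unfolding H1_norm_def Inf_less_iff by blast
      have "Lp_norm (Lq_dt_t q) lebesgue 1 (T f) \<le> ennreal (S.K_atom * (\<Sum>j. \<bar>c j\<bar>))"
        by (rule S.T_H1[OF ca(1-3)])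
      also have "\<dots> \<le> ennreal (S.K_atom * A)"
        using ca(4) S.K_atom_ge(2) \<open>0 < A\<close>
        by (intro ennreal_leI mult_left_mono) (auto simp: ennreal_less_iff suminf_nonneg ca(1))
      finally show "Lp_norm (Lq_dt_t q) lebesgue 1 (T f) \<le> ennreal (S.K_atom * A)" .
    qed
    \<comment> \<open>\<open>K4\<close> belongs to a locale with parameters \<open>A\<close> and
      \<open>f\<close> but does not involve them; naming it before they are fixed records that the
      bound is uniform.\<close>
    define K where "K = local_square_function_BMO.K4 p C C0 \<kappa> \<omega> DIM('a) KJ"
    have loc: "local_square_function_BMO \<rho> T q p C C0 \<kappa> \<omega> DIM('a) KJ (A * \<omega>) f"
      if A: "0 < A" and f: "BMO_norm \<rho> xnorm f < ennreal A" for A and f :: "'a \<Rightarrow> 'x"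
    proof unfold_locales
      obtain B where B: "B < ennreal A" "locally_integrable xnorm f"
        "\<And>x r. 0 < r \<Longrightarrow> (\<integral>\<^sup>+ y. xnorm (f y - ball_mean xnorm x r f) \<partial>lebesgue_on (ball x r)) / emeasure lebesgue (ball x r) \<le> B"
        "\<And>x r. 0 < r \<Longrightarrow> \<rho> x \<le> r \<Longrightarrow> (\<integral>\<^sup>+ y. xnorm (f y) \<partial>lebesgue_on (ball x r)) / emeasure lebesgue (ball x r) \<le> B"
        using f unfolding BMO_norm_def Inf_less_iff by blast
      have mult: "(\<integral>\<^sup>+ y. g y * indicator (ball x r) y \<partial>lebesgue) \<le> ennreal (A * \<omega> * r ^ DIM('a))"
        if r: "0 < r" and g: "(\<integral>\<^sup>+ y. g y \<partial>lebesgue_on (ball x r)) / emeasure lebesgue (ball x r) \<le> B"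
        for g :: "'a \<Rightarrow> ennreal" and x r
      proof -
        have em: "emeasure lebesgue (ball x r) = ennreal (r ^ DIM('a) * \<omega>)"
          using r by (intro S.emeasure_ball_eq) simp
        have pos: "0 < r ^ DIM('a) * \<omega>" using r S.\<omega>_pos by simp
        let ?I = "\<integral>\<^sup>+ y. g y * indicator (ball x r) y \<partial>lebesgue"
        have "?I = (\<integral>\<^sup>+ y. g y \<partial>lebesgue_on (ball x r))"
          by (rule nn_integral_restrict_space[symmetric]) simp
        then have "?I / ennreal (r ^ DIM('a) * \<omega>) \<le> ennreal A"
          using g B(1) unfolding em by (simp add: order.trans less_imp_le)
        then have "ennreal (r ^ DIM('a) * \<omega>) * (?I / ennreal (r ^ DIM('a) * \<omega>)) \<le> ennreal (r ^ DIM('a) * \<omega>) * ennreal A"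
          by (rule mult_left_mono) simp
        also have "ennreal (r ^ DIM('a) * \<omega>) * (?I / ennreal (r ^ DIM('a) * \<omega>)) = ?I"
        proof -
          have "ennreal (r ^ DIM('a) * \<omega>) * (?I / ennreal (r ^ DIM('a) * \<omega>)) = ?I * ennreal (r ^ DIM('a) * \<omega>) / ennreal (r ^ DIM('a) * \<omega>)"
            by (simp only: ennreal_times_divide mult.commute)
          also have "\<dots> = ?I" using pos r by (intro ennreal_mult_divide_eq) auto
          finally show ?thesis .
        qed
        also have "ennreal (r ^ DIM('a) * \<omega>) * ennreal A = ennreal (A * \<omega> * r ^ DIM('a))"
          using pos by (subst ennreal_mult'[symmetric]) (simp_all only: less_imp_le mult_ac)
        finally show ?thesis .
      qed
      show "\<exists>m. (\<integral>\<^sup>+ y. xnorm (f y - m) * indicator (ball x r) y \<partial>lebesgue) \<le> ennreal (A * \<omega> * r ^ DIM('a))" if "0 < r" for x r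
        using mult[OF that B(3)[OF that]] by blast
      show "(\<integral>\<^sup>+ y. xnorm (f y) * indicator (ball x r) y \<partial>lebesgue) \<le> ennreal (A * \<omega> * r ^ DIM('a))" if "0 < r" "\<rho> x \<le> r" for x r
        using mult[OF that(1) B(4)[OF that]] .
      show "L1 (\<lambda>y. indicator (ball x r) y *\<^sub>R f y)" if "0 < r" for x r
        unfolding L1_def
      proof
        have sm: "strongly_measurable xnorm (lebesgue_on (ball x r)) f"
          and fin: "(\<integral>\<^sup>+ y. xnorm (f y) \<partial>lebesgue_on (ball x r)) < \<infinity>"
          using B(2) that unfolding locally_integrable_def Lp_norm_one by (auto split: if_splits)
        show "strongly_measurable xnorm lebesgue (\<lambda>y. indicator (ball x r) y *\<^sub>R f y)"
          using sm by (intro xnorm.strongly_measurable_extend) simp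
        have "(\<integral>\<^sup>+ y. xnorm (indicator (ball x r) y *\<^sub>R f y) \<partial>lebesgue) = (\<integral>\<^sup>+ y. xnorm (f y) \<partial>lebesgue_on (ball x r))"
          by (subst nn_integral_restrict_space) (auto intro!: nn_integral_cong simp: indicator_def)
        then show "(\<integral>\<^sup>+ y. xnorm (indicator (ball x r) y *\<^sub>R f y) \<partial>lebesgue) < \<infinity>" using fin by simp
      qed
      show "0 < A * \<omega>" using A S.\<omega>_pos by simp
    qed (fact KJ)+
    show "maps_boundedly T (BMO_norm \<rho> xnorm) (BMO_norm \<rho> (Lq_dt_t q))"
    proof (rule maps_boundedlyI)
      fix f :: "'a \<Rightarrow> 'x" and A :: real assume Af: "0 < A" "BMO_norm \<rho> xnorm f < ennreal A"
      interpret B: local_square_function_BMO \<rho> T q p C C0 \<kappa> \<omega> "DIM('a)" KJ "A * \<omega>" f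
        by (rule loc[OF Af])
      have "BMO_norm \<rho> (Lq_dt_t q) (T f) \<le> ennreal (A * \<omega> / \<omega> * K)"
        unfolding K_def by (rule B.T_BMO)
      then show "BMO_norm \<rho> (Lq_dt_t q) (T f) \<le> ennreal (max K 0 * A)"
        using S.\<omega>_pos Af by (simp add: mult.commute order_trans[OF _ ennreal_leI] mult_right_mono)
    qed simp
  qed
qed

end
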